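(* Let $x_1,x_2\in\mathbb{C}\setminus((-\infty,-1]\cup[1,\infty))$ and $\lambda,\alpha\in\mathbb{C}^\ast$, such that $\Re(\lambda+2\alpha)>0$, $\Re\lambda<4$. Then $$\mathsf{C}_\lambda^\alpha(x_1)\mathsf{C}_\lambda^\alpha(x_2)=\frac{-2^\lambda\sqrt{\pi}\,\Gamma(\frac12\lambda+\alpha+\frac12)}{\Gamma(\lambda)\Gamma(\alpha)\Gamma(1-\frac{\lambda}{2})(1-x_1^2)^{\frac12\alpha-\frac14}(1-x_2^2)^{\frac12\alpha-\frac14}}\int_{\frac{x_1+x_2}{1+x_1x_2}}^1\mathsf{C}_\lambda^\alpha(x_3)(1-x_3^2)^{\frac12\alpha-\frac54}P_{\lambda+\alpha-\frac12}(B)\,dx_3 ,$$ where $$B=\frac{2-x_1^2-x_2^2-x_3^2+x_1^2x_2^2x_3^2}{2\sqrt{(1-x_1^2)(1-x_2^2)(1-x_3^2)}}.$$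
   Context: $\mathbb{C}^\ast=\mathbb{C}\setminus\{0\}$. Let $\mathbf{F}(a,b;c;z)=\sum_{n\ge0}\frac{(a)_n(b)_n}{\Gamma(c+n)}\frac{z^n}{n!}$ (continued analytically) be the regularized Gauss hypergeometric function. Gegenbauer function of the first kind in the trigonometric context: $\mathsf{C}_\lambda^\alpha(x)=\frac{\sqrt\pi\,\Gamma(2\alpha+\lambda)}{2^{2\alpha-1}\Gamma(\alpha)\Gamma(\lambda+1)}\mathbf{F}\big(-\lambda,2\alpha+\lambda;\alpha+\frac12;\frac{1-x}{2}\big)$. Legendre function of the first kind: $P_\nu(z)=\mathbf{F}(-\nu,\nu+1;1;\frac{1-z}{2})$.
   Formalization: Added: 1+x1x2≠0, the segment to 1 avoids the cuts of C and P(B), and the integral converges (it diverges for λ=α=1, x1,x2 in (0,1)); the square root in B is read as the product of the three principal roots. *)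

theory Defs
  imports "HOL-Complex_Analysis.Complex_Analysis"
begin

text \<open>
  Regularized Gauss hypergeometric function. The analytic continuation of the series to the
  plane cut along \<open>[1,\<infinity>)\<close> is unique; values on the cut itself are unspecified.
  \<open>rGamma\<close> is the entire function \<open>1/\<Gamma>\<close>.
\<close>

definition reg_hyp2F1 :: "complex \<Rightarrow> complex \<Rightarrow> complex \<Rightarrow> complex \<Rightarrow> complex" where
  "reg_hyp2F1 a b c =
     (SOME f. f holomorphic_on - {z. z \<in> \<real> \<and> Re z \<ge> 1} \<and>
        (\<forall>z. norm z < 1 \<longrightarrow>
           (\<lambda>n. pochhammer a n * pochhammer b n * rGamma (c + of_nat n) * z ^ n / fact n)
             sums f z))"

definition gegenbauer_C :: "complex \<Rightarrow> complex \<Rightarrow> complex \<Rightarrow> complex" where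
  "gegenbauer_C l \<alpha> x =
     of_real (sqrt pi) * Gamma (2 * \<alpha> + l) * rGamma \<alpha> * rGamma (l + 1) / 2 powr (2 * \<alpha> - 1)
       * reg_hyp2F1 (- l) (2 * \<alpha> + l) (\<alpha> + 1 / 2) ((1 - x) / 2)"

definition legendre_P :: "complex \<Rightarrow> complex \<Rightarrow> complex" where
  "legendre_P \<nu> z = reg_hyp2F1 (- \<nu>) (\<nu> + 1) 1 ((1 - z) / 2)"

definition trig_domain :: "complex set" where
  "trig_domain = - {z. z \<in> \<real> \<and> (Re z \<le> - 1 \<or> 1 \<le> Re z)}"

text \<open>
  For \<open>z \<in> trig_domain\<close> the number \<open>1 - z\<^sup>2\<close> avoids \<open>(-\<infinity>,0]\<close>, so each
  principal root below is analytic there. The root of the product is taken as the product of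
  the roots: this is the branch that is analytic in all three variables and positive for
  arguments in \<open>(-1,1)\<close>. The principal root of the product jumps inside the domain.
\<close>

definition legendre_arg :: "complex \<Rightarrow> complex \<Rightarrow> complex \<Rightarrow> complex" where
  "legendre_arg x1 x2 x3 =
     (2 - x1\<^sup>2 - x2\<^sup>2 - x3\<^sup>2 + x1\<^sup>2 * x2\<^sup>2 * x3\<^sup>2)
       / (2 * (csqrt (1 - x1\<^sup>2) * csqrt (1 - x2\<^sup>2) * csqrt (1 - x3\<^sup>2)))"

definition product_integrand ::
    "complex \<Rightarrow> complex \<Rightarrow> complex \<Rightarrow> complex \<Rightarrow> complex \<Rightarrow> complex" where
  "product_integrand l \<alpha> x1 x2 x3 =
     gegenbauer_C l \<alpha> x3 * (1 - x3\<^sup>2) powr (\<alpha> / 2 - 5 / 4)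
       * legendre_P (l + \<alpha> - 1 / 2) (legendre_arg x1 x2 x3)"

text \<open>
  The integral along the segment from \<open>(x1 + x2) / (1 + x1 * x2)\<close> to \<open>1\<close> is meaningful: its
  lower limit exists, up to the end point \<open>1\<close> every function in the integrand is evaluated
  inside its cut plane (\<open>legendre_P\<close> being cut along \<open>(-\<infinity>,-1]\<close>), and it converges.
  Contour integrals are gauge integrals, so improper integrals are included. For \<open>x1\<close>, \<open>x2\<close> in \<open>(-1,1)\<close>
  only convergence at \<open>1\<close> is a restriction: near \<open>1\<close> the integrand is a combination of
  \<open>(1 - x3) powr (- l / 2 - 1)\<close> and \<open>(1 - x3) powr (l / 2 + \<alpha> - 1)\<close> to leading order.
\<close>

definition product_integral_exists ::
    "complex \<Rightarrow> complex \<Rightarrow> complex \<Rightarrow> complex \<Rightarrow> bool" where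
  "product_integral_exists l \<alpha> x1 x2 \<longleftrightarrow>
     1 + x1 * x2 \<noteq> 0 \<and>
     (\<forall>x3 \<in> closed_segment ((x1 + x2) / (1 + x1 * x2)) 1 - {1}.
        x3 \<in> trig_domain \<and>
        legendre_arg x1 x2 x3 \<notin> {z. z \<in> \<real> \<and> Re z \<le> - 1}) \<and>
     product_integrand l \<alpha> x1 x2
       contour_integrable_on linepath ((x1 + x2) / (1 + x1 * x2)) 1"

end

theory Submission
  imports Defs
begin

text \<open>
  Write \<open>x = (1 - p) / (1 + p)\<close> with \<open>p = exp L\<close>, \<open>\<bar>Im L\<bar> < pi\<close>, and put \<open>\<mu> = \<alpha> - 1/2\<close>, \<open>\<nu> = l + \<alpha> - 1/2\<close>.
  Up to a constant, \<open>(1 - x\<^sup>2) powr (\<mu>/2)\<close> times the Gegenbauer function is \<open>p powr (\<mu>/2) * G p\<close> for a solution \<open>G\<close>,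
  holomorphic at \<open>0\<close>, of \<open>p G'' + (1 + \<mu>) G' + \<nu> (\<nu> + 1) / (1 + p)\<^sup>2 G = 0\<close>. (If \<open>\<mu> + 1\<close> is a nonpositive integer,
  the regularized series starts at the power \<open>p ^ m\<close>, \<open>m = - \<mu>\<close>, and \<open>\<mu>\<close> is replaced by \<open>m\<close>.)

  On the ray \<open>p3 = p1 p2 t\<^sup>2\<close>, \<open>0 < t \<le> 1\<close>, the integral becomes
  \<open>U(p1, p2) = \<integral> t powr (\<mu> - 1) G(p1 p2 t\<^sup>2) P\<^sub>\<nu>(B) dt\<close>. The differential operator above, applied in \<open>p1\<close>, turns
  the integrand into a total derivative in \<open>t\<close> that contributes nothing at the end points. So \<open>U\<close> solves the same
  equation as \<open>G\<close>, and since a solution holomorphic at the regular singular point \<open>0\<close> is determined by its value there,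
  \<open>U(p1, p2) G(0) = G(p1) U(0, p2)\<close>. Repeating this in \<open>p2\<close> leaves the constant \<open>U(0, 0) / G(0)\<close>, a Mellin
  transform of \<open>P\<^sub>\<nu>\<close> that a two-step recurrence evaluates in Gamma functions.

  The ray is exchanged for the segment by Cauchy's theorem in the strip \<open>\<bar>Im L\<bar> \<le> \<bar>Im (L1 + L2)\<bar>\<close>, where the
  Legendre factor stays off its cut. Existence of the integral forces both \<open>\<bar>Im (L1 + L2)\<bar> < pi\<close> (otherwise
  \<open>B = -1\<close> at the lower limit) and \<open>Re \<mu> > Re \<nu>\<close> (otherwise the integrand is not integrable at \<open>1\<close>).
\<close>

section \<open>The regularized hypergeometric function\<close>

text \<open>In the coordinate \<open>L\<close> one has \<open>x = - tanh (L / 2)\<close>, so the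
  lower limit of the integral is the addition theorem of tanh: the path runs from
  \<open>L1 + L2\<close> to real part minus infinity, where \<open>p3 = 0\<close>. The variable
  \<open>t = exp ((L - L1 - L2) / 2)\<close> removes the square roots from \<open>B\<close>:
  \<open>(1 + B) / 2\<close> becomes a rational function of \<open>t\<close> with a simple pole at
  \<open>0\<close>. At \<open>t = 1\<close> it equals \<open>1\<close> whatever \<open>p1\<close>
  and \<open>p2\<close> are, so the derivative of the Legendre factor in \<open>p1\<close> vanishes
  there, and with it the upper boundary term of the total derivative. At \<open>t = 0\<close>
  everything depends on the behaviour of the Legendre function at infinity. No connection formula
  enters: bounds in closed sectors come from Legendre's equation by a Gronwall estimate, and the
  leading coefficient is shown to be nonzero by means of the Mellin transform. Since
  \<open>reg_hyp2F1\<close> is defined by choice, the continuation to the cut plane has to be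
  constructed before anything can be said about its values.\<close>

definition cut1 :: "complex set" where
  "cut1 = - {z. z \<in> \<real> \<and> Re z \<ge> 1}"

definition hyp_fps :: "complex \<Rightarrow> complex \<Rightarrow> complex \<Rightarrow> complex fps" where
  "hyp_fps a b c = Abs_fps (\<lambda>n. pochhammer a n * pochhammer b n * rGamma (c + of_nat n) / fact n)"

text \<open>Only the germ at \<open>0\<close> is recorded. On the connected set \<open>cut1\<close>
  it determines the function, so a relation between coefficients becomes an identity of
  functions.\<close>

definition is_hyp :: "complex \<Rightarrow> complex \<Rightarrow> complex \<Rightarrow> (complex \<Rightarrow> complex) \<Rightarrow> bool" where
  "is_hyp a b c f \<longleftrightarrow> f holomorphic_on cut1 \<and> f has_fps_expansion hyp_fps a b c"

lemma open_cut1 [simp]: "open cut1"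
proof -
  have "closed {z::complex. z \<in> \<real> \<and> Re z \<ge> 1}"
    using closed_Real_halfspace_Re_ge[of 1] by (simp add: Int_def conj_commute)
  then show ?thesis
    by (simp add: cut1_def open_Compl)
qed

lemma zero_in_cut1 [simp]: "0 \<in> cut1"
  by (simp add: cut1_def)

lemma cut1_scale:
  assumes "z \<in> cut1" "0 \<le> t" "t \<le> 1"
  shows "of_real t * z \<in> cut1"
proof (rule ccontr)
  assume "of_real t * z \<notin> cut1"
  then have r: "Im (of_real t * z) = 0" "Re (of_real t * z) \<ge> 1"
    by (auto simp: cut1_def complex_is_Real_iff)
  then have t: "t > 0" using assms by (cases "t = 0") auto
  then have "Im z = 0" "t * Re z \<ge> 1" using r by auto
  moreover have "Re z \<ge> 1"
  proof (rule ccontr)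
    assume "\<not> Re z \<ge> 1"
    then have "t * Re z < t * 1" using t by (intro mult_strict_left_mono) auto
    then show False using \<open>t * Re z \<ge> 1\<close> assms by simp
  qed
  ultimately show False using assms by (auto simp: cut1_def complex_is_Real_iff)
qed

lemma starlike_cut1: "starlike cut1"
  unfolding starlike_def
proof (intro bexI[of _ 0] ballI subsetI)
  fix z w assume "z \<in> cut1" "w \<in> closed_segment 0 z"
  then obtain t where "0 \<le> t" "t \<le> 1" "w = of_real t * z"
    by (auto simp: in_segment scaleR_conv_of_real)
  then show "w \<in> cut1" using cut1_scale \<open>z \<in> cut1\<close> by auto
qed auto

lemma connected_cut1 [simp]: "connected cut1"
  using starlike_cut1 starlike_imp_connected by blast

lemma ball_subset_cut1: "ball 0 1 \<subseteq> cut1"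
proof
  fix z :: complex assume "z \<in> ball 0 1"
  then have "norm z < 1" by simp
  then show "z \<in> cut1" using complex_Re_le_cmod[of z] by (auto simp: cut1_def)
qed

lemma cut1_one_minus: "z \<in> cut1 \<Longrightarrow> 0 \<le> t \<Longrightarrow> t \<le> 1 \<Longrightarrow> 1 - z * of_real t \<notin> \<real>\<^sub>\<le>\<^sub>0"
  using cut1_scale[of z t] by (auto simp: cut1_def complex_nonpos_Reals_iff complex_is_Real_iff mult.commute)

lemma has_fps_expansion_unique_on:
  fixes f g :: "complex \<Rightarrow> complex"
  assumes "f has_fps_expansion F" "g has_fps_expansion F"
    and "f holomorphic_on A" "g holomorphic_on A" "open A" "connected A" "0 \<in> A" "z \<in> A"
  shows "f z = g z"
proof -
  have "(\<lambda>z. f z - g z) has_fps_expansion F - F"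
    by (intro fps_expansion_intros assms)
  then have "f z - g z = 0"
    by (intro has_fps_expansion_0_analytic_continuation[where f = "\<lambda>z. f z - g z" and A = A])
       (use assms in \<open>auto intro!: holomorphic_intros\<close>)
  then show ?thesis by simp
qed

lemma is_hyp_sums:
  assumes "is_hyp a b c f" "norm z < 1"
  shows "(\<lambda>n. pochhammer a n * pochhammer b n * rGamma (c + of_nat n) * z ^ n / fact n) sums f z"
proof -
  have "f holomorphic_on eball 0 (ereal 1)"
    using assms(1) ball_subset_cut1 unfolding is_hyp_def by (auto intro: holomorphic_on_subset)
  then have "(\<lambda>n. fps_nth (hyp_fps a b c) n * z ^ n) sums f z"
    using assms by (intro has_fps_expansion_imp_sums_complex[where r = "ereal 1"]) (auto simp: is_hyp_def)
  then show ?thesis by (simp add: hyp_fps_def)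
qed

lemma is_hypI:
  assumes "f holomorphic_on cut1"
    and "\<And>z. norm z < 1 \<Longrightarrow>
      (\<lambda>n. pochhammer a n * pochhammer b n * rGamma (c + of_nat n) * z ^ n / fact n) sums f z"
  shows "is_hyp a b c f"
proof -
  have "eventually (\<lambda>z::complex. z \<in> ball 0 1) (nhds 0)"
    by (intro eventually_nhds_in_open) auto
  then have "f has_fps_expansion hyp_fps a b c"
    by (intro has_fps_expansionI, elim eventually_mono) (use assms(2) in \<open>simp add: hyp_fps_def\<close>)
  with assms show ?thesis by (simp add: is_hyp_def)
qed

text \<open>Contiguous relation: \<open>z d/dz + (c - 1)\<close> multiplies the n-th coefficient by
  \<open>c - 1 + n\<close>, and this factor is exactly what turns \<open>rGamma (c + n)\<close> into
  \<open>rGamma (c - 1 + n)\<close>.\<close>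

lemma is_hyp_lower_c:
  assumes "is_hyp a b c f"
  shows "is_hyp a b (c - 1) (\<lambda>z. z * deriv f z + (c - 1) * f z)"
proof -
  have f: "f holomorphic_on cut1" "f has_fps_expansion hyp_fps a b c"
    using assms by (auto simp: is_hyp_def)
  have "(\<lambda>z. z * deriv f z + (c - 1) * f z) has_fps_expansion
      fps_X * fps_deriv (hyp_fps a b c) + fps_const (c - 1) * hyp_fps a b c"
    by (intro fps_expansion_intros f)
  also have "fps_X * fps_deriv (hyp_fps a b c) + fps_const (c - 1) * hyp_fps a b c = hyp_fps a b (c - 1)"
  proof (rule fps_ext)
    fix n
    have "rGamma (c - 1 + of_nat n) = (c - 1 + of_nat n) * rGamma (c + of_nat n)"
      using rGamma_plus1[of "c - 1 + of_nat n"] by (simp add: add_ac)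
    then show "fps_nth (fps_X * fps_deriv (hyp_fps a b c) + fps_const (c - 1) * hyp_fps a b c) n
        = fps_nth (hyp_fps a b (c - 1)) n"
      by (cases n) (simp_all add: hyp_fps_def divide_simps, simp_all add: algebra_simps)
  qed
  finally show ?thesis
    using f by (auto simp: is_hyp_def intro!: holomorphic_intros)
qed

text \<open>Contiguous relation. The operator couples only the coefficients \<open>n\<close> and
  \<open>n - 1\<close>, so the claim is a two-term identity. The division by \<open>c - b\<close> is
  the reason why \<open>b\<close> is lowered while \<open>Re c\<close> still exceeds
  \<open>Re b\<close>, and \<open>c\<close> only afterwards.\<close>

lemma is_hyp_lower_b:
  assumes "is_hyp a b c f" "c \<noteq> b"
  shows "is_hyp a (b - 1) c (\<lambda>z. (z * (1 - z) * deriv f z + (c - b - a * z) * f z) * (1 / (c - b)))"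
proof -
  let ?F = "hyp_fps a b c"
  have f: "f holomorphic_on cut1" "f has_fps_expansion ?F"
    using assms by (auto simp: is_hyp_def)
  have "(\<lambda>z. (z * (1 - z) * deriv f z + (c - b - a * z) * f z) * (1 / (c - b))) has_fps_expansion
      (fps_X * (1 - fps_X) * fps_deriv ?F + (fps_const (c - b) - fps_const a * fps_X) * ?F) * fps_const (1 / (c - b))"
    by (intro fps_expansion_intros f)
  also have "\<dots> = hyp_fps a (b - 1) c"
  proof (rule fps_ext)
    fix n
    have "(of_nat n + c - b) * fps_nth ?F n - (if n = 0 then 0 else (of_nat n - 1 + a) * fps_nth ?F (n - 1))
        = (c - b) * fps_nth (hyp_fps a (b - 1) c) n"
    proof (cases n)
      case (Suc k)
      have r: "rGamma (c + of_nat k) = (c + of_nat k) * rGamma (1 + (c + of_nat k))"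
        using rGamma_plus1[of "c + of_nat k"] by (simp add: algebra_simps)
      have "(a + of_nat k) * pochhammer a k = pochhammer a (Suc k)"
        by (simp add: pochhammer_Suc)
      have bb: "pochhammer (b - 1) (Suc k) = (b - 1) * pochhammer b k"
        by (simp add: pochhammer_rec)
      have "fact (Suc k) = (of_nat k + 1) * (fact k :: complex)" by simp
      then show ?thesis unfolding Suc hyp_fps_def
        using of_nat_neq_0[of k, where 'a = complex]
        by (simp add: r bb pochhammer_Suc[of a] pochhammer_Suc[of b] divide_simps)
           (simp add: algebra_simps)
    qed (simp add: hyp_fps_def)
    moreover have "fps_nth (fps_X * (1 - fps_X) * fps_deriv ?F) n
        = of_nat n * fps_nth ?F n - (if n = 0 then 0 else (of_nat n - 1) * fps_nth ?F (n - 1))"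
    proof -
      have "fps_X * (1 - fps_X) * fps_deriv ?F = fps_X * fps_deriv ?F - fps_X * (fps_X * fps_deriv ?F)"
        by (simp add: algebra_simps)
      then show ?thesis
        by (cases n; cases "n - 1") (simp_all add: algebra_simps)
    qed
    moreover have "fps_nth ((fps_const (c - b) - fps_const a * fps_X) * ?F) n
        = (c - b) * fps_nth ?F n - (if n = 0 then 0 else a * fps_nth ?F (n - 1))"
    proof -
      have "(fps_const (c - b) - fps_const a * fps_X) * ?F = fps_const (c - b) * ?F - fps_const a * (fps_X * ?F)"
        by (simp add: algebra_simps)
      then show ?thesis by (cases n) (simp_all add: algebra_simps)
    qed
    ultimately have "fps_nth (fps_X * (1 - fps_X) * fps_deriv ?F + (fps_const (c - b) - fps_const a * fps_X) * ?F) n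
        = (c - b) * fps_nth (hyp_fps a (b - 1) c) n"
      by (simp add: algebra_simps split: if_splits)
    then show "fps_nth ((fps_X * (1 - fps_X) * fps_deriv ?F + (fps_const (c - b) - fps_const a * fps_X) * ?F)
          * fps_const (1 / (c - b))) n = fps_nth (hyp_fps a (b - 1) c) n"
      using assms(2) by (simp add: fps_mult_right_const_nth)
  qed
  finally show ?thesis
    using f by (auto simp: is_hyp_def intro!: holomorphic_intros)
qed

text \<open>Vanishing moments make \<open>u\<close> orthogonal to all polynomials, so the integral
  of \<open>u * u\<close> equals that of \<open>u * (u - p)\<close>, which is arbitrarily small for
  a uniform polynomial approximation \<open>p\<close> of \<open>u\<close>.\<close>

lemma continuous_eq_zero_if_moments_zero:
  fixes u :: "real \<Rightarrow> real"
  assumes u: "continuous_on {0..1} u" and m: "\<And>n. integral {0..1} (\<lambda>t. u t * t ^ n) = 0"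
  shows "\<forall>t\<in>{0..1}. u t = 0"
proof -
  have poly: "integral {0..1} (\<lambda>t. u t * p t) = 0" if rp: "real_polynomial_function p" for p
  proof -
    obtain a n where p: "p = (\<lambda>x. \<Sum>i\<le>n. a i * x ^ i)"
      using rp[unfolded real_polynomial_function_iff_sum] by (elim exE) (rule that)
    have "integral {0..1} (\<lambda>t. u t * p t) = integral {0..1} (\<lambda>t. \<Sum>i\<le>n. a i * (u t * t ^ i))"
      by (simp add: p sum_distrib_left algebra_simps)
    also have "\<dots> = (\<Sum>i\<le>n. integral {0..1} (\<lambda>t. a i * (u t * t ^ i)))"
      by (intro integral_sum integrable_continuous_real continuous_intros u) auto
    finally show ?thesis by (simp add: m)
  qed
  obtain B where B: "\<And>t. t \<in> {0..1} \<Longrightarrow> \<bar>u t\<bar> \<le> B" "B > 0"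
  proof -
    have "bounded (u ` {0..1})"
      by (intro compact_imp_bounded compact_continuous_image u) auto
    then show ?thesis using that by (force simp: bounded_pos)
  qed
  have "integral {0..1} (\<lambda>t. u t * u t) \<le> 0"
  proof (rule field_le_epsilon)
    fix e :: real assume e: "e > 0"
    obtain p where p: "real_polynomial_function p" "\<And>t. t \<in> {0..1} \<Longrightarrow> \<bar>u t - p t\<bar> < e / B"
      using Stone_Weierstrass_real_polynomial_function[OF _ u, of "e / B"] e B by auto
    have cp: "continuous_on {0..1} p"
      using p(1) by (intro continuous_on_polymonial_function) (simp add: real_polynomial_function_eq)
    have "integral {0..1} (\<lambda>t. u t * u t) = integral {0..1} (\<lambda>t. u t * (u t - p t))"
      using poly[OF p(1)] by (simp add: right_diff_distrib integral_diff integrable_continuous_real continuous_intros u cp)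
    also have "\<dots> \<le> integral {0..1} (\<lambda>t::real. e)"
    proof (rule integral_le)
      show "(\<lambda>t. u t * (u t - p t)) integrable_on {0..1}" "(\<lambda>t::real. e) integrable_on {0..1}"
        by (intro integrable_continuous_real continuous_intros u cp)+
    next
      fix t :: real assume t: "t \<in> {0..1}"
      have "u t * (u t - p t) \<le> \<bar>u t\<bar> * \<bar>u t - p t\<bar>" by (simp add: abs_mult[symmetric])
      also have "\<dots> \<le> B * (e / B)" using B(1)[OF t] p(2)[OF t] by (intro mult_mono) auto
      finally show "u t * (u t - p t) \<le> e" using B by simp
    qed
    finally show "integral {0..1} (\<lambda>t. u t * u t) \<le> 0 + e" by simp
  qed
  moreover have "integral {0..1} (\<lambda>t. u t * u t) \<ge> 0"
    by (intro integral_nonneg integrable_continuous_real continuous_intros u) auto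
  ultimately have "integral {0..1} (\<lambda>t. u t * u t) = 0" by simp
  then have "\<forall>t\<in>{0..1}. u t * u t = 0"
    by (subst (asm) integral_eq_0_iff) (auto intro!: continuous_intros u)
  then show ?thesis by simp
qed

section \<open>Moments of the Beta weight and Euler's integral\<close>

definition beta_weight :: "complex \<Rightarrow> complex \<Rightarrow> real \<Rightarrow> complex" where
  "beta_weight b d t = of_real t powr (b - 1) * of_real (1 - t) powr (d - 1)"

lemma continuous_on_beta_weight:
  assumes "Re b > 1" "Re d > 1"
  shows "continuous_on {0..1} (beta_weight b d)"
  unfolding beta_weight_def
  by (intro continuous_intros continuous_on_powr_complex) (use assms in auto)

text \<open>Integration by parts: the weight times \<open>t ^ Suc n * (1 - t)\<close> vanishes at
  both end points, and its derivative is the difference of the two integrands. Real parts above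
  \<open>1\<close> keep the weight continuous on the closed interval.\<close>

lemma beta_weight_moment_Suc:
  assumes "Re b > 1" "Re d > 1"
  shows "(b + d + of_nat n) * integral {0..1} (\<lambda>t. beta_weight b d t * of_real t ^ Suc n)
       = (b + of_nat n) * integral {0..1} (\<lambda>t. beta_weight b d t * of_real t ^ n)"
proof -
  note c = continuous_on_beta_weight[OF assms]
  let ?P = "\<lambda>t::real. beta_weight b d t * of_real t ^ Suc n * of_real (1 - t)"
  have der: "(?P has_vector_derivative
      (b + of_nat n) * (beta_weight b d t * of_real t ^ n)
        - (b + d + of_nat n) * (beta_weight b d t * of_real t ^ Suc n)) (at t)" if t: "t \<in> {0<..<1}" for t
  proof -
    let ?Q = "\<lambda>z::complex. z powr (b - 1) * (1 - z) powr (d - 1) * z ^ Suc n * (1 - z)"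
    have n1: "complex_of_real t \<noteq> 1" using t of_real_eq_1_iff by fastforce
    have pw: "complex_of_real t powr (b - 2) = complex_of_real t powr (b - 1) / of_real t"
             "(1 - complex_of_real t) powr (d - 2) = (1 - complex_of_real t) powr (d - 1) / (1 - of_real t)"
      using t n1 by (simp_all add: powr_diff power2_eq_square)
    have "(?Q has_field_derivative
       (b + of_nat n) * (of_real t powr (b - 1) * (1 - of_real t) powr (d - 1) * of_real t ^ n)
        - (b + d + of_nat n) * (of_real t powr (b - 1) * (1 - of_real t) powr (d - 1) * of_real t ^ Suc n))
        (at (of_real t))"
      by (rule derivative_eq_intros refl | use t in \<open>force simp: complex_nonpos_Reals_iff\<close>)+
         (use t n1 in \<open>simp add: pw divide_simps\<close>, use t n1 in \<open>simp add: algebra_simps power2_eq_square\<close>)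
    from has_vector_derivative_real_field[OF this] show ?thesis
      unfolding beta_weight_def by (simp add: o_def)
  qed
  have "((\<lambda>t. (b + of_nat n) * (beta_weight b d t * of_real t ^ n)
        - (b + d + of_nat n) * (beta_weight b d t * of_real t ^ Suc n)) has_integral ?P 1 - ?P 0) {0..1}"
    by (rule fundamental_theorem_of_calculus_interior) (use der in \<open>auto intro!: continuous_intros c\<close>)
  then have 0: "integral {0..1} (\<lambda>t. (b + of_nat n) * (beta_weight b d t * of_real t ^ n)
        - (b + d + of_nat n) * (beta_weight b d t * of_real t ^ Suc n)) = 0"
    by (simp add: integral_unique)
  have "integral {0..1} (\<lambda>t. (b + of_nat n) * (beta_weight b d t * of_real t ^ n)
        - (b + d + of_nat n) * (beta_weight b d t * of_real t ^ Suc n))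
    = integral {0..1} (\<lambda>t. (b + of_nat n) * (beta_weight b d t * of_real t ^ n))
      - integral {0..1} (\<lambda>t. (b + d + of_nat n) * (beta_weight b d t * of_real t ^ Suc n))"
    by (intro integral_diff integrable_continuous_real continuous_intros c)
  with 0 show ?thesis by simp
qed

lemma beta_weight_moment:
  assumes "Re b > 1" "Re d > 1"
  shows "integral {0..1} (\<lambda>t. beta_weight b d t * of_real t ^ n)
       = integral {0..1} (beta_weight b d) * pochhammer b n / pochhammer (b + d) n"
proof (induction n)
  case (Suc n)
  have "b + d + of_nat n \<noteq> 0"
  proof
    assume "b + d + of_nat n = 0"
    then have "Re (b + d + of_nat n) = 0" by simp
    then show False using assms by simp
  qed
  then have "integral {0..1} (\<lambda>t. beta_weight b d t * of_real t ^ Suc n)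
      = (b + of_nat n) * integral {0..1} (\<lambda>t. beta_weight b d t * of_real t ^ n) / (b + d + of_nat n)"
    using beta_weight_moment_Suc[OF assms, of n] by (simp add: field_simps)
  with Suc show ?case by (simp add: pochhammer_Suc mult_ac)
qed simp

text \<open>If the integral were zero, \<open>beta_weight_moment\<close> would make every moment
  zero. The moment lemma for real functions then applies to the real part of the weight divided by
  its value at \<open>1/2\<close>, a function that equals \<open>1\<close> at that point.\<close>

lemma beta_weight_integral_nonzero:
  assumes "Re b > 1" "Re d > 1"
  shows "integral {0..1} (beta_weight b d) \<noteq> 0"
proof
  assume 0: "integral {0..1} (beta_weight b d) = 0"
  note c = continuous_on_beta_weight[OF assms]
  define w where "w = beta_weight b d (1/2)"
  have w: "w \<noteq> 0" by (auto simp: w_def beta_weight_def)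
  have "integral {0..1} (\<lambda>t. Re (beta_weight b d t / w) * t ^ n) = 0" for n
  proof -
    have "((\<lambda>t. beta_weight b d t * of_real t ^ n) has_integral 0) {0..1}"
    proof -
      have "(\<lambda>t. beta_weight b d t * of_real t ^ n) integrable_on {0..1}"
        by (intro integrable_continuous_real continuous_intros c)
      then show ?thesis
        using beta_weight_moment[OF assms, of n] 0 by (simp add: has_integral_integrable_integral)
    qed
    then have "((\<lambda>t. beta_weight b d t * of_real t ^ n / w) has_integral 0 / w) {0..1}"
      by (rule has_integral_divide)
    then have "((\<lambda>t. Re (beta_weight b d t * of_real t ^ n / w)) has_integral Re (0 / w)) {0..1}"
      by (rule has_integral_Re)
    moreover have "Re (beta_weight b d t * of_real t ^ n / w) = Re (beta_weight b d t / w) * t ^ n" for t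
    proof -
      have "beta_weight b d t * of_real t ^ n / w = beta_weight b d t / w * of_real (t ^ n)" by simp
      then show ?thesis by (simp only: times_complex.simps Re_complex_of_real Im_complex_of_real mult_zero_right diff_zero)
    qed
    ultimately show ?thesis by (simp add: integral_unique)
  qed
  then have "\<forall>t\<in>{0..1}. Re (beta_weight b d t / w) = 0"
    by (intro continuous_eq_zero_if_moments_zero continuous_intros c) (use w in auto)
  then have "Re (beta_weight b d (1/2) / w) = 0" by simp
  then show False using w by (simp add: w_def)
qed

lemma has_integral_uniform_series:
  fixes F :: "nat \<Rightarrow> real \<Rightarrow> complex"
  assumes c: "\<And>n. continuous_on {0..1} (F n)"
    and M: "\<And>n t. t \<in> {0..1} \<Longrightarrow> norm (F n t) \<le> M n" "summable M"
    and s: "\<And>t. t \<in> {0..1} \<Longrightarrow> (\<lambda>n. F n t) sums g t"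
  shows "(\<lambda>n. integral {0..1} (F n)) sums integral {0..1} g"
proof -
  have "uniform_limit {0..1} (\<lambda>n t. \<Sum>i<n. F i t) (\<lambda>t. \<Sum>i. F i t) sequentially"
    using M by (rule Weierstrass_m_test)
  then have u: "uniform_limit {0..1} (\<lambda>n t. \<Sum>i<n. F i t) g sequentially"
    by (rule uniform_limit_cong'[THEN iffD1, rotated -1]) (use s in \<open>auto simp: sums_iff\<close>)
  obtain I J where IJ: "\<And>n. ((\<lambda>t. \<Sum>i<n. F i t) has_integral I n) {0..1}" "(g has_integral J) {0..1}" "I \<longlonglongrightarrow> J"
    by (rule uniform_limit_integral[OF u]) (auto intro!: continuous_intros c)
  have "I = (\<lambda>n. \<Sum>i<n. integral {0..1} (F i))"
  proof
    fix n show "I n = (\<Sum>i<n. integral {0..1} (F i))" using integral_unique[OF IJ(1)[of n]] by (simp add: integral_sum integrable_continuous_real c)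
  qed
  moreover have "integral {0..1} g = J"
    using IJ(2) by (rule integral_unique)
  ultimately show ?thesis
    using IJ(3) by (simp add: sums_def)
qed

lemma one_minus_powr_sums:
  fixes z :: complex
  assumes "norm z < 1"
  shows "(\<lambda>n. pochhammer a n / fact n * z ^ n) sums (1 - z) powr (- a)"
proof -
  have "(\<lambda>n. ((- a) gchoose n) * (- z) ^ n) sums (1 + (- z)) powr (- a)"
    by (rule gen_binomial_complex) (use assms in simp)
  moreover have "((- a) gchoose n) * (- z) ^ n = pochhammer a n / fact n * z ^ n" for n
  proof -
    have "(-1::complex) ^ n * (- z) ^ n = z ^ n"
      by (simp flip: power_mult_distrib)
    moreover have "((- a) gchoose n) * (- z) ^ n = pochhammer a n / fact n * ((-1) ^ n * (- z) ^ n)"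
      by (simp add: gbinomial_pochhammer)
    ultimately show ?thesis by simp
  qed
  ultimately show ?thesis by simp
qed

lemma summable_norm_one_minus_powr:
  fixes z :: complex
  assumes "norm z < 1"
  shows "summable (\<lambda>n. norm (pochhammer a n / fact n * z ^ n))"
proof -
  obtain r where r: "norm z < r" "r < 1" using assms dense by blast
  have "summable (\<lambda>n. pochhammer a n / fact n * of_real r ^ n)"
    using one_minus_powr_sums[of "of_real r" a] r norm_ge_zero[of z] by (simp add: sums_iff)
  then show ?thesis
    by (rule powser_insidea) (use r norm_ge_zero[of z] in auto)
qed

text \<open>For \<open>z\<close> in \<open>cut1\<close> the number \<open>1 - z t\<close> stays off
  the slit, so the integral of \<open>(1 - z t) powr (- a)\<close> against the weight is holomorphic
  there. The binomial series and the moments of the weight give its coefficients.\<close>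

lemma is_hyp_euler:
  assumes "Re b > 1" "Re d > 1"
  shows "\<exists>f. is_hyp a b (b + d) f"
proof -
  note c = continuous_on_beta_weight[OF assms]
  let ?w = "beta_weight b d"
  define h where "h z = integral {0..1} (\<lambda>t. ?w t * (1 - z * of_real t) powr (- a))" for z
  \<comment> \<open>The Beta integral is left unevaluated. Dividing by it and by
    \<open>Gamma (b + d)\<close> turns the moment quotient into
    \<open>pochhammer b n * rGamma (b + d + n)\<close>.\<close>
  define K where "K = integral {0..1} ?w * Gamma (b + d)"
  have nz: "integral {0..1} ?w \<noteq> 0"
    by (rule beta_weight_integral_nonzero[OF assms])
  have bd: "b + d \<notin> \<int>\<^sub>\<le>\<^sub>0"
  proof
    assume "b + d \<in> \<int>\<^sub>\<le>\<^sub>0"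
    then obtain n where "n \<le> 0" "b + d = of_int n" by (elim nonpos_Ints_cases)
    then have "Re (b + d) \<le> 0" by (metis Re_complex_of_real of_int_le_0_iff of_real_of_int_eq)
    then show False using assms by simp
  qed
  have "K \<noteq> 0" using nz bd by (simp add: K_def Gamma_eq_zero_iff)
  have hol: "h holomorphic_on cut1"
    unfolding holomorphic_on_def
  proof
    fix z0 assume "z0 \<in> cut1"
    then obtain r where r: "r > 0" "ball z0 r \<subseteq> cut1"
      using open_cut1 openE by blast
    have ne: "1 - z * of_real t \<notin> \<real>\<^sub>\<le>\<^sub>0" if "z \<in> ball z0 r" "t \<in> cbox 0 1" for z and t :: real
      using that r by (intro cut1_one_minus) auto
    have ne': "0 \<le> Re (1 - z * of_real t) \<or> Im (1 - z * of_real t) \<noteq> 0" "1 - z * of_real t \<noteq> 0"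
      if "z \<in> ball z0 r" "t \<in> cbox 0 1" for z and t :: real
    proof -
      show "0 \<le> Re (1 - z * of_real t) \<or> Im (1 - z * of_real t) \<noteq> 0"
        using ne[OF that] by (auto simp: complex_nonpos_Reals_iff)
      show "1 - z * of_real t \<noteq> 0"
      proof
        assume "1 - z * of_real t = 0"
        with ne[OF that] show False by (simp only: nonpos_Reals_zero_I not_True_eq_False)
      qed
    qed
    have "(\<lambda>z. integral (cbox 0 1) (\<lambda>t. ?w t * (1 - z * of_real t) powr (- a))) holomorphic_on ball z0 r"
    proof (rule leibniz_rule_holomorphic[where fx = "\<lambda>z t. ?w t * (a * of_real t * (1 - z * of_real t) powr (- a - 1))"])
      show "((\<lambda>z. ?w t * (1 - z * of_real t) powr (- a)) has_field_derivative
          ?w t * (a * of_real t * (1 - z * of_real t) powr (- a - 1))) (at z within ball z0 r)"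
        if "z \<in> ball z0 r" "t \<in> cbox 0 1" for z t
        by (rule derivative_eq_intros refl ne[OF that])+ (simp add: algebra_simps)
      show "(\<lambda>t. ?w t * (1 - z * of_real t) powr (- a)) integrable_on cbox 0 1" if "z \<in> ball z0 r" for z
      proof (intro integrable_continuous continuous_intros)
        show "continuous_on (cbox 0 1) ?w" using c by simp
        show "cbox 0 1 \<subseteq> {t. 0 \<le> Re (1 - z * of_real t) \<or> Im (1 - z * of_real t) \<noteq> 0}"
          using ne'(1)[OF that] by blast
        show "0 < Re (- a)" if "t \<in> cbox 0 1" "1 - z * of_real t = 0" for t
          using ne'(2)[OF \<open>z \<in> ball z0 r\<close> that(1)] that(2) by blast
      qed
      have c': "continuous_on (ball z0 r \<times> cbox 0 1) (\<lambda>x. ?w (snd x))"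
        by (rule continuous_on_compose2[OF c]) (auto intro!: continuous_intros)
      show "continuous_on (ball z0 r \<times> cbox 0 1)
          (\<lambda>(z, t). ?w t * (a * of_real t * (1 - z * of_real t) powr (- a - 1)))"
        unfolding split_def
      proof (intro continuous_intros c')
        show "ball z0 r \<times> cbox 0 1 \<subseteq> {x. 0 \<le> Re (1 - fst x * of_real (snd x)) \<or> Im (1 - fst x * of_real (snd x)) \<noteq> 0}"
        proof
          fix x assume "x \<in> ball z0 r \<times> cbox 0 (1::real)"
          then have "fst x \<in> ball z0 r" "snd x \<in> cbox 0 1" by (auto simp only: mem_Times_iff)
          from ne'(1)[OF this] show "x \<in> {x. 0 \<le> Re (1 - fst x * of_real (snd x)) \<or> Im (1 - fst x * of_real (snd x)) \<noteq> 0}"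
            by (simp only: mem_Collect_eq)
        qed
        show "0 < Re (- a - 1)" if "x \<in> ball z0 r \<times> cbox 0 1" "1 - fst x * of_real (snd x) = 0" for x
          using ne'(2)[of "fst x" "snd x"] that mem_Times_iff by blast
      qed
    qed auto
    then have "h holomorphic_on ball z0 r"
      by (simp add: h_def[abs_def])
    then have "h field_differentiable at z0"
      by (rule holomorphic_on_imp_differentiable_at) (use r in auto)
    then show "h field_differentiable at z0 within cut1"
      by (rule field_differentiable_at_within)
  qed
  obtain B where B: "\<And>t. t \<in> {0..1} \<Longrightarrow> norm (?w t) \<le> B" "B > 0"
  proof -
    have "bounded (?w ` {0..1})"
      by (intro compact_imp_bounded compact_continuous_image c) auto
    then show ?thesis using that by (force simp: bounded_pos)
  qed
  have ser: "(\<lambda>n. pochhammer a n * pochhammer b n * rGamma (b + d + of_nat n) * z ^ n / fact n) sums (h z / K)"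
    if z: "norm z < 1" for z
  proof -
    let ?F = "\<lambda>n t. ?w t * (pochhammer a n / fact n * (z * of_real t) ^ n)"
    have "(\<lambda>n. integral {0..1} (?F n)) sums h z"
      unfolding h_def
    proof (rule has_integral_uniform_series[where M = "\<lambda>n. B * norm (pochhammer a n / fact n * z ^ n)"])
      show "continuous_on {0..1} (?F n)" for n
        by (intro continuous_intros c)
      show "norm (?F n t) \<le> B * norm (pochhammer a n / fact n * z ^ n)" if t: "t \<in> {0..1}" for n t
      proof -
        have "norm (z * of_real t) ^ n \<le> norm z ^ n"
          using t by (intro power_mono) (auto simp: norm_mult mult_left_le)
        then have "norm (pochhammer a n / fact n * (z * of_real t) ^ n) \<le> norm (pochhammer a n / fact n * z ^ n)"
          unfolding norm_mult norm_power by (intro mult_left_mono) (auto simp: norm_mult)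
        then show ?thesis
          unfolding norm_mult[of "?w t"] by (intro mult_mono B t) (use B in auto)
      qed
      show "summable (\<lambda>n. B * norm (pochhammer a n / fact n * z ^ n))"
        by (intro summable_mult summable_norm_one_minus_powr z)
      show "(\<lambda>n. ?F n t) sums (?w t * (1 - z * of_real t) powr (- a))" if t: "t \<in> {0..1}" for t
      proof -
        have "norm (z * of_real t) \<le> norm z * 1"
          using t unfolding norm_mult by (intro mult_left_mono) auto
        then show ?thesis
          by (intro sums_mult one_minus_powr_sums) (use z in simp)
      qed
    qed
    then have "(\<lambda>n. integral {0..1} (?F n) / K) sums (h z / K)"
      by (rule sums_divide)
    moreover have "integral {0..1} (?F n) / K
        = pochhammer a n * pochhammer b n * rGamma (b + d + of_nat n) * z ^ n / fact n" for n
    proof -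
      have "integral {0..1} (?F n) = integral {0..1} (\<lambda>t. (pochhammer a n / fact n * z ^ n) * (?w t * of_real t ^ n))"
        by (simp add: power_mult_distrib mult_ac)
      also have "\<dots> = (pochhammer a n / fact n * z ^ n) * integral {0..1} (\<lambda>t. ?w t * of_real t ^ n)"
        by (rule integral_mult_right)
      also have "\<dots> = (pochhammer a n / fact n * z ^ n) *
          (integral {0..1} ?w * pochhammer b n / pochhammer (b + d) n)"
        by (simp only: beta_weight_moment[OF assms])
      also have "\<dots> / K = pochhammer a n * pochhammer b n * (1 / (Gamma (b + d) * pochhammer (b + d) n)) * z ^ n / fact n"
        using nz by (simp add: K_def mult_ac)
      also have "1 / (Gamma (b + d) * pochhammer (b + d) n) = rGamma (b + d + of_nat n)"
      proof -
        have "pochhammer (b + d) n \<noteq> 0" using bd by (auto simp: pochhammer_eq_0_iff)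
        then show ?thesis
          using pochhammer_rGamma[of "b + d" n] by (simp add: Gamma_def inverse_eq_divide)
      qed
      finally show ?thesis .
    qed
    ultimately show ?thesis by simp
  qed
  have "is_hyp a b (b + d) (\<lambda>z. h z / K)"
    by (rule is_hypI) (use ser hol \<open>K \<noteq> 0\<close> in \<open>auto intro!: holomorphic_intros\<close>)
  then show ?thesis by blast
qed

text \<open>
  Euler's integral covers large \<open>Re b\<close> and larger \<open>Re c\<close>; the contiguous relations then lower \<open>b\<close>, and finally \<open>c\<close>.
\<close>

lemma is_hyp_exists: "\<exists>f. is_hyp a b c f"
proof -
  have b: "\<exists>f. is_hyp a (b + of_nat n - of_nat k) c f" if "k \<le> n" "Re b + n > 1" "Re c > Re b + n + 1" for n k b c
    using that(1)
  proof (induction k)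
    case 0
    then show ?case using is_hyp_euler[of "b + of_nat n" "c - (b + of_nat n)" a] that by (simp add: algebra_simps)
  next
    case (Suc k)
    then obtain f where "is_hyp a (b + of_nat n - of_nat k) c f" by auto
    moreover have "c \<noteq> b + of_nat n - of_nat k"
    proof
      assume "c = b + of_nat n - of_nat k"
      then have "Re c = Re b + n - k" by simp
      then show False using that by simp
    qed
    ultimately have "\<exists>f. is_hyp a (b + of_nat n - of_nat k - 1) c f"
      using is_hyp_lower_b by blast
    then show ?case by (simp add: algebra_simps)
  qed
  have b': "\<exists>f. is_hyp a b c f" if "Re b + n > 1" "Re c > Re b + n + 1" for n :: nat and b c
    using b[of n n b c] that by simp
  have c: "\<exists>f. is_hyp a b (c - of_nat k) f" if "\<exists>f. is_hyp a b c f" for b c k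
  proof (induction k)
    case (Suc k)
    then obtain f where "is_hyp a b (c - of_nat k) f" by auto
    from is_hyp_lower_c[OF this] have "\<exists>f. is_hyp a b (c - of_nat k - 1) f" by blast
    then show ?case by (simp add: algebra_simps)
  qed (use that in simp)
  obtain n :: nat where n: "1 - Re b < n" using reals_Archimedean2 by blast
  obtain k :: nat where k: "Re b + n + 1 - Re c < k" using reals_Archimedean2 by blast
  have "\<exists>f. is_hyp a b (c + of_nat k) f"
    by (rule b'[of b n]) (use n k in auto)
  from c[OF this, of k] show ?thesis by simp
qed

text \<open>Discharges the choice in the definition: some function has the required properties,
  hence the chosen one does. From here on only \<open>is_hyp\<close> is used.\<close>

lemma reg_hyp2F1_is_hyp: "is_hyp a b c (reg_hyp2F1 a b c)"
proof -
  let ?P = "\<lambda>f. f holomorphic_on - {z. z \<in> \<real> \<and> Re z \<ge> 1} \<and>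
        (\<forall>z. norm z < 1 \<longrightarrow>
           (\<lambda>n. pochhammer a n * pochhammer b n * rGamma (c + of_nat n) * z ^ n / fact n)
             sums f z)"
  obtain f where f: "is_hyp a b c f" using is_hyp_exists by blast
  then have "?P f" using is_hyp_sums[OF f] by (auto simp: is_hyp_def cut1_def)
  then have "?P (reg_hyp2F1 a b c)"
    unfolding reg_hyp2F1_def by (rule someI[where P = ?P])
  then show ?thesis by (intro is_hypI) (auto simp: cut1_def)
qed

section \<open>Value at zero, differential equation, the case of nonpositive integer
  \<open>c\<close>, and uniqueness\<close>

lemma is_hyp_0:
  assumes "is_hyp a b c f"
  shows "f 0 = rGamma c"
  using has_fps_expansion_imp_0_eq_fps_nth_0[of f "hyp_fps a b c"] assms by (simp add: is_hyp_def hyp_fps_def)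

text \<open>The coefficients satisfy \<open>(n + 1) (c + n) F (n + 1) = (a + n) (b + n) F n\<close>.
  In the regularized form this holds for every \<open>c\<close>, because \<open>rGamma\<close> obeys
  its recurrence without exceptions; the identity theorem spreads the equation over
  \<open>cut1\<close>.\<close>

lemma is_hyp_ode:
  assumes "is_hyp a b c f" "z \<in> cut1"
  shows "z * (1 - z) * deriv (deriv f) z + (c - (a + b + 1) * z) * deriv f z - a * b * f z = 0"
proof -
  let ?F = "hyp_fps a b c"
  have f: "f holomorphic_on cut1" "f has_fps_expansion ?F"
    using assms by (auto simp: is_hyp_def)
  let ?D = "fps_X * (1 - fps_X) * fps_deriv (fps_deriv ?F)
       + (fps_const c - fps_const (a + b + 1) * fps_X) * fps_deriv ?F - fps_const (a * b) * ?F"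
  have "(\<lambda>z. z * (1 - z) * deriv (deriv f) z + (c - (a + b + 1) * z) * deriv f z - a * b * f z) has_fps_expansion ?D"
    by (intro fps_expansion_intros f)
  also have "?D = 0"
  proof (rule fps_ext)
    fix n
    have *: "(of_nat n + 1) * (c + of_nat n) * fps_nth ?F (Suc n) = (a + of_nat n) * (b + of_nat n) * fps_nth ?F n"
    proof -
      have "rGamma (c + of_nat n) = (c + of_nat n) * rGamma (1 + (c + of_nat n))"
        using rGamma_plus1[of "c + of_nat n"] by (simp add: algebra_simps)
      then show ?thesis
        using of_nat_neq_0[of n, where 'a = complex]
        by (simp add: hyp_fps_def pochhammer_Suc divide_simps) (simp add: algebra_simps)
    qed
    have "?D = fps_X * fps_deriv (fps_deriv ?F) - fps_X * (fps_X * fps_deriv (fps_deriv ?F))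
        + fps_const c * fps_deriv ?F - fps_const (a + b + 1) * (fps_X * fps_deriv ?F) - fps_const (a * b) * ?F"
      by (simp add: algebra_simps)
    then have "fps_nth ?D n = (of_nat n + 1) * (c + of_nat n) * fps_nth ?F (Suc n) - (a + of_nat n) * (b + of_nat n) * fps_nth ?F n"
      by (cases n; cases "n - 1") (simp_all add: algebra_simps)
    with * show "fps_nth ?D n = fps_nth 0 n" by simp
  qed
  finally show ?thesis
    by (rule has_fps_expansion_0_analytic_continuation[where A = cut1]) (use f assms in \<open>auto intro!: holomorphic_intros\<close>)
qed

text \<open>The zeros of \<open>rGamma\<close> remove all powers below \<open>z ^ m\<close>, and the
  index shift \<open>n = m + k\<close> identifies what is left as another hypergeometric
  series.\<close>

lemma is_hyp_nonpos_int:
  assumes f: "is_hyp a b (1 - of_nat m) f" and g: "is_hyp (a + of_nat m) (b + of_nat m) (1 + of_nat m) g"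
    and "z \<in> cut1"
  shows "f z = pochhammer a m * pochhammer b m * z ^ m * g z"
proof -
  have eq: "hyp_fps a b (1 - of_nat m) = fps_const (pochhammer a m * pochhammer b m) * fps_X ^ m
      * hyp_fps (a + of_nat m) (b + of_nat m) (1 + of_nat m)"
  proof (rule fps_ext)
    fix n
    show "fps_nth (hyp_fps a b (1 - of_nat m)) n = fps_nth (fps_const (pochhammer a m * pochhammer b m) * fps_X ^ m
      * hyp_fps (a + of_nat m) (b + of_nat m) (1 + of_nat m)) n"
    proof (cases "n < m")
      case True
      then have "1 - of_nat m + of_nat n = - (of_nat (m - n - 1) :: complex)"
        by (simp add: of_nat_diff)
      then have "rGamma (1 - of_nat m + of_nat n :: complex) = 0"
        by (simp add: rGamma_eq_zero_iff)
      then show ?thesis using True by (simp add: hyp_fps_def mult.assoc fps_X_power_mult_nth)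
    next
      case False
      then obtain k where n: "n = m + k" using le_Suc_ex by force
      have r: "rGamma (1 + of_nat j :: complex) = 1 / fact j" for j
        using Gamma_fact[of j, where 'a = complex] by (simp add: rGamma_inverse_Gamma add_ac field_simps)
      have "rGamma (1 - of_nat m + of_nat n :: complex) = 1 / fact k" using r[of k] by (simp add: n)
      moreover have "rGamma (1 + of_nat m + of_nat k :: complex) = 1 / fact (m + k)" using r[of "m + k"] by (simp add: add_ac)
      ultimately show ?thesis using False
        by (simp add: hyp_fps_def mult.assoc fps_X_power_mult_nth n pochhammer_product'[of _ m k] mult_ac)
    qed
  qed
  have "(\<lambda>z. pochhammer a m * pochhammer b m * z ^ m * g z) has_fps_expansion hyp_fps a b (1 - of_nat m)"
    unfolding eq by (intro fps_expansion_intros) (use g in \<open>auto simp: is_hyp_def\<close>)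
  then show ?thesis
    using f g assms(3) by (intro has_fps_expansion_unique_on[where A = cut1]) (auto simp: is_hyp_def intro!: holomorphic_intros)
qed

text \<open>The coefficient of \<open>z ^ k\<close> in the equation expresses
  \<open>(k + 1) (k + c) g (k + 1)\<close> through earlier coefficients of \<open>g\<close>. Since
  \<open>Re c > 0\<close> the factor never vanishes, so \<open>g 0 = 0\<close> forces the whole
  expansion to be zero.\<close>

lemma regular_singular_unique:
  fixes g h :: "complex \<Rightarrow> complex"
  assumes A: "open A" "connected A" "0 \<in> A" and g: "g holomorphic_on A" and h: "h holomorphic_on A"
    and ode: "\<And>z. z \<in> A \<Longrightarrow> z * deriv (deriv g) z + c * deriv g z + h z * g z = 0"
    and c: "Re c > 0" and g0: "g 0 = 0" and z: "z \<in> A"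
  shows "g z = 0"
proof -
  define F where "F = fps_expansion g 0"
  define H where "H = fps_expansion h 0"
  have F: "g has_fps_expansion F" and H: "h has_fps_expansion H"
    unfolding F_def H_def using A g h by (auto intro!: analytic_at_imp_has_fps_expansion_0 simp: analytic_at)
  have "(\<lambda>z. z * deriv (deriv g) z + c * deriv g z + h z * g z) has_fps_expansion
      fps_X * fps_deriv (fps_deriv F) + fps_const c * fps_deriv F + H * F"
    by (intro fps_expansion_intros F H)
  moreover have "(\<lambda>z. z * deriv (deriv g) z + c * deriv g z + h z * g z) has_fps_expansion 0"
    unfolding has_fps_expansion_0_iff using eventually_nhds_in_open[OF A(1,3)] ode by (auto elim!: eventually_mono)
  ultimately have eq: "fps_X * fps_deriv (fps_deriv F) + fps_const c * fps_deriv F + H * F = 0"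
    using fps_expansion_unique_complex by blast
  have "fps_nth F n = 0" for n
  proof (induction n rule: less_induct)
    case (less n)
    show ?case
    proof (cases n)
      case 0
      then show ?thesis using has_fps_expansion_imp_0_eq_fps_nth_0[OF F] g0 by simp
    next
      case (Suc k)
      have "fps_nth (H * F) k = 0"
        unfolding fps_mult_nth by (rule sum.neutral) (use less Suc in auto)
      moreover have "fps_nth (fps_X * fps_deriv (fps_deriv F) + fps_const c * fps_deriv F + H * F) k = 0"
        by (simp add: eq)
      ultimately have "(of_nat k + c) * ((of_nat k + 1) * fps_nth F (Suc k)) = 0"
        by (cases k) (auto simp: algebra_simps)
      moreover have "of_nat k + c \<noteq> 0"
      proof
        assume "of_nat k + c = 0"
        then have "Re (of_nat k + c) = 0" by simp
        then show False using c by simp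
      qed
      moreover have "of_nat k + 1 \<noteq> (0::complex)"
        using of_nat_neq_0[of k, where 'a = complex] by (simp add: add.commute)
      ultimately show ?thesis by (simp add: Suc)
    qed
  qed
  then have "F = 0" by (simp add: fps_eq_iff)
  with F show ?thesis
    using has_fps_expansion_0_analytic_continuation g A z by blast
qed

section \<open>Growth of the Legendre function\<close>

lemma has_real_derivative_powr_div:
  assumes "r > 0"
  shows "((\<lambda>r. r powr c) has_real_derivative (c * r powr c / r)) (at r)"
  using assms by (auto intro!: derivative_eq_intros simp: powr_diff)

text \<open>Gronwall's argument for a system that is diagonal in \<open>log r\<close> up to errors
  of relative size \<open>r powr (- d)\<close>. These are integrable against \<open>dr / r\<close>,
  so they cost only the constant factor \<open>exp (4 * k / d)\<close>. The \<open>4\<close> arises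
  from \<open>2 (|u| + |v|)^2 \<le> 4 (|u|^2 + |v|^2)\<close>.\<close>

lemma energy_growth:
  fixes u v e1 e2 :: "real \<Rightarrow> complex"
  assumes r0: "1 \<le> r0" and d: "d > 0" and k: "k \<ge> 0"
    and u: "\<And>r. r \<ge> r0 \<Longrightarrow> (u has_vector_derivative (a * u r + e1 r) / of_real r) (at r)"
    and v: "\<And>r. r \<ge> r0 \<Longrightarrow> (v has_vector_derivative (b * v r + e2 r) / of_real r) (at r)"
    and ab: "Re a \<le> \<rho>" "Re b \<le> \<rho>"
    and e1: "\<And>r. r \<ge> r0 \<Longrightarrow> norm (e1 r) \<le> k * r powr (-d) * (norm (u r) + norm (v r))"
    and e2: "\<And>r. r \<ge> r0 \<Longrightarrow> norm (e2 r) \<le> k * r powr (-d) * (norm (u r) + norm (v r))"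
    and r: "r \<ge> r0"
  shows "(norm (u r))\<^sup>2 + (norm (v r))\<^sup>2
      \<le> ((norm (u r0))\<^sup>2 + (norm (v r0))\<^sup>2) * (r / r0) powr (2 * \<rho>) * exp (4 * k / d)"
proof -
  define \<phi> where "\<phi> r = u r \<bullet> u r + v r \<bullet> v r" for r
  have \<phi>_norm: "\<phi> r = (norm (u r))\<^sup>2 + (norm (v r))\<^sup>2" for r
    by (simp add: \<phi>_def power2_norm_eq_inner)
  define \<phi>' where "\<phi>' r = 2 * (u r \<bullet> ((a * u r + e1 r) / of_real r)) + 2 * (v r \<bullet> ((b * v r + e2 r) / of_real r))" for r
  have d\<phi>: "(\<phi> has_real_derivative \<phi>' r) (at r)" if "r \<ge> r0" for r
  proof -
    have "(\<phi> has_vector_derivative \<phi>' r) (at r)"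
      unfolding \<phi>_def[abs_def] \<phi>'_def
      by (rule derivative_eq_intros bounded_bilinear.has_vector_derivative[OF bounded_bilinear_inner] u[OF that] v[OF that] refl)+
         (simp add: inner_commute)
    then show ?thesis by (simp add: has_real_derivative_iff_has_vector_derivative)
  qed
  have b\<phi>: "\<phi>' r \<le> (2 * \<rho> + 4 * k * r powr (-d)) * \<phi> r / r" if "r \<ge> r0" for r
  proof -
    have r: "r > 0" using that r0 by simp
    have *: "w \<bullet> ((c * w + e) / of_real r) \<le> (\<rho> * (norm w)\<^sup>2 + norm w * norm e) / r"
      if "Re c \<le> \<rho>" for w c e :: complex
    proof -
      have "w \<bullet> (z / of_real r) = (w \<bullet> z) / r" for z
        by (simp add: inner_complex_def add_divide_distrib)
      moreover have "w \<bullet> (c * w) = Re c * (norm w)\<^sup>2"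
        unfolding cmod_power2 by (simp add: inner_complex_def power2_eq_square algebra_simps)
      ultimately have "w \<bullet> ((c * w + e) / of_real r) = (Re c * (norm w)\<^sup>2 + w \<bullet> e) / r"
        by (simp add: inner_add_right)
      also have "\<dots> \<le> (\<rho> * (norm w)\<^sup>2 + norm w * norm e) / r"
        using r that by (intro divide_right_mono add_mono mult_right_mono norm_cauchy_schwarz) auto
      finally show ?thesis .
    qed
    let ?K = "k * r powr (-d)" and ?n = "norm (u r)" and ?m = "norm (v r)"
    have "\<phi>' r \<le> 2 * ((\<rho> * ?n\<^sup>2 + ?n * norm (e1 r)) / r) + 2 * ((\<rho> * ?m\<^sup>2 + ?m * norm (e2 r)) / r)"
      unfolding \<phi>'_def using *[OF ab(1), of "u r" "e1 r"] *[OF ab(2), of "v r" "e2 r"] by linarith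
    also have "\<dots> = (2 * \<rho> * \<phi> r + 2 * (?n * norm (e1 r) + ?m * norm (e2 r))) / r"
      by (simp add: \<phi>_norm add_divide_distrib distrib_left)
    also have "\<dots> \<le> (2 * \<rho> * \<phi> r + 2 * (?n * (?K * (?n + ?m)) + ?m * (?K * (?n + ?m)))) / r"
    proof (intro divide_right_mono add_left_mono)
      show "2 * (?n * norm (e1 r) + ?m * norm (e2 r)) \<le> 2 * (?n * (?K * (?n + ?m)) + ?m * (?K * (?n + ?m)))"
        by (intro mult_left_mono add_mono e1 e2 that) auto
    qed (use r in simp)
    also have "\<dots> \<le> (2 * \<rho> * \<phi> r + 4 * (?K * \<phi> r)) / r"
    proof (intro divide_right_mono add_left_mono)
      have "?n * (?K * (?n + ?m)) + ?m * (?K * (?n + ?m)) = ?K * (?n + ?m)\<^sup>2"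
        by (simp add: power2_eq_square algebra_simps)
      also have "\<dots> \<le> ?K * (2 * \<phi> r)"
      proof (intro mult_left_mono)
        have "0 \<le> (?n - ?m)\<^sup>2" by simp
        then show "(?n + ?m)\<^sup>2 \<le> 2 * \<phi> r" unfolding \<phi>_norm by (simp add: power2_eq_square algebra_simps)
      qed (use k in simp)
      finally show "2 * (?n * (?K * (?n + ?m)) + ?m * (?K * (?n + ?m))) \<le> 4 * (?K * \<phi> r)" by simp
    qed (use r in simp)
    finally show ?thesis by (simp add: algebra_simps)
  qed
  \<comment> \<open>The energy \<open>\<phi>\<close> times the integrating factor \<open>W\<close> of its differential inequality is nonincreasing.\<close>
  define W where "W r = r powr (- 2 * \<rho>) * exp (4 * k / d * r powr (-d))" for r
  have W: "(W has_real_derivative W r * (- 2 * \<rho> / r - 4 * k * r powr (-d) / r)) (at r)" if "r \<ge> r0" for r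
  proof -
    have r: "r > 0" using that r0 by simp
    show ?thesis
      unfolding W_def[abs_def]
      by (rule has_real_derivative_powr_div[OF r] derivative_eq_intros refl)+
         (use d r in \<open>simp add: algebra_simps diff_divide_distrib\<close>)
  qed
  have "\<phi> r * W r \<le> \<phi> r0 * W r0"
  proof (rule DERIV_nonpos_imp_nonincreasing[OF r])
    fix x assume x: "r0 \<le> x" "x \<le> r"
    then have x0: "x > 0" using r0 by simp
    have "((\<lambda>r. \<phi> r * W r) has_real_derivative \<phi>' x * W x + W x * (- 2 * \<rho> / x - 4 * k * x powr (-d) / x) * \<phi> x) (at x)"
      by (rule DERIV_mult'[THEN DERIV_cong] d\<phi> W x)+ simp
    moreover have "\<phi>' x * W x + W x * (- 2 * \<rho> / x - 4 * k * x powr (-d) / x) * \<phi> x \<le> 0"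
    proof -
      have "\<phi>' x * W x \<le> ((2 * \<rho> + 4 * k * x powr (-d)) * \<phi> x / x) * W x"
        by (intro mult_right_mono b\<phi> x) (simp add: W_def)
      then show ?thesis using x0 by (simp add: field_simps)
    qed
    ultimately show "\<exists>y. ((\<lambda>r. \<phi> r * W r) has_real_derivative y) (at x) \<and> y \<le> 0" by blast
  qed
  have rp: "r > 0" "r0 > 0" using r r0 by auto
  have "\<phi> r * r powr (- 2 * \<rho>) \<le> \<phi> r * W r"
  proof (rule mult_left_mono)
    have "r powr (- 2 * \<rho>) * 1 \<le> W r"
      unfolding W_def using k d by (intro mult_left_mono) auto
    then show "r powr (- 2 * \<rho>) \<le> W r" by simp
  qed (simp add: \<phi>_norm)
  also have "\<dots> \<le> \<phi> r0 * W r0" by fact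
  also have "\<dots> \<le> \<phi> r0 * (r0 powr (- 2 * \<rho>) * exp (4 * k / d))"
  proof -
    have "4 * k / d * r0 powr (-d) \<le> 4 * k / d * 1"
      using k d r0 powr_mono[of "-d" 0 r0] by (intro mult_left_mono) auto
    then show ?thesis
      unfolding W_def by (intro mult_left_mono) (auto simp: \<phi>_norm intro: add_nonneg_nonneg)
  qed
  finally have "\<phi> r * r powr (- 2 * \<rho>) * r powr (2 * \<rho>) \<le> \<phi> r0 * (r0 powr (- 2 * \<rho>) * exp (4 * k / d)) * r powr (2 * \<rho>)"
    by (intro mult_right_mono) auto
  moreover have "r powr (- 2 * \<rho>) * r powr (2 * \<rho>) = 1" using rp by (simp flip: powr_add)
  ultimately have "\<phi> r \<le> \<phi> r0 * (r0 powr (- 2 * \<rho>) * r powr (2 * \<rho>)) * exp (4 * k / d)"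
    by (simp add: mult_ac)
  also have "r0 powr (- 2 * \<rho>) * r powr (2 * \<rho>) = (r / r0) powr (2 * \<rho>)"
    using rp by (simp add: powr_divide powr_minus_divide)
  finally show ?thesis by (simp add: \<phi>_norm)
qed

text \<open>
  \<open>yl \<nu> z\<close> is \<open>P\<^sub>\<nu>(2 z - 1)\<close>, whose cut is the nonpositive real axis. The combination \<open>ya\<close> annihilates the
  leading behaviour \<open>z powr \<nu>\<close> at infinity, so it grows more slowly than \<open>yl\<close>.
\<close>

definition yl :: "complex \<Rightarrow> complex \<Rightarrow> complex" where
  "yl \<nu> z = reg_hyp2F1 (- \<nu>) (\<nu> + 1) 1 (1 - z)"

definition ya :: "complex \<Rightarrow> complex \<Rightarrow> complex" where
  "ya \<nu> z = z * deriv (yl \<nu>) z - \<nu> * yl \<nu> z"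

lemma legendre_P_yl: "legendre_P \<nu> z = yl \<nu> ((1 + z) / 2)"
proof -
  have "(1 - z) / 2 = 1 - (1 + z) / 2" by (simp add: field_simps)
  then show ?thesis by (simp only: legendre_P_def yl_def)
qed

lemma one_minus_in_cut1: "z \<notin> \<real>\<^sub>\<le>\<^sub>0 \<Longrightarrow> 1 - z \<in> cut1"
  by (auto simp: cut1_def complex_nonpos_Reals_iff complex_is_Real_iff)

lemma yl_holomorphic: "yl \<nu> holomorphic_on - \<real>\<^sub>\<le>\<^sub>0"
proof -
  have "reg_hyp2F1 (- \<nu>) (\<nu> + 1) 1 \<circ> (\<lambda>z. 1 - z) holomorphic_on - \<real>\<^sub>\<le>\<^sub>0"
    by (rule holomorphic_on_compose_gen[where t = cut1])
       (use reg_hyp2F1_is_hyp one_minus_in_cut1 in \<open>auto simp: is_hyp_def intro!: holomorphic_intros\<close>)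
  then show ?thesis by (simp add: yl_def[abs_def] o_def)
qed

lemma yl_one: "yl \<nu> 1 = 1"
  using is_hyp_0[OF reg_hyp2F1_is_hyp, of "- \<nu>" "\<nu> + 1" 1] by (simp add: yl_def rGamma_inverse_Gamma)

lemma open_slit: "open (- \<real>\<^sub>\<le>\<^sub>0 :: complex set)"
  by (simp add: open_Compl)

lemma yl_deriv: "z \<notin> \<real>\<^sub>\<le>\<^sub>0 \<Longrightarrow> (yl \<nu> has_field_derivative deriv (yl \<nu>) z) (at z)"
  using holomorphic_derivI[OF yl_holomorphic open_slit] by auto

lemma yl_deriv2: "z \<notin> \<real>\<^sub>\<le>\<^sub>0 \<Longrightarrow> (deriv (yl \<nu>) has_field_derivative deriv (deriv (yl \<nu>)) z) (at z)"
  using holomorphic_derivI[OF holomorphic_deriv[OF yl_holomorphic open_slit] open_slit] by auto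

lemma yl_ode:
  assumes z: "z \<notin> \<real>\<^sub>\<le>\<^sub>0"
  shows "z * (1 - z) * deriv (deriv (yl \<nu>)) z + (1 - 2 * z) * deriv (yl \<nu>) z + \<nu> * (\<nu> + 1) * yl \<nu> z = 0"
proof -
  let ?f = "reg_hyp2F1 (- \<nu>) (\<nu> + 1) 1"
  note hyp = reg_hyp2F1_is_hyp[of "- \<nu>" "\<nu> + 1" 1]
  then have f: "?f holomorphic_on cut1" by (simp add: is_hyp_def)
  have f1: "(?f has_field_derivative deriv ?f w) (at w)" if "w \<in> cut1" for w
    using holomorphic_derivI[OF f open_cut1] that by auto
  have f2: "(deriv ?f has_field_derivative deriv (deriv ?f) w) (at w)" if "w \<in> cut1" for w
    using holomorphic_derivI[OF holomorphic_deriv[OF f open_cut1] open_cut1] that by auto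
  have d1: "deriv (yl \<nu>) w = - deriv ?f (1 - w)" if "w \<notin> \<real>\<^sub>\<le>\<^sub>0" for w
  proof (rule DERIV_imp_deriv)
    have "((\<lambda>w. ?f (1 - w)) has_field_derivative deriv ?f (1 - w) * (0 - 1)) (at w)"
      by (rule DERIV_chain2[where g = "\<lambda>w. 1 - w" and x = w, OF f1[OF one_minus_in_cut1[OF that]]]) (auto intro!: derivative_eq_intros)
    then show "(yl \<nu> has_field_derivative - deriv ?f (1 - w)) (at w)" by (simp add: yl_def[abs_def])
  qed
  have d2: "deriv (deriv (yl \<nu>)) z = deriv (deriv ?f) (1 - z)"
  proof (rule DERIV_imp_deriv)
    have "((\<lambda>w. - deriv ?f (1 - w)) has_field_derivative - (deriv (deriv ?f) (1 - z) * (0 - 1))) (at z)"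
      by (rule DERIV_minus, rule DERIV_chain2[where g = "\<lambda>w. 1 - w" and x = z, OF f2[OF one_minus_in_cut1[OF z]]]) (auto intro!: derivative_eq_intros)
    then have "((\<lambda>w. - deriv ?f (1 - w)) has_field_derivative deriv (deriv ?f) (1 - z)) (at z)" by simp
    then show "(deriv (yl \<nu>) has_field_derivative deriv (deriv ?f) (1 - z)) (at z)"
      by (rule has_field_derivative_transform_within_open[OF _ open_slit]) (use z d1 in auto)
  qed
  have "(1 - z) * z * deriv (deriv ?f) (1 - z) + (1 - 2 * (1 - z)) * deriv ?f (1 - z) + \<nu> * (\<nu> + 1) * ?f (1 - z) = 0"
    using is_hyp_ode[OF hyp one_minus_in_cut1[OF z]] by (simp add: algebra_simps)
  then show ?thesis
    unfolding d2 d1[OF z] yl_def by (simp add: algebra_simps)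
qed

text \<open>Legendre's equation in first-order form. The leading coefficient
  \<open>- (\<nu> + 1)\<close> is the second growth exponent at infinity, and the rest is smaller by
  the factor \<open>1 / (z - 1)\<close>, as \<open>energy_growth\<close> requires.\<close>

lemma ya_deriv:
  assumes z: "z \<notin> \<real>\<^sub>\<le>\<^sub>0" "z \<noteq> 1"
  shows "(ya \<nu> has_field_derivative
      (- (\<nu> + 1) * ya \<nu> z + (\<nu>\<^sup>2 * yl \<nu> z - ya \<nu> z) / (z - 1)) / z) (at z)"
proof -
  have z0: "z \<noteq> 0" using z by auto
  let ?y = "yl \<nu> z" and ?y1 = "deriv (yl \<nu>) z" and ?y2 = "deriv (deriv (yl \<nu>)) z"
  have "(ya \<nu> has_field_derivative (?y1 + z * ?y2 - \<nu> * ?y1)) (at z)"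
    unfolding ya_def[abs_def]
    by (rule derivative_eq_intros yl_deriv yl_deriv2 z refl)+ (simp add: algebra_simps)
  moreover have "?y1 + z * ?y2 - \<nu> * ?y1 = (- (\<nu> + 1) * ya \<nu> z + (\<nu>\<^sup>2 * yl \<nu> z - ya \<nu> z) / (z - 1)) / z"
  proof -
    have h0: "z * (z - 1) * ?y2 = (1 - 2 * z) * ?y1 + \<nu> * (\<nu> + 1) * ?y"
      using yl_ode[OF z(1), of \<nu>] by (simp add: algebra_simps)
    have "z * (z - 1) * (?y1 + z * ?y2 - \<nu> * ?y1) = z * (z - 1) * (1 - \<nu>) * ?y1 + z * (z * (z - 1) * ?y2)"
      by (simp add: algebra_simps)
    also have "\<dots> = (z - 1) * (- (\<nu> + 1) * ya \<nu> z) + (\<nu>\<^sup>2 * yl \<nu> z - ya \<nu> z)"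
      unfolding h0 ya_def by (simp add: algebra_simps power2_eq_square)
    finally have "?y1 + z * ?y2 - \<nu> * ?y1 = ((z - 1) * (- (\<nu> + 1) * ya \<nu> z) + (\<nu>\<^sup>2 * yl \<nu> z - ya \<nu> z)) / (z * (z - 1))"
      using z0 z(2) by (simp only: eq_divide_eq mult_eq_0_iff right_minus_eq mult.commute[of _ "z * (z - 1)"]) simp
    also have "\<dots> = (- (\<nu> + 1) * ya \<nu> z + (\<nu>\<^sup>2 * yl \<nu> z - ya \<nu> z) / (z - 1)) / z"
      using z0 z(2) by (simp add: add_divide_distrib)
    finally show ?thesis .
  qed
  ultimately show ?thesis by simp
qed

lemma cis_notin_nonpos_Reals:
  assumes "r > 0" "\<bar>\<theta>\<bar> < pi"
  shows "of_real r * cis \<theta> \<notin> \<real>\<^sub>\<le>\<^sub>0"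
proof
  assume "of_real r * cis \<theta> \<in> \<real>\<^sub>\<le>\<^sub>0"
  then have s: "sin \<theta> = 0" "cos \<theta> \<le> 0"
    using assms by (auto simp: complex_nonpos_Reals_iff mult_le_0_iff)
  then have "\<theta> = 0" using assms sin_eq_0_pi by auto
  with s show False by simp
qed

lemma norm_bound_from_square:
  fixes z :: complex
  assumes "(norm z)\<^sup>2 \<le> x" "x \<le> D\<^sup>2 * (r powr \<rho>)\<^sup>2" "D \<ge> 0"
  shows "norm z \<le> D * r powr \<rho>"
  by (rule power2_le_imp_le) (use assms in \<open>auto simp: power_mult_distrib\<close>)

text \<open>\<open>energy_growth\<close> along rays with \<open>u = yl\<close> and
  \<open>v = r powr \<delta> * ya\<close>. The weight balances the coupling: \<open>v\<close> enters
  the equation of \<open>u\<close> with \<open>r powr (- \<delta>)\<close>, and \<open>u\<close>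
  enters that of \<open>v\<close> with \<open>r powr (\<delta> - 1)\<close>, so both errors decay
  for \<open>0 < \<delta> < 1\<close>. Its diagonal exponents are \<open>\<nu>\<close> and
  \<open>\<delta> - \<nu> - 1\<close>. Starting at \<open>r = 2\<close> keeps
  \<open>|z - 1| \<ge> r / 2\<close>, and compactness of the arc there makes the constant uniform in
  the angle.\<close>

lemma yl_far_bound:
  assumes \<Theta>: "0 \<le> \<Theta>" "\<Theta> < pi" and \<delta>: "0 < \<delta>" "\<delta> < 1" "Re \<nu> \<le> \<rho>" "\<delta> - Re \<nu> - 1 \<le> \<rho>"
  shows "\<exists>C>0. \<forall>r\<ge>2. \<forall>\<theta>\<in>{-\<Theta>..\<Theta>}. norm (yl \<nu> (of_real r * cis \<theta>)) \<le> C * r powr \<rho> \<and>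
      norm (ya \<nu> (of_real r * cis \<theta>)) \<le> C * r powr (\<rho> - \<delta>)"
proof -
  \<comment> \<open>The slower of the two decay rates of the coupling terms.\<close>
  define d where "d = min \<delta> (1 - \<delta>)"
  define k where "k = 2 * (1 + (norm \<nu>)\<^sup>2)"
  have d: "d > 0" "d \<le> \<delta>" "d \<le> 1 - \<delta>" using \<delta> by (auto simp: d_def)
  have k: "k \<ge> 1" by (simp add: k_def)
  define U where "U \<theta> r = yl \<nu> (of_real r * cis \<theta>)" for \<theta> r
  define V where "V \<theta> r = of_real (r powr \<delta>) * ya \<nu> (of_real r * cis \<theta>)" for \<theta> r
  define E where "E = (\<lambda>\<theta>. (norm (U \<theta> 2))\<^sup>2 + (norm (V \<theta> 2))\<^sup>2)"
  have cont_cis: "continuous_on {-\<Theta>..\<Theta>} (\<lambda>\<theta>. f (of_real 2 * cis \<theta>))" if "f holomorphic_on - \<real>\<^sub>\<le>\<^sub>0" for f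
    by (rule continuous_on_compose2[OF holomorphic_on_imp_continuous_on[OF that]])
       (use \<Theta> cis_notin_nonpos_Reals[of 2] in \<open>auto intro!: continuous_intros\<close>)
  have "continuous_on {-\<Theta>..\<Theta>} E"
    unfolding E_def U_def V_def
    by (intro continuous_intros cont_cis yl_holomorphic)
       (auto simp: ya_def[abs_def] intro!: holomorphic_intros yl_holomorphic holomorphic_deriv open_slit)
  then have "bounded (E ` {-\<Theta>..\<Theta>})"
    by (intro compact_imp_bounded compact_continuous_image) auto
  then obtain B where B: "B > 0" "\<And>\<theta>. \<theta> \<in> {-\<Theta>..\<Theta>} \<Longrightarrow> E \<theta> \<le> B"
    by (force simp: bounded_pos)
  define C where "C = sqrt (B * 2 powr (-2 * \<rho>) * exp (4 * k / d))"
  have "C > 0" using B by (simp add: C_def)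
  have main: "(norm (U \<theta> r))\<^sup>2 + (norm (V \<theta> r))\<^sup>2 \<le> C\<^sup>2 * (r powr \<rho>)\<^sup>2" if r: "r \<ge> 2" and \<theta>: "\<theta> \<in> {-\<Theta>..\<Theta>}" for r \<theta>
  proof -
    define w where "w = cis \<theta>"
    have nw: "norm w = 1" by (simp add: w_def)
    define e1 where "e1 r = of_real (r powr (-\<delta>)) * V \<theta> r" for r
    define e2 where "e2 r = (\<nu>\<^sup>2 * of_real (r powr \<delta>) * U \<theta> r - V \<theta> r) / (of_real r * w - 1)" for r
    have slit: "of_real r * w \<notin> \<real>\<^sub>\<le>\<^sub>0" if "r \<ge> 2" for r
      unfolding w_def by (rule cis_notin_nonpos_Reals) (use that \<theta> \<Theta> in auto)
    have far: "norm (of_real r * w - 1) \<ge> r / 2" if "r \<ge> 2" for r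
    proof -
      have "norm (of_real r * w) - norm (1::complex) \<le> norm (of_real r * w - 1)" by (rule norm_triangle_ineq2)
      then show ?thesis using that nw by (simp add: norm_mult)
    qed
    have lin: "((\<lambda>r. of_real r * w) has_vector_derivative w) (at r)" for r
      by (auto intro!: derivative_eq_intros)
    have "(norm (U \<theta> r))\<^sup>2 + (norm (V \<theta> r))\<^sup>2 \<le> ((norm (U \<theta> 2))\<^sup>2 + (norm (V \<theta> 2))\<^sup>2) * (r / 2) powr (2 * \<rho>) * exp (4 * k / d)"
    proof (rule energy_growth[where a = \<nu> and b = "\<delta> - \<nu> - 1" and ?e1.0 = e1 and ?e2.0 = e2])
      fix r :: real assume r: "2 \<le> r"
      have z: "of_real r * w \<notin> \<real>\<^sub>\<le>\<^sub>0" "of_real r * w \<noteq> 1"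
        using slit[OF r] far[OF r] r by auto
      have rr: "complex_of_real (r powr (-\<delta>)) * of_real (r powr \<delta>) = 1"
        using r by (simp flip: of_real_mult powr_add)
      have "(U \<theta> has_vector_derivative (w * deriv (yl \<nu>) (of_real r * w))) (at r)"
        unfolding U_def w_def[symmetric]
        using field_vector_diff_chain_at[OF lin yl_deriv[OF z(1)]] by (simp add: o_def)
      moreover have "w * deriv (yl \<nu>) (of_real r * w) = (\<nu> * U \<theta> r + e1 r) / of_real r"
      proof -
        have "e1 r = ya \<nu> (of_real r * w)"
          unfolding e1_def V_def w_def[symmetric] mult.assoc[symmetric] rr by simp
        then show ?thesis
          using r unfolding U_def w_def[symmetric] ya_def by simp
      qed
      ultimately show "(U \<theta> has_vector_derivative (\<nu> * U \<theta> r + e1 r) / of_real r) (at r)" by simp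
      let ?A = "ya \<nu> (of_real r * w)" and ?y = "yl \<nu> (of_real r * w)"
      define X where "X = (\<nu>\<^sup>2 * ?y - ?A) / (of_real r * w - 1)"
      let ?D = "(- (\<nu> + 1) * ?A + X) / (of_real r * w)"
      have d1: "((\<lambda>r. ya \<nu> (of_real r * w)) has_vector_derivative w * ?D) (at r)"
        using field_vector_diff_chain_at[OF lin ya_deriv[OF z, of \<nu>, folded X_def]] by (simp only: o_def)
      have d2: "((\<lambda>r. complex_of_real (r powr \<delta>)) has_vector_derivative of_real (\<delta> * r powr \<delta> / r)) (at r)"
      proof -
        have "((\<lambda>r. r powr \<delta>) has_real_derivative (\<delta> * r powr \<delta> / r)) (at r)"
          using r by (auto intro!: derivative_eq_intros simp: powr_diff)
        then show ?thesis
          using has_vector_derivative_of_real has_real_derivative_iff_has_vector_derivative by blast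
      qed
      have "(V \<theta> has_vector_derivative (of_real (r powr \<delta>) * (w * ?D) + of_real (\<delta> * r powr \<delta> / r) * ?A)) (at r)"
        unfolding V_def w_def[symmetric] by (rule has_vector_derivative_mult[OF d2 d1])
      moreover have "of_real (r powr \<delta>) * (w * ?D) + of_real (\<delta> * r powr \<delta> / r) * ?A = ((\<delta> - \<nu> - 1) * V \<theta> r + e2 r) / of_real r"
      proof -
        have "w \<noteq> 0" using nw by auto
        then have "of_real (r powr \<delta>) * (w * ?D) = of_real (r powr \<delta>) * (- (\<nu> + 1) * ?A + X) / of_real r"
          by simp
        moreover have "e2 r = of_real (r powr \<delta>) * X"
          unfolding e2_def U_def V_def w_def[symmetric] X_def by (simp add: diff_divide_distrib algebra_simps)
        ultimately show ?thesis
          unfolding V_def w_def[symmetric] by (simp add: add_divide_distrib diff_divide_distrib algebra_simps)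
      qed
      ultimately show "(V \<theta> has_vector_derivative ((\<delta> - \<nu> - 1) * V \<theta> r + e2 r) / of_real r) (at r)" by simp
      have "norm (e1 r) = r powr (-\<delta>) * norm (V \<theta> r)"
        by (simp add: e1_def norm_mult)
      also have "\<dots> \<le> (k * r powr (-d)) * (norm (U \<theta> r) + norm (V \<theta> r))"
      proof (intro mult_mono)
        have "1 * r powr (-\<delta>) \<le> k * r powr (-d)"
          using k d r by (intro mult_mono powr_mono) auto
        then show "r powr (-\<delta>) \<le> k * r powr (-d)" by simp
      qed (use k in auto)
      finally show "norm (e1 r) \<le> k * r powr (-d) * (norm (U \<theta> r) + norm (V \<theta> r))" .
      have "norm (e2 r) \<le> ((norm \<nu>)\<^sup>2 * r powr \<delta> * norm (U \<theta> r) + norm (V \<theta> r)) / (r / 2)"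
        unfolding e2_def norm_divide
      proof (rule frac_le)
        show "norm (\<nu>\<^sup>2 * of_real (r powr \<delta>) * U \<theta> r - V \<theta> r) \<le> (norm \<nu>)\<^sup>2 * r powr \<delta> * norm (U \<theta> r) + norm (V \<theta> r)"
          by (rule order_trans[OF norm_triangle_ineq4]) (simp add: norm_mult norm_power)
      qed (use r far in auto)
      also have "\<dots> \<le> ((norm \<nu>)\<^sup>2 * r powr \<delta> * norm (U \<theta> r) + r powr \<delta> * norm (V \<theta> r)) / (r / 2)"
        using r \<delta> mult_right_mono[of 1 "r powr \<delta>" "norm (V \<theta> r)"]
        by (intro divide_right_mono add_left_mono) (auto simp: ge_one_powr_ge_zero)
      also have "\<dots> = 2 * r powr (\<delta> - 1) * ((norm \<nu>)\<^sup>2 * norm (U \<theta> r) + 1 * norm (V \<theta> r))"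
        using r by (simp add: powr_diff field_simps)
      also have "\<dots> \<le> 2 * r powr (-d) * ((1 + (norm \<nu>)\<^sup>2) * norm (U \<theta> r) + (1 + (norm \<nu>)\<^sup>2) * norm (V \<theta> r))"
        using d r by (intro mult_mono add_mono powr_mono order_refl) auto
      also have "\<dots> = k * r powr (-d) * (norm (U \<theta> r) + norm (V \<theta> r))"
        by (simp add: k_def algebra_simps)
      finally show "norm (e2 r) \<le> k * r powr (-d) * (norm (U \<theta> r) + norm (V \<theta> r))" .
    qed (use d k \<delta> r in auto)
    also have "\<dots> \<le> B * (r / 2) powr (2 * \<rho>) * exp (4 * k / d)"
      using B(2)[OF \<theta>] unfolding E_def by (intro mult_right_mono) auto
    also have "\<dots> = C\<^sup>2 * (r powr \<rho>)\<^sup>2"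
    proof -
      have "(r powr \<rho>)\<^sup>2 = r powr (2 * \<rho>)" using r by (simp add: powr_power mult.commute)
      then show ?thesis using r B by (simp add: C_def powr_divide powr_minus_divide field_simps)
    qed
    finally show ?thesis .
  qed
  show ?thesis
  proof (intro exI[of _ C] conjI allI impI ballI)
    fix r \<theta> assume r: "2 \<le> (r::real)" and \<theta>: "\<theta> \<in> {-\<Theta>..\<Theta>}"
    show "norm (yl \<nu> (of_real r * cis \<theta>)) \<le> C * r powr \<rho>"
      by (rule norm_bound_from_square[OF _ main[OF r \<theta>]]) (use \<open>C > 0\<close> in \<open>auto simp: U_def\<close>)
    have "norm (V \<theta> r) \<le> C * r powr \<rho>"
      by (rule norm_bound_from_square[OF _ main[OF r \<theta>]]) (use \<open>C > 0\<close> in auto)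
    then have "r powr \<delta> * norm (ya \<nu> (of_real r * cis \<theta>)) \<le> C * r powr \<rho>" by (simp add: V_def norm_mult)
    then show "norm (ya \<nu> (of_real r * cis \<theta>)) \<le> C * r powr (\<rho> - \<delta>)"
      using r by (simp add: powr_diff field_simps)
  qed (fact \<open>C > 0\<close>)
qed

text \<open>For radii between \<open>m\<close> and \<open>2\<close> the sector is compact and off
  the slit, so continuity supplies the bound that \<open>yl_far_bound\<close> gives beyond
  \<open>2\<close>.\<close>

lemma yl_sector_bound:
  assumes \<Theta>: "0 \<le> \<Theta>" "\<Theta> < pi" and \<delta>: "0 < \<delta>" "\<delta> < 1" "Re \<nu> \<le> \<rho>" "\<delta> - Re \<nu> - 1 \<le> \<rho>" and m: "m > 0"
  shows "\<exists>C>0. \<forall>r\<ge>m. \<forall>\<theta>\<in>{-\<Theta>..\<Theta>}. norm (yl \<nu> (of_real r * cis \<theta>)) \<le> C * r powr \<rho> \<and>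
      norm (ya \<nu> (of_real r * cis \<theta>)) \<le> C * r powr (\<rho> - \<delta>)"
proof -
  from yl_far_bound[OF assms(1-6)] obtain C1 where C1: "C1 > 0"
    "\<And>r \<theta>. r \<ge> 2 \<Longrightarrow> \<theta> \<in> {-\<Theta>..\<Theta>} \<Longrightarrow> norm (yl \<nu> (of_real r * cis \<theta>)) \<le> C1 * r powr \<rho> \<and>
      norm (ya \<nu> (of_real r * cis \<theta>)) \<le> C1 * r powr (\<rho> - \<delta>)" by blast
  define F where "F x = norm (yl \<nu> (of_real (fst x) * cis (snd x))) / (fst x) powr \<rho>
      + norm (ya \<nu> (of_real (fst x) * cis (snd x))) / (fst x) powr (\<rho> - \<delta>)" for x
  have cont: "continuous_on ({m..2} \<times> {-\<Theta>..\<Theta>}) (\<lambda>x. f (of_real (fst x) * cis (snd x)))" if "f holomorphic_on - \<real>\<^sub>\<le>\<^sub>0" for f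
    by (rule continuous_on_compose2[OF holomorphic_on_imp_continuous_on[OF that]])
       (use \<Theta> m cis_notin_nonpos_Reals in \<open>auto intro!: continuous_intros\<close>)
  have "continuous_on ({m..2} \<times> {-\<Theta>..\<Theta>}) F"
    unfolding F_def[abs_def]
    by (intro continuous_intros cont yl_holomorphic)
       (use m in \<open>auto simp: ya_def[abs_def] intro!: holomorphic_intros yl_holomorphic holomorphic_deriv open_slit\<close>)
  then have "bounded (F ` ({m..2} \<times> {-\<Theta>..\<Theta>}))"
    by (intro compact_imp_bounded compact_continuous_image compact_Times) auto
  then obtain B where B: "B > 0" "\<And>x. x \<in> {m..2} \<times> {-\<Theta>..\<Theta>} \<Longrightarrow> F x \<le> B"
    by (force simp: bounded_pos)
  show ?thesis
  proof (intro exI[of _ "max C1 B"] conjI allI impI ballI)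
    fix r \<theta> assume r: "m \<le> (r::real)" and \<theta>: "\<theta> \<in> {-\<Theta>..\<Theta>}"
    let ?y = "norm (yl \<nu> (of_real r * cis \<theta>))" and ?A = "norm (ya \<nu> (of_real r * cis \<theta>))"
    have "?y \<le> max C1 B * r powr \<rho> \<and> ?A \<le> max C1 B * r powr (\<rho> - \<delta>)"
    proof (cases "r \<ge> 2")
      case True
      have "C1 * r powr e \<le> max C1 B * r powr e" for e by (intro mult_right_mono) auto
      then show ?thesis using C1(2)[OF True \<theta>] order_trans by blast
    next
      case False
      then have "?y / r powr \<rho> + ?A / r powr (\<rho> - \<delta>) \<le> B" using B(2)[of "(r, \<theta>)"] r \<theta> by (simp add: F_def)
      moreover have "?y / r powr \<rho> \<ge> 0" "?A / r powr (\<rho> - \<delta>) \<ge> 0" by auto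
      ultimately have "?y / r powr \<rho> \<le> max C1 B" "?A / r powr (\<rho> - \<delta>) \<le> max C1 B" by linarith+
      then show ?thesis using r m by (simp add: divide_le_eq)
    qed
    then show "?y \<le> max C1 B * r powr \<rho>" "?A \<le> max C1 B * r powr (\<rho> - \<delta>)" by auto
  qed (use B in auto)
qed

lemma continuous_on_vector_derivative_at:
  "(\<And>x. x \<in> S \<Longrightarrow> (f has_vector_derivative f' x) (at x)) \<Longrightarrow> continuous_on S f"
  by (rule continuous_on_vector_derivative) (auto intro: has_vector_derivative_at_within)

lemma norm_powr_le:
  "norm (z powr (- \<nu>)) \<le> exp (pi * \<bar>Im \<nu>\<bar>) * norm z powr (- Re \<nu>)"
proof -
  have "Im \<nu> * Arg z \<le> \<bar>Im \<nu>\<bar> * pi"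
  proof -
    have "Im \<nu> * Arg z \<le> \<bar>Im \<nu>\<bar> * \<bar>Arg z\<bar>" by (metis abs_ge_self abs_mult)
    also have "\<dots> \<le> \<bar>Im \<nu>\<bar> * pi" using Arg_bounded[of z] by (intro mult_left_mono) auto
    finally show ?thesis .
  qed
  then show ?thesis
    unfolding norm_powr_complex by (simp add: mult.commute mult_right_mono)
qed

text \<open>The derivative of \<open>z powr (- \<nu>) * yl \<nu> z\<close> is
  \<open>z powr (- \<nu>) * ya \<nu> z / z\<close>, of size \<open>r powr (- \<delta> - 1)\<close>.
  Hence the function is Cauchy along the positive axis, and its variation over an arc of length at
  most \<open>pi * r\<close> also tends to zero, so all directions share the limit
  \<open>c\<close>.\<close>

lemma yl_limit:
  assumes \<nu>: "Re \<nu> > -1/2" and \<Theta>: "0 \<le> \<Theta>" "\<Theta> < pi"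
  shows "\<exists>c C \<delta>. \<delta> > 0 \<and> (\<forall>r\<ge>1. \<forall>\<theta>\<in>{-\<Theta>..\<Theta>}.
      norm ((of_real r * cis \<theta>) powr (- \<nu>) * yl \<nu> (of_real r * cis \<theta>) - c) \<le> C * r powr (-\<delta>))"
proof -
  \<comment> \<open>For \<open>Re \<nu> > -1/2\<close> the power \<open>\<nu>\<close> dominates
    \<open>- \<nu> - 1\<close> with gap \<open>2 * Re \<nu> + 1\<close>. A \<open>\<delta>\<close>
    within this gap allows the growth rate \<open>\<rho> = Re \<nu>\<close> itself in
    \<open>yl_sector_bound\<close>.\<close>
  define \<delta> where "\<delta> = min (1/2) (2 * Re \<nu> + 1)"
  have \<delta>: "0 < \<delta>" "\<delta> < 1" "\<delta> - Re \<nu> - 1 \<le> Re \<nu>" using \<nu> by (auto simp: \<delta>_def)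
  obtain C1 where C1: "C1 > 0"
    "\<And>r \<theta>. r \<ge> 1 \<Longrightarrow> \<theta> \<in> {-\<Theta>..\<Theta>} \<Longrightarrow> norm (ya \<nu> (of_real r * cis \<theta>)) \<le> C1 * r powr (Re \<nu> - \<delta>)"
    using yl_sector_bound[OF \<Theta> \<delta>(1,2) order_refl \<delta>(3), of 1] by auto
  define C2 where "C2 = exp (pi * \<bar>Im \<nu>\<bar>) * C1"
  have "C2 > 0" using C1 by (simp add: C2_def)
  define q where "q z = z powr (- \<nu>) * yl \<nu> z" for z
  define q' where "q' z = z powr (- \<nu>) * ya \<nu> z / z" for z
  have dq: "(q has_field_derivative q' z) (at z)" if z: "z \<notin> \<real>\<^sub>\<le>\<^sub>0" for z
  proof -
    have z0: "z \<noteq> 0" using z by auto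
    have "(q has_field_derivative (- \<nu> * z powr (- \<nu> - 1)) * yl \<nu> z + z powr (- \<nu>) * deriv (yl \<nu>) z) (at z)"
      unfolding q_def[abs_def] by (rule derivative_eq_intros yl_deriv z refl)+ (simp add: algebra_simps)
    moreover have "z powr (- \<nu> - 1) = z powr (- \<nu>) / z" using z0 by (simp add: powr_diff)
    ultimately show ?thesis
      using z0 by (simp add: q'_def ya_def field_simps)
  qed
  have bq: "norm (q' (of_real r * cis \<theta>)) \<le> C2 * r powr (- \<delta> - 1)" if r: "r \<ge> 1" and \<theta>: "\<theta> \<in> {-\<Theta>..\<Theta>}" for r \<theta>
  proof -
    let ?z = "of_real r * cis \<theta>"
    have nz: "norm ?z = r" using r by (simp add: norm_mult)
    have "norm (q' ?z) = norm (?z powr (- \<nu>)) * norm (ya \<nu> ?z) / r"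
      using r by (simp add: q'_def norm_mult norm_divide)
    also have "\<dots> \<le> (exp (pi * \<bar>Im \<nu>\<bar>) * r powr (- Re \<nu>)) * (C1 * r powr (Re \<nu> - \<delta>)) / r"
      using norm_powr_le[of ?z \<nu>] C1(2)[OF r \<theta>] r unfolding nz by (intro divide_right_mono mult_mono) auto
    also have "\<dots> = C2 * (r powr (- Re \<nu>) * r powr (Re \<nu> - \<delta>) / r)" by (simp add: C2_def)
    also have "r powr (- Re \<nu>) * r powr (Re \<nu> - \<delta>) / r = r powr (- \<delta> - 1)"
    proof -
      have "r powr (- Re \<nu>) * r powr (Re \<nu> - \<delta>) = r powr (- \<delta>)" by (simp flip: powr_add)
      then show ?thesis using r by (simp add: powr_diff)
    qed
    finally show ?thesis .
  qed
  have radial: "norm (q (of_real s) - q (of_real r)) \<le> C2 / \<delta> * r powr (-\<delta>)" if rs: "1 \<le> r" "r \<le> s" for r s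
  proof (cases "r = s")
    case True then show ?thesis using \<open>C2 > 0\<close> \<delta> by simp
  next
    case False
    let ?f = "\<lambda>t::real. q (of_real t)" and ?\<phi> = "\<lambda>t. - (C2 / \<delta>) * t powr (-\<delta>)"
    have df: "(?f has_vector_derivative q' (of_real t)) (at t)" if "t \<ge> 1" for t
      using has_vector_derivative_real_field[OF dq[of "of_real t"]] that by (simp add: complex_nonpos_Reals_iff)
    have dp: "(?\<phi> has_vector_derivative C2 * t powr (-\<delta> - 1)) (at t)" if "t \<ge> 1" for t
      using that \<delta> unfolding has_real_derivative_iff_has_vector_derivative[symmetric]
      by (auto intro!: derivative_eq_intros)
    have "norm (?f s - ?f r) \<le> ?\<phi> s - ?\<phi> r"
    proof (rule differentiable_bound_general[where f' = "\<lambda>t. q' (of_real t)" and \<phi>' = "\<lambda>t. C2 * t powr (-\<delta> - 1)"])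
      show "continuous_on {r..s} ?f"
        by (rule continuous_on_vector_derivative_at[OF df]) (use rs in auto)
      show "continuous_on {r..s} ?\<phi>"
        by (rule continuous_on_vector_derivative_at[OF dp]) (use rs in auto)
      show "norm (q' (of_real t)) \<le> C2 * t powr (-\<delta> - 1)" if "r < t" "t < s" for t
        using bq[of t 0] that rs \<Theta> by simp
    qed (use df dp rs False in auto)
    also have "\<dots> \<le> C2 / \<delta> * r powr (-\<delta>)"
    proof -
      have "0 \<le> C2 / \<delta> * s powr (-\<delta>)" using \<open>C2 > 0\<close> \<delta> by simp
      then show ?thesis by simp
    qed
    finally show ?thesis .
  qed
  have lim0: "(\<lambda>n. C2 / \<delta> * (real n + 1) powr (-\<delta>)) \<longlonglongrightarrow> 0"
  proof -
    have "filterlim (\<lambda>n. 1 + real n) at_top sequentially"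
      by (rule filterlim_tendsto_add_at_top[OF tendsto_const filterlim_real_sequentially])
    then have "((\<lambda>n. (1 + real n) powr (-\<delta>)) \<longlongrightarrow> 0) sequentially"
      by (intro tendsto_neg_powr) (use \<delta> in auto)
    from tendsto_mult_right_zero[OF this, of "C2 / \<delta>"] show ?thesis by (simp add: add.commute)
  qed
  have "Cauchy (\<lambda>n. q (of_real (real n + 1)))"
  proof (rule metric_CauchyI)
    fix e :: real assume "e > 0"
    then obtain N where N: "C2 / \<delta> * (real N + 1) powr (-\<delta>) < e / 2"
      using order_tendstoD(2)[OF lim0, of "e / 2"] by (auto simp: eventually_sequentially)
    have *: "dist (q (of_real (real n + 1))) (q (of_real (real N + 1))) < e / 2" if "n \<ge> N" for n
      unfolding dist_norm by (rule le_less_trans[OF radial N]) (use that in auto)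
    have "dist (q (of_real (real m + 1))) (q (of_real (real n + 1))) < e" if "m \<ge> N" "n \<ge> N" for m n
      using *[OF that(1)] *[OF that(2)] dist_triangle_half_l by blast
    then show "\<exists>M. \<forall>m\<ge>M. \<forall>n\<ge>M. dist (q (of_real (real m + 1))) (q (of_real (real n + 1))) < e" by blast
  qed
  then obtain c where c: "(\<lambda>n. q (of_real (real n + 1))) \<longlonglongrightarrow> c"
    using Cauchy_convergent_iff convergent_def by blast
  have rad: "norm (q (of_real r) - c) \<le> C2 / \<delta> * r powr (-\<delta>)" if "r \<ge> 1" for r
  proof -
    have "(\<lambda>n. norm (q (of_real (real n + 1)) - q (of_real r))) \<longlonglongrightarrow> norm (c - q (of_real r))"
      by (intro tendsto_intros c)
    moreover have "eventually (\<lambda>n. norm (q (of_real (real n + 1)) - q (of_real r)) \<le> C2 / \<delta> * r powr (-\<delta>)) sequentially"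
      using eventually_ge_at_top[of "nat \<lceil>r\<rceil>"]
    proof eventually_elim
      case (elim n)
      then have "r \<le> real n + 1" by linarith
      then show ?case by (rule radial[OF that])
    qed
    ultimately have "norm (c - q (of_real r)) \<le> C2 / \<delta> * r powr (-\<delta>)"
      by (rule tendsto_upperbound) simp
    then show ?thesis by (simp add: norm_minus_commute)
  qed
  have ang: "norm (q (of_real r * cis \<theta>) - q (of_real r)) \<le> C2 * pi * r powr (-\<delta>)"
    if r: "r \<ge> 1" and \<theta>: "\<theta> \<in> {-\<Theta>..\<Theta>}" for r \<theta>
  proof -
    let ?f = "\<lambda>t. q (of_real r * cis t)"
    have df: "(?f has_vector_derivative (\<i> * of_real r * cis t) * q' (of_real r * cis t)) (at t within {-\<Theta>..\<Theta>})" if "t \<in> {-\<Theta>..\<Theta>}" for t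
    proof -
      have "((\<lambda>t. of_real r * cis t) has_vector_derivative \<i> * of_real r * cis t) (at t)"
      proof -
        have "((\<lambda>z. of_real r * exp (\<i> * z)) has_field_derivative \<i> * of_real r * exp (\<i> * of_real t)) (at (of_real t))"
          by (rule derivative_eq_intros refl)+ simp
        from has_vector_derivative_real_field[OF this] show ?thesis by (simp add: cis_conv_exp)
      qed
      from field_vector_diff_chain_at[OF this dq[OF cis_notin_nonpos_Reals]] that \<Theta> r
      show ?thesis by (auto simp: o_def intro: has_vector_derivative_at_within)
    qed
    have "norm (?f \<theta> - ?f 0) \<le> (C2 * r powr (-\<delta>)) * norm (\<theta> - 0)"
    proof (rule differentiable_bound[where S = "{-\<Theta>..\<Theta>}" and f' = "\<lambda>t h. h *\<^sub>R ((\<i> * of_real r * cis t) * q' (of_real r * cis t))"])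
      show "(?f has_derivative (\<lambda>h. h *\<^sub>R ((\<i> * of_real r * cis t) * q' (of_real r * cis t)))) (at t within {-\<Theta>..\<Theta>})" if "t \<in> {-\<Theta>..\<Theta>}" for t
        using df[OF that] by (simp add: has_vector_derivative_def)
      show "onorm (\<lambda>h. h *\<^sub>R ((\<i> * of_real r * cis t) * q' (of_real r * cis t))) \<le> C2 * r powr (-\<delta>)" if "t \<in> {-\<Theta>..\<Theta>}" for t
      proof (rule onorm_le)
        fix h :: real
        have "norm (h *\<^sub>R ((\<i> * of_real r * cis t) * q' (of_real r * cis t))) = \<bar>h\<bar> * (r * norm (q' (of_real r * cis t)))"
          using r by (simp add: norm_mult)
        also have "\<dots> \<le> \<bar>h\<bar> * (r * (C2 * r powr (- \<delta> - 1)))"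
          using bq[OF r that] r by (intro mult_left_mono) auto
        also have "\<dots> = C2 * r powr (-\<delta>) * norm h" using r by (simp add: powr_diff)
        finally show "norm (h *\<^sub>R ((\<i> * of_real r * cis t) * q' (of_real r * cis t))) \<le> C2 * r powr (-\<delta>) * norm h" .
      qed
    qed (use \<theta> \<Theta> in auto)
    also have "\<dots> \<le> C2 * r powr (-\<delta>) * pi"
      using \<theta> \<Theta> \<open>C2 > 0\<close> by (intro mult_left_mono) auto
    finally show ?thesis by (simp add: mult_ac)
  qed
  have "norm (q (of_real r * cis \<theta>) - c) \<le> (C2 * pi + C2 / \<delta>) * r powr (-\<delta>)" if r: "r \<ge> 1" and \<theta>: "\<theta> \<in> {-\<Theta>..\<Theta>}" for r \<theta>
  proof -
    have "norm (q (of_real r * cis \<theta>) - c) \<le> norm (q (of_real r * cis \<theta>) - q (of_real r)) + norm (q (of_real r) - c)"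
      using norm_triangle_ineq[of "q (of_real r * cis \<theta>) - q (of_real r)" "q (of_real r) - c"] by simp
    then show ?thesis using ang[OF r \<theta>] rad[OF r] by (simp add: distrib_right)
  qed
  then show ?thesis using \<delta>(1) unfolding q_def by blast
qed

section \<open>A Mellin transform\<close>

lemma integrable_powr_majorant:
  fixes f :: "real \<Rightarrow> complex"
  assumes f: "continuous_on {0<..1} f" and e: "e > 0"
    and b: "\<And>t. 0 < t \<Longrightarrow> t \<le> 1 \<Longrightarrow> norm (f t) \<le> C * t powr (e - 1)"
  shows "f integrable_on {0..1}"
    and "norm (integral {0..1} f) \<le> C / e"
    and "0 < \<epsilon> \<Longrightarrow> \<epsilon> \<le> 1 \<Longrightarrow> norm (integral {0..1} f - integral {\<epsilon>..1} f) \<le> C / e * \<epsilon> powr e"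
proof -
  have hp: "((\<lambda>t. C * t powr (e - 1)) has_integral C * (c powr e / e)) {0..c}" if "c \<ge> 0" for c
    using has_integral_mult_right[OF has_integral_powr_from_0[of "e - 1" c], of C] e that by simp
  have neg: "negligible (sym_diff {0..1} {0<..1::real})"
    by (rule negligible_subset[of "{0}"]) auto
  have "f absolutely_integrable_on {0<..1}"
  proof (rule measurable_bounded_by_integrable_imp_absolutely_integrable[where g = "\<lambda>t. C * t powr (e - 1)"])
    show "f \<in> borel_measurable (lebesgue_on {0<..1})"
      by (rule continuous_imp_measurable_on_sets_lebesgue[OF f]) auto
    show "(\<lambda>t. C * t powr (e - 1)) integrable_on {0<..1}"
      using has_integral_integrable[OF hp[of 1]] integrable_spike_set_eq[OF neg, of "\<lambda>t. C * t powr (e - 1)"] by simp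
  qed (use b in auto)
  then show int: "f integrable_on {0..1}"
    using integrable_spike_set_eq[OF neg, of f] set_lebesgue_integral_eq_integral(1) by blast
  have b0: "norm (integral {0..c} f) \<le> C * (c powr e / e)" if c: "0 \<le> c" "c \<le> 1" for c
  proof -
    \<comment> \<open>The bound on \<open>f\<close> says nothing about \<open>t = 0\<close>, so the
      value there is reset; a single point does not affect the integral.\<close>
    define h where "h t = (if t = 0 then 0 else f t)" for t
    have neg0: "negligible {0::real}" by simp
    have "integral {0..c} f = integral {0..c} h"
      by (rule integral_spike[OF neg0]) (auto simp: h_def)
    moreover have "h integrable_on {0..c}"
      by (rule integrable_spike[OF integrable_on_subinterval[OF int] neg0]) (use c in \<open>auto simp: h_def\<close>)
    then have "norm (integral {0..c} h) \<le> integral {0..c} (\<lambda>t. C * t powr (e - 1))"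
      by (rule integral_norm_bound_integral[OF _ has_integral_integrable[OF hp[OF c(1)]]])
         (use b c in \<open>auto simp: h_def\<close>)
    ultimately show ?thesis using integral_unique[OF hp[OF c(1)]] by simp
  qed
  show "norm (integral {0..1} f) \<le> C / e" using b0[of 1] by simp
  show "norm (integral {0..1} f - integral {\<epsilon>..1} f) \<le> C / e * \<epsilon> powr e" if "0 < \<epsilon>" "\<epsilon> \<le> 1"
  proof -
    have "integral {0..1} f - integral {\<epsilon>..1} f = integral {0..\<epsilon>} f"
      using Henstock_Kurzweil_Integration.integral_combine[OF _ that(2) int] that by (simp add: algebra_simps)
    then show ?thesis using b0[of \<epsilon>] that by simp
  qed
qed

lemma Lim_transform_bound_at_right:
  fixes f :: "real \<Rightarrow> complex"
  assumes "eventually (\<lambda>t. norm (f t - l) \<le> g t) (at_right 0)" "(g \<longlongrightarrow> 0) (at_right 0)"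
  shows "(f \<longlongrightarrow> l) (at_right 0)"
proof -
  have "((\<lambda>t. f t - l) \<longlongrightarrow> 0) (at_right 0)"
    by (rule Lim_null_comparison[OF assms])
  then show ?thesis by (simp add: LIM_zero_iff)
qed

lemma powr_tendsto_0_at_right:
  fixes e :: real
  assumes "e > 0"
  shows "((\<lambda>t. c * t powr e) \<longlongrightarrow> 0) (at_right 0)"
proof (rule tendsto_mult_right_zero, rule tendsto_zero_powrI)
  show "eventually (\<lambda>t::real. 0 \<le> t) (at_right 0)"
    unfolding eventually_at_right_field by (intro exI[of _ 1]) auto
qed (use assms in \<open>auto intro!: tendsto_intros\<close>)

text \<open>The fundamental theorem on \<open>[t, 1]\<close>, followed by \<open>t\<close> to
  \<open>0\<close>: the majorant makes the integrals converge and the bound on \<open>H\<close>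
  removes the lower boundary value.\<close>

lemma integral_derivative_vanishing_at_0:
  fixes H h :: "real \<Rightarrow> complex"
  assumes H: "\<And>t. 0 < t \<Longrightarrow> t \<le> 1 \<Longrightarrow> (H has_vector_derivative h t) (at t)"
    and h: "continuous_on {0<..1} h" and e: "e > 0"
    and b: "\<And>t. 0 < t \<Longrightarrow> t \<le> 1 \<Longrightarrow> norm (h t) \<le> C * t powr (e - 1)"
    and b0: "\<And>t. 0 < t \<Longrightarrow> t \<le> 1 \<Longrightarrow> norm (H t) \<le> D * t powr e"
  shows "integral {0..1} h = H 1"
proof -
  have "((\<lambda>t. integral {t..1} h) \<longlongrightarrow> integral {0..1} h) (at_right 0)"
  proof (rule Lim_transform_bound_at_right)
    show "eventually (\<lambda>t. norm (integral {t..1} h - integral {0..1} h) \<le> C / e * t powr e) (at_right 0)"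
      unfolding eventually_at_right_field
      using integrable_powr_majorant(3)[OF h e b] by (intro exI[of _ 1]) (auto simp: norm_minus_commute)
    show "((\<lambda>t. C / e * t powr e) \<longlongrightarrow> 0) (at_right 0)" by (rule powr_tendsto_0_at_right[OF e])
  qed
  moreover have "((\<lambda>t. integral {t..1} h) \<longlongrightarrow> H 1) (at_right 0)"
  proof (rule Lim_transform_bound_at_right)
    have "norm (integral {t..1} h - H 1) \<le> D * t powr e" if "0 < t" "t < 1" for t
    proof -
      have "(h has_integral H 1 - H t) {t..1}"
        by (rule fundamental_theorem_of_calculus) (use H that in \<open>auto intro: has_vector_derivative_at_within\<close>)
      then have "integral {t..1} h - H 1 = - H t" by (simp add: integral_unique)
      then show ?thesis using b0[of t] that by simp
    qed
    then show "eventually (\<lambda>t. norm (integral {t..1} h - H 1) \<le> D * t powr e) (at_right 0)"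
      unfolding eventually_at_right_field by (intro exI[of _ 1]) auto
    show "((\<lambda>t. D * t powr e) \<longlongrightarrow> 0) (at_right 0)" by (rule powr_tendsto_0_at_right[OF e])
  qed
  ultimately show ?thesis
    by (rule tendsto_unique[rotated]) simp
qed

lemma yl_real_bounds:
  assumes "\<rho> > Re \<nu>" "\<rho> > - Re \<nu> - 1"
  shows "\<exists>C>0. \<forall>r\<ge>1. norm (yl \<nu> (of_real r)) \<le> C * r powr \<rho> \<and> norm (deriv (yl \<nu>) (of_real r)) \<le> C * r powr (\<rho> - 1)"
proof -
  define \<delta> where "\<delta> = min (1/2) (\<rho> + Re \<nu> + 1)"
  have \<delta>: "0 < \<delta>" "\<delta> < 1" "\<delta> - Re \<nu> - 1 \<le> \<rho>" using assms by (auto simp: \<delta>_def)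
  obtain C where C: "C > 0" "\<And>r. r \<ge> 1 \<Longrightarrow> norm (yl \<nu> (of_real r)) \<le> C * r powr \<rho> \<and> norm (ya \<nu> (of_real r)) \<le> C * r powr (\<rho> - \<delta>)"
    using yl_sector_bound[of 0 \<delta> \<nu> \<rho> 1] \<delta> assms by auto
  show ?thesis
  proof (intro exI[of _ "C * (2 + norm \<nu>)"] conjI allI impI)
    fix r :: real assume r: "1 \<le> r"
    have n: "norm \<nu> \<ge> 0" by simp
    have "norm (yl \<nu> (of_real r)) \<le> C * r powr \<rho>" using C r by auto
    also have "\<dots> \<le> C * (2 + norm \<nu>) * r powr \<rho>"
      using C n by (intro mult_right_mono) (auto simp: algebra_simps)
    finally show "norm (yl \<nu> (of_real r)) \<le> C * (2 + norm \<nu>) * r powr \<rho>" .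
    have "deriv (yl \<nu>) (of_real r) = (ya \<nu> (of_real r) + \<nu> * yl \<nu> (of_real r)) / of_real r"
      using r by (simp add: ya_def)
    also have "norm \<dots> \<le> (norm (ya \<nu> (of_real r)) + norm \<nu> * norm (yl \<nu> (of_real r))) / r"
      using r norm_triangle_ineq[of "ya \<nu> (of_real r)" "\<nu> * yl \<nu> (of_real r)"]
      by (simp add: norm_divide norm_mult divide_right_mono)
    also have "\<dots> \<le> (C * r powr \<rho> + norm \<nu> * (C * r powr \<rho>)) / r"
    proof (intro divide_right_mono add_mono mult_left_mono)
      have "norm (ya \<nu> (of_real r)) \<le> C * r powr (\<rho> - \<delta>)" using C r by auto
      also have "\<dots> \<le> C * r powr \<rho>" using C r \<delta> by (intro mult_left_mono powr_mono) auto
      finally show "norm (ya \<nu> (of_real r)) \<le> C * r powr \<rho>" .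
    qed (use C r in auto)
    also have "\<dots> = C * (1 + norm \<nu>) * r powr (\<rho> - 1)"
      using r by (simp add: powr_diff field_simps)
    also have "\<dots> \<le> C * (2 + norm \<nu>) * r powr (\<rho> - 1)"
      using C by (intro mult_right_mono mult_left_mono) auto
    finally show "norm (deriv (yl \<nu>) (of_real r)) \<le> C * (2 + norm \<nu>) * r powr (\<rho> - 1)" .
  qed (use C in \<open>simp add: add_pos_nonneg\<close>)
qed

text \<open>
  \<open>pl \<nu> t\<close> is \<open>P\<^sub>\<nu>(1 / t)\<close>, and \<open>pl1\<close> its derivative.
\<close>

definition pl :: "complex \<Rightarrow> real \<Rightarrow> complex" where
  "pl \<nu> t = yl \<nu> (of_real ((1 + t) / (2 * t)))"

definition pl1 :: "complex \<Rightarrow> real \<Rightarrow> complex" where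
  "pl1 \<nu> t = deriv (yl \<nu>) (of_real ((1 + t) / (2 * t))) * of_real (- 1 / (2 * t\<^sup>2))"

text \<open>With \<open>x = 1 / t\<close> this is the integral of \<open>x powr (- s)\<close> times
  the Legendre function over \<open>x > 1\<close>.\<close>

definition mellin :: "complex \<Rightarrow> complex \<Rightarrow> complex" where
  "mellin \<nu> s = integral {0..1} (\<lambda>t. of_real t powr (s - 2) * pl \<nu> t)"

text \<open>The argument lies between \<open>1 / (2 t)\<close> and \<open>1 / t\<close>; which of
  the two bounds the power depends on the sign of the exponent.\<close>

lemma powr_mean_bound:
  fixes t e :: real
  assumes t: "0 < t" "t \<le> 1"
  shows "((1 + t) / (2 * t)) powr e \<le> max 1 (2 powr (- e)) * t powr (- e)"
proof (cases "e \<ge> 0")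
    case True
    have "((1 + t) / (2 * t)) powr e \<le> (1 / t) powr e"
      using t True by (intro powr_mono2) (auto simp: field_simps)
    also have "\<dots> = 1 * t powr (- e)" using t by (simp add: powr_divide powr_minus_divide)
    also have "\<dots> \<le> max 1 (2 powr (- e)) * t powr (- e)" by (intro mult_right_mono) auto
    finally show ?thesis .
  next
    case False
    have "((1 + t) / (2 * t)) powr e \<le> (1 / (2 * t)) powr e"
      using t False by (intro powr_mono2') (auto simp: field_simps)
    also have "\<dots> = 2 powr (- e) * t powr (- e)" using t by (simp add: powr_divide powr_minus_divide powr_mult)
    also have "\<dots> \<le> max 1 (2 powr (- e)) * t powr (- e)" by (intro mult_right_mono) auto
    finally show ?thesis .
  qed

lemma pl_bounds:
  assumes "\<rho> > Re \<nu>" "\<rho> > - Re \<nu> - 1"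
  shows "\<exists>C>0. \<forall>t. 0 < t \<and> t \<le> 1 \<longrightarrow> norm (pl \<nu> t) \<le> C * t powr (-\<rho>) \<and> norm (pl1 \<nu> t) \<le> C * t powr (- \<rho> - 1)"
proof -
  obtain C where C: "C > 0" "\<And>r. r \<ge> 1 \<Longrightarrow> norm (yl \<nu> (of_real r)) \<le> C * r powr \<rho>"
    "\<And>r. r \<ge> 1 \<Longrightarrow> norm (deriv (yl \<nu>) (of_real r)) \<le> C * r powr (\<rho> - 1)"
    using yl_real_bounds[OF assms] by blast
  define D where "D = max 1 (2 powr (-\<rho>)) * max 1 (2 powr (1 - \<rho>))"
  show ?thesis
  proof (intro exI[of _ "C * D"] conjI allI impI)
    fix t :: real assume "0 < t \<and> t \<le> 1"
    then have t: "0 < t" "t \<le> 1" by auto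
    have r: "(1 + t) / (2 * t) \<ge> 1" using t by (simp add: field_simps)
    have "norm (pl \<nu> t) \<le> C * ((1 + t) / (2 * t)) powr \<rho>" unfolding pl_def by (rule C(2)[OF r])
    also have "\<dots> \<le> C * (max 1 (2 powr (- \<rho>)) * t powr (- \<rho>))"
      using C by (intro mult_left_mono powr_mean_bound t) auto
    also have "\<dots> \<le> C * (D * t powr (- \<rho>))"
    proof -
      have "max 1 (2 powr (- \<rho>)) * 1 \<le> D" unfolding D_def by (intro mult_left_mono) auto
      then show ?thesis using C by (intro mult_left_mono mult_right_mono) auto
    qed
    finally show "norm (pl \<nu> t) \<le> C * D * t powr (-\<rho>)" by simp
    have "norm (pl1 \<nu> t) = norm (deriv (yl \<nu>) (of_real ((1 + t) / (2 * t)))) * (1 / (2 * t\<^sup>2))"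
      using t by (simp add: pl1_def norm_mult norm_divide norm_power)
    also have "\<dots> \<le> (C * ((1 + t) / (2 * t)) powr (\<rho> - 1)) * (1 / (2 * t\<^sup>2))"
      by (intro mult_right_mono C(3) r) auto
    also have "\<dots> \<le> (C * (max 1 (2 powr (- (\<rho> - 1))) * t powr (- (\<rho> - 1)))) * (1 / t\<^sup>2)"
      using C t by (intro mult_mono mult_left_mono powr_mean_bound t) (auto simp: field_simps)
    also have "\<dots> \<le> (C * (D * t powr (- (\<rho> - 1)))) * (1 / t\<^sup>2)"
    proof -
      have "1 * max 1 (2 powr (- (\<rho> - 1))) \<le> D" unfolding D_def by (intro mult_mono) auto
      then show ?thesis using C by (intro mult_left_mono mult_right_mono) auto
    qed
    also have "\<dots> = C * D * t powr (- \<rho> - 1)"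
    proof -
      have "t powr (- (\<rho> - 1)) = t powr (- \<rho> - 1) * t\<^sup>2"
      proof -
        have "t powr (- \<rho> - 1) * t powr 2 = t powr (- (\<rho> - 1))"
          unfolding powr_add[symmetric] by (simp add: algebra_simps)
        then show ?thesis using t by simp
      qed
      then show ?thesis using t by simp
    qed
    finally show "norm (pl1 \<nu> t) \<le> C * D * t powr (- \<rho> - 1)" .
  qed (use C in \<open>simp add: D_def less_max_iff_disj\<close>)
qed

lemma pl_deriv:
  assumes "t > 0"
  shows "(pl \<nu> has_vector_derivative pl1 \<nu> t) (at t)"
proof -
  let ?g = "\<lambda>t::real. (1 + t) / (2 * t)"
  have g: "(?g has_real_derivative - 1 / (2 * t\<^sup>2)) (at t)"
    using assms by (auto intro!: derivative_eq_intros simp: field_simps power2_eq_square)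
  have "((\<lambda>t. complex_of_real (?g t)) has_vector_derivative of_real (- 1 / (2 * t\<^sup>2))) (at t)"
    using g by (intro has_vector_derivative_of_real) (simp add: has_real_derivative_iff_has_vector_derivative)
  moreover have "(yl \<nu> has_field_derivative deriv (yl \<nu>) (of_real (?g t))) (at (of_real (?g t)))"
    by (rule yl_deriv) (use assms in \<open>simp add: complex_nonpos_Reals_iff divide_le_0_iff flip: of_real_divide\<close>)
  ultimately show ?thesis
    unfolding pl_def[abs_def] pl1_def using field_vector_diff_chain_at by (fastforce simp: o_def mult.commute)
qed

lemma pl_one: "pl \<nu> 1 = 1"
  by (simp add: pl_def yl_one)

lemma powr_real_deriv:
  assumes "t > 0"
  shows "((\<lambda>t. complex_of_real t powr a) has_vector_derivative a * of_real t powr (a - 1)) (at t)"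
proof -
  have "((\<lambda>z. z powr a) has_field_derivative a * of_real t powr (a - 1)) (at (of_real t))"
    by (rule derivative_eq_intros refl | use assms in \<open>simp add: complex_nonpos_Reals_iff\<close>)+
  from has_vector_derivative_real_field[OF this] show ?thesis by (simp add: o_def)
qed

lemma norm_powr_of_real: "t > 0 \<Longrightarrow> norm (complex_of_real t powr a) = t powr Re a"
  by (simp add: norm_powr_real_powr)

lemma continuous_on_pl: "continuous_on {0<..1} (pl \<nu>)"
  by (rule continuous_on_vector_derivative_at[OF pl_deriv]) auto

lemma continuous_on_powr_real: "continuous_on {0<..1} (\<lambda>t. complex_of_real t powr a)"
  by (rule continuous_on_vector_derivative_at[OF powr_real_deriv]) auto

lemma continuous_on_pl1: "continuous_on {0<..1} (pl1 \<nu>)"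
proof -
  have c: "continuous_on (- \<real>\<^sub>\<le>\<^sub>0) (deriv (yl \<nu>))"
    by (intro holomorphic_on_imp_continuous_on holomorphic_deriv yl_holomorphic open_slit)
  have "continuous_on {0<..1} (\<lambda>t. deriv (yl \<nu>) (of_real ((1 + t) / (2 * t))))"
    by (rule continuous_on_compose2[OF c])
       (auto intro!: continuous_intros simp: complex_nonpos_Reals_iff divide_le_0_iff simp flip: of_real_divide)
  then show ?thesis
    unfolding pl1_def[abs_def] by (intro continuous_intros) auto
qed

lemma mellin_bound:
  assumes C: "\<And>t. 0 < t \<Longrightarrow> t \<le> 1 \<Longrightarrow> norm (pl \<nu> t) \<le> C * t powr (-\<rho>)" and s: "Re s - 1 - \<rho> > 0"
  shows "(\<lambda>t. of_real t powr (s - 2) * pl \<nu> t) integrable_on {0..1}"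
    and "norm (mellin \<nu> s) \<le> C / (Re s - 1 - \<rho>)"
proof -
  have "norm (of_real t powr (s - 2) * pl \<nu> t) \<le> C * t powr ((Re s - 1 - \<rho>) - 1)" if t: "0 < t" "t \<le> 1" for t
  proof -
    have "norm (of_real t powr (s - 2) * pl \<nu> t) \<le> t powr (Re s - 2) * (C * t powr (-\<rho>))"
      unfolding norm_mult using C[OF t] t by (intro mult_mono) (auto simp: norm_powr_of_real)
    also have "\<dots> = C * (t powr (Re s - 2) * t powr (-\<rho>))" by simp
    also have "t powr (Re s - 2) * t powr (-\<rho>) = t powr ((Re s - 1 - \<rho>) - 1)"
      by (simp flip: powr_add add: algebra_simps)
    finally show ?thesis .
  qed
  note * = integrable_powr_majorant[OF continuous_on_mult[OF continuous_on_powr_real continuous_on_pl] s this]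
  show "(\<lambda>t. of_real t powr (s - 2) * pl \<nu> t) integrable_on {0..1}"
    "norm (mellin \<nu> s) \<le> C / (Re s - 1 - \<rho>)"
    using *(1,2) by (simp_all add: mellin_def)
qed

text \<open>Two integrations by parts move Legendre's operator in \<open>x = 1 / t\<close> onto
  \<open>x powr (- s)\<close>, which produces the powers \<open>- s\<close> and
  \<open>- s - 2\<close>. Both boundary terms carry the factor \<open>t^2 - 1\<close>, so they
  vanish at \<open>1\<close>; at \<open>0\<close> they vanish by the growth bound.\<close>

lemma mellin_recurrence:
  assumes s: "Re s - 1 > Re \<nu>" "Re s > - Re \<nu>"
  shows "(s + \<nu>) * (s - \<nu> - 1) * mellin \<nu> s = s * (s + 1) * mellin \<nu> (s + 2)"
proof -
  obtain \<rho> where \<rho>: "\<rho> > Re \<nu>" "\<rho> > - Re \<nu> - 1" "Re s - 1 > \<rho>"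
  proof -
    obtain \<rho> where "max (Re \<nu>) (- Re \<nu> - 1) < \<rho>" "\<rho> < Re s - 1"
      using dense[of "max (Re \<nu>) (- Re \<nu> - 1)" "Re s - 1"] s by auto
    then show ?thesis by (intro that) auto
  qed
  obtain C where C: "C > 0" "\<And>t. 0 < t \<Longrightarrow> t \<le> 1 \<Longrightarrow> norm (pl \<nu> t) \<le> C * t powr (-\<rho>)"
      "\<And>t. 0 < t \<Longrightarrow> t \<le> 1 \<Longrightarrow> norm (pl1 \<nu> t) \<le> C * t powr (- \<rho> - 1)"
    using pl_bounds[OF \<rho>(1,2)] by blast
  define e where "e = Re s - 1 - \<rho>"
  have e: "e > 0" using \<rho> by (simp add: e_def)
  define Y where "Y t = deriv (yl \<nu>) (of_real ((1 + t) / (2 * t)))" for t :: real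
  define T where "T t = complex_of_real t powr (s - 2)" for t
  \<comment> \<open>The two boundary terms \<open>x powr (- s) * (x^2 - 1) * P'\<close> and
    \<open>s * x powr (- s - 1) * (x^2 - 1) * P\<close>, up to sign, written in \<open>t\<close>.
    The half comes from \<open>P' = Y / 2\<close>, as \<open>yl\<close> takes the argument
    \<open>(1 + x) / 2\<close>.\<close>
  define H where "H t = of_real (t\<^sup>2 - 1) * (T t * Y t * (1/2) + s * T t * of_real t * pl \<nu> t)" for t
  define h where "h t = s * (s + 1) * (of_real t powr (s + 2 - 2) * pl \<nu> t)
       - (s + \<nu>) * (s - \<nu> - 1) * (of_real t powr (s - 2) * pl \<nu> t)" for t
  have Y1: "pl1 \<nu> t = - Y t / (2 * of_real t ^ 2)" for t
    by (simp add: pl1_def Y_def)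
  have Ts: "of_real t powr s = T t * of_real t ^ 2" if "t > 0" for t
    using that by (simp add: T_def powr_diff)
  have normT: "norm (T t) = t powr (Re s - 2)" if "t > 0" for t
    unfolding T_def using norm_powr_of_real[OF that] by simp
  have "integral {0..1} h = H 1"
  proof (rule integral_derivative_vanishing_at_0[OF _ _ e])
    fix t :: real assume t: "0 < t" "t \<le> 1"
    define z where "z = complex_of_real ((1 + t) / (2 * t))"
    define Y2 where "Y2 = deriv (deriv (yl \<nu>)) z"
    have zs: "z \<notin> \<real>\<^sub>\<le>\<^sub>0"
      unfolding z_def using t by (simp add: complex_nonpos_Reals_iff divide_le_0_iff flip: of_real_divide)
    have t0: "complex_of_real t \<noteq> 0" using t by simp
    have dY: "(Y has_vector_derivative Y2 * of_real (- 1 / (2 * t\<^sup>2))) (at t)"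
    proof -
      have "((\<lambda>t::real. (1 + t) / (2 * t)) has_real_derivative - 1 / (2 * t\<^sup>2)) (at t)"
        using t by (auto intro!: derivative_eq_intros simp: field_simps power2_eq_square)
      then have "((\<lambda>t. complex_of_real ((1 + t) / (2 * t))) has_vector_derivative of_real (- 1 / (2 * t\<^sup>2))) (at t)"
        by (intro has_vector_derivative_of_real) (simp add: has_real_derivative_iff_has_vector_derivative)
      from field_vector_diff_chain_at[OF this, of "deriv (yl \<nu>)" Y2] yl_deriv2[OF zs, of \<nu>]
      show ?thesis unfolding Y_def[abs_def] Y2_def z_def by (simp add: o_def mult.commute)
    qed
    have dT: "(T has_vector_derivative (s - 2) * (T t / of_real t)) (at t)"
      using powr_real_deriv[OF t(1), of "s - 2"] t0 powr_diff[of "complex_of_real t" "s - 2" 1]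
      by (simp add: T_def[abs_def] diff_diff_eq)
    have did: "((\<lambda>t. complex_of_real t) has_vector_derivative 1) (at t)"
      by (auto intro!: derivative_eq_intros)
    have dp: "((\<lambda>t. complex_of_real (t\<^sup>2 - 1)) has_vector_derivative 2 * of_real t) (at t)"
    proof -
      have "((\<lambda>t. t\<^sup>2 - 1) has_real_derivative 2 * t) (at t)"
        by (auto intro!: derivative_eq_intros)
      from has_vector_derivative_of_real[OF this] show ?thesis by simp
    qed
    have ode: "of_real (t\<^sup>2 - 1) * Y2 = 4 * of_real t * Y t - 4 * of_real t ^ 2 * \<nu> * (\<nu> + 1) * pl \<nu> t"
    proof -
      have z1: "4 * of_real t ^ 2 * (z * (1 - z)) = of_real (t\<^sup>2 - 1)" "of_real t * (1 - 2 * z) = - 1"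
        using t0 by (simp_all add: z_def field_simps power2_eq_square)
      have "4 * of_real t ^ 2 * (z * (1 - z) * Y2 + (1 - 2 * z) * Y t + \<nu> * (\<nu> + 1) * pl \<nu> t) = 0"
        using yl_ode[OF zs, of \<nu>] by (simp add: Y2_def Y_def pl_def z_def)
      then have "(4 * of_real t ^ 2 * (z * (1 - z))) * Y2 + 4 * of_real t * (of_real t * (1 - 2 * z)) * Y t
          + 4 * of_real t ^ 2 * \<nu> * (\<nu> + 1) * pl \<nu> t = 0"
        by (simp add: algebra_simps power2_eq_square)
      then show ?thesis unfolding z1 by (simp add: algebra_simps)
    qed
    have "(H has_vector_derivative
        of_real (t\<^sup>2 - 1) * ((T t * (Y2 * of_real (- 1 / (2 * t\<^sup>2))) + (s - 2) * (T t / of_real t) * Y t) * (1/2)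
           + ((s * T t * of_real t) * pl1 \<nu> t + (s * T t * 1 + (s * ((s - 2) * (T t / of_real t))) * of_real t) * pl \<nu> t))
        + 2 * of_real t * (T t * Y t * (1/2) + s * T t * of_real t * pl \<nu> t)) (at t)"
      unfolding H_def[abs_def]
      by (intro has_vector_derivative_mult has_vector_derivative_add has_vector_derivative_mult_left
          has_vector_derivative_mult_right dp dT dY did pl_deriv t)
    moreover have "of_real (t\<^sup>2 - 1) * ((T t * (Y2 * of_real (- 1 / (2 * t\<^sup>2))) + (s - 2) * (T t / of_real t) * Y t) * (1/2)
           + ((s * T t * of_real t) * pl1 \<nu> t + (s * T t * 1 + (s * ((s - 2) * (T t / of_real t))) * of_real t) * pl \<nu> t))
        + 2 * of_real t * (T t * Y t * (1/2) + s * T t * of_real t * pl \<nu> t) = h t"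
    proof -
      have "of_real (t\<^sup>2 - 1) * ((T t * (Y2 * of_real (- 1 / (2 * t\<^sup>2))) + (s - 2) * (T t / of_real t) * Y t) * (1/2)
           + ((s * T t * of_real t) * pl1 \<nu> t + (s * T t * 1 + (s * ((s - 2) * (T t / of_real t))) * of_real t) * pl \<nu> t))
        + 2 * of_real t * (T t * Y t * (1/2) + s * T t * of_real t * pl \<nu> t)
        = T t * (- (of_real (t\<^sup>2 - 1) * Y2) / (4 * of_real t ^ 2) - of_real (t\<^sup>2 - 1) * Y t / of_real t + of_real t * Y t
           + (of_real (t\<^sup>2 - 1) * s * (s - 1) + 2 * s * of_real t ^ 2) * pl \<nu> t)"
        using t0 by (simp add: Y1 field_simps power2_eq_square)
      also have "\<dots> = h t"
        unfolding ode h_def using t0 t Ts[OF t(1)]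
        by (simp add: T_def[symmetric] divide_simps) (simp add: algebra_simps power2_eq_square)
      finally show ?thesis .
    qed
    ultimately show "(H has_vector_derivative h t) (at t)" by simp
    have p0: "C * t powr (-\<rho>) \<ge> 0" using C by simp
    have "norm (h t) \<le> norm (s * (s + 1)) * (t powr Re s * (C * t powr (-\<rho>)))
        + norm ((s + \<nu>) * (s - \<nu> - 1)) * (t powr (Re s - 2) * (C * t powr (-\<rho>)))"
    proof -
      have "norm (h t) \<le> norm (s * (s + 1) * (of_real t powr (s + 2 - 2) * pl \<nu> t)) + norm ((s + \<nu>) * (s - \<nu> - 1) * (of_real t powr (s - 2) * pl \<nu> t))"
        unfolding h_def by (rule norm_triangle_ineq4)
      also have "\<dots> = norm (s * (s + 1)) * (t powr Re s * norm (pl \<nu> t)) + norm ((s + \<nu>) * (s - \<nu> - 1)) * (t powr (Re s - 2) * norm (pl \<nu> t))"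
        using t by (simp add: norm_mult norm_powr_of_real)
      also have "\<dots> \<le> norm (s * (s + 1)) * (t powr Re s * (C * t powr (-\<rho>)))
        + norm ((s + \<nu>) * (s - \<nu> - 1)) * (t powr (Re s - 2) * (C * t powr (-\<rho>)))"
        by (intro add_mono mult_left_mono C t) auto
      finally show ?thesis .
    qed
    also have "\<dots> \<le> norm (s * (s + 1)) * (t powr (Re s - 2) * (C * t powr (-\<rho>)))
        + norm ((s + \<nu>) * (s - \<nu> - 1)) * (t powr (Re s - 2) * (C * t powr (-\<rho>)))"
      using t p0 by (intro add_mono mult_left_mono mult_right_mono powr_mono') auto
    also have "\<dots> = (norm (s * (s + 1)) + norm ((s + \<nu>) * (s - \<nu> - 1))) * C * (t powr (Re s - 2) * t powr (-\<rho>))"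
      by (simp add: algebra_simps)
    also have "t powr (Re s - 2) * t powr (-\<rho>) = t powr (e - 1)"
      unfolding powr_add[symmetric] e_def by (simp add: algebra_simps)
    finally show "norm (h t) \<le> (norm (s * (s + 1)) + norm ((s + \<nu>) * (s - \<nu> - 1))) * C * t powr (e - 1)" .
    have nY: "norm (Y t) \<le> 2 * C * (t powr (-\<rho>) * t)"
    proof -
      have "norm (Y t) = 2 * t\<^sup>2 * norm (pl1 \<nu> t)"
        unfolding Y1 using t by (simp add: norm_divide norm_mult norm_power)
      also have "\<dots> \<le> 2 * t\<^sup>2 * (C * t powr (-\<rho> - 1))"
        by (intro mult_left_mono C t) auto
      also have "\<dots> = 2 * C * (t powr (-\<rho>) * t)"
        using t by (simp add: powr_diff power2_eq_square)
      finally show ?thesis .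
    qed
    have "norm (H t) \<le> 1 * (t powr (Re s - 2) * norm (Y t) * (1/2) + norm s * t powr (Re s - 2) * t * norm (pl \<nu> t))"
      unfolding H_def norm_mult
    proof (rule mult_mono)
      show "norm (complex_of_real (t\<^sup>2 - 1)) \<le> 1"
        using t power_le_one[of t 2] by (simp only: norm_of_real) auto
      show "norm (T t * Y t * (1/2) + s * T t * of_real t * pl \<nu> t)
        \<le> t powr (Re s - 2) * norm (Y t) * (1/2) + norm s * t powr (Re s - 2) * t * norm (pl \<nu> t)"
        by (rule order_trans[OF norm_triangle_ineq]) (use t in \<open>simp add: norm_mult normT\<close>)
    qed auto
    also have "\<dots> \<le> t powr (Re s - 2) * (2 * C * (t powr (-\<rho>) * t)) * (1/2) + norm s * t powr (Re s - 2) * t * (C * t powr (-\<rho>))"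
      unfolding mult_1 using t by (intro add_mono mult_right_mono mult_left_mono nY C t) auto
    also have "\<dots> = C * (1 + norm s) * (t powr (Re s - 2) * t powr (-\<rho>) * t)"
      by (simp add: algebra_simps)
    also have "t powr (Re s - 2) * t powr (-\<rho>) * t = t powr e"
    proof -
      have "t powr (Re s - 2) * t powr (-\<rho>) * t powr 1 = t powr e"
        unfolding powr_add[symmetric] e_def by (simp add: algebra_simps)
      then show ?thesis using t by simp
    qed
    finally show "norm (H t) \<le> C * (1 + norm s) * t powr e" .
  next
    show "continuous_on {0<..1} h"
      unfolding h_def[abs_def] by (intro continuous_intros continuous_on_powr_real continuous_on_pl)
  qed
  moreover have "integral {0..1} h = s * (s + 1) * mellin \<nu> (s + 2) - (s + \<nu>) * (s - \<nu> - 1) * mellin \<nu> s"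
  proof -
    have i: "(\<lambda>t. of_real t powr (s + 2 - 2) * pl \<nu> t) integrable_on {0..1}" "(\<lambda>t. of_real t powr (s - 2) * pl \<nu> t) integrable_on {0..1}"
      using mellin_bound(1)[OF C(2), of "s + 2"] mellin_bound(1)[OF C(2), of s] \<rho> by auto
    show ?thesis
      unfolding h_def[abs_def] mellin_def
      by (subst integral_diff) (auto intro!: integrable_on_mult_right i simp only: integral_mult_right)
  qed
  moreover have "H 1 = 0" by (simp add: H_def)
  ultimately show ?thesis by simp
qed

text \<open>The integral of the derivative of \<open>t powr (s - 1) * pl \<nu> t\<close> is
  \<open>1\<close>, the value at \<open>t = 1\<close>, and the part with \<open>pl1\<close> is of
  order \<open>1 / Re s\<close>. This normalization singles out one solution of
  \<open>mellin_recurrence\<close>.\<close>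

lemma mellin_near_infinity:
  assumes C: "\<And>t. 0 < t \<Longrightarrow> t \<le> 1 \<Longrightarrow> norm (pl \<nu> t) \<le> C * t powr (-\<rho>)"
    and C1: "\<And>t. 0 < t \<Longrightarrow> t \<le> 1 \<Longrightarrow> norm (pl1 \<nu> t) \<le> C * t powr (- \<rho> - 1)"
    and s: "Re s - 1 - \<rho> > 0"
  shows "norm ((s - 1) * mellin \<nu> s - 1) \<le> C / (Re s - 1 - \<rho>)"
proof -
  define e where "e = Re s - 1 - \<rho>"
  have e: "e > 0" using s by (simp add: e_def)
  define h where "h t = of_real t powr (s - 1) * pl1 \<nu> t + (s - 1) * (of_real t powr (s - 2) * pl \<nu> t)" for t
  have C0: "C \<ge> 0" using order_trans[OF norm_ge_zero C[of 1]] by simp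
  have b1: "norm (of_real t powr (s - 1) * pl1 \<nu> t) \<le> C * t powr (e - 1)" if t: "0 < t" "t \<le> 1" for t
  proof -
    have "norm (of_real t powr (s - 1) * pl1 \<nu> t) \<le> t powr (Re s - 1) * (C * t powr (-\<rho> - 1))"
      unfolding norm_mult using C1[OF t] t by (intro mult_mono) (auto simp: norm_powr_of_real)
    also have "\<dots> = C * (t powr (Re s - 1) * t powr (-\<rho> - 1))" by simp
    also have "t powr (Re s - 1) * t powr (-\<rho> - 1) = t powr (e - 1)"
      unfolding powr_add[symmetric] e_def by (simp add: algebra_simps)
    finally show ?thesis .
  qed
  have b2: "norm (of_real t powr (s - 2) * pl \<nu> t) \<le> C * t powr (e - 1)" if t: "0 < t" "t \<le> 1" for t
  proof -
    have "norm (of_real t powr (s - 2) * pl \<nu> t) \<le> t powr (Re s - 2) * (C * t powr (-\<rho>))"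
      unfolding norm_mult using C[OF t] t by (intro mult_mono) (auto simp: norm_powr_of_real)
    also have "\<dots> = C * (t powr (Re s - 2) * t powr (-\<rho>))" by simp
    also have "t powr (Re s - 2) * t powr (-\<rho>) = t powr (e - 1)"
      unfolding powr_add[symmetric] e_def by (simp add: algebra_simps)
    finally show ?thesis .
  qed
  have c1: "continuous_on {0<..1} (\<lambda>t. of_real t powr (s - 1) * pl1 \<nu> t)"
    by (intro continuous_intros continuous_on_powr_real continuous_on_pl1)
  have c2: "continuous_on {0<..1} (\<lambda>t. of_real t powr (s - 2) * pl \<nu> t)"
    by (intro continuous_intros continuous_on_powr_real continuous_on_pl)
  have "integral {0..1} h = of_real 1 powr (s - 1) * pl \<nu> 1"
  proof (rule integral_derivative_vanishing_at_0[OF _ _ e, where H = "\<lambda>t. of_real t powr (s - 1) * pl \<nu> t"])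
    fix t :: real assume t: "0 < t" "t \<le> 1"
    show "((\<lambda>t. of_real t powr (s - 1) * pl \<nu> t) has_vector_derivative h t) (at t)"
      using has_vector_derivative_mult[OF powr_real_deriv[OF t(1), of "s - 1"] pl_deriv[OF t(1), of \<nu>]]
      by (simp add: h_def algebra_simps)
    have "norm (h t) \<le> C * t powr (e - 1) + norm (s - 1) * (C * t powr (e - 1))"
      unfolding h_def
      by (rule order_trans[OF norm_triangle_ineq], unfold norm_mult[of "s - 1"])
         (intro add_mono mult_left_mono b1 b2 t, simp)
    then show "norm (h t) \<le> (C + norm (s - 1) * C) * t powr (e - 1)" by (simp add: algebra_simps)
    have "norm (of_real t powr (s - 1) * pl \<nu> t) \<le> t powr (Re s - 1) * (C * t powr (-\<rho>))"
      unfolding norm_mult using C[OF t] t by (intro mult_mono) (auto simp: norm_powr_of_real)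
    also have "\<dots> = C * (t powr (Re s - 1) * t powr (-\<rho>))" by simp
    also have "t powr (Re s - 1) * t powr (-\<rho>) = t powr e"
      unfolding powr_add[symmetric] e_def by (simp add: algebra_simps)
    finally show "norm (of_real t powr (s - 1) * pl \<nu> t) \<le> C * t powr e" .
  qed (auto simp: h_def[abs_def] intro!: continuous_intros c1 c2)
  moreover have "integral {0..1} h = integral {0..1} (\<lambda>t. of_real t powr (s - 1) * pl1 \<nu> t) + (s - 1) * mellin \<nu> s"
    unfolding h_def[abs_def] mellin_def
    by (subst integral_add) (auto intro!: integrable_on_mult_right integrable_powr_majorant(1)[OF c1 e b1]
        integrable_powr_majorant(1)[OF c2 e b2])
  ultimately have "(s - 1) * mellin \<nu> s - 1 = - integral {0..1} (\<lambda>t. of_real t powr (s - 1) * pl1 \<nu> t)"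
    by (simp add: pl_one algebra_simps)
  then show ?thesis
    using integrable_powr_majorant(2)[OF c1 e b1] by (simp add: e_def)
qed

text \<open>Iterating the recurrence expresses \<open>mellin \<nu> s\<close> by a quotient of
  Pochhammer symbols times \<open>mellin \<nu> (s + 2 * n)\<close>. The quotient is matched with
  \<open>Gamma_series'\<close>, whose limit is \<open>Gamma\<close>, and the last factor is
  asymptotic to \<open>1 / (2 * n)\<close>.\<close>

lemma mellin_formula:
  assumes s: "Re s - 1 > Re \<nu>" "Re s > - Re \<nu>"
  shows "mellin \<nu> s = Gamma ((s + \<nu>) / 2) * Gamma ((s - \<nu> - 1) / 2) * rGamma (s / 2) * rGamma ((s + 1) / 2) / 2"
proof -
  obtain \<rho> where \<rho>: "\<rho> > Re \<nu>" "\<rho> > - Re \<nu> - 1" "Re s - 1 > \<rho>"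
  proof -
    obtain \<rho> where "max (Re \<nu>) (- Re \<nu> - 1) < \<rho>" "\<rho> < Re s - 1"
      using dense[of "max (Re \<nu>) (- Re \<nu> - 1)" "Re s - 1"] s by auto
    then show ?thesis by (intro that) auto
  qed
  obtain C where C: "C > 0" "\<And>t. 0 < t \<Longrightarrow> t \<le> 1 \<Longrightarrow> norm (pl \<nu> t) \<le> C * t powr (-\<rho>)"
      "\<And>t. 0 < t \<Longrightarrow> t \<le> 1 \<Longrightarrow> norm (pl1 \<nu> t) \<le> C * t powr (- \<rho> - 1)"
    using pl_bounds[OF \<rho>(1,2)] by blast
  define a b c d where "a = s / 2" and "b = (s + 1) / 2" and "c = (s + \<nu>) / 2" and "d = (s - \<nu> - 1) / 2"
  have Re_pos: "Re a > 0" "Re b > 0" "Re c > 0" "Re d > 0"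
    using s by (simp_all add: a_def b_def c_def d_def)
  have notin: "z \<notin> \<int>\<^sub>\<le>\<^sub>0" if "Re z > 0" for z
    using that by (auto elim!: nonpos_Ints_cases)
  have poch0: "pochhammer z n \<noteq> 0" if "Re z > 0" for z :: complex and n
    using notin[OF that] by (auto simp: pochhammer_eq_0_iff)
  have rec: "pochhammer c n * pochhammer d n * mellin \<nu> s = pochhammer a n * pochhammer b n * mellin \<nu> (s + 2 * of_nat n)" for n
  proof (induction n)
    case (Suc n)
    let ?s = "s + 2 * of_nat n"
    have e: "2 * (c + of_nat n) = ?s + \<nu>" "2 * (d + of_nat n) = ?s - \<nu> - 1" "2 * (a + of_nat n) = ?s" "2 * (b + of_nat n) = ?s + 1"
      by (simp_all add: a_def b_def c_def d_def field_simps)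
    have "(2 * (c + of_nat n)) * (2 * (d + of_nat n)) * mellin \<nu> ?s = (2 * (a + of_nat n)) * (2 * (b + of_nat n)) * mellin \<nu> (?s + 2)"
      unfolding e by (rule mellin_recurrence) (use s in auto)
    moreover have "(2 * x) * (2 * y) * z = 4 * (x * y * z)" for x y z :: complex by simp
    ultimately have "4 * ((c + of_nat n) * (d + of_nat n) * mellin \<nu> ?s) = 4 * ((a + of_nat n) * (b + of_nat n) * mellin \<nu> (?s + 2))"
      by (simp only:)
    then have k: "(c + of_nat n) * (d + of_nat n) * mellin \<nu> ?s = (a + of_nat n) * (b + of_nat n) * mellin \<nu> (?s + 2)"
      by simp
    have "pochhammer c (Suc n) * pochhammer d (Suc n) * mellin \<nu> s
        = (c + of_nat n) * (d + of_nat n) * (pochhammer c n * pochhammer d n * mellin \<nu> s)"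
      by (simp add: pochhammer_Suc mult_ac)
    also have "\<dots> = pochhammer a n * pochhammer b n * ((c + of_nat n) * (d + of_nat n) * mellin \<nu> ?s)"
      unfolding Suc by (simp add: mult_ac)
    also have "\<dots> = pochhammer a (Suc n) * pochhammer b (Suc n) * mellin \<nu> (?s + 2)"
      unfolding k by (simp add: pochhammer_Suc mult_ac)
    also have "?s + 2 = s + 2 * of_nat (Suc n)" by simp
    finally show ?case .
  qed simp
  have lim1: "(\<lambda>n. (s + 2 * of_nat n - 1) * mellin \<nu> (s + 2 * of_nat n)) \<longlonglongrightarrow> 1"
  proof -
    have "(\<lambda>n. (s + 2 * of_nat n - 1) * mellin \<nu> (s + 2 * of_nat n) - 1) \<longlonglongrightarrow> 0"
    proof (rule Lim_null_comparison)
      show "eventually (\<lambda>n. norm ((s + 2 * of_nat n - 1) * mellin \<nu> (s + 2 * of_nat n) - 1) \<le> C * inverse (real n)) sequentially"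
        using eventually_gt_at_top[of 0]
      proof eventually_elim
        case (elim n)
        have "norm ((s + 2 * of_nat n - 1) * mellin \<nu> (s + 2 * of_nat n) - 1) \<le> C / (Re (s + 2 * of_nat n) - 1 - \<rho>)"
          by (rule mellin_near_infinity[OF C(2,3)]) (use \<rho> in auto)
        also have "\<dots> \<le> C / real n"
          by (rule divide_left_mono) (use \<rho> C elim in \<open>auto intro!: mult_pos_pos\<close>)
        finally show ?case by (simp add: divide_inverse)
      qed
      show "(\<lambda>n. C * inverse (real n)) \<longlonglongrightarrow> 0"
        by (rule tendsto_mult_right_zero[OF lim_inverse_n])
    qed
    then show ?thesis by (simp add: LIM_zero_iff)
  qed
  have lim2: "(\<lambda>n. of_nat n / (s + 2 * of_nat n - 1)) \<longlonglongrightarrow> 1 / 2"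
  proof -
    have "(\<lambda>n. 1 / (2 + (s - 1) / of_nat n)) \<longlonglongrightarrow> 1 / (2 + 0)"
      by (intro tendsto_intros lim_const_over_n) auto
    then have "(\<lambda>n. 1 / (2 + (s - 1) / of_nat n)) \<longlonglongrightarrow> 1 / 2" by simp
    then show ?thesis
    proof (rule Lim_transform_eventually)
      show "eventually (\<lambda>n. 1 / (2 + (s - 1) / of_nat n) = of_nat n / (s + 2 * of_nat n - 1)) sequentially"
        using eventually_gt_at_top[of 0]
      proof eventually_elim
        case (elim n)
        then have "(2 + (s - 1) / of_nat n) = (s + 2 * of_nat n - 1) / of_nat n" by (simp add: field_simps)
        then show ?case by simp
      qed
    qed
  qed
  have s2: "s + 2 * of_nat n - 1 \<noteq> 0" if "n > 0" for n
  proof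
    assume "s + 2 * of_nat n - 1 = 0"
    then have "Re (s + 2 * of_nat n - 1) = 0" by simp
    then show False using s that by simp
  qed
  have lim3: "(\<lambda>n. of_nat n * mellin \<nu> (s + 2 * of_nat n)) \<longlonglongrightarrow> 1 / 2"
  proof -
    have "(\<lambda>n. of_nat n / (s + 2 * of_nat n - 1) * ((s + 2 * of_nat n - 1) * mellin \<nu> (s + 2 * of_nat n))) \<longlonglongrightarrow> 1 / 2 * 1"
      by (intro tendsto_mult lim1 lim2)
    then have "(\<lambda>n. of_nat n / (s + 2 * of_nat n - 1) * ((s + 2 * of_nat n - 1) * mellin \<nu> (s + 2 * of_nat n))) \<longlonglongrightarrow> 1 / 2" by simp
    then show ?thesis
    proof (rule Lim_transform_eventually)
      show "eventually (\<lambda>n. of_nat n / (s + 2 * of_nat n - 1) * ((s + 2 * of_nat n - 1) * mellin \<nu> (s + 2 * of_nat n)) = of_nat n * mellin \<nu> (s + 2 * of_nat n)) sequentially"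
        using eventually_gt_at_top[of 0] by eventually_elim (use s2 in simp)
    qed
  qed
  have lim4: "(\<lambda>n. Gamma_series' c n * Gamma_series' d n / (Gamma_series' a n * Gamma_series' b n)
      * (of_nat n * mellin \<nu> (s + 2 * of_nat n))) \<longlonglongrightarrow> Gamma c * Gamma d / (Gamma a * Gamma b) * (1 / 2)"
    by (intro tendsto_intros Gamma_series'_LIMSEQ lim3) (use notin Re_pos in \<open>auto simp: Gamma_eq_zero_iff\<close>)
  have "(\<lambda>n. mellin \<nu> s) \<longlonglongrightarrow> Gamma c * Gamma d / (Gamma a * Gamma b) * (1 / 2)"
    using lim4
  proof (rule Lim_transform_eventually)
    show "eventually (\<lambda>n. Gamma_series' c n * Gamma_series' d n / (Gamma_series' a n * Gamma_series' b n)
      * (of_nat n * mellin \<nu> (s + 2 * of_nat n)) = mellin \<nu> s) sequentially"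
      using eventually_gt_at_top[of 0]
    proof eventually_elim
      case (elim n)
      define L where "L = complex_of_real (ln (of_nat n))"
      define F where "F = (fact (n - 1) :: complex)"
      have F: "F \<noteq> 0" by (simp add: F_def)
      \<comment> \<open>Because \<open>a + b = c + d + 1\<close>, the powers of \<open>n\<close> in
        the four Gamma series leave one surplus factor \<open>n\<close>, which is the one paired
        with \<open>mellin \<nu> (s + 2 * n)\<close>.\<close>
      have "exp (a * L) * exp (b * L) * of_nat n = exp (c * L) * exp (d * L) * of_nat n * of_nat n"
      proof -
        have "exp L = of_nat n" using elim by (simp add: L_def exp_of_real)
        moreover have "exp (a * L) * exp (b * L) = exp (c * L) * exp (d * L) * exp L"
        proof -
          have "a + b = c + d + 1" by (simp add: a_def b_def c_def d_def field_simps)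
          from arg_cong[OF this, of "\<lambda>x. exp (x * L)"] show ?thesis by (simp add: distrib_right exp_add)
        qed
        ultimately show ?thesis by simp
      qed
      then have E: "exp (a * L) * exp (b * L) = exp (c * L) * exp (d * L) * of_nat n"
        using elim by simp
      have "mellin \<nu> s = pochhammer a n * pochhammer b n * mellin \<nu> (s + 2 * of_nat n) / (pochhammer c n * pochhammer d n)"
        using rec[of n] poch0 Re_pos by (simp add: field_simps)
      moreover have "Gamma_series' c n * Gamma_series' d n / (Gamma_series' a n * Gamma_series' b n) * of_nat n
          = pochhammer a n * pochhammer b n / (pochhammer c n * pochhammer d n)"
      proof -
        have "Gamma_series' c n * Gamma_series' d n / (Gamma_series' a n * Gamma_series' b n) * of_nat n
          = (exp (c * L) * exp (d * L) * of_nat n) / (exp (a * L) * exp (b * L)) * (pochhammer a n * pochhammer b n / (pochhammer c n * pochhammer d n))"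
          unfolding Gamma_series'_def L_def[symmetric] F_def[symmetric] using F by (simp add: field_simps)
        also have "(exp (c * L) * exp (d * L) * of_nat n) / (exp (a * L) * exp (b * L)) = 1"
          unfolding E using elim by simp
        finally show ?thesis by simp
      qed
      ultimately show ?case by (simp add: mult.assoc[symmetric])
    qed
  qed
  then have "mellin \<nu> s = Gamma c * Gamma d / (Gamma a * Gamma b) * (1 / 2)"
    using LIMSEQ_unique tendsto_const by blast
  then show ?thesis
    by (simp add: a_def b_def c_def d_def rGamma_inverse_Gamma field_simps)
qed

text \<open>
  If \<open>c\<close> were \<open>0\<close>, the Mellin transform would be bounded near \<open>s = \<nu> + 1\<close>, where the Gamma quotient has a pole.
\<close>

lemma yl_limit_nonzero:
  assumes \<nu>: "Re \<nu> > -1/2" and \<delta>: "\<delta> > 0"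
    and lim: "\<And>r. r \<ge> 1 \<Longrightarrow> norm (of_real r powr (- \<nu>) * yl \<nu> (of_real r) - c) \<le> C * r powr (-\<delta>)"
  shows "c \<noteq> 0"
proof
  assume c: "c = 0"
  \<comment> \<open>With \<open>c = 0\<close> the function grows only at this smaller rate, so the
    Mellin integral stays bounded up to \<open>s = \<nu> + 1\<close>.\<close>
  define \<rho> where "\<rho> = Re \<nu> - \<delta>"
  have "norm (0::real) \<le> norm (of_real 1 powr (- \<nu>) * yl \<nu> (of_real 1) - c)" by simp
  also have "\<dots> \<le> C" using lim[of 1] by simp
  finally have C: "C \<ge> 0" by simp
  define D where "D = C * max 1 (2 powr (-\<rho>))"
  have b: "norm (pl \<nu> t) \<le> D * t powr (-\<rho>)" if t: "0 < t" "t \<le> 1" for t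
  proof -
    define r where "r = (1 + t) / (2 * t)"
    have r: "r \<ge> 1" using t by (simp add: r_def field_simps)
    have "norm (of_real r powr (- \<nu>) * yl \<nu> (of_real r)) \<le> C * r powr (-\<delta>)" using lim[OF r] c by simp
    then have "r powr (- Re \<nu>) * norm (pl \<nu> t) \<le> C * r powr (-\<delta>)"
      using r by (simp add: norm_mult norm_powr_of_real pl_def r_def[symmetric])
    then have "r powr Re \<nu> * (r powr (- Re \<nu>) * norm (pl \<nu> t)) \<le> r powr Re \<nu> * (C * r powr (-\<delta>))"
      by (rule mult_left_mono) simp
    moreover have "r powr Re \<nu> * (r powr (- Re \<nu>) * norm (pl \<nu> t)) = norm (pl \<nu> t)"
      using r by (simp add: powr_minus field_simps)
    moreover have "r powr Re \<nu> * (C * r powr (-\<delta>)) = C * r powr \<rho>"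
      by (simp add: \<rho>_def powr_diff powr_minus divide_inverse)
    moreover have "C * r powr \<rho> \<le> D * t powr (-\<rho>)"
      using mult_left_mono[OF powr_mean_bound[OF t, of \<rho>] C] by (simp add: D_def r_def mult.assoc)
    ultimately show ?thesis by linarith
  qed
  have D: "D \<ge> 0" using C by (simp add: D_def)
  \<comment> \<open>This is \<open>h * mellin \<nu> (\<nu> + 1 + h)\<close> with the polar factor
    absorbed through \<open>h / 2 * Gamma (h / 2) = Gamma (1 + h / 2)\<close>. It is continuous and
    nonzero at \<open>0\<close>.\<close>
  define \<Phi> where "\<Phi> h = Gamma ((2 * \<nu> + 1 + h) / 2) * Gamma (1 + h / 2) * rGamma ((\<nu> + 1 + h) / 2) * rGamma ((\<nu> + 2 + h) / 2)" for h :: complex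
  have eq: "of_real h * mellin \<nu> (\<nu> + 1 + of_real h) = \<Phi> (of_real h)" if h: "h > 0" for h :: real
  proof -
    let ?h = "complex_of_real h"
    have "?h / 2 * Gamma (?h / 2) = Gamma (1 + ?h / 2)"
      using Gamma_plus1[of "?h / 2"] h by (simp add: add.commute nonpos_Ints_def) (use h in \<open>auto simp: complex_eq_iff\<close>)
    moreover have "mellin \<nu> (\<nu> + 1 + ?h) = Gamma ((2 * \<nu> + 1 + ?h) / 2) * Gamma (?h / 2) * rGamma ((\<nu> + 1 + ?h) / 2) * rGamma ((\<nu> + 2 + ?h) / 2) / 2"
      by (subst mellin_formula) (use h \<nu> in \<open>auto simp: algebra_simps\<close>)
    ultimately show ?thesis by (simp add: \<Phi>_def mult_ac flip: \<open>?h / 2 * Gamma (?h / 2) = Gamma (1 + ?h / 2)\<close>)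
  qed
  have notin: "z \<notin> \<int>\<^sub>\<le>\<^sub>0" if "Re z > 0" for z
    using that by (auto elim!: nonpos_Ints_cases)
  have "((\<lambda>h::real. \<Phi> (of_real h)) \<longlongrightarrow> \<Phi> (of_real 0)) (at_right 0)"
    unfolding \<Phi>_def[abs_def]
    by (intro tendsto_intros isCont_tendsto_compose[of _ rGamma] isCont_rGamma continuous_ident) (use \<nu> in \<open>auto intro!: notin\<close>)
  moreover have "((\<lambda>h::real. \<Phi> (of_real h)) \<longlongrightarrow> 0) (at_right 0)"
  proof (rule Lim_transform_bound_at_right)
    have "norm (\<Phi> (of_real h) - 0) \<le> D / \<delta> * h powr 1" if h: "0 < h" for h
    proof -
      have "norm (mellin \<nu> (\<nu> + 1 + of_real h)) \<le> D / (Re (\<nu> + 1 + of_real h) - 1 - \<rho>)"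
        by (rule mellin_bound(2)[OF b]) (use h \<delta> in \<open>auto simp: \<rho>_def\<close>)
      also have "\<dots> \<le> D / \<delta>"
        by (rule divide_left_mono) (use h \<delta> D in \<open>auto simp: \<rho>_def intro!: mult_pos_pos\<close>)
      finally have "h * norm (mellin \<nu> (\<nu> + 1 + of_real h)) \<le> h * (D / \<delta>)" using h by (intro mult_left_mono) auto
      then show ?thesis using h by (simp add: eq[OF h, symmetric] norm_mult mult.commute)
    qed
    then show "eventually (\<lambda>h. norm (\<Phi> (of_real h) - 0) \<le> D / \<delta> * h powr 1) (at_right 0)"
      unfolding eventually_at_right_field by (intro exI[of _ 1]) auto
    show "((\<lambda>h. D / \<delta> * h powr 1) \<longlongrightarrow> 0) (at_right 0)" by (rule powr_tendsto_0_at_right) simp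
  qed
  ultimately have "\<Phi> (of_real 0) = 0" by (rule tendsto_unique[rotated]) simp
  moreover have "\<Phi> (of_real 0) \<noteq> 0"
    using \<nu> by (auto simp: \<Phi>_def Gamma_eq_zero_iff rGamma_eq_zero_iff dest!: notin[rotated] intro!: notin)
  ultimately show False by simp
qed

section \<open>The kernel of the product formula\<close>

text \<open>
  \<open>RR p q t / t\<close> is \<open>(1 + B) / 2\<close> for the argument \<open>B\<close> of the Legendre function at \<open>p3 = p q t\<^sup>2\<close>. Its logarithmic
  derivatives in \<open>p\<close> and \<open>t\<close> are \<open>sg\<close> and \<open>om\<close>; \<open>sgp\<close> and \<open>omp\<close> are the \<open>p\<close>- and \<open>t\<close>-derivatives of \<open>sg\<close>, and
  \<open>omp\<close> is also the \<open>p\<close>-derivative of \<open>om\<close>.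
\<close>

definition RR :: "complex \<Rightarrow> complex \<Rightarrow> complex \<Rightarrow> complex" where
  "RR p q t = (1 + t) * (1 + p * t) * (1 + q * t) * (1 + p * q * t) / (2 * (1 + p) * (1 + q) * (1 + p * q * t\<^sup>2))"

definition sg :: "complex \<Rightarrow> complex \<Rightarrow> complex \<Rightarrow> complex" where
  "sg p q t = t / (1 + p * t) + q * t / (1 + p * q * t) - 1 / (1 + p) - q * t\<^sup>2 / (1 + p * q * t\<^sup>2)"

definition sgp :: "complex \<Rightarrow> complex \<Rightarrow> complex \<Rightarrow> complex" where
  "sgp p q t = - (t / (1 + p * t))\<^sup>2 - (q * t / (1 + p * q * t))\<^sup>2 + (1 / (1 + p))\<^sup>2 + (q * t\<^sup>2 / (1 + p * q * t\<^sup>2))\<^sup>2"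

definition om :: "complex \<Rightarrow> complex \<Rightarrow> complex \<Rightarrow> complex" where
  "om p q t = 1 / (1 + t) + p / (1 + p * t) + q / (1 + q * t) + p * q / (1 + p * q * t)
     - 2 * p * q * t / (1 + p * q * t\<^sup>2) - 1 / t"

definition omp :: "complex \<Rightarrow> complex \<Rightarrow> complex \<Rightarrow> complex" where
  "omp p q t = 1 / (1 + p * t)\<^sup>2 + q / (1 + p * q * t)\<^sup>2 - 2 * q * t / (1 + p * q * t\<^sup>2)\<^sup>2"

text \<open>The potential of the equation at \<open>p\<close> minus that at
  \<open>p * q * t^2\<close>, the latter weighted by the derivative \<open>q * t^2\<close> of the
  inner argument.\<close>

definition kap :: "complex \<Rightarrow> complex \<Rightarrow> complex \<Rightarrow> complex" where
  "kap p q t = 1 / (1 + p)\<^sup>2 - q * t\<^sup>2 / (1 + p * q * t\<^sup>2)\<^sup>2"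

text \<open>The numerator factors of \<open>RR\<close> are included, as they are denominators of its
  logarithmic derivatives \<open>sg\<close> and \<open>om\<close>.\<close>

definition regp :: "complex \<Rightarrow> complex \<Rightarrow> complex \<Rightarrow> bool" where
  "regp p q t \<longleftrightarrow> 1 + t \<noteq> 0 \<and> 1 + p * t \<noteq> 0 \<and> 1 + q * t \<noteq> 0 \<and> 1 + p * q * t \<noteq> 0
     \<and> 1 + p \<noteq> 0 \<and> 1 + q \<noteq> 0 \<and> 1 + p * q * t\<^sup>2 \<noteq> 0"

lemma regp_if_RR_nonzero: "RR p q t \<noteq> 0 \<Longrightarrow> regp p q t"
  by (auto simp: RR_def regp_def simp del: distrib_left_numeral)

text \<open>This factored form and the three that follow serve one purpose: in
  \<open>kernel_identity_Z\<close> all their factors cancel.\<close>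

lemma sg_closed:
  assumes "regp p q t"
  shows "sg p q t = - ((1 - t) * (1 - q * t) * (1 - p\<^sup>2 * q * t\<^sup>2)) / ((1 + p) * (1 + p * t) * (1 + p * q * t) * (1 + p * q * t\<^sup>2))"
proof -
  have nz: "1 + p * t \<noteq> 0" "1 + p * q * t \<noteq> 0" "1 + p \<noteq> 0" "1 + p * q * t\<^sup>2 \<noteq> 0"
    using assms by (auto simp: regp_def)
  have 1: "t / (1 + p * t) - 1 / (1 + p) = (t - 1) / ((1 + p * t) * (1 + p))"
    using nz by (simp add: divide_simps) (simp add: algebra_simps)
  have 2: "q * t / (1 + p * q * t) - q * t\<^sup>2 / (1 + p * q * t\<^sup>2) = q * t * (1 - t) / ((1 + p * q * t) * (1 + p * q * t\<^sup>2))"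
    using nz by (simp add: divide_simps) (simp add: algebra_simps power2_eq_square)
  have "sg p q t = (t / (1 + p * t) - 1 / (1 + p)) + (q * t / (1 + p * q * t) - q * t\<^sup>2 / (1 + p * q * t\<^sup>2))"
    by (simp add: sg_def)
  also have "\<dots> = ((t - 1) * ((1 + p * q * t) * (1 + p * q * t\<^sup>2)) + q * t * (1 - t) * ((1 + p * t) * (1 + p)))
      / (((1 + p * t) * (1 + p)) * ((1 + p * q * t) * (1 + p * q * t\<^sup>2)))"
    unfolding 1 2 by (rule add_frac_eq) (use nz in auto)
  also have "(t - 1) * ((1 + p * q * t) * (1 + p * q * t\<^sup>2)) + q * t * (1 - t) * ((1 + p * t) * (1 + p))
      = - ((1 - t) * (1 - q * t) * (1 - p\<^sup>2 * q * t\<^sup>2))"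
    by algebra
  finally show ?thesis by (simp add: mult_ac)
qed

lemma psg_minus_tom_closed:
  assumes "regp p q t" "t \<noteq> 0"
  shows "p * sg p q t - t * om p q t = (1 - p * t) * (1 - p * q * t) * (1 - q * t\<^sup>2) / ((1 + p) * (1 + t) * (1 + p * q * t\<^sup>2) * (1 + q * t))"
proof -
  have nz: "1 + t \<noteq> 0" "1 + q * t \<noteq> 0" "1 + p * t \<noteq> 0" "1 + p * q * t \<noteq> 0" "1 + p \<noteq> 0" "1 + p * q * t\<^sup>2 \<noteq> 0"
    using assms by (auto simp: regp_def)
  have "p * sg p q t - t * om p q t = (1 / (1 + p) - t / (1 + t)) + (p * q * t\<^sup>2 / (1 + p * q * t\<^sup>2) - q * t / (1 + q * t))"
  proof -
    have "1 - p / (1 + p) = 1 / (1 + p)" using nz by (simp add: field_simps)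
    then show ?thesis
      using assms(2) by (simp add: sg_def om_def algebra_simps power2_eq_square)
  qed
  also have "1 / (1 + p) - t / (1 + t) = (1 - p * t) / ((1 + p) * (1 + t))"
    using nz by (simp add: divide_simps) (simp add: algebra_simps)
  also have "p * q * t\<^sup>2 / (1 + p * q * t\<^sup>2) - q * t / (1 + q * t) = - (q * t * (1 - p * t)) / ((1 + p * q * t\<^sup>2) * (1 + q * t))"
    using nz by (simp add: divide_simps) (simp add: algebra_simps power2_eq_square)
  also have "(1 - p * t) / ((1 + p) * (1 + t)) + - (q * t * (1 - p * t)) / ((1 + p * q * t\<^sup>2) * (1 + q * t))
    = ((1 - p * t) * ((1 + p * q * t\<^sup>2) * (1 + q * t)) + - (q * t * (1 - p * t)) * ((1 + p) * (1 + t))) / (((1 + p) * (1 + t)) * ((1 + p * q * t\<^sup>2) * (1 + q * t)))"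
    by (rule add_frac_eq) (use nz in auto)
  also have "(1 - p * t) * ((1 + p * q * t\<^sup>2) * (1 + q * t)) + - (q * t * (1 - p * t)) * ((1 + p) * (1 + t))
      = (1 - p * t) * (1 - p * q * t) * (1 - q * t\<^sup>2)"
    by algebra
  finally show ?thesis by (simp add: mult_ac)
qed

lemma kap_closed:
  assumes "regp p q t"
  shows "kap p q t = (1 - q * t\<^sup>2) * (1 - p\<^sup>2 * q * t\<^sup>2) / ((1 + p)\<^sup>2 * (1 + p * q * t\<^sup>2)\<^sup>2)"
proof -
  have nz: "(1 + p)\<^sup>2 \<noteq> 0" "(1 + p * q * t\<^sup>2)\<^sup>2 \<noteq> 0"
    using assms by (auto simp: regp_def)
  have "kap p q t = (1 * (1 + p * q * t\<^sup>2)\<^sup>2 - q * t\<^sup>2 * (1 + p)\<^sup>2) / ((1 + p)\<^sup>2 * (1 + p * q * t\<^sup>2)\<^sup>2)"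
    unfolding kap_def by (rule diff_frac_eq) (use nz in auto)
  also have "1 * (1 + p * q * t\<^sup>2)\<^sup>2 - q * t\<^sup>2 * (1 + p)\<^sup>2 = (1 - q * t\<^sup>2) * (1 - p\<^sup>2 * q * t\<^sup>2)"
    by algebra
  finally show ?thesis .
qed

lemma one_minus_RR:
  assumes "regp p q t" "t \<noteq> 0"
  shows "1 - RR p q t / t = - ((1 - t) * (1 - p * t) * (1 - q * t) * (1 - p * q * t)) / (2 * t * (1 + p) * (1 + q) * (1 + p * q * t\<^sup>2))"
proof -
  have nz: "2 * t * (1 + p) * (1 + q) * (1 + p * q * t\<^sup>2) \<noteq> 0"
    using assms by (auto simp: regp_def)
  have "RR p q t / t = ((1 + t) * (1 + p * t) * (1 + q * t) * (1 + p * q * t)) / (2 * t * (1 + p) * (1 + q) * (1 + p * q * t\<^sup>2))"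
    by (simp add: RR_def mult_ac)
  then have "1 - RR p q t / t = ((2 * t * (1 + p) * (1 + q) * (1 + p * q * t\<^sup>2)) - ((1 + t) * (1 + p * t) * (1 + q * t) * (1 + p * q * t))) / (2 * t * (1 + p) * (1 + q) * (1 + p * q * t\<^sup>2))"
    using nz by (simp only: diff_divide_distrib divide_self not_False_eq_True)
  also have "(2 * t * (1 + p) * (1 + q) * (1 + p * q * t\<^sup>2)) - ((1 + t) * (1 + p * t) * (1 + q * t) * (1 + p * q * t))
      = - ((1 - t) * (1 - p * t) * (1 - q * t) * (1 - p * q * t))"
    by algebra
  finally show ?thesis .
qed

text \<open>Write \<open>Z\<close> for \<open>RR p q t / t\<close>. In
  \<open>total_derivative_identity\<close> the second derivative of the Legendre factor appears with
  coefficient \<open>Z^2 * sg * (p * sg - t * om)\<close>. The identity turns this into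
  \<open>kap * Z * (1 - Z)\<close>, the leading coefficient of Legendre's equation times
  \<open>kap\<close>.\<close>

lemma kernel_identity_Z:
  assumes "regp p q t" "t \<noteq> 0"
  shows "RR p q t / t * sg p q t * (p * sg p q t - t * om p q t) = kap p q t * (1 - RR p q t / t)"
proof -
  define a b c d e f g where "a = 1 + t" and "b = 1 + p * t" and "c = 1 + q * t" and "d = 1 + p * q * t"
    and "e = 1 + p" and "f = 1 + q" and "g = 1 + p * q * t\<^sup>2"
  define a' b' c' d' h k where "a' = 1 - t" and "b' = 1 - p * t" and "c' = 1 - q * t" and "d' = 1 - p * q * t"
    and "h = 1 - p\<^sup>2 * q * t\<^sup>2" and "k = 1 - q * t\<^sup>2"
  have nz: "a \<noteq> 0" "b \<noteq> 0" "c \<noteq> 0" "d \<noteq> 0" "e \<noteq> 0" "f \<noteq> 0" "g \<noteq> 0"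
    using assms by (auto simp: regp_def a_def b_def c_def d_def e_def f_def g_def)
  have e1: "RR p q t = a * b * c * d / (2 * e * f * g)"
    by (simp add: RR_def a_def b_def c_def d_def e_def f_def g_def)
  have e2: "sg p q t = - (a' * c' * h) / (e * b * d * g)"
    unfolding sg_closed[OF assms(1)] by (simp add: a'_def c'_def h_def b_def d_def e_def g_def)
  have e3: "p * sg p q t - t * om p q t = b' * d' * k / (e * a * g * c)"
    unfolding psg_minus_tom_closed[OF assms] by (simp add: b'_def d'_def k_def e_def a_def g_def c_def)
  have e4: "kap p q t = k * h / (e\<^sup>2 * g\<^sup>2)"
    unfolding kap_closed[OF assms(1)] by (simp add: k_def h_def e_def g_def)
  have e5: "1 - RR p q t / t = - (a' * b' * c' * d') / (2 * t * e * f * g)"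
    unfolding one_minus_RR[OF assms] by (simp add: a'_def b'_def c'_def d'_def e_def f_def g_def)
  show ?thesis
    unfolding e3 e4 e5 unfolding e1 e2 using nz assms(2) by (simp add: field_simps power2_eq_square)
qed

text \<open>Together with \<open>kernel_identity_Z\<close> this reduces the coefficient of the first
  derivative to \<open>kap * (1 - 2 * Z)\<close>. In partial fractions it follows term by term from
  the single relation \<open>*\<close>.\<close>

lemma kernel_identity_sg:
  assumes "regp p q t"
  shows "sg p q t + p * sgp p q t - t * omp p q t = - kap p q t"
proof -
  have *: "x / (1 + p * x) - p * (x / (1 + p * x))\<^sup>2 = x / (1 + p * x)\<^sup>2" if "1 + p * x \<noteq> 0" for x
    using that by (simp add: divide_simps) (simp add: algebra_simps power2_eq_square)
  have nz: "1 + p * t \<noteq> 0" "1 + p * (q * t) \<noteq> 0" "1 + p * 1 \<noteq> 0" "1 + p * (q * t\<^sup>2) \<noteq> 0"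
    using assms by (auto simp: regp_def mult.assoc)
  define A B C D where "A = t / (1 + p * t)" and "B = q * t / (1 + p * q * t)" and "C = 1 / (1 + p)"
    and "D = q * t\<^sup>2 / (1 + p * q * t\<^sup>2)"
  have "t * omp p q t = t / (1 + p * t)\<^sup>2 + q * t / (1 + p * q * t)\<^sup>2 - 2 * (q * t\<^sup>2 / (1 + p * q * t\<^sup>2)\<^sup>2)"
    by (simp add: omp_def algebra_simps power2_eq_square)
  also have "\<dots> = (A - p * A\<^sup>2) + (B - p * B\<^sup>2) - 2 * (D - p * D\<^sup>2)"
    using *[OF nz(1)] *[OF nz(2)] *[OF nz(4)] by (simp add: A_def B_def D_def mult.assoc)
  finally have o: "t * omp p q t = (A - p * A\<^sup>2) + (B - p * B\<^sup>2) - 2 * (D - p * D\<^sup>2)" .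
  have k: "kap p q t = (C - p * C\<^sup>2) - (D - p * D\<^sup>2)"
    unfolding kap_def using *[OF nz(3)] *[OF nz(4)] by (simp add: C_def D_def mult.assoc)
  have s: "sg p q t = A + B - C - D" "sgp p q t = - A\<^sup>2 - B\<^sup>2 + C\<^sup>2 + D\<^sup>2"
    by (simp_all add: sg_def sgp_def A_def B_def C_def D_def)
  show ?thesis unfolding o k s by (simp add: algebra_simps)
qed

text \<open>Derivatives are kept as function times logarithmic derivative, so for a product like
  \<open>RR\<close> the logarithmic derivatives simply add and nothing is expanded.\<close>

lemma logderiv_mult:
  assumes "(f has_field_derivative f x * a) (at x)" "(g has_field_derivative g x * b) (at x)"
  shows "((\<lambda>x. f x * g x) has_field_derivative f x * g x * (a + b)) (at (x::complex))"
  using DERIV_mult[OF assms] by (simp add: algebra_simps)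

lemma logderiv_divide:
  assumes "(f has_field_derivative f x * a) (at x)" "(g has_field_derivative g x * b) (at x)" "g x \<noteq> 0"
  shows "((\<lambda>x. f x / g x) has_field_derivative f x / g x * (a - b)) (at (x::complex))"
  by (rule DERIV_cong[OF DERIV_divide[OF assms]]) (use assms(3) in \<open>simp add: field_simps\<close>)

lemma logderiv_const: "((\<lambda>x. c) has_field_derivative c * 0) (at (x::complex))"
  by simp

lemma logderiv_linear:
  assumes "1 + c * x \<noteq> 0"
  shows "((\<lambda>x. 1 + c * x) has_field_derivative (1 + c * x) * (c / (1 + c * x))) (at (x::complex))"
  using assms by (auto intro!: derivative_eq_intros)

lemma logderiv_quadratic:
  assumes "1 + c * x\<^sup>2 \<noteq> 0"
  shows "((\<lambda>x. 1 + c * x\<^sup>2) has_field_derivative (1 + c * x\<^sup>2) * (2 * c * x / (1 + c * x\<^sup>2))) (at (x::complex))"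
  using assms by (auto intro!: derivative_eq_intros)

lemma RR_deriv_p:
  assumes "regp p q t"
  shows "((\<lambda>p. RR p q t) has_field_derivative RR p q t * sg p q t) (at p)"
proof -
  have nz: "1 + t * p \<noteq> 0" "1 + (q * t) * p \<noteq> 0" "1 + 1 * p \<noteq> 0" "1 + (q * t\<^sup>2) * p \<noteq> 0" "1 + q \<noteq> 0"
    using assms by (auto simp: regp_def mult_ac)
  have "((\<lambda>p. ((1 + t) * (1 + t * p)) * (1 + q * t) * (1 + (q * t) * p) / (2 * (1 + 1 * p) * (1 + q) * (1 + (q * t\<^sup>2) * p)))
     has_field_derivative ((1 + t) * (1 + t * p)) * (1 + q * t) * (1 + (q * t) * p) / (2 * (1 + 1 * p) * (1 + q) * (1 + (q * t\<^sup>2) * p))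
       * ((((0 + t / (1 + t * p)) + 0) + (q * t) / (1 + (q * t) * p)) - (((0 + 1 / (1 + 1 * p)) + 0) + (q * t\<^sup>2) / (1 + (q * t\<^sup>2) * p)))) (at p)"
    by (intro logderiv_mult logderiv_divide logderiv_const logderiv_linear nz) (use nz in \<open>auto simp del: distrib_left_numeral\<close>)
  then show ?thesis
    by (simp add: RR_def[abs_def] sg_def mult_ac diff_diff_eq)
qed

lemma RR_deriv_t:
  assumes "regp p q t" "t \<noteq> 0"
  shows "((\<lambda>t. RR p q t / t) has_field_derivative RR p q t / t * om p q t) (at t)"
proof -
  have nz: "1 + 1 * t \<noteq> 0" "1 + p * t \<noteq> 0" "1 + q * t \<noteq> 0" "1 + (p * q) * t \<noteq> 0" "1 + p \<noteq> 0" "1 + q \<noteq> 0" "1 + (p * q) * t\<^sup>2 \<noteq> 0"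
    using assms by (auto simp: regp_def mult_ac)
  have id: "((\<lambda>t. t) has_field_derivative t * (1 / t)) (at t)" using assms(2) by simp
  have "((\<lambda>t. ((1 + 1 * t) * (1 + p * t)) * (1 + q * t) * (1 + (p * q) * t) / ((2 * (1 + p) * (1 + q)) * (1 + (p * q) * t\<^sup>2)) / t)
     has_field_derivative ((1 + 1 * t) * (1 + p * t)) * (1 + q * t) * (1 + (p * q) * t) / ((2 * (1 + p) * (1 + q)) * (1 + (p * q) * t\<^sup>2)) / t
       * ((((1 / (1 + 1 * t) + p / (1 + p * t)) + q / (1 + q * t)) + (p * q) / (1 + (p * q) * t)
           - (0 + 2 * (p * q) * t / (1 + (p * q) * t\<^sup>2))) - 1 / t)) (at t)"
    by (intro logderiv_mult logderiv_divide logderiv_const logderiv_linear logderiv_quadratic nz id) (use nz assms(2) in \<open>auto simp del: distrib_left_numeral\<close>)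
  then show ?thesis
    by (simp add: RR_def om_def mult_ac)
qed

lemma sg_deriv_p:
  assumes "regp p q t"
  shows "((\<lambda>p. sg p q t) has_field_derivative sgp p q t) (at p)"
proof -
  have *: "((\<lambda>p. x / (1 + p * x)) has_field_derivative - (x / (1 + p * x))\<^sup>2) (at p)" if "1 + p * x \<noteq> 0" for x
    using that by (auto intro!: derivative_eq_intros simp: power2_eq_square)
  have nz: "1 + p * t \<noteq> 0" "1 + p * (q * t) \<noteq> 0" "1 + p * 1 \<noteq> 0" "1 + p * (q * t\<^sup>2) \<noteq> 0"
    using assms by (auto simp: regp_def mult.assoc)
  have "((\<lambda>p. t / (1 + p * t) + q * t / (1 + p * (q * t)) - 1 / (1 + p * 1) - q * t\<^sup>2 / (1 + p * (q * t\<^sup>2))) has_field_derivative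
     - (t / (1 + p * t))\<^sup>2 + - (q * t / (1 + p * (q * t)))\<^sup>2 - - (1 / (1 + p * 1))\<^sup>2 - - (q * t\<^sup>2 / (1 + p * (q * t\<^sup>2)))\<^sup>2) (at p)"
    by (intro DERIV_add DERIV_diff * nz)
  then show ?thesis by (simp add: sg_def[abs_def] sgp_def mult.assoc)
qed

lemma sg_deriv_t:
  assumes "regp p q t"
  shows "((\<lambda>t. sg p q t) has_field_derivative omp p q t) (at t)"
proof -
  have *: "((\<lambda>t. c * t / (1 + p * c * t)) has_field_derivative c / (1 + p * c * t)\<^sup>2) (at t)" if "1 + p * c * t \<noteq> 0" for c
    using that by (auto intro!: derivative_eq_intros simp: divide_simps) (auto simp: algebra_simps power2_eq_square)
  have **: "((\<lambda>t. c * t\<^sup>2 / (1 + p * c * t\<^sup>2)) has_field_derivative 2 * c * t / (1 + p * c * t\<^sup>2)\<^sup>2) (at t)" if "1 + p * c * t\<^sup>2 \<noteq> 0" for c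
    using that by (auto intro!: derivative_eq_intros simp: divide_simps) (auto simp: algebra_simps power2_eq_square)
  have nz: "1 + p * 1 * t \<noteq> 0" "1 + p * q * t \<noteq> 0" "1 + p * q * t\<^sup>2 \<noteq> 0"
    using assms by (auto simp: regp_def mult.assoc)
  have "((\<lambda>t. 1 * t / (1 + p * 1 * t) + q * t / (1 + p * q * t) - 1 / (1 + p) - q * t\<^sup>2 / (1 + p * q * t\<^sup>2)) has_field_derivative
      1 / (1 + p * 1 * t)\<^sup>2 + q / (1 + p * q * t)\<^sup>2 - 0 - 2 * q * t / (1 + p * q * t\<^sup>2)\<^sup>2) (at t)"
    by (intro DERIV_add DERIV_diff DERIV_const * ** nz)
  then show ?thesis by (simp add: sg_def omp_def)
qed

text \<open>
  Here \<open>T\<close> is \<open>t powr (\<mu> - 1)\<close>. The left-hand side is the differential operator in \<open>p\<close> applied to the integrand, the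
  right-hand side the \<open>t\<close>-derivative of \<open>t T\<close> times the \<open>p\<close>-derivative of the Legendre factor times \<open>G\<close>.
\<close>

lemma total_derivative_identity:
  fixes T q t y G :: complex
  assumes h1: "p * q * t\<^sup>2 * G2 + (1 + \<mu>) * G1 + N * Vs * G = 0"
    and h2: "Z * (1 - Z) * y2 + (1 - 2 * Z) * y1 + N * y = 0"
    and h3: "Z * \<sigma> * (p * \<sigma> - t * \<omega>) = \<kappa> * (1 - Z)"
    and h4: "\<sigma> + p * \<sigma>p - t * \<omega>p = - \<kappa>" and \<kappa>: "\<kappa> = Vp - q * t\<^sup>2 * Vs"
  shows "p * (T * (q\<^sup>2 * t ^ 4 * G2 * y + 2 * (q * t\<^sup>2 * G1 * (y1 * Z * \<sigma>)) + G * (y2 * Z\<^sup>2 * \<sigma>\<^sup>2 + y1 * Z * (\<sigma>\<^sup>2 + \<sigma>p))))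
      + (1 + \<mu>) * (T * (q * t\<^sup>2 * G1 * y + G * (y1 * Z * \<sigma>))) + N * Vp * (T * (G * y))
    = \<mu> * T * (G * (y1 * Z * \<sigma>)) + t * T * (2 * p * q * t * G1 * (y1 * Z * \<sigma>) + G * (y2 * Z\<^sup>2 * \<omega> * \<sigma> + y1 * Z * (\<omega> * \<sigma> + \<omega>p)))"
    (is "?L = ?R")
proof -
  \<comment> \<open>The difference as a combination of the hypotheses. The multipliers are read off
    from the terms with \<open>G2 * y\<close>, then \<open>y\<close>, then \<open>y2\<close> and
    \<open>y1\<close>.\<close>
  have "?L - ?R = q * t\<^sup>2 * y * T * (p * q * t\<^sup>2 * G2 + (1 + \<mu>) * G1 + N * Vs * G)
     + T * G * \<kappa> * (Z * (1 - Z) * y2 + (1 - 2 * Z) * y1 + N * y)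
     + T * G * (y2 * Z + y1) * (Z * \<sigma> * (p * \<sigma> - t * \<omega>) - \<kappa> * (1 - Z))
     + T * G * y1 * Z * (\<sigma> + p * \<sigma>p - t * \<omega>p - - \<kappa>)"
    unfolding \<kappa> by (simp add: algebra_simps power2_eq_square power4_eq_xxxx)
  also have "\<dots> = 0" unfolding h1 h2 h3 h4 by simp
  finally show ?thesis by simp
qed

text \<open>Places a compact set off the slit inside an annular sector of half-angle below
  \<open>pi\<close>, the region covered by \<open>yl_sector_bound\<close>.\<close>

lemma compact_slit_bounds:
  assumes "compact X" "X \<subseteq> - \<real>\<^sub>\<le>\<^sub>0"
  shows "\<exists>m M \<Theta>. 0 < m \<and> 0 < M \<and> 0 \<le> \<Theta> \<and> \<Theta> < pi \<and> (\<forall>z\<in>X. m \<le> norm z \<and> norm z \<le> M \<and> \<bar>Arg z\<bar> \<le> \<Theta>)"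
proof -
  \<comment> \<open>Adding a point makes the set nonempty, so that the extrema exist even if
    \<open>X\<close> is empty.\<close>
  define Y where "Y = insert 1 X"
  have Y: "compact Y" "Y \<subseteq> - \<real>\<^sub>\<le>\<^sub>0" "Y \<noteq> {}" using assms by (auto simp: Y_def)
  obtain z0 where z0: "z0 \<in> Y" "\<And>z. z \<in> Y \<Longrightarrow> norm z0 \<le> norm z"
    using continuous_attains_inf[OF Y(1,3), of norm] by (auto intro!: continuous_intros)
  obtain z1 where z1: "z1 \<in> Y" "\<And>z. z \<in> Y \<Longrightarrow> \<bar>Arg z\<bar> \<le> \<bar>Arg z1\<bar>"
  proof -
    have c: "continuous_on Y (\<lambda>z. \<bar>Arg z\<bar>)" by (intro continuous_intros) (use Y in auto)
    show ?thesis using continuous_attains_sup[OF Y(1,3) c] that by auto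
  qed
  obtain M where M: "M > 0" "\<And>z. z \<in> Y \<Longrightarrow> norm z \<le> M"
    using compact_imp_bounded[OF Y(1)] bounded_pos by metis
  have "\<bar>Arg z1\<bar> < pi"
  proof -
    have s: "z1 \<notin> \<real>\<^sub>\<le>\<^sub>0" using z1 Y by auto
    then have "z1 \<noteq> 0" by auto
    have "Arg z1 \<noteq> pi"
    proof
      assume "Arg z1 = pi"
      then have "z1 = of_real (norm z1) * cis pi" using rcis_cmod_Arg[of z1] by (simp add: rcis_def)
      then have "z1 = of_real (- norm z1)" by simp
      then have "z1 \<in> \<real>\<^sub>\<le>\<^sub>0" by (metis nonpos_Reals_of_real_iff neg_le_0_iff_le norm_ge_zero)
      with s show False by simp
    qed
    then show ?thesis using Arg_bounded[of z1] by auto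
  qed
  moreover have "norm z0 > 0" using z0 Y by auto
  ultimately show ?thesis
    using z0 z1 M by (intro exI[of _ "norm z0"] exI[of _ M] exI[of _ "\<bar>Arg z1\<bar>"]) (auto simp: Y_def)
qed

text \<open>Dividing by \<open>t \<le> 1\<close> keeps the argument of \<open>w\<close> and does not
  decrease its modulus, so \<open>w / t\<close> stays in the sector of \<open>X\<close>. The
  derivative is recovered from \<open>z * y' = ya + \<nu> * y\<close>, and the division by
  \<open>z\<close> gains one power of \<open>t\<close>.\<close>

lemma yl_ray_bound:
  assumes X: "compact X" "X \<subseteq> - \<real>\<^sub>\<le>\<^sub>0" and \<rho>: "\<rho> > Re \<nu>" "\<rho> > - Re \<nu> - 1"
  shows "\<exists>C>0. \<forall>w\<in>X. \<forall>t. 0 < t \<and> t \<le> 1 \<longrightarrow> norm (yl \<nu> (w / of_real t)) \<le> C * t powr (-\<rho>)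
     \<and> norm (deriv (yl \<nu>) (w / of_real t)) \<le> C * t powr (1 - \<rho>)"
proof -
  obtain m M \<Theta> where m: "0 < m" "0 < M" "0 \<le> \<Theta>" "\<Theta> < pi"
    and b: "\<And>z. z \<in> X \<Longrightarrow> m \<le> norm z \<and> norm z \<le> M \<and> \<bar>Arg z\<bar> \<le> \<Theta>"
    using compact_slit_bounds[OF X] by metis
  define \<delta> where "\<delta> = min (1/2) (\<rho> + Re \<nu> + 1)"
  have \<delta>: "0 < \<delta>" "\<delta> < 1" "\<delta> - Re \<nu> - 1 \<le> \<rho>" using \<rho> by (auto simp: \<delta>_def)
  obtain C where C: "C > 0" "\<And>r \<theta>. r \<ge> m \<Longrightarrow> \<theta> \<in> {-\<Theta>..\<Theta>} \<Longrightarrow> norm (yl \<nu> (of_real r * cis \<theta>)) \<le> C * r powr \<rho>"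
    "\<And>r \<theta>. r \<ge> m \<Longrightarrow> \<theta> \<in> {-\<Theta>..\<Theta>} \<Longrightarrow> norm (ya \<nu> (of_real r * cis \<theta>)) \<le> C * r powr (\<rho> - \<delta>)"
    using yl_sector_bound[OF m(3,4) \<delta>(1,2) less_imp_le[OF \<rho>(1)] \<delta>(3) m(1)] by blast
  define B where "B = m powr \<rho> + M powr \<rho>"
  define D where "D = C * B + (C * m powr (-\<delta>) + norm \<nu> * C) * B / m"
  have Bpos: "B > 0" using m by (simp add: B_def add_pos_nonneg)
  have D: "D \<ge> C * B" "D \<ge> (C * m powr (-\<delta>) + norm \<nu> * C) * B / m" "D > 0"
    using C(1) Bpos m by (auto simp: D_def intro!: divide_nonneg_pos mult_nonneg_nonneg add_nonneg_nonneg add_pos_nonneg)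
  show ?thesis
  proof (intro exI[of _ D] conjI ballI allI impI)
    fix w t assume w: "w \<in> X" and "0 < t \<and> t \<le> (1::real)"
    then have t: "0 < t" "t \<le> 1" by auto
    define r where "r = norm w / t"
    have z: "w / of_real t = of_real r * cis (Arg w)"
      using rcis_cmod_Arg[of w] by (simp add: r_def rcis_def)
    have "m * t \<le> m * 1" using t m by (intro mult_left_mono) auto
    then have r: "r \<ge> m" using b[OF w] t by (simp add: r_def le_divide_eq)
    have \<theta>: "Arg w \<in> {-\<Theta>..\<Theta>}" using b[OF w] by auto
    have wb: "norm w powr \<rho> \<le> B"
    proof (cases "\<rho> \<ge> 0")
      case True
      then have "norm w powr \<rho> \<le> M powr \<rho>" using b[OF w] m by (intro powr_mono2) auto
      then show ?thesis by (simp add: B_def add_increasing)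
    next
      case False
      then have "norm w powr \<rho> \<le> m powr \<rho>" using b[OF w] m by (intro powr_mono2') auto
      then show ?thesis by (simp add: B_def add_increasing2)
    qed
    have "r powr \<rho> = norm w powr \<rho> * t powr (-\<rho>)"
      using t by (simp add: r_def powr_divide powr_minus_divide)
    then have rb: "r powr \<rho> \<le> B * t powr (-\<rho>)"
      using wb by (simp add: mult_right_mono)
    have "norm (yl \<nu> (w / of_real t)) \<le> C * r powr \<rho>" unfolding z by (rule C(2)[OF r \<theta>])
    also have "\<dots> \<le> C * (B * t powr (-\<rho>))" using C(1) rb by (intro mult_left_mono) auto
    also have "\<dots> \<le> D * t powr (-\<rho>)" using mult_right_mono[OF D(1), of "t powr (-\<rho>)"] by (simp add: mult.assoc)
    finally show "norm (yl \<nu> (w / of_real t)) \<le> D * t powr (-\<rho>)" .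
    have r0: "r > 0" using r m by simp
    have "of_real r * cis (Arg w) \<noteq> 0" using r0 by simp
    then have "deriv (yl \<nu>) (w / of_real t) = (ya \<nu> (w / of_real t) + \<nu> * yl \<nu> (w / of_real t)) / (w / of_real t)"
      unfolding z by (simp add: ya_def)
    also have "norm \<dots> = norm (ya \<nu> (w / of_real t) + \<nu> * yl \<nu> (w / of_real t)) / r"
      using t by (simp add: norm_divide norm_mult r_def)
    also have "\<dots> \<le> (C * m powr (-\<delta>) * r powr \<rho> + norm \<nu> * (C * r powr \<rho>)) / r"
    proof (rule divide_right_mono)
      have "norm (ya \<nu> (w / of_real t)) \<le> C * r powr (\<rho> - \<delta>)" unfolding z by (rule C(3)[OF r \<theta>])
      also have "\<dots> = C * (r powr (-\<delta>) * r powr \<rho>)" by (simp flip: powr_add)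
      also have "\<dots> \<le> C * (m powr (-\<delta>) * r powr \<rho>)"
        using C(1) m r \<delta> by (intro mult_left_mono mult_right_mono powr_mono2') auto
      finally have 1: "norm (ya \<nu> (w / of_real t)) \<le> C * m powr (-\<delta>) * r powr \<rho>" by simp
      have "norm (yl \<nu> (w / of_real t)) \<le> C * r powr \<rho>" unfolding z by (rule C(2)[OF r \<theta>])
      then have 2: "norm (\<nu> * yl \<nu> (w / of_real t)) \<le> norm \<nu> * (C * r powr \<rho>)"
        unfolding norm_mult by (intro mult_left_mono) auto
      show "norm (ya \<nu> (w / of_real t) + \<nu> * yl \<nu> (w / of_real t)) \<le> C * m powr (-\<delta>) * r powr \<rho> + norm \<nu> * (C * r powr \<rho>)"
        by (rule order_trans[OF norm_triangle_ineq add_mono[OF 1 2]])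
    qed (use r0 in simp)
    also have "\<dots> = (C * m powr (-\<delta>) + norm \<nu> * C) * r powr \<rho> * (t / norm w)"
      using t by (simp add: r_def field_simps)
    also have "\<dots> \<le> (C * m powr (-\<delta>) + norm \<nu> * C) * (B * t powr (-\<rho>)) * (t / m)"
      using C(1) t m b[OF w] by (intro mult_mono rb mult_left_mono frac_le order_refl) (auto intro!: add_nonneg_nonneg mult_nonneg_nonneg simp: less_imp_le[OF Bpos])
    also have "\<dots> = ((C * m powr (-\<delta>) + norm \<nu> * C) * B / m) * t powr (1 - \<rho>)"
      using t by (simp add: powr_diff powr_minus divide_inverse)
    also have "\<dots> \<le> D * t powr (1 - \<rho>)" by (intro mult_right_mono D) auto
    finally show "norm (deriv (yl \<nu>) (w / of_real t)) \<le> D * t powr (1 - \<rho>)" .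
  qed (fact D)
qed

text \<open>Under \<open>w = p / (1 + p)\<close>, which is \<open>(1 - x) / 2\<close>, this is the
  preimage of \<open>cut1\<close>; compare \<open>1 - w = 1 / (1 + p)\<close>.\<close>

definition cutm :: "complex set" where "cutm = {p. 1 + p \<notin> \<real>\<^sub>\<le>\<^sub>0}"

text \<open>
  \<open>Wdom q\<close> keeps both \<open>G\<close> and the Legendre factor of the integrand off their cuts.
\<close>

definition Wdom :: "complex \<Rightarrow> (complex \<times> real) set" where
  "Wdom q = {x. 1 + fst x \<notin> \<real>\<^sub>\<le>\<^sub>0 \<and> 1 + fst x * q * (of_real (snd x))\<^sup>2 \<notin> \<real>\<^sub>\<le>\<^sub>0 \<and> RR (fst x) q (of_real (snd x)) \<notin> \<real>\<^sub>\<le>\<^sub>0}"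

definition Adom :: "complex \<Rightarrow> complex set" where
  "Adom q = {p. {p} \<times> {0..1} \<subseteq> Wdom q}"

lemma open_cutm: "open cutm"
proof -
  have "open ((\<lambda>p. 1 + p) -` (- \<real>\<^sub>\<le>\<^sub>0 :: complex set))"
    by (intro open_vimage open_slit continuous_intros)
  moreover have "(\<lambda>p. 1 + p) -` (- \<real>\<^sub>\<le>\<^sub>0) = cutm" by (auto simp: cutm_def)
  ultimately show ?thesis by simp
qed

lemma zero_in_cutm [simp]: "0 \<in> cutm"
  by (simp add: cutm_def)

lemma Wdom_regp:
  assumes "x \<in> Wdom q"
  shows "regp (fst x) q (of_real (snd x))"
proof (rule regp_if_RR_nonzero)
  have "RR (fst x) q (of_real (snd x)) \<notin> \<real>\<^sub>\<le>\<^sub>0" using assms by (simp add: Wdom_def)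
  then show "RR (fst x) q (of_real (snd x)) \<noteq> 0" by (metis nonpos_Reals_zero_I)
qed

lemma continuous_on_RR_Wdom:
  assumes "1 + q \<noteq> 0"
  shows "continuous_on (Wdom q) (\<lambda>x. RR (fst x) q (of_real (snd x)))"
  unfolding RR_def
proof (intro continuous_intros ballI)
  fix x assume "x \<in> Wdom q"
  then have "regp (fst x) q (of_real (snd x))" by (rule Wdom_regp)
  then show "2 * (1 + fst x) * (1 + q) * (1 + fst x * q * of_real (snd x) ^ 2) \<noteq> 0"
    using assms by (simp add: regp_def del: distrib_left_numeral)
qed

lemma open_Wdom:
  assumes "1 + q \<noteq> 0"
  shows "open (Wdom q)"
proof -
  define V where "V = {x::complex \<times> real. 1 + fst x \<in> - \<real>\<^sub>\<le>\<^sub>0} \<inter> {x. 1 + fst x * q * (of_real (snd x))\<^sup>2 \<in> - \<real>\<^sub>\<le>\<^sub>0}"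
  have "open ((\<lambda>x::complex \<times> real. 1 + fst x) -` (- \<real>\<^sub>\<le>\<^sub>0))" "open ((\<lambda>x::complex \<times> real. 1 + fst x * q * (of_real (snd x))\<^sup>2) -` (- \<real>\<^sub>\<le>\<^sub>0))"
    by (intro open_vimage open_slit continuous_intros)+
  then have V: "open V" by (simp add: V_def vimage_def open_Int)
  have nz: "1 + fst x \<noteq> 0" "1 + fst x * q * of_real (snd x) ^ 2 \<noteq> 0" if "x \<in> V" for x
    using that by (auto simp: V_def)
  have "continuous_on V (\<lambda>x. RR (fst x) q (of_real (snd x)))"
    unfolding RR_def by (intro continuous_intros ballI) (use nz assms in \<open>simp del: distrib_left_numeral\<close>)
  then have "open (V \<inter> (\<lambda>x. RR (fst x) q (of_real (snd x))) -` (- \<real>\<^sub>\<le>\<^sub>0))"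
    by (rule continuous_open_preimage[OF _ V open_slit])
  moreover have "V \<inter> (\<lambda>x. RR (fst x) q (of_real (snd x))) -` (- \<real>\<^sub>\<le>\<^sub>0) = Wdom q"
    by (auto simp: V_def Wdom_def)
  ultimately show ?thesis by simp
qed

lemma open_Adom:
  assumes "1 + q \<noteq> 0"
  shows "open (Adom q)"
  unfolding open_subopen[of "Adom q"]
proof
  fix p assume "p \<in> Adom q"
  then have "{p} \<times> {0..1} \<subseteq> Wdom q" by (simp add: Adom_def)
  from Elementary_Topology.tube_lemma[OF _ open_Wdom[OF assms] this]
  obtain X where "p \<in> X" "open X" "X \<times> {0..1} \<subseteq> Wdom q" by auto
  then show "\<exists>T. open T \<and> p \<in> T \<and> T \<subseteq> Adom q" by (intro exI[of _ X]) (auto simp: Adom_def)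
qed

lemma Adom_Wdom: "p \<in> Adom q \<Longrightarrow> t \<in> {0..1} \<Longrightarrow> (p, t) \<in> Wdom q"
  by (auto simp: Adom_def)

lemma Adom_subset_cutm: "Adom q \<subseteq> cutm"
  using Adom_Wdom[of _ q 0] by (auto simp: Wdom_def cutm_def)

lemma slit_divide:
  fixes z :: complex
  assumes "z \<notin> \<real>\<^sub>\<le>\<^sub>0" "t > 0"
  shows "z / of_real t \<notin> \<real>\<^sub>\<le>\<^sub>0"
  using assms by (auto simp: complex_nonpos_Reals_iff divide_le_0_iff)

text \<open>The condition \<open>mu\<close> lets \<open>t powr (\<mu> - 1)\<close> outweigh both
  possible growth rates \<open>t powr (- \<nu>)\<close> and \<open>t powr (\<nu> + 1)\<close> of the
  Legendre factor, so the integral \<open>UU\<close> converges at \<open>0\<close>. Adding its two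
  parts gives \<open>Re (1 + \<mu>) > 0\<close>, as \<open>regular_singular_unique\<close>
  requires.\<close>

locale legendre_solution =
  fixes \<mu> \<nu> :: complex and G :: "complex \<Rightarrow> complex"
  assumes holG: "G holomorphic_on cutm"
    and odeG: "p \<in> cutm \<Longrightarrow> p * deriv (deriv G) p + (1 + \<mu>) * deriv G p + \<nu> * (\<nu> + 1) * (1 / (1 + p)\<^sup>2) * G p = 0"
    and mu: "Re \<mu> > Re \<nu>" "Re \<mu> > - Re \<nu> - 1"
begin

lemma G_deriv: "p \<in> cutm \<Longrightarrow> (G has_field_derivative deriv G p) (at p)"
  using holomorphic_derivI[OF holG open_cutm] by auto

lemma G_deriv2: "p \<in> cutm \<Longrightarrow> (deriv G has_field_derivative deriv (deriv G) p) (at p)"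
  using holomorphic_derivI[OF holomorphic_deriv[OF holG open_cutm] open_cutm] by auto

definition KU :: "complex \<Rightarrow> complex \<Rightarrow> real \<Rightarrow> complex" where
  "KU q p t = of_real t powr (\<mu> - 1) * (G (p * q * of_real t ^ 2) * yl \<nu> (RR p q (of_real t) / of_real t))"

definition UU :: "complex \<Rightarrow> complex \<Rightarrow> complex" where
  "UU q p = integral {0..1} (KU q p)"

text \<open>First derivative of \<open>KU\<close> in \<open>p\<close>, and \<open>KU2\<close> the
  second. They are explicit because the Leibniz rule needs their joint continuity in
  \<open>p\<close> and \<open>t\<close>.\<close>

definition KU1 :: "complex \<Rightarrow> complex \<Rightarrow> real \<Rightarrow> complex" where
  "KU1 q p t = of_real t powr (\<mu> - 1) *
     (q * of_real t ^ 2 * deriv G (p * q * of_real t ^ 2) * yl \<nu> (RR p q (of_real t) / of_real t)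
      + G (p * q * of_real t ^ 2) * (deriv (yl \<nu>) (RR p q (of_real t) / of_real t) * (RR p q (of_real t) / of_real t) * sg p q (of_real t)))"

definition KU2 :: "complex \<Rightarrow> complex \<Rightarrow> real \<Rightarrow> complex" where
  "KU2 q p t = of_real t powr (\<mu> - 1) *
     (q\<^sup>2 * of_real t ^ 4 * deriv (deriv G) (p * q * of_real t ^ 2) * yl \<nu> (RR p q (of_real t) / of_real t)
      + 2 * (q * of_real t ^ 2 * deriv G (p * q * of_real t ^ 2) *
           (deriv (yl \<nu>) (RR p q (of_real t) / of_real t) * (RR p q (of_real t) / of_real t) * sg p q (of_real t)))
      + G (p * q * of_real t ^ 2) *
          (deriv (deriv (yl \<nu>)) (RR p q (of_real t) / of_real t) * (RR p q (of_real t) / of_real t)\<^sup>2 * (sg p q (of_real t))\<^sup>2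
           + deriv (yl \<nu>) (RR p q (of_real t) / of_real t) * (RR p q (of_real t) / of_real t) * ((sg p q (of_real t))\<^sup>2 + sgp p q (of_real t))))"

context
  fixes p q :: complex and t :: real
  assumes pt: "(p, t) \<in> Wdom q" and t: "t > 0"
begin

lemma reg: "regp p q (of_real t)"
  using Wdom_regp[OF pt] by simp

lemma Zslit: "RR p q (of_real t) / of_real t \<notin> \<real>\<^sub>\<le>\<^sub>0"
  using pt t by (intro slit_divide) (auto simp: Wdom_def)

lemma scut: "p * q * of_real t ^ 2 \<in> cutm"
  using pt by (auto simp: Wdom_def cutm_def)

lemma G_chain_p:
  assumes "(H has_field_derivative H') (at (p * q * of_real t ^ 2))"
  shows "((\<lambda>p. H (p * q * of_real t ^ 2)) has_field_derivative H' * (q * of_real t ^ 2)) (at p)"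
  by (rule DERIV_chain2[where g = "\<lambda>p. p * q * of_real t ^ 2", OF assms]) (auto intro!: derivative_eq_intros)

lemma Z_deriv_p:
  "((\<lambda>p. RR p q (of_real t) / of_real t) has_field_derivative (RR p q (of_real t) / of_real t) * sg p q (of_real t)) (at p)"
  using DERIV_cdivide[OF RR_deriv_p[OF reg], of "of_real t"] by simp

lemma Z_chain_p:
  assumes "(H has_field_derivative H') (at (RR p q (of_real t) / of_real t))"
  shows "((\<lambda>p. H (RR p q (of_real t) / of_real t)) has_field_derivative H' * ((RR p q (of_real t) / of_real t) * sg p q (of_real t))) (at p)"
  by (rule DERIV_chain2[where g = "\<lambda>p. RR p q (of_real t) / of_real t", OF assms Z_deriv_p])

lemma KU_deriv: "((\<lambda>p. KU q p t) has_field_derivative KU1 q p t) (at p)"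
proof -
  have "((\<lambda>p. KU q p t) has_field_derivative of_real t powr (\<mu> - 1) *
     (deriv G (p * q * of_real t ^ 2) * (q * of_real t ^ 2) * yl \<nu> (RR p q (of_real t) / of_real t)
      + deriv (yl \<nu>) (RR p q (of_real t) / of_real t) * ((RR p q (of_real t) / of_real t) * sg p q (of_real t)) * G (p * q * of_real t ^ 2))) (at p)"
    unfolding KU_def by (intro DERIV_cmult DERIV_mult G_chain_p Z_chain_p G_deriv yl_deriv scut Zslit)
  then show ?thesis by (simp add: KU1_def mult_ac)
qed

lemma KU1_deriv: "((\<lambda>p. KU1 q p t) has_field_derivative KU2 q p t) (at p)"
proof -
  let ?s = "p * q * of_real t ^ 2" and ?Z = "RR p q (of_real t) / of_real t" and ?\<sigma> = "sg p q (of_real t)"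
  have "((\<lambda>p. KU1 q p t) has_field_derivative of_real t powr (\<mu> - 1) *
     ((q * of_real t ^ 2 * (deriv (deriv G) ?s * (q * of_real t ^ 2)) * yl \<nu> ?Z
        + deriv (yl \<nu>) ?Z * (?Z * ?\<sigma>) * (q * of_real t ^ 2 * deriv G ?s))
      + (deriv G ?s * (q * of_real t ^ 2) * (deriv (yl \<nu>) ?Z * ?Z * ?\<sigma>)
        + (((deriv (deriv (yl \<nu>)) ?Z * (?Z * ?\<sigma>)) * ?Z + (?Z * ?\<sigma>) * deriv (yl \<nu>) ?Z) * ?\<sigma> + sgp p q (of_real t) * (deriv (yl \<nu>) ?Z * ?Z)) * G ?s))) (at p)"
    unfolding KU1_def
    by (intro DERIV_cmult DERIV_mult DERIV_add G_chain_p Z_chain_p Z_deriv_p G_deriv G_deriv2 yl_deriv yl_deriv2 scut Zslit sg_deriv_p reg)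
  moreover have "of_real t powr (\<mu> - 1) *
     ((q * of_real t ^ 2 * (deriv (deriv G) ?s * (q * of_real t ^ 2)) * yl \<nu> ?Z
        + deriv (yl \<nu>) ?Z * (?Z * ?\<sigma>) * (q * of_real t ^ 2 * deriv G ?s))
      + (deriv G ?s * (q * of_real t ^ 2) * (deriv (yl \<nu>) ?Z * ?Z * ?\<sigma>)
        + (((deriv (deriv (yl \<nu>)) ?Z * (?Z * ?\<sigma>)) * ?Z + (?Z * ?\<sigma>) * deriv (yl \<nu>) ?Z) * ?\<sigma> + sgp p q (of_real t) * (deriv (yl \<nu>) ?Z * ?Z)) * G ?s)) = KU2 q p t"
  proof -
    have alg: "(q * \<tau>\<^sup>2 * (G2 * (q * \<tau>\<^sup>2)) * y + y1 * (Z * \<sigma>) * (q * \<tau>\<^sup>2 * G1))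
        + (G1 * (q * \<tau>\<^sup>2) * (y1 * Z * \<sigma>) + (((y2 * (Z * \<sigma>)) * Z + (Z * \<sigma>) * y1) * \<sigma> + s' * (y1 * Z)) * g)
        = q\<^sup>2 * \<tau> ^ 4 * G2 * y + 2 * (q * \<tau>\<^sup>2 * G1 * (y1 * Z * \<sigma>)) + g * (y2 * Z\<^sup>2 * \<sigma>\<^sup>2 + y1 * Z * (\<sigma>\<^sup>2 + s'))"
      for \<tau> G1 G2 g y y1 y2 Z \<sigma> s' :: complex
      by (simp add: algebra_simps power2_eq_square power4_eq_xxxx)
    show ?thesis unfolding KU2_def by (simp only: alg)
  qed
  ultimately show ?thesis by simp
qed

text \<open>The instance of \<open>total_derivative_identity\<close> on the ray. Its primitive
  contains \<open>sg p q t\<close>, which is \<open>0\<close> at \<open>t = 1\<close>.\<close>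

lemma Phi_deriv:
  "((\<lambda>t. of_real t powr \<mu> * (G (p * q * of_real t ^ 2) * (deriv (yl \<nu>) (RR p q (of_real t) / of_real t) * (RR p q (of_real t) / of_real t) * sg p q (of_real t))))
    has_vector_derivative p * KU2 q p t + (1 + \<mu>) * KU1 q p t + \<nu> * (\<nu> + 1) * (1 / (1 + p)\<^sup>2) * KU q p t) (at t)"
proof -
  let ?t = "complex_of_real t"
  let ?s = "p * q * ?t ^ 2" and ?Z = "RR p q ?t / ?t" and ?\<sigma> = "sg p q ?t" and ?\<omega> = "om p q ?t"
  let ?T = "?t powr (\<mu> - 1)"
  have t0: "?t \<noteq> 0" using t by simp
  have d0: "((\<lambda>t. t powr \<mu>) has_field_derivative \<mu> * ?T) (at ?t)"
    by (rule derivative_eq_intros refl | use t in \<open>simp add: complex_nonpos_Reals_iff\<close>)+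
  have ds: "((\<lambda>t. p * q * t ^ 2) has_field_derivative 2 * p * q * ?t) (at ?t)"
    by (auto intro!: derivative_eq_intros)
  have dG: "((\<lambda>t. G (p * q * t ^ 2)) has_field_derivative deriv G ?s * (2 * p * q * ?t)) (at ?t)"
    by (rule DERIV_chain2[where g = "\<lambda>t. p * q * t ^ 2", OF G_deriv[OF scut] ds])
  have dZ: "((\<lambda>t. RR p q t / t) has_field_derivative ?Z * ?\<omega>) (at ?t)"
    by (rule RR_deriv_t[OF reg t0])
  have dy: "((\<lambda>t. deriv (yl \<nu>) (RR p q t / t)) has_field_derivative deriv (deriv (yl \<nu>)) ?Z * (?Z * ?\<omega>)) (at ?t)"
    by (rule DERIV_chain2[where g = "\<lambda>t. RR p q t / t", OF yl_deriv2[OF Zslit] dZ])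
  have dsg: "((\<lambda>t. sg p q t) has_field_derivative omp p q ?t) (at ?t)"
    by (rule sg_deriv_t[OF reg])
  have "((\<lambda>t. t powr \<mu> * (G (p * q * t ^ 2) * (deriv (yl \<nu>) (RR p q t / t) * (RR p q t / t) * sg p q t))) has_field_derivative
     \<mu> * ?T * (G ?s * (deriv (yl \<nu>) ?Z * ?Z * ?\<sigma>))
     + (deriv G ?s * (2 * p * q * ?t) * (deriv (yl \<nu>) ?Z * ?Z * ?\<sigma>)
         + ((deriv (deriv (yl \<nu>)) ?Z * (?Z * ?\<omega>) * ?Z + ?Z * ?\<omega> * deriv (yl \<nu>) ?Z) * ?\<sigma> + omp p q ?t * (deriv (yl \<nu>) ?Z * ?Z)) * G ?s) * ?t powr \<mu>) (at ?t)"
    by (intro DERIV_mult d0 dG dy dZ dsg)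
  moreover have "\<mu> * ?T * (G ?s * (deriv (yl \<nu>) ?Z * ?Z * ?\<sigma>))
     + (deriv G ?s * (2 * p * q * ?t) * (deriv (yl \<nu>) ?Z * ?Z * ?\<sigma>)
         + ((deriv (deriv (yl \<nu>)) ?Z * (?Z * ?\<omega>) * ?Z + ?Z * ?\<omega> * deriv (yl \<nu>) ?Z) * ?\<sigma> + omp p q ?t * (deriv (yl \<nu>) ?Z * ?Z)) * G ?s) * ?t powr \<mu>
     = \<mu> * ?T * (G ?s * (deriv (yl \<nu>) ?Z * ?Z * ?\<sigma>)) + ?t * ?T * (2 * p * q * ?t * deriv G ?s * (deriv (yl \<nu>) ?Z * ?Z * ?\<sigma>)
        + G ?s * (deriv (deriv (yl \<nu>)) ?Z * ?Z\<^sup>2 * ?\<omega> * ?\<sigma> + deriv (yl \<nu>) ?Z * ?Z * (?\<omega> * ?\<sigma> + omp p q ?t)))"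
  proof -
    have tm: "?t powr \<mu> = ?t * ?T" using t0 by (simp add: powr_diff)
    have alg: "\<mu> * T * (g * (y1 * Z * \<sigma>)) + (G1 * (2 * p * q * \<tau>) * (y1 * Z * \<sigma>) + ((y2 * (Z * \<omega>) * Z + Z * \<omega> * y1) * \<sigma> + o' * (y1 * Z)) * g) * (\<tau> * T)
      = \<mu> * T * (g * (y1 * Z * \<sigma>)) + \<tau> * T * (2 * p * q * \<tau> * G1 * (y1 * Z * \<sigma>) + g * (y2 * Z\<^sup>2 * \<omega> * \<sigma> + y1 * Z * (\<omega> * \<sigma> + o')))"
      for T \<tau> G1 g y1 y2 Z \<sigma> \<omega> o' :: complex
      by (simp add: algebra_simps power2_eq_square)
    show ?thesis unfolding tm by (rule alg)
  qed
  moreover have "\<dots> = p * KU2 q p t + (1 + \<mu>) * KU1 q p t + \<nu> * (\<nu> + 1) * (1 / (1 + p)\<^sup>2) * KU q p t"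
    unfolding KU2_def KU1_def KU_def
  proof (rule total_derivative_identity[symmetric])
    show "p * q * ?t\<^sup>2 * deriv (deriv G) ?s + (1 + \<mu>) * deriv G ?s + \<nu> * (\<nu> + 1) * (1 / (1 + ?s)\<^sup>2) * G ?s = 0"
      using odeG[OF scut] by simp
    show "?Z * (1 - ?Z) * deriv (deriv (yl \<nu>)) ?Z + (1 - 2 * ?Z) * deriv (yl \<nu>) ?Z + \<nu> * (\<nu> + 1) * yl \<nu> ?Z = 0"
      by (rule yl_ode[OF Zslit])
    show "?Z * ?\<sigma> * (p * ?\<sigma> - ?t * ?\<omega>) = kap p q ?t * (1 - ?Z)"
      by (rule kernel_identity_Z[OF reg t0])
    show "?\<sigma> + p * sgp p q ?t - ?t * omp p q ?t = - kap p q ?t"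
      by (rule kernel_identity_sg[OF reg])
    show "kap p q ?t = 1 / (1 + p)\<^sup>2 - q * ?t\<^sup>2 * (1 / (1 + ?s)\<^sup>2)"
      by (simp add: kap_def)
  qed
  ultimately show ?thesis
    using has_vector_derivative_real_field by fastforce
qed

end

lemma continuous_on_parts:
  assumes D: "D \<subseteq> Wdom q \<inter> {x. snd x > 0}" and q: "1 + q \<noteq> 0"
  shows "continuous_on D (\<lambda>x. RR (fst x) q (of_real (snd x)) / of_real (snd x))"
    and "continuous_on D (\<lambda>x. sg (fst x) q (of_real (snd x)))"
    and "continuous_on D (\<lambda>x. sgp (fst x) q (of_real (snd x)))"
    and "f holomorphic_on cutm \<Longrightarrow> continuous_on D (\<lambda>x. f (fst x * q * of_real (snd x) ^ 2))"
    and "g holomorphic_on - \<real>\<^sub>\<le>\<^sub>0 \<Longrightarrow> continuous_on D (\<lambda>x. g (RR (fst x) q (of_real (snd x)) / of_real (snd x)))"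
    and "continuous_on D (\<lambda>x. complex_of_real (snd x) powr c)"
proof -
  have r: "regp (fst x) q (of_real (snd x))" "snd x > 0" "x \<in> Wdom q" if "x \<in> D" for x
    using Wdom_regp that D by auto
  have sl: "RR (fst x) q (of_real (snd x)) / of_real (snd x) \<notin> \<real>\<^sub>\<le>\<^sub>0" if "x \<in> D" for x
    by (rule slit_divide) (use r(2,3)[OF that] in \<open>auto simp: Wdom_def\<close>)
  show R: "continuous_on D (\<lambda>x. RR (fst x) q (of_real (snd x)) / of_real (snd x))"
    by (intro continuous_intros continuous_on_subset[OF continuous_on_RR_Wdom[OF q]]) (use r D in auto)
  show "continuous_on D (\<lambda>x. sg (fst x) q (of_real (snd x)))" "continuous_on D (\<lambda>x. sgp (fst x) q (of_real (snd x)))"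
    unfolding sg_def sgp_def by (intro continuous_intros ballI; use r(1) in \<open>simp add: regp_def\<close>)+
  show "continuous_on D (\<lambda>x. f (fst x * q * of_real (snd x) ^ 2))" if "f holomorphic_on cutm"
    by (rule continuous_on_compose2[OF holomorphic_on_imp_continuous_on[OF that]])
       (use r(3) in \<open>auto intro!: continuous_intros simp: Wdom_def cutm_def\<close>)
  show "continuous_on D (\<lambda>x. g (RR (fst x) q (of_real (snd x)) / of_real (snd x)))" if "g holomorphic_on - \<real>\<^sub>\<le>\<^sub>0"
    by (rule continuous_on_compose2[OF holomorphic_on_imp_continuous_on[OF that] R])
       (use sl in \<open>simp add: image_subset_iff\<close>)
  show "continuous_on D (\<lambda>x. complex_of_real (snd x) powr c)"
    by (intro continuous_intros) (use r(2) in \<open>force simp: less_imp_le\<close>)+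
qed

lemma continuous_on_KU:
  assumes D: "D \<subseteq> Wdom q \<inter> {x. snd x > 0}" and q: "1 + q \<noteq> 0"
  shows "continuous_on D (\<lambda>x. KU q (fst x) (snd x))" "continuous_on D (\<lambda>x. KU1 q (fst x) (snd x))"
    "continuous_on D (\<lambda>x. KU2 q (fst x) (snd x))"
  unfolding KU_def KU1_def KU2_def
  by (intro continuous_on_mult continuous_on_add continuous_on_const continuous_on_power continuous_on_fst continuous_on_snd continuous_on_id
      continuous_on_of_real continuous_on_parts[OF D q] holG yl_holomorphic holomorphic_deriv open_cutm open_slit)+

end

section \<open>The differential equation and the product rule for \<open>UU\<close>\<close>

context legendre_solution
begin

text \<open>A growth rate strictly between that of the Legendre factor and \<open>Re \<mu>\<close>,
  fixed once so that all later bounds share it. The remaining margin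
  \<open>Re \<mu> - \<rho>0\<close> is the rate at which boundary terms and tails tend to
  zero.\<close>

definition \<rho>0 :: real where "\<rho>0 = (SOME \<rho>. \<rho> > Re \<nu> \<and> \<rho> > - Re \<nu> - 1 \<and> \<rho> < Re \<mu>)"

lemma \<rho>0: "\<rho>0 > Re \<nu>" "\<rho>0 > - Re \<nu> - 1" "Re \<mu> - \<rho>0 > 0"
proof -
  have "\<exists>\<rho>. \<rho> > Re \<nu> \<and> \<rho> > - Re \<nu> - 1 \<and> \<rho> < Re \<mu>"
    using dense[of "max (Re \<nu>) (- Re \<nu> - 1)" "Re \<mu>"] mu by auto
  then have "\<rho>0 > Re \<nu> \<and> \<rho>0 > - Re \<nu> - 1 \<and> \<rho>0 < Re \<mu>" unfolding \<rho>0_def by (rule someI_ex)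
  then show "\<rho>0 > Re \<nu>" "\<rho>0 > - Re \<nu> - 1" "Re \<mu> - \<rho>0 > 0" by auto
qed

lemma kernel_bounds:
  assumes K: "compact K" "K \<subseteq> Adom q" and q: "1 + q \<noteq> 0"
  shows "\<exists>C>0. \<forall>p\<in>K. \<forall>t. 0 < t \<and> t \<le> 1 \<longrightarrow> norm (KU q p t) \<le> C * t powr (Re \<mu> - \<rho>0 - 1)
    \<and> norm (G (p * q * of_real t ^ 2)) \<le> C
    \<and> norm (deriv (yl \<nu>) (RR p q (of_real t) / of_real t)) \<le> C * t powr (1 - \<rho>0)"
proof -
  have sub: "K \<times> {0..1} \<subseteq> Wdom q" using K by (auto simp: Adom_def)
  have cp: "compact (K \<times> {0..1::real})" using K by (intro compact_Times) auto
  define X where "X = (\<lambda>x. RR (fst x) q (of_real (snd x))) ` (K \<times> {0..1})"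
  have X: "compact X" "X \<subseteq> - \<real>\<^sub>\<le>\<^sub>0"
    unfolding X_def using sub
    by (auto intro!: compact_continuous_image cp continuous_on_subset[OF continuous_on_RR_Wdom[OF q]] simp: Wdom_def image_subset_iff)
  obtain C1 where C1: "C1 > 0" "\<And>w t. w \<in> X \<Longrightarrow> 0 < t \<Longrightarrow> t \<le> 1 \<Longrightarrow> norm (yl \<nu> (w / of_real t)) \<le> C1 * t powr (-\<rho>0)"
    "\<And>w t. w \<in> X \<Longrightarrow> 0 < t \<Longrightarrow> t \<le> 1 \<Longrightarrow> norm (deriv (yl \<nu>) (w / of_real t)) \<le> C1 * t powr (1 - \<rho>0)"
    using yl_ray_bound[OF X \<rho>0(1,2)] by blast
  have "continuous_on (K \<times> {0..1}) (\<lambda>x. G (fst x * q * of_real (snd x) ^ 2))"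
    by (rule continuous_on_compose2[OF holomorphic_on_imp_continuous_on[OF holG]])
       (use sub in \<open>auto intro!: continuous_intros simp: Wdom_def cutm_def\<close>)
  then have "bounded ((\<lambda>x. G (fst x * q * of_real (snd x) ^ 2)) ` (K \<times> {0..1::real}))"
    by (intro compact_imp_bounded compact_continuous_image cp)
  then obtain C2 where C2: "C2 > 0" "\<And>x. x \<in> K \<times> {0..1} \<Longrightarrow> norm (G (fst x * q * of_real (snd x) ^ 2)) \<le> C2"
    unfolding bounded_pos by blast
  define C where "C = C1 + C2 + C1 * C2"
  have C: "C > 0" "C1 \<le> C" "C2 \<le> C" "C2 * C1 \<le> C" using C1(1) C2(1) by (simp_all add: C_def add_pos_pos)
  show ?thesis
  proof (intro exI[of _ C] conjI ballI allI impI)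
    fix p t assume p: "p \<in> K" and "0 < t \<and> t \<le> (1::real)"
    then have t: "0 < t" "t \<le> 1" by auto
    have w: "RR p q (of_real t) \<in> X" unfolding X_def using p t by (intro image_eqI[of _ _ "(p, t)"]) auto
    have g: "norm (G (p * q * of_real t ^ 2)) \<le> C2" using C2(2)[of "(p, t)"] p t by simp
    then show "norm (G (p * q * of_real t ^ 2)) \<le> C" using C by linarith
    have "norm (deriv (yl \<nu>) (RR p q (of_real t) / of_real t)) \<le> C1 * t powr (1 - \<rho>0)" by (rule C1(3)[OF w t])
    also have "\<dots> \<le> C * t powr (1 - \<rho>0)" using C by (intro mult_right_mono) auto
    finally show "norm (deriv (yl \<nu>) (RR p q (of_real t) / of_real t)) \<le> C * t powr (1 - \<rho>0)" .
    have "norm (KU q p t) = t powr (Re \<mu> - 1) * (norm (G (p * q * of_real t ^ 2)) * norm (yl \<nu> (RR p q (of_real t) / of_real t)))"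
      unfolding KU_def norm_mult norm_powr_of_real[OF t(1)] by simp
    also have "\<dots> \<le> t powr (Re \<mu> - 1) * (C2 * (C1 * t powr (-\<rho>0)))"
      using C2(1) by (intro mult_left_mono mult_mono g C1(2)[OF w t]) auto
    also have "\<dots> = C2 * C1 * (t powr (Re \<mu> - 1) * t powr (-\<rho>0))" by simp
    also have "t powr (Re \<mu> - 1) * t powr (-\<rho>0) = t powr (Re \<mu> - \<rho>0 - 1)"
      unfolding powr_add[symmetric] by (simp add: algebra_simps)
    also have "C2 * C1 * t powr (Re \<mu> - \<rho>0 - 1) \<le> C * t powr (Re \<mu> - \<rho>0 - 1)"
      using C by (intro mult_right_mono) auto
    finally show "norm (KU q p t) \<le> C * t powr (Re \<mu> - \<rho>0 - 1)" .
  qed (fact C)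
qed

lemma continuous_on_KU_t:
  assumes "p \<in> Adom q" "1 + q \<noteq> 0"
  shows "continuous_on {0<..1} (KU q p)"
proof -
  have "continuous_on ({p} \<times> {0<..1}) (\<lambda>x. KU q (fst x) (snd x))"
    by (rule continuous_on_KU) (use assms in \<open>auto simp: Adom_def\<close>)
  then have "continuous_on {0<..1} (\<lambda>t. (\<lambda>x. KU q (fst x) (snd x)) (p, t))"
    by (rule continuous_on_compose2) (auto intro!: continuous_intros)
  then show ?thesis by simp
qed

text \<open>On \<open>[\<epsilon>, 1]\<close> everything is continuous, so the Leibniz rule applies
  twice and the total derivative integrates exactly. The boundary term at \<open>1\<close> is zero,
  hence the equation holds up to the term at \<open>\<epsilon>\<close>.\<close>

lemma UU_truncated_derivs:
  assumes B: "ball p0 r \<subseteq> Adom q" and q: "1 + q \<noteq> 0" and e: "0 < \<epsilon>" "\<epsilon> \<le> 1" and p: "p \<in> ball p0 r"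
  shows "((\<lambda>p. integral {\<epsilon>..1} (KU q p)) has_field_derivative integral {\<epsilon>..1} (KU1 q p)) (at p)"
    and "((\<lambda>p. integral {\<epsilon>..1} (KU1 q p)) has_field_derivative integral {\<epsilon>..1} (KU2 q p)) (at p)"
    and "p * integral {\<epsilon>..1} (KU2 q p) + (1 + \<mu>) * integral {\<epsilon>..1} (KU1 q p) + \<nu> * (\<nu> + 1) * (1 / (1 + p)\<^sup>2) * integral {\<epsilon>..1} (KU q p)
      = - (of_real \<epsilon> powr \<mu> * (G (p * q * of_real \<epsilon> ^ 2) * (deriv (yl \<nu>) (RR p q (of_real \<epsilon>) / of_real \<epsilon>) * (RR p q (of_real \<epsilon>) / of_real \<epsilon>) * sg p q (of_real \<epsilon>))))"
proof -
  let ?D = "ball p0 r \<times> {\<epsilon>..1}"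
  have D: "?D \<subseteq> Wdom q \<inter> {x. snd x > 0}"
  proof
    fix x assume "x \<in> ?D"
    then have x: "fst x \<in> Adom q" "snd x \<in> {0..1}" "snd x > 0" using B e by (auto simp: mem_Times_iff)
    then show "x \<in> Wdom q \<inter> {x. snd x > 0}" using Adom_Wdom[OF x(1,2)] by simp
  qed
  note cont = continuous_on_KU[OF D q]
  have W: "(p, t) \<in> Wdom q" "t > 0" if "p \<in> ball p0 r" "t \<in> {\<epsilon>..1}" for p t
    using D that e by auto
  have sec: "continuous_on {\<epsilon>..1} (\<lambda>t. f p t)" if "continuous_on ?D (\<lambda>x. f (fst x) (snd x))" "p \<in> ball p0 r" for f :: "complex \<Rightarrow> real \<Rightarrow> complex" and p
  proof -
    have "continuous_on {\<epsilon>..1} (\<lambda>t. (\<lambda>x. f (fst x) (snd x)) (p, t))"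
      by (rule continuous_on_compose2[OF that(1)]) (use that(2) in \<open>auto intro!: continuous_intros\<close>)
    then show ?thesis by simp
  qed
  have leib: "((\<lambda>p. integral {\<epsilon>..1} (f p)) has_field_derivative integral {\<epsilon>..1} (f' p)) (at p)"
    if d: "\<And>p t. p \<in> ball p0 r \<Longrightarrow> t \<in> {\<epsilon>..1} \<Longrightarrow> ((\<lambda>p. f p t) has_field_derivative f' p t) (at p)"
      and c: "continuous_on ?D (\<lambda>x. f (fst x) (snd x))" "continuous_on ?D (\<lambda>x. f' (fst x) (snd x))"
    for f f' :: "complex \<Rightarrow> real \<Rightarrow> complex"
  proof -
    have "((\<lambda>p. integral (cbox \<epsilon> 1) (f p)) has_field_derivative integral (cbox \<epsilon> 1) (f' p)) (at p within ball p0 r)"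
    proof (rule leibniz_rule_field_derivative)
      show "((\<lambda>p. f p t) has_field_derivative f' p t) (at p within ball p0 r)" if "p \<in> ball p0 r" "t \<in> cbox \<epsilon> 1" for p t
        using d[of p t] that by (auto intro: has_field_derivative_at_within)
      show "f p integrable_on cbox \<epsilon> 1" if "p \<in> ball p0 r" for p
        using integrable_continuous_real[OF sec[OF c(1) that]] by simp
      show "continuous_on (ball p0 r \<times> cbox \<epsilon> 1) (\<lambda>(x, t). f' x t)"
        using c(2) by (simp add: split_def)
    qed (use p in auto)
    moreover have "at p within ball p0 r = at p" by (rule at_within_open[OF p open_ball])
    ultimately show ?thesis by simp
  qed
  show "((\<lambda>p. integral {\<epsilon>..1} (KU q p)) has_field_derivative integral {\<epsilon>..1} (KU1 q p)) (at p)"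
    by (rule leib[OF KU_deriv cont(1,2)]) (use W in auto)
  show "((\<lambda>p. integral {\<epsilon>..1} (KU1 q p)) has_field_derivative integral {\<epsilon>..1} (KU2 q p)) (at p)"
    by (rule leib[OF KU1_deriv cont(2,3)]) (use W in auto)
  let ?\<Phi> = "\<lambda>t::real. of_real t powr \<mu> * (G (p * q * of_real t ^ 2) * (deriv (yl \<nu>) (RR p q (of_real t) / of_real t) * (RR p q (of_real t) / of_real t) * sg p q (of_real t)))"
  have "((\<lambda>t. p * KU2 q p t + (1 + \<mu>) * KU1 q p t + \<nu> * (\<nu> + 1) * (1 / (1 + p)\<^sup>2) * KU q p t) has_integral ?\<Phi> 1 - ?\<Phi> \<epsilon>) {\<epsilon>..1}"
  proof (rule fundamental_theorem_of_calculus[OF e(2)])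
    fix t assume "t \<in> {\<epsilon>..1}"
    from has_vector_derivative_at_within[OF Phi_deriv[OF W[OF p this]]]
    show "(?\<Phi> has_vector_derivative p * KU2 q p t + (1 + \<mu>) * KU1 q p t + \<nu> * (\<nu> + 1) * (1 / (1 + p)\<^sup>2) * KU q p t) (at t within {\<epsilon>..1})" .
  qed
  moreover have "sg p q (of_real 1) = 0" by (simp add: sg_def)
  ultimately have "((\<lambda>t. p * KU2 q p t + (1 + \<mu>) * KU1 q p t + \<nu> * (\<nu> + 1) * (1 / (1 + p)\<^sup>2) * KU q p t) has_integral - ?\<Phi> \<epsilon>) {\<epsilon>..1}"
    by simp
  moreover have "((\<lambda>t. p * KU2 q p t + (1 + \<mu>) * KU1 q p t + \<nu> * (\<nu> + 1) * (1 / (1 + p)\<^sup>2) * KU q p t) has_integral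
     p * integral {\<epsilon>..1} (KU2 q p) + (1 + \<mu>) * integral {\<epsilon>..1} (KU1 q p) + \<nu> * (\<nu> + 1) * (1 / (1 + p)\<^sup>2) * integral {\<epsilon>..1} (KU q p)) {\<epsilon>..1}"
    by (intro has_integral_add has_integral_mult_right integrable_integral integrable_continuous_real sec cont p)
  ultimately show "p * integral {\<epsilon>..1} (KU2 q p) + (1 + \<mu>) * integral {\<epsilon>..1} (KU1 q p) + \<nu> * (\<nu> + 1) * (1 / (1 + p)\<^sup>2) * integral {\<epsilon>..1} (KU q p) = - ?\<Phi> \<epsilon>"
    by (rule has_integral_unique[rotated])
qed

text \<open>The truncated integrals converge to \<open>UU q\<close> uniformly near
  \<open>p0\<close>, and for holomorphic functions this carries over to all derivatives. So only
  \<open>KU\<close> itself has to be dominated near \<open>t = 0\<close>. The boundary term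
  \<open>b\<close> left by the truncation tends to zero like
  \<open>\<epsilon> powr (Re \<mu> - \<rho>0)\<close>.\<close>

lemma UU_ode:
  assumes p0: "p0 \<in> Adom q" and q: "1 + q \<noteq> 0"
  shows "UU q field_differentiable at p0"
    and "p0 * deriv (deriv (UU q)) p0 + (1 + \<mu>) * deriv (UU q) p0 + \<nu> * (\<nu> + 1) * (1 / (1 + p0)\<^sup>2) * UU q p0 = 0"
proof -
  obtain r where r: "r > 0" "cball p0 r \<subseteq> Adom q"
    using open_Adom[OF q] p0 open_contains_cball by blast
  let ?B = "ball p0 r"
  have B: "?B \<subseteq> Adom q" using r by auto
  have p0B: "p0 \<in> ?B" using r by simp
  define e where "e = Re \<mu> - \<rho>0"
  have e: "e > 0" using \<rho>0 by (simp add: e_def)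
  obtain C where C: "C > 0" "\<And>p t. p \<in> cball p0 r \<Longrightarrow> 0 < t \<Longrightarrow> t \<le> 1 \<Longrightarrow> norm (KU q p t) \<le> C * t powr (e - 1)"
    "\<And>p t. p \<in> cball p0 r \<Longrightarrow> 0 < t \<Longrightarrow> t \<le> 1 \<Longrightarrow> norm (G (p * q * of_real t ^ 2)) \<le> C"
    "\<And>p t. p \<in> cball p0 r \<Longrightarrow> 0 < t \<Longrightarrow> t \<le> 1 \<Longrightarrow> norm (deriv (yl \<nu>) (RR p q (of_real t) / of_real t)) \<le> C * t powr (1 - \<rho>0)"
    using kernel_bounds[OF compact_cball r(2) q] unfolding e_def by blast
  define \<epsilon> where "\<epsilon> n = inverse (real (Suc n))" for n
  have \<epsilon>: "0 < \<epsilon> n" "\<epsilon> n \<le> 1" for n by (auto simp: \<epsilon>_def inverse_le_1_iff)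
  have \<epsilon>0: "\<epsilon> \<longlonglongrightarrow> 0" unfolding \<epsilon>_def[abs_def] by (rule LIMSEQ_inverse_real_of_nat)
  have \<epsilon>e: "(\<lambda>n. c * \<epsilon> n powr e) \<longlonglongrightarrow> 0" for c
    by (rule tendsto_mult_right_zero, rule tendsto_zero_powrI[OF \<epsilon>0 tendsto_const _ e])
       (use \<epsilon> in \<open>auto intro!: always_eventually simp: less_imp_le\<close>)
  define f where "f n p = integral {\<epsilon> n..1} (KU q p)" for n p
  have ul: "uniform_limit (cball p0 r) f (UU q) sequentially"
  proof (rule uniform_limitI)
    fix \<eta> :: real assume \<eta>: "\<eta> > 0"
    from order_tendstoD(2)[OF \<epsilon>e[of "C / e"] \<eta>]
    show "\<forall>\<^sub>F n in sequentially. \<forall>p\<in>cball p0 r. dist (f n p) (UU q p) < \<eta>"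
    proof eventually_elim
      case (elim n)
      show ?case
      proof
        fix p assume p: "p \<in> cball p0 r"
        have "norm (integral {0..1} (KU q p) - integral {\<epsilon> n..1} (KU q p)) \<le> C / e * \<epsilon> n powr e"
          by (rule integrable_powr_majorant(3)[OF continuous_on_KU_t e C(2)]) (use p r q \<epsilon> in auto)
        with elim show "dist (f n p) (UU q p) < \<eta>"
          by (simp add: f_def UU_def dist_norm norm_minus_commute)
      qed
    qed
  qed
  then have ulB: "uniform_limit ?B f (UU q) sequentially"
    by (rule uniform_limit_on_subset) auto
  have d1: "(f n has_field_derivative integral {\<epsilon> n..1} (KU1 q p)) (at p)" if "p \<in> ?B" for n p
    unfolding f_def[abs_def] by (rule UU_truncated_derivs(1)[OF B q \<epsilon> that])
  have hol: "f n holomorphic_on ?B" for n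
    unfolding holomorphic_on_open[OF open_ball] using d1 by blast
  have "UU q holomorphic_on ?B"
  proof (rule holomorphic_uniform_sequence[OF open_ball hol])
    fix x assume "x \<in> ?B"
    then obtain d where "d > 0" "cball x d \<subseteq> ?B" using open_contains_cball open_ball by blast
    then show "\<exists>d>0. cball x d \<subseteq> ?B \<and> uniform_limit (cball x d) f (UU q) sequentially"
      using uniform_limit_on_subset[OF ulB] by blast
  qed
  then show "UU q field_differentiable at p0"
    by (rule holomorphic_on_imp_differentiable_at[OF _ open_ball p0B])
  have L: "(\<lambda>n. (deriv ^^ m) (f n) p0) \<longlonglongrightarrow> (deriv ^^ m) (UU q) p0" for m
    by (rule higher_deriv_complex_uniform_limit[OF ulB]) (use hol p0B in auto)
  have D1: "deriv (f n) p = integral {\<epsilon> n..1} (KU1 q p)" if "p \<in> ?B" for n p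
    using d1[OF that] by (rule DERIV_imp_deriv)
  have D2: "deriv (deriv (f n)) p0 = integral {\<epsilon> n..1} (KU2 q p0)" for n
  proof (rule DERIV_imp_deriv)
    show "(deriv (f n) has_field_derivative integral {\<epsilon> n..1} (KU2 q p0)) (at p0)"
      by (rule has_field_derivative_transform_within_open[OF UU_truncated_derivs(2)[OF B q \<epsilon> p0B] open_ball p0B])
         (use D1 in auto)
  qed
  define b where "b n = - (of_real (\<epsilon> n) powr \<mu> * (G (p0 * q * of_real (\<epsilon> n) ^ 2) * (deriv (yl \<nu>) (RR p0 q (of_real (\<epsilon> n)) / of_real (\<epsilon> n)) * (RR p0 q (of_real (\<epsilon> n)) / of_real (\<epsilon> n)) * sg p0 q (of_real (\<epsilon> n)))))" for n
  have eq: "p0 * deriv (deriv (f n)) p0 + (1 + \<mu>) * deriv (f n) p0 + \<nu> * (\<nu> + 1) * (1 / (1 + p0)\<^sup>2) * f n p0 = b n" for n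
    unfolding D1[OF p0B] D2 f_def b_def by (rule UU_truncated_derivs(3)[OF B q \<epsilon> p0B])
  have lim1: "(\<lambda>n. p0 * deriv (deriv (f n)) p0 + (1 + \<mu>) * deriv (f n) p0 + \<nu> * (\<nu> + 1) * (1 / (1 + p0)\<^sup>2) * f n p0)
     \<longlonglongrightarrow> p0 * deriv (deriv (UU q)) p0 + (1 + \<mu>) * deriv (UU q) p0 + \<nu> * (\<nu> + 1) * (1 / (1 + p0)\<^sup>2) * UU q p0"
    using L[of 0] L[of 1] L[of 2] by (intro tendsto_add tendsto_mult tendsto_const) (simp_all add: numeral_2_eq_2)
  have "b \<longlonglongrightarrow> 0"
  proof -
    \<comment> \<open>The product stays bounded down to \<open>t = 0\<close>. The
      \<open>1 / t\<close> split off from it is paid for by the extra power of \<open>t\<close> in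
      the bound for \<open>deriv (yl \<nu>)\<close>.\<close>
    have "continuous_on {0..1} (\<lambda>t::real. RR p0 q (of_real t) * sg p0 q (of_real t))"
    proof -
      have "regp p0 q (of_real t)" if "t \<in> {0..1}" for t :: real
        using Wdom_regp[OF Adom_Wdom[OF p0 that]] by simp
      then have "\<forall>t\<in>{0..1::real}. 2 * (1 + p0) * (1 + q) * (1 + p0 * q * of_real t ^ 2) \<noteq> 0 \<and> 1 + p0 * of_real t \<noteq> 0 \<and> 1 + p0 * q * of_real t \<noteq> 0
          \<and> 1 + p0 \<noteq> 0 \<and> 1 + p0 * q * of_real t ^ 2 \<noteq> 0"
        by (simp add: regp_def del: distrib_left_numeral)
      then show ?thesis unfolding RR_def sg_def by (intro continuous_intros ballI) auto
    qed
    then have "bounded ((\<lambda>t::real. RR p0 q (of_real t) * sg p0 q (of_real t)) ` {0..1})"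
      by (intro compact_imp_bounded compact_continuous_image) auto
    then obtain M where M: "M > 0" "\<And>t::real. t \<in> {0..1} \<Longrightarrow> norm (RR p0 q (of_real t) * sg p0 q (of_real t)) \<le> M"
      unfolding bounded_pos by blast
    have "norm (b n) \<le> C * C * M * \<epsilon> n powr e" for n
    proof -
      let ?t = "\<epsilon> n"
      have "norm (b n) = ?t powr Re \<mu> * (norm (G (p0 * q * of_real ?t ^ 2)) * (norm (deriv (yl \<nu>) (RR p0 q (of_real ?t) / of_real ?t)) * (norm (RR p0 q (of_real ?t) * sg p0 q (of_real ?t)) / ?t)))"
        using \<epsilon>[of n] by (simp add: b_def norm_mult norm_powr_of_real norm_divide)
      also have "\<dots> \<le> ?t powr Re \<mu> * (C * ((C * ?t powr (1 - \<rho>0)) * (M / ?t)))"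
        using \<epsilon>[of n] C(1) M(1) r(1)
        by (intro mult_left_mono mult_mono C(3) C(4) divide_right_mono M(2)) auto
      also have "\<dots> = C * C * M * (?t powr Re \<mu> * (?t powr (1 - \<rho>0) / ?t))" by simp
      also have "?t powr (1 - \<rho>0) / ?t = ?t powr (-\<rho>0)" using \<epsilon>[of n] by (simp add: powr_diff powr_minus divide_inverse)
      also have "?t powr Re \<mu> * ?t powr (-\<rho>0) = ?t powr e"
        unfolding powr_add[symmetric] e_def by simp
      finally show ?thesis .
    qed
    then show ?thesis by (intro Lim_null_comparison[OF _ \<epsilon>e[of "C * C * M"]]) auto
  qed
  with lim1 show "p0 * deriv (deriv (UU q)) p0 + (1 + \<mu>) * deriv (UU q) p0 + \<nu> * (\<nu> + 1) * (1 / (1 + p0)\<^sup>2) * UU q p0 = 0"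
    unfolding eq by (rule LIMSEQ_unique)
qed

text \<open>\<open>UU q\<close> and \<open>G\<close> solve the same equation, so
  \<open>UU q x * G 0 - G x * UU q 0\<close> is a solution that vanishes at \<open>0\<close>. The
  identity theorem needs a connected domain, hence the component of \<open>Adom q\<close> containing
  the segment.\<close>

lemma UU_product_step:
  assumes q: "1 + q \<noteq> 0" and seg: "closed_segment 0 p \<subseteq> Adom q"
  shows "UU q p * G 0 = G p * UU q 0"
proof -
  define A where "A = connected_component_set (Adom q) 0"
  have z: "0 \<in> Adom q" using seg by auto
  have A: "open A" "connected A" "0 \<in> A" "p \<in> A" "A \<subseteq> Adom q"
  proof -
    show "open A" unfolding A_def by (rule open_connected_component[OF open_Adom[OF q]])
    show "connected A" unfolding A_def by (rule connected_connected_component)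
    show "0 \<in> A" unfolding A_def using z by (simp add: connected_component_refl_eq)
    have "closed_segment 0 p \<subseteq> A" unfolding A_def
      by (rule connected_component_maximal) (use seg in auto)
    then show "p \<in> A" by auto
    show "A \<subseteq> Adom q" unfolding A_def by (rule connected_component_subset)
  qed
  have Ac: "A \<subseteq> cutm" using A Adom_subset_cutm by blast
  have Uh: "UU q holomorphic_on A"
    unfolding holomorphic_on_def using UU_ode(1)[OF _ q] A(5) by (auto intro: field_differentiable_at_within)
  have Gh: "G holomorphic_on A" using holG Ac by (rule holomorphic_on_subset)
  define g where "g x = UU q x * G 0 - G x * UU q 0" for x
  have gh: "g holomorphic_on A" unfolding g_def[abs_def] by (intro holomorphic_intros Uh Gh)
  have hd: "(f has_field_derivative deriv f x) (at x)" "(deriv f has_field_derivative deriv (deriv f) x) (at x)"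
    if "f holomorphic_on A" "x \<in> A" for f x
    using holomorphic_derivI[OF that(1) A(1) that(2)] holomorphic_derivI[OF holomorphic_deriv[OF that(1) A(1)] A(1) that(2)] by auto
  have g1: "deriv g x = deriv (UU q) x * G 0 - deriv G x * UU q 0" if "x \<in> A" for x
    unfolding g_def[abs_def] by (intro DERIV_imp_deriv DERIV_diff DERIV_cmult_right hd Uh Gh that)
  have g2: "deriv (deriv g) x = deriv (deriv (UU q)) x * G 0 - deriv (deriv G) x * UU q 0" if "x \<in> A" for x
  proof (rule DERIV_imp_deriv)
    have "((\<lambda>x. deriv (UU q) x * G 0 - deriv G x * UU q 0) has_field_derivative deriv (deriv (UU q)) x * G 0 - deriv (deriv G) x * UU q 0) (at x)"
      by (intro DERIV_diff DERIV_cmult_right hd Uh Gh that)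
    then show "(deriv g has_field_derivative deriv (deriv (UU q)) x * G 0 - deriv (deriv G) x * UU q 0) (at x)"
      by (rule has_field_derivative_transform_within_open[OF _ A(1) that]) (simp add: g1)
  qed
  have "g p = 0"
  proof (rule regular_singular_unique[OF A(1-3) gh, where h = "\<lambda>x. \<nu> * (\<nu> + 1) * (1 / (1 + x)\<^sup>2)" and c = "1 + \<mu>"])
    have "1 + x \<noteq> 0" if "x \<in> A" for x using that Ac by (force simp: cutm_def)
    then show "(\<lambda>x. \<nu> * (\<nu> + 1) * (1 / (1 + x)\<^sup>2)) holomorphic_on A"
      by (intro holomorphic_intros) auto
    show "x * deriv (deriv g) x + (1 + \<mu>) * deriv g x + \<nu> * (\<nu> + 1) * (1 / (1 + x)\<^sup>2) * g x = 0" if x: "x \<in> A" for x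
    proof -
      have 1: "x * deriv (deriv (UU q)) x + (1 + \<mu>) * deriv (UU q) x + \<nu> * (\<nu> + 1) * (1 / (1 + x)\<^sup>2) * UU q x = 0"
        by (rule UU_ode(2)[OF _ q]) (use x A in auto)
      have 2: "x * deriv (deriv G) x + (1 + \<mu>) * deriv G x + \<nu> * (\<nu> + 1) * (1 / (1 + x)\<^sup>2) * G x = 0"
        by (rule odeG) (use x Ac in auto)
      have "x * deriv (deriv g) x + (1 + \<mu>) * deriv g x + \<nu> * (\<nu> + 1) * (1 / (1 + x)\<^sup>2) * g x
        = (x * deriv (deriv (UU q)) x + (1 + \<mu>) * deriv (UU q) x + \<nu> * (\<nu> + 1) * (1 / (1 + x)\<^sup>2) * UU q x) * G 0
        - (x * deriv (deriv G) x + (1 + \<mu>) * deriv G x + \<nu> * (\<nu> + 1) * (1 / (1 + x)\<^sup>2) * G x) * UU q 0"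
        unfolding g1[OF x] g2[OF x] g_def by (simp add: algebra_simps)
      then show ?thesis unfolding 1 2 by simp
    qed
    show "Re (1 + \<mu>) > 0" using mu by simp
    show "g 0 = 0" by (simp add: g_def)
    show "p \<in> A" by fact
  qed
  then show ?thesis by (simp add: g_def)
qed

lemma RR_commute: "RR p q t = RR q p t"
  by (simp add: RR_def mult_ac del: distrib_left_numeral distrib_right_numeral)

text \<open>The kernel is symmetric in \<open>p\<close> and \<open>q\<close>, so
  \<open>UU q 0 = UU 0 q\<close> and the previous step can be repeated in the other variable. At
  \<open>(0, 0)\<close> the kernel is \<open>G 0\<close> times the Mellin integrand.\<close>

theorem UU_product:
  assumes q: "1 + q \<noteq> 0" and s1: "closed_segment 0 p \<subseteq> Adom q" and s2: "closed_segment 0 q \<subseteq> Adom 0" and G0: "G 0 \<noteq> 0"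
  shows "UU q p * G 0 = G p * G q * mellin \<nu> (\<mu> + 1)"
proof -
  have e: "UU q 0 = UU 0 q"
    unfolding UU_def KU_def by (simp add: RR_commute[of 0 q])
  have "UU 0 q * G 0 = G q * UU 0 0"
    by (rule UU_product_step) (use s2 in auto)
  moreover have "UU 0 0 = G 0 * mellin \<nu> (\<mu> + 1)"
  proof -
    have "KU 0 0 t = G 0 * (of_real t powr (\<mu> + 1 - 2) * pl \<nu> t)" for t
      by (simp add: KU_def RR_def pl_def mult_ac)
    then have "KU 0 0 = (\<lambda>t. G 0 * (of_real t powr (\<mu> + 1 - 2) * pl \<nu> t))" by (rule ext)
    then show ?thesis unfolding UU_def mellin_def by (simp only: integral_mult_right)
  qed
  ultimately have "UU 0 q = G q * mellin \<nu> (\<mu> + 1)" using G0 by simp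
  then show ?thesis using UU_product_step[OF q s1] e by simp
qed

end

section \<open>Arguments along rays\<close>

text \<open>
  \<open>bt \<theta> u\<close>: the nonzero number \<open>u\<close> has an argument between \<open>0\<close> and \<open>\<theta>\<close>.
\<close>

definition bt :: "real \<Rightarrow> complex \<Rightarrow> bool" where
  "bt \<theta> u \<longleftrightarrow> (\<exists>r>0. \<exists>c\<in>{0..1}. u = of_real r * cis (c * \<theta>))"

lemma bt_nonzero: "bt \<theta> u \<Longrightarrow> u \<noteq> 0"
  by (auto simp: bt_def)

lemma bt_inverse: "bt \<theta> u \<Longrightarrow> bt (- \<theta>) (1 / u)"
  unfolding bt_def
proof (elim exE conjE bexE)
  fix r c assume r: "r > 0" "c \<in> {0..1::real}" "u = of_real r * cis (c * \<theta>)"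
  have "1 / u = of_real (1 / r) * inverse (cis (c * \<theta>))" by (simp add: r(3) divide_inverse)
  also have "inverse (cis (c * \<theta>)) = cis (c * - \<theta>)" by simp
  finally show "\<exists>r>0. \<exists>c\<in>{0..1}. 1 / u = of_real r * cis (c * - \<theta>)"
    using r by (intro exI[of _ "1 / r"] conjI bexI[of _ c]) auto
qed

lemma bt_smaller:
  assumes "bt (c * \<theta>) u" "c \<in> {0..1}"
  shows "bt \<theta> u"
proof -
  from assms obtain r d where "r > 0" "d \<in> {0..1}" "u = of_real r * cis (d * (c * \<theta>))" by (auto simp: bt_def)
  then show ?thesis unfolding bt_def using assms(2)
    by (intro exI[of _ r] conjI bexI[of _ "d * c"]) (auto simp: mult_le_one mult.assoc)
qed

text \<open>A point of the cone spanned by \<open>1\<close> and \<open>cis \<theta>\<close> has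
  nonnegative imaginary part, and after rotation by \<open>- \<theta>\<close> a nonpositive one. The
  two signs confine its argument to \<open>[0, \<theta>]\<close>.\<close>

lemma bt_cone_nonneg:
  assumes \<theta>: "0 \<le> \<theta>" "\<theta> < pi" and ab: "0 \<le> a" "0 \<le> b" "a + b > 0"
  shows "bt \<theta> (of_real a + of_real b * cis \<theta>)"
proof (cases "\<theta> = 0")
  case True
  then show ?thesis unfolding bt_def using ab by (intro exI[of _ "a + b"] conjI bexI[of _ 0]) auto
next
  case False
  with \<theta> have s: "sin \<theta> > 0" by (simp add: sin_gt_zero)
  define u where "u = of_real a + of_real b * cis \<theta>"
  have u0: "u \<noteq> 0"
  proof
    assume "u = 0"
    then have "Re u = 0" "Im u = 0" by auto
    then have "b * sin \<theta> = 0" "a + b * cos \<theta> = 0" by (auto simp: u_def)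
    then have "b = 0" "a = 0" using s by auto
    with ab show False by simp
  qed
  have u: "u = of_real (norm u) * cis (Arg u)" using rcis_cmod_Arg[of u] by (simp add: rcis_def)
  have n: "norm u > 0" using u0 by simp
  have "norm u * sin (Arg u) = Im u" by (subst (3) u) simp
  then have "norm u * sin (Arg u) \<ge> 0" using ab s by (simp add: u_def)
  then have s1: "sin (Arg u) \<ge> 0" using n by (simp add: zero_le_mult_iff)
  have "norm u * sin (Arg u - \<theta>) = Im (u * cis (- \<theta>))"
    by (subst (2) u) (simp add: cis_mult mult.assoc)
  also have "u * cis (- \<theta>) = of_real a * cis (- \<theta>) + of_real b"
    by (simp add: u_def algebra_simps cis_mult)
  finally have "norm u * sin (Arg u - \<theta>) \<le> 0" using ab s by simp
  then have s2: "sin (Arg u - \<theta>) \<le> 0" using n by (simp add: mult_le_0_iff)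
  have A0: "Arg u \<ge> 0"
  proof (rule ccontr)
    assume "\<not> 0 \<le> Arg u"
    then have "sin (Arg u) < 0" using Arg_bounded[of u] sin_gt_zero[of "- Arg u"] by auto
    then show False using s1 by simp
  qed
  have "Arg u \<le> \<theta>"
  proof (rule ccontr)
    assume "\<not> Arg u \<le> \<theta>"
    then have "sin (Arg u - \<theta>) > 0" using Arg_bounded[of u] \<theta> False by (intro sin_gt_zero) auto
    then show False using s2 by simp
  qed
  then show ?thesis unfolding bt_def u_def[symmetric]
    using u n A0 False \<theta> by (intro exI[of _ "norm u"] conjI bexI[of _ "Arg u / \<theta>"]) auto
qed

lemma bt_cnj: "bt \<theta> u \<Longrightarrow> bt (- \<theta>) (cnj u)"
  unfolding bt_def
proof (elim exE conjE bexE)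
  fix r c assume "r > 0" "c \<in> {0..1::real}" "u = of_real r * cis (c * \<theta>)"
  then show "\<exists>r>0. \<exists>c\<in>{0..1}. cnj u = of_real r * cis (c * - \<theta>)"
    by (intro exI[of _ r] conjI bexI[of _ c]) (auto simp: cis_cnj)
qed

lemma bt_cone:
  assumes \<theta>: "\<bar>\<theta>\<bar> < pi" and ab: "0 \<le> a" "0 \<le> b" "a + b > 0"
  shows "bt \<theta> (of_real a + of_real b * cis \<theta>)"
proof (cases "\<theta> \<ge> 0")
  case True
  then show ?thesis using bt_cone_nonneg assms by auto
next
  case False
  then have "bt (- \<theta>) (of_real a + of_real b * cis (- \<theta>))" using assms by (intro bt_cone_nonneg) auto
  from bt_cnj[OF this] show ?thesis by (simp add: cis_cnj)
qed

text \<open>\<open>(1 + z t) / z = t + 1 / z\<close> lies in the cone of angle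
  \<open>- \<theta>\<close>, so its inverse has an argument \<open>c * \<theta>\<close>. Then
  \<open>(1 + z) / (1 + z t) = 1 + (1 - t) * z / (1 + z t)\<close> lies in the cone of that smaller
  angle.\<close>

lemma bt_quotient:
  assumes \<theta>: "\<bar>\<theta>\<bar> < pi" and z: "z = of_real \<rho> * cis \<theta>" "\<rho> \<ge> 0" and t: "0 \<le> t" "t \<le> 1"
  shows "bt \<theta> ((1 + z) / (1 + z * of_real t))"
proof (cases "\<rho> = 0")
  case True
  then show ?thesis using z unfolding bt_def by (intro exI[of _ 1] conjI bexI[of _ 0]) auto
next
  case False
  with z have \<rho>: "\<rho> > 0" by simp
  have z0: "z \<noteq> 0" using z \<rho> by simp
  have "bt (- \<theta>) (of_real t + of_real (1 / \<rho>) * cis (- \<theta>))"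
    by (rule bt_cone) (use \<theta> t \<rho> in \<open>auto intro: add_nonneg_pos\<close>)
  moreover have "of_real t + of_real (1 / \<rho>) * cis (- \<theta>) = (1 + z * of_real t) / z"
  proof -
    have "1 / z = of_real (1 / \<rho>) * inverse (cis \<theta>)" by (simp add: z(1) divide_inverse)
    also have "inverse (cis \<theta>) = cis (- \<theta>)" by simp
    finally show ?thesis using z0 by (simp add: add_divide_distrib)
  qed
  ultimately have 1: "bt (- \<theta>) ((1 + z * of_real t) / z)" by simp
  then have "1 + z * of_real t \<noteq> 0" using bt_nonzero by fastforce
  from bt_inverse[OF 1] have "bt \<theta> (z / (1 + z * of_real t))" by simp
  then obtain r c where r: "r > 0" "c \<in> {0..1}" "z / (1 + z * of_real t) = of_real r * cis (c * \<theta>)"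
    by (auto simp: bt_def)
  have "\<bar>c * \<theta>\<bar> < pi"
  proof -
    have "\<bar>c * \<theta>\<bar> \<le> 1 * \<bar>\<theta>\<bar>" unfolding abs_mult using r(2) by (intro mult_right_mono) auto
    then show ?thesis using \<theta> by simp
  qed
  then have "bt (c * \<theta>) (of_real 1 + of_real ((1 - t) * r) * cis (c * \<theta>))"
    by (rule bt_cone) (use r t in \<open>auto intro: add_pos_nonneg\<close>)
  moreover have "of_real 1 + of_real ((1 - t) * r) * cis (c * \<theta>) = 1 + of_real (1 - t) * (z / (1 + z * of_real t))"
    unfolding r(3) by simp
  also have "\<dots> = (1 + z) / (1 + z * of_real t)"
    using \<open>1 + z * of_real t \<noteq> 0\<close> by (simp add: field_simps)
  finally show ?thesis using bt_smaller[OF _ r(2)] by simp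
qed

text \<open>The coefficients \<open>a = c1 - c3\<close> and \<open>b = c2 - c3\<close> range over
  the hexagon \<open>|a|, |b|, |a - b| \<le> 1\<close>. At its vertices \<open>a * x + b * y\<close>
  is plus or minus \<open>x\<close>, \<open>y\<close> or \<open>x + y\<close>; the three cases split
  the hexagon accordingly.\<close>

lemma angle_bound:
  fixes a b x y m :: real
  assumes "\<bar>x\<bar> < m" "\<bar>y\<bar> < m" "\<bar>x + y\<bar> < m" and c: "c1 \<in> {0..1}" "c2 \<in> {0..1}" "c3 \<in> {0..1}"
  shows "\<bar>c1 * x + c2 * y - c3 * (x + y)\<bar> < m"
proof -
  obtain k where k: "k < m" "0 \<le> k" "\<bar>x\<bar> \<le> k" "\<bar>y\<bar> \<le> k" "\<bar>x + y\<bar> \<le> k"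
    using assms by (intro that[of "max \<bar>x\<bar> (max \<bar>y\<bar> \<bar>x + y\<bar>)"]) auto
  define a b where "a = c1 - c3" and "b = c2 - c3"
  have ab: "\<bar>a\<bar> \<le> 1" "\<bar>b\<bar> \<le> 1" "\<bar>a - b\<bar> \<le> 1" using c by (auto simp: a_def b_def abs_if)
  have tri: "\<bar>s * u + t * v\<bar> \<le> (\<bar>s\<bar> + \<bar>t\<bar>) * k" if "\<bar>u\<bar> \<le> k" "\<bar>v\<bar> \<le> k" for s t u v
  proof -
    have "\<bar>s * u + t * v\<bar> \<le> \<bar>s\<bar> * \<bar>u\<bar> + \<bar>t\<bar> * \<bar>v\<bar>" by (metis abs_mult abs_triangle_ineq)
    also have "\<dots> \<le> \<bar>s\<bar> * k + \<bar>t\<bar> * k" using that by (intro add_mono mult_left_mono) auto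
    finally show ?thesis by (simp add: distrib_right)
  qed
  have le: "(\<bar>s\<bar> + \<bar>t\<bar>) * k \<le> k" if "\<bar>s\<bar> + \<bar>t\<bar> \<le> 1" for s t
    using mult_right_mono[OF that k(2)] by simp
  have e1: "a * x + b * y = b * (x + y) + (a - b) * x" and e2: "a * x + b * y = a * (x + y) + (b - a) * y"
    by (simp_all add: algebra_simps)
  consider "\<bar>a\<bar> + \<bar>b\<bar> \<le> 1" | "\<bar>b\<bar> + \<bar>a - b\<bar> \<le> 1" | "\<bar>a\<bar> + \<bar>b - a\<bar> \<le> 1" using ab by linarith
  then have "\<bar>a * x + b * y\<bar> \<le> k"
  proof cases
    case 1 then show ?thesis using tri[of x y a b] le[of a b] k by linarith
  next
    case 2 then show ?thesis using tri[of "x + y" x b "a - b"] le[of b "a - b"] k e1 by linarith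
  next
    case 3 then show ?thesis using tri[of "x + y" y a "b - a"] le[of a "b - a"] k e2 by linarith
  qed
  moreover have "c1 * x + c2 * y - c3 * (x + y) = a * x + b * y" by (simp add: a_def b_def algebra_simps)
  ultimately show ?thesis using k by simp
qed

lemma bt_product_slit:
  assumes "\<bar>x\<bar> < pi" "\<bar>y\<bar> < pi" "\<bar>x + y\<bar> < pi" and u: "bt x u" "bt y v" "bt (- (x + y)) w" and s: "s > 0"
  shows "of_real s * (u * v * w) \<notin> \<real>\<^sub>\<le>\<^sub>0"
proof -
  from u obtain r1 c1 r2 c2 r3 c3 where r: "r1 > 0" "c1 \<in> {0..1}" "u = of_real r1 * cis (c1 * x)"
    "r2 > 0" "c2 \<in> {0..1}" "v = of_real r2 * cis (c2 * y)"
    "r3 > 0" "c3 \<in> {0..1}" "w = of_real r3 * cis (c3 * - (x + y))"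
    unfolding bt_def by blast
  have "of_real s * (u * v * w) = of_real (s * r1 * r2 * r3) * (cis (c1 * x) * cis (c2 * y) * cis (c3 * - (x + y)))"
    by (simp add: r mult_ac)
  also have "cis (c1 * x) * cis (c2 * y) * cis (c3 * - (x + y)) = cis (c1 * x + c2 * y - c3 * (x + y))"
    by (simp add: cis_mult algebra_simps)
  finally have e: "of_real s * (u * v * w) = of_real (s * r1 * r2 * r3) * cis (c1 * x + c2 * y - c3 * (x + y))" .
  show ?thesis
    unfolding e by (rule cis_notin_nonpos_Reals[OF _ angle_bound[OF assms(1-3) r(2,5,8)]]) (use r s in simp)
qed

lemma bt_notin: "bt \<theta> u \<Longrightarrow> \<bar>\<theta>\<bar> < pi \<Longrightarrow> u \<notin> \<real>\<^sub>\<le>\<^sub>0"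
proof -
  assume b: "bt \<theta> u" and t: "\<bar>\<theta>\<bar> < pi"
  from b obtain r c where r: "r > 0" "c \<in> {0..1}" "u = of_real r * cis (c * \<theta>)" by (auto simp: bt_def)
  have "\<bar>c * \<theta>\<bar> \<le> 1 * \<bar>\<theta>\<bar>" unfolding abs_mult using r(2) by (intro mult_right_mono) auto
  then show ?thesis unfolding r(3) using r t by (intro cis_notin_nonpos_Reals) auto
qed

text \<open>\<open>RR\<close> is \<open>(1 + t) / 2\<close> times three quotients of the kind in
  \<open>bt_quotient\<close> or their inverses, at \<open>p\<close>, \<open>q\<close> and
  \<open>p * q * t\<close>. Their angles lie towards \<open>- x\<close>, \<open>- y\<close> and
  \<open>x + y\<close>, which \<open>bt_product_slit\<close> can combine.\<close>

lemma RR_slit_small: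
  assumes p: "p = of_real a * cis x" "a \<ge> 0" and q: "q = of_real b * cis y" "b \<ge> 0"
    and xy: "\<bar>x\<bar> < pi" "\<bar>y\<bar> < pi" "\<bar>x + y\<bar> < pi" and t: "0 \<le> t" "t \<le> 1"
  shows "RR p q (of_real t) \<notin> \<real>\<^sub>\<le>\<^sub>0"
proof -
  have pq: "p * q * of_real t = of_real (a * b * t) * cis (x + y)" by (simp add: p q cis_mult[symmetric] mult_ac)
  have 1: "bt (- x) ((1 + p * of_real t) / (1 + p))"
    using bt_inverse[OF bt_quotient[OF xy(1) p t]] by simp
  have 2: "bt (- y) ((1 + q * of_real t) / (1 + q))"
    using bt_inverse[OF bt_quotient[OF xy(2) q t]] by simp
  have 3: "bt (- (- x + - y)) ((1 + p * q * of_real t) / (1 + p * q * of_real t * of_real t))"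
  proof -
    have e: "- (- x + - y) = x + y" by simp
    have "0 \<le> a * b * t" using p q t by simp
    then show ?thesis unfolding e by (rule bt_quotient[OF xy(3) pq _ t])
  qed
  have "of_real ((1 + t) / 2) * ((1 + p * of_real t) / (1 + p) * ((1 + q * of_real t) / (1 + q)) * ((1 + p * q * of_real t) / (1 + p * q * of_real t * of_real t))) \<notin> \<real>\<^sub>\<le>\<^sub>0"
    by (rule bt_product_slit[OF _ _ _ 1 2 3]) (use xy t in auto)
  moreover have "of_real ((1 + t) / 2) * ((1 + p * of_real t) / (1 + p) * ((1 + q * of_real t) / (1 + q)) * ((1 + p * q * of_real t) / (1 + p * q * of_real t * of_real t))) = RR p q (of_real t)"
    by (simp add: RR_def power2_eq_square mult_ac del: distrib_left_numeral distrib_right_numeral)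
  ultimately show ?thesis by simp
qed

text \<open>Same factorization, but for \<open>t \<ge> 1\<close> the parameter of
  \<open>bt_quotient\<close> is \<open>1 / t\<close> and its base point is multiplied by
  \<open>t\<close>, so all three angles change sign.\<close>

lemma RR_slit_large:
  assumes p: "p = of_real a * cis x" "a \<ge> 0" and q: "q = of_real b * cis y" "b \<ge> 0"
    and xy: "\<bar>x\<bar> < pi" "\<bar>y\<bar> < pi" "\<bar>x + y\<bar> < pi" and t: "t \<ge> 1"
  shows "RR p q (of_real t) \<notin> \<real>\<^sub>\<le>\<^sub>0"
proof -
  have t': "0 \<le> 1 / t" "1 / t \<le> 1" "t > 0" using t by auto
  have pt: "p * of_real t = of_real (a * t) * cis x" "q * of_real t = of_real (b * t) * cis y"
    by (simp_all add: p q)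
  have pq: "p * q * of_real t * of_real t = of_real (a * b * t * t) * cis (x + y)" by (simp add: p q cis_mult[symmetric] mult_ac)
  have 1: "bt x ((1 + p * of_real t) / (1 + p))"
    using bt_quotient[OF xy(1) pt(1) _ t'(1,2)] p t' by simp
  have 2: "bt y ((1 + q * of_real t) / (1 + q))"
    using bt_quotient[OF xy(2) pt(2) _ t'(1,2)] q t' by simp
  have 3: "bt (- (x + y)) ((1 + p * q * of_real t) / (1 + p * q * of_real t * of_real t))"
    using bt_inverse[OF bt_quotient[OF xy(3) pq _ t'(1,2)]] p q t' by simp
  have "of_real ((1 + t) / 2) * ((1 + p * of_real t) / (1 + p) * ((1 + q * of_real t) / (1 + q)) * ((1 + p * q * of_real t) / (1 + p * q * of_real t * of_real t))) \<notin> \<real>\<^sub>\<le>\<^sub>0"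
    by (rule bt_product_slit[OF xy 1 2 3]) (use t in auto)
  moreover have "of_real ((1 + t) / 2) * ((1 + p * of_real t) / (1 + p) * ((1 + q * of_real t) / (1 + q)) * ((1 + p * q * of_real t) / (1 + p * q * of_real t * of_real t))) = RR p q (of_real t)"
    by (simp add: RR_def power2_eq_square mult_ac del: distrib_left_numeral distrib_right_numeral)
  ultimately show ?thesis by simp
qed

lemma one_plus_slit:
  assumes "z = of_real a * cis x" "a \<ge> 0" "\<bar>x\<bar> < pi"
  shows "1 + z \<notin> \<real>\<^sub>\<le>\<^sub>0"
  using bt_notin[OF bt_cone[of x 1 a]] assms by simp

lemma segment_subset_Adom:
  assumes p: "p = of_real a * cis x" "a \<ge> 0" and q: "q = of_real b * cis y" "b \<ge> 0"
    and xy: "\<bar>x\<bar> < pi" "\<bar>y\<bar> < pi" "\<bar>x + y\<bar> < pi"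
  shows "closed_segment 0 p \<subseteq> Adom q"
proof
  fix p' assume "p' \<in> closed_segment 0 p"
  then obtain s where s: "0 \<le> s" "s \<le> 1" "p' = of_real s * p"
    by (auto simp: in_segment scaleR_conv_of_real)
  have p': "p' = of_real (s * a) * cis x" "s * a \<ge> 0" using s p by auto
  have "(p', t) \<in> Wdom q" if t: "t \<in> {0..1}" for t
  proof -
    have e: "p' * q * (of_real t)\<^sup>2 = of_real (s * a * b * t\<^sup>2) * cis (x + y)"
      by (simp add: p' q cis_mult[symmetric] mult_ac)
    show ?thesis
      unfolding Wdom_def using one_plus_slit[OF p' xy(1)] one_plus_slit[OF e _ xy(3)] RR_slit_small[OF p' q xy, of t] t s p q
      by simp
  qed
  then show "p' \<in> Adom q" by (auto simp: Adom_def)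
qed

section \<open>The kernel in logarithmic coordinates\<close>

locale log_pair =
  fixes P Q :: complex
  assumes ImP: "\<bar>Im P\<bar> < pi" and ImQ: "\<bar>Im Q\<bar> < pi" and ImPQ: "\<bar>Im P + Im Q\<bar> < pi"
begin

text \<open>
  In the coordinate \<open>L\<close>, with \<open>p3 = exp L\<close>, the Legendre function is taken at \<open>2 * ZL L - 1\<close>. On the strip,
  \<open>wf\<close> is \<open>ZL\<close> without its positive factor \<open>1 / s\<close>; unlike \<open>ZL\<close> it extends to \<open>s = 0\<close>.
\<close>

definition p where "p = exp P"
definition q where "q = exp Q"
definition \<Theta> where "\<Theta> = Im P + Im Q"
definition \<tau> where "\<tau> L = exp ((L - P - Q) / 2)"
definition ZL where "ZL L = RR p q (\<tau> L) / \<tau> L"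
definition strip where "strip = {L. \<bar>Im L\<bar> \<le> \<bar>\<Theta>\<bar>}"
definition wf where "wf s c = RR p q (of_real s * cis (- (c * \<Theta>))) * cis (c * \<Theta>)" for s c :: real
definition sL where "sL L = exp ((Re L - Re P - Re Q) / 2)"

lemma p_polar: "p = of_real (exp (Re P)) * cis (Im P)" and q_polar: "q = of_real (exp (Re Q)) * cis (Im Q)"
  by (simp_all add: p_def q_def exp_eq_polar)

lemma Theta: "\<bar>\<Theta>\<bar> < pi"
  using ImPQ by (simp add: \<Theta>_def)

lemma p1: "1 + p \<notin> \<real>\<^sub>\<le>\<^sub>0" and q1: "1 + q \<notin> \<real>\<^sub>\<le>\<^sub>0"
  by (rule one_plus_slit[OF p_polar _ ImP] one_plus_slit[OF q_polar _ ImQ]; simp)+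

lemma p1': "1 + p \<noteq> 0" and q1': "1 + q \<noteq> 0"
  using p1 q1 by (metis nonpos_Reals_zero_I)+

lemma pq0: "p \<noteq> 0" "q \<noteq> 0" "\<tau> L \<noteq> 0"
  by (simp_all add: p_def q_def \<tau>_def)

lemma pq_tau: "p * q * (\<tau> L)\<^sup>2 = exp L"
  by (simp add: p_def q_def \<tau>_def power2_eq_square field_simps flip: exp_add)

lemma one_plus_exp: "\<bar>Im L\<bar> < pi \<Longrightarrow> 1 + exp L \<notin> \<real>\<^sub>\<le>\<^sub>0"
  by (rule one_plus_slit[of _ "exp (Re L)" "Im L"]) (simp_all add: exp_eq_polar)

lemma one_plus_exp': "\<bar>Im L\<bar> < pi \<Longrightarrow> 1 + exp L \<noteq> 0"
  using one_plus_exp by (metis nonpos_Reals_zero_I)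

text \<open>Negating \<open>L\<close> negates \<open>x3\<close>, and \<open>B\<close> contains only
  the square of \<open>x3\<close>. In the variable \<open>t\<close> this is the substitution of
  \<open>1 / (p * q * t)\<close> for \<open>t\<close>.\<close>

lemma ZL_even:
  assumes "\<bar>Im L\<bar> < pi"
  shows "ZL (- L) = ZL L"
proof -
  define t where "t = \<tau> L"
  have t: "t \<noteq> 0" using pq0 by (simp add: t_def)
  have g: "1 + p * q * t\<^sup>2 \<noteq> 0" using one_plus_exp'[OF assms] pq_tau[of L] by (simp add: t_def)
  have "\<tau> (- L) * (p * q * t) = 1"
    by (simp add: \<tau>_def t_def p_def q_def field_simps flip: exp_add)
  then have t': "\<tau> (- L) = 1 / (p * q * t)" using pq0 t by (simp add: field_simps)
  have n: "(1 + 1 / (p * q * t)) = (1 + p * q * t) / (p * q * t)" "1 + p * (1 / (p * q * t)) = (1 + q * t) / (q * t)"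
    "1 + q * (1 / (p * q * t)) = (1 + p * t) / (p * t)" "1 + p * q * (1 / (p * q * t)) = (1 + t) / t"
    "1 + p * q * (1 / (p * q * t))\<^sup>2 = (1 + p * q * t\<^sup>2) / (p * q * t\<^sup>2)"
    using pq0 t by (simp_all add: divide_simps power2_eq_square)
  define A B C D E where "A = 1 + t" and "B = 1 + p * t" and "C = 1 + q * t" and "D = 1 + p * q * t" and "E = 1 + p * q * t\<^sup>2"
  have "ZL (- L) = (D / (p * q * t)) * (C / (q * t)) * (B / (p * t)) * (A / t) / (2 * (1 + p) * (1 + q) * (E / (p * q * t\<^sup>2))) / (1 / (p * q * t))"
    unfolding ZL_def t' RR_def n A_def B_def C_def D_def E_def by simp
  also have "\<dots> = A * B * C * D / (2 * (1 + p) * (1 + q) * E) / t"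
    using pq0 t g p1' q1' unfolding E_def[symmetric]
    by (simp add: divide_simps power2_eq_square del: distrib_left_numeral distrib_right_numeral)
  also have "\<dots> = ZL L"
    by (simp add: ZL_def RR_def t_def[symmetric] A_def B_def C_def D_def E_def)
  finally show ?thesis .
qed

lemma sL_pos: "sL L > 0"
  by (simp add: sL_def)

text \<open>The parameter \<open>c\<close> runs across the strip: \<open>c = 0\<close> is the line
  \<open>Im L = \<Theta>\<close>, which carries the ray, and \<open>c = 1\<close> is the opposite
  line.\<close>

lemma \<tau>_polar:
  assumes "Im L = (1 - 2 * c) * \<Theta>"
  shows "\<tau> L = of_real (sL L) * cis (- (c * \<Theta>))"
proof -
  have "Im ((L - P - Q) / 2) = - (c * \<Theta>)" using assms by (simp add: \<Theta>_def field_simps)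
  moreover have "Re ((L - P - Q) / 2) = (Re L - Re P - Re Q) / 2" by simp
  ultimately show ?thesis unfolding \<tau>_def sL_def exp_eq_polar by (simp only: of_real_exp[symmetric])
qed

lemma ZL_wf:
  assumes "Im L = (1 - 2 * c) * \<Theta>"
  shows "ZL L = wf (sL L) c / of_real (sL L)"
proof -
  have "1 / cis (- (c * \<Theta>)) = cis (c * \<Theta>)" using cis_inverse[of "- (c * \<Theta>)"] by (simp add: divide_inverse)
  then show ?thesis
    unfolding ZL_def wf_def \<tau>_polar[OF assms] using sL_pos[of L] by (simp add: divide_divide_eq_left[symmetric] divide_inverse)
qed

lemma strip_angle:
  assumes "L \<in> strip"
  obtains c where "c \<in> {0..1}" "Im L = (1 - 2 * c) * \<Theta>"
proof (cases "\<Theta> = 0")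
  case True
  then show ?thesis using assms that[of 0] by (simp add: strip_def)
next
  case False
  define c where "c = (1 - Im L / \<Theta>) / 2"
  have "\<bar>Im L / \<Theta>\<bar> \<le> 1" using assms False by (simp add: strip_def abs_divide)
  then have "Im L / \<Theta> \<le> 1" "- 1 \<le> Im L / \<Theta>" by linarith+
  then have "c \<in> {0..1}" by (auto simp: c_def)
  moreover have "Im L = (1 - 2 * c) * \<Theta>" using False by (simp add: c_def field_simps)
  ultimately show ?thesis using that by blast
qed

lemma strip_pi: "L \<in> strip \<Longrightarrow> \<bar>Im L\<bar> < pi"
  using Theta by (simp add: strip_def)

lemma wf_regular:
  assumes "s \<ge> 0" "c \<in> {0..1}"
  shows "1 + p * q * (of_real s * cis (- (c * \<Theta>)))\<^sup>2 \<noteq> 0"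
proof -
  have "p * q * (of_real s * cis (- (c * \<Theta>)))\<^sup>2 = of_real (exp (Re P) * exp (Re Q) * s\<^sup>2) * (cis (Im P) * cis (Im Q) * cis (- (c * \<Theta>)) * cis (- (c * \<Theta>)))"
    by (simp add: p_polar q_polar power2_eq_square mult_ac)
  also have "cis (Im P) * cis (Im Q) * cis (- (c * \<Theta>)) * cis (- (c * \<Theta>)) = cis ((1 - 2 * c) * \<Theta>)"
    by (simp add: cis_mult \<Theta>_def algebra_simps)
  finally have e: "p * q * (of_real s * cis (- (c * \<Theta>)))\<^sup>2 = of_real (exp (Re P) * exp (Re Q) * s\<^sup>2) * cis ((1 - 2 * c) * \<Theta>)" .
  have "\<bar>(1 - 2 * c) * \<Theta>\<bar> \<le> 1 * \<bar>\<Theta>\<bar>" unfolding abs_mult using assms(2) by (intro mult_right_mono) auto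
  then have "1 + p * q * (of_real s * cis (- (c * \<Theta>)))\<^sup>2 \<notin> \<real>\<^sub>\<le>\<^sub>0"
    by (intro one_plus_slit[OF e]) (use Theta in auto)
  then show ?thesis by (metis nonpos_Reals_zero_I)
qed

lemma continuous_on_wf: "continuous_on ({0..} \<times> {0..1}) (\<lambda>x. wf (fst x) (snd x))"
  unfolding wf_def RR_def
  by (intro continuous_intros ballI) (use wf_regular p1' q1' in \<open>auto simp del: distrib_left_numeral distrib_right_numeral\<close>)

lemma wf_0:
  assumes "c \<in> {0..1}"
  shows "wf 0 c \<notin> \<real>\<^sub>\<le>\<^sub>0"
proof -
  have 1: "bt (- Im P) (1 / (1 + p))" using bt_inverse[OF bt_quotient[OF ImP p_polar, of 0]] by simp
  have 2: "bt (- Im Q) (1 / (1 + q))" using bt_inverse[OF bt_quotient[OF ImQ q_polar, of 0]] by simp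
  have 3: "bt (- (- Im P + - Im Q)) (cis (c * \<Theta>))"
    unfolding bt_def using assms by (intro exI[of _ 1] conjI bexI[of _ c]) (auto simp: \<Theta>_def algebra_simps)
  have "of_real (1 / 2) * (1 / (1 + p) * (1 / (1 + q)) * cis (c * \<Theta>)) \<notin> \<real>\<^sub>\<le>\<^sub>0"
    by (rule bt_product_slit[OF _ _ _ 1 2 3]) (use ImP ImQ ImPQ in auto)
  moreover have "wf 0 c = of_real (1 / 2) * (1 / (1 + p) * (1 / (1 + q)) * cis (c * \<Theta>))"
    by (simp add: wf_def RR_def mult_ac del: distrib_left_numeral distrib_right_numeral)
  ultimately show ?thesis by simp
qed

text \<open>The preimage of the cut in the unit square is compact and, by \<open>wf_0\<close>,
  misses the edge \<open>s = 0\<close>; so its smallest \<open>s\<close>, if there is one, is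
  positive.\<close>

lemma wf_near_0: "\<exists>s0>0. \<forall>s c. 0 \<le> s \<and> s < s0 \<and> c \<in> {0..1} \<longrightarrow> wf s c \<notin> \<real>\<^sub>\<le>\<^sub>0"
proof -
  define X where "X = {0..1::real} \<times> {0..1::real}"
  define Bad where "Bad = X \<inter> (\<lambda>x. wf (fst x) (snd x)) -` \<real>\<^sub>\<le>\<^sub>0"
  have "closed Bad" unfolding Bad_def
    by (rule continuous_closed_preimage[OF continuous_on_subset[OF continuous_on_wf]]) (auto simp: X_def closed_Times)
  moreover have "bounded Bad" by (rule bounded_subset[of X]) (auto simp: Bad_def X_def intro!: bounded_Times)
  ultimately have cB: "compact Bad" by (simp add: compact_eq_bounded_closed)
  show ?thesis
  proof (cases "Bad = {}")
    case True
    have "wf s c \<notin> \<real>\<^sub>\<le>\<^sub>0" if "0 \<le> s \<and> s < 1 \<and> c \<in> {0..1}" for s c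
    proof
      assume "wf s c \<in> \<real>\<^sub>\<le>\<^sub>0"
      then have "(s, c) \<in> Bad" using that by (auto simp: Bad_def X_def)
      with True show False by simp
    qed
    then show ?thesis by (intro exI[of _ 1]) auto
  next
    case False
    obtain x where x: "x \<in> Bad" "\<And>y. y \<in> Bad \<Longrightarrow> fst x \<le> fst y"
      using continuous_attains_inf[OF cB False continuous_on_fst[OF continuous_on_id]] by auto
    have "fst x > 0"
    proof (rule ccontr)
      assume "\<not> fst x > 0"
      then have "fst x = 0" "snd x \<in> {0..1}" "wf (fst x) (snd x) \<in> \<real>\<^sub>\<le>\<^sub>0" using x(1) by (auto simp: Bad_def X_def)
      then show False using wf_0 by simp
    qed
    moreover have "wf s c \<notin> \<real>\<^sub>\<le>\<^sub>0" if "0 \<le> s \<and> s < min (fst x) 1 \<and> c \<in> {0..1}" for s c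
    proof
      assume "wf s c \<in> \<real>\<^sub>\<le>\<^sub>0"
      then have "(s, c) \<in> Bad" using that by (auto simp: Bad_def X_def)
      then show False using x(2)[of "(s, c)"] that by simp
    qed
    ultimately show ?thesis by (intro exI[of _ "min (fst x) 1"]) auto
  qed
qed

text \<open>On the line \<open>Im L = \<Theta>\<close> the variable \<open>\<tau> L\<close> is a
  positive real, so the two lemmas on \<open>RR\<close> apply. The other line follows by
  evenness.\<close>

lemma ZL_boundary:
  assumes "\<bar>Im L\<bar> = \<bar>\<Theta>\<bar>"
  shows "ZL L \<notin> \<real>\<^sub>\<le>\<^sub>0"
proof -
  have main: "ZL L \<notin> \<real>\<^sub>\<le>\<^sub>0" if L: "Im L = \<Theta>" for L
  proof -
    have t: "\<tau> L = of_real (sL L)" using \<tau>_polar[of L 0] L by simp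
    have "RR p q (of_real (sL L)) \<notin> \<real>\<^sub>\<le>\<^sub>0"
      using RR_slit_small[OF p_polar _ q_polar _ ImP ImQ ImPQ, of "sL L"] RR_slit_large[OF p_polar _ q_polar _ ImP ImQ ImPQ, of "sL L"]
        sL_pos[of L] by (cases "sL L \<le> 1") auto
    then show ?thesis unfolding ZL_def t using sL_pos by (rule slit_divide)
  qed
  from assms have "Im L = \<Theta> \<or> Im (- L) = \<Theta>" by auto
  then show ?thesis
  proof
    assume "Im (- L) = \<Theta>"
    from main[OF this] show ?thesis using ZL_even[of L] assms Theta by simp
  qed (rule main)
qed

lemma ZL_holomorphic: "ZL holomorphic_on {L. \<bar>Im L\<bar> < pi}"
proof -
  have "1 + p * q * (\<tau> L)\<^sup>2 \<noteq> 0" if "\<bar>Im L\<bar> < pi" for L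
    unfolding pq_tau by (rule one_plus_exp'[OF that])
  then show ?thesis
    unfolding ZL_def[abs_def] RR_def
    using pq0(3) p1' q1'
    by (intro holomorphic_intros)
       (auto simp: \<tau>_def[abs_def] intro!: holomorphic_intros simp del: distrib_left_numeral distrib_right_numeral)
qed

text \<open>
  On the boundary of the strip and near both of its ends \<open>ZL\<close> avoids the cut. If it met the cut inside, the real part
  of \<open>ZL\<close> would attain a minimum on the compact preimage of the cut, which contradicts the open mapping theorem.
\<close>

lemma ZL_strip:
  assumes "L \<in> strip"
  shows "ZL L \<notin> \<real>\<^sub>\<le>\<^sub>0"
proof
  assume "ZL L \<in> \<real>\<^sub>\<le>\<^sub>0"
  define A where "A = strip \<inter> ZL -` \<real>\<^sub>\<le>\<^sub>0"
  have LA: "L \<in> A" using assms \<open>ZL L \<in> \<real>\<^sub>\<le>\<^sub>0\<close> by (simp add: A_def)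
  obtain s0 where s0: "s0 > 0" "\<And>s c. 0 \<le> s \<Longrightarrow> s < s0 \<Longrightarrow> c \<in> {0..1} \<Longrightarrow> wf s c \<notin> \<real>\<^sub>\<le>\<^sub>0"
    using wf_near_0 by blast
  have small: "ZL M \<notin> \<real>\<^sub>\<le>\<^sub>0" if M: "M \<in> strip" "sL M < s0" for M
  proof -
    obtain c where c: "c \<in> {0..1}" "Im M = (1 - 2 * c) * \<Theta>" using strip_angle[OF M(1)] by blast
    show ?thesis unfolding ZL_wf[OF c(2)]
      by (rule slit_divide[OF s0(2)]) (use c M sL_pos[of M] in auto)
  qed
  \<comment> \<open>Evenness carries the exclusion near the left end over to the right end; together
    they bound the real part of \<open>M\<close> on both sides.\<close>
  have sL_ge: "sL M \<ge> s0" "sL (- M) \<ge> s0" if "M \<in> A" for M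
  proof -
    show "sL M \<ge> s0" using small[of M] that by (auto simp: A_def not_less[symmetric])
    have "ZL (- M) \<in> \<real>\<^sub>\<le>\<^sub>0" using that ZL_even[OF strip_pi, of M] by (simp add: A_def)
    moreover have "- M \<in> strip" using that by (simp add: A_def strip_def)
    ultimately show "sL (- M) \<ge> s0" using small[of "- M"] by (auto simp: not_less[symmetric])
  qed
  have closed_strip: "closed strip"
    unfolding strip_def by (intro closed_Collect_le continuous_intros)
  have cont: "continuous_on strip ZL"
    by (rule holomorphic_on_imp_continuous_on[OF holomorphic_on_subset[OF ZL_holomorphic]]) (use strip_pi in auto)
  have "closed A" unfolding A_def by (rule continuous_closed_preimage[OF cont closed_strip]) simp
  moreover have "bounded A"
  proof (rule boundedI)
    fix M assume M: "M \<in> A"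
    define R where "R = Re P + Re Q"
    have "ln s0 \<le> (Re M - R) / 2" "ln s0 \<le> (- Re M - R) / 2"
    proof -
      have "ln s0 \<le> ln (sL M)" "ln s0 \<le> ln (sL (- M))"
        using sL_ge[OF M] s0(1) sL_pos by (simp_all add: ln_le_cancel_iff)
      then show "ln s0 \<le> (Re M - R) / 2" "ln s0 \<le> (- Re M - R) / 2"
        by (simp_all add: sL_def R_def)
    qed
    then have "2 * ln s0 + R \<le> Re M" "Re M \<le> - (2 * ln s0) - R" by (simp_all add: field_simps)
    then have "\<bar>Re M\<bar> \<le> \<bar>2 * ln s0\<bar> + \<bar>R\<bar>"
      using abs_ge_minus_self[of "2 * ln s0"] abs_ge_minus_self[of R] by (intro abs_leI) linarith+
    moreover have "\<bar>Im M\<bar> \<le> pi" using M strip_pi[of M] by (simp add: A_def)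
    ultimately show "norm M \<le> \<bar>2 * ln s0\<bar> + \<bar>R\<bar> + pi" using cmod_le[of M] by linarith
  qed
  ultimately have cA: "compact A" by (simp add: compact_eq_bounded_closed)
  have "continuous_on A (\<lambda>M. Re (ZL M))"
    by (intro continuous_intros continuous_on_subset[OF cont]) (auto simp: A_def)
  then obtain L1 where L1: "L1 \<in> A" "\<And>M. M \<in> A \<Longrightarrow> Re (ZL L1) \<le> Re (ZL M)"
    using continuous_attains_inf[OF cA] LA by blast
  define S where "S = {L. \<bar>Im L\<bar> < \<bar>\<Theta>\<bar>}"
  have L1S: "L1 \<in> S"
    using L1(1) ZL_boundary[of L1] by (auto simp: A_def S_def strip_def less_le)
  have Seq: "S = {L. Im L < \<bar>\<Theta>\<bar>} \<inter> {L. - \<bar>\<Theta>\<bar> < Im L}" by (auto simp: S_def abs_less_iff)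
  have S: "open S" "connected S"
    unfolding Seq
    by (auto intro!: open_Int open_halfspace_Im_lt open_halfspace_Im_gt convex_connected convex_Int convex_halfspace_Im_lt convex_halfspace_Im_gt)
  have Sstrip: "S \<subseteq> strip" by (auto simp: S_def strip_def)
  have hS: "ZL holomorphic_on S"
    by (rule holomorphic_on_subset[OF ZL_holomorphic]) (use Sstrip strip_pi in auto)
  have nc: "\<not> ZL constant_on S"
  proof
    assume c: "ZL constant_on S"
    \<comment> \<open>A real point near the left end, with \<open>sL M = s0 / 2\<close>. There
      \<open>ZL\<close> is off the cut while \<open>ZL L1\<close> lies on it, so \<open>ZL\<close>
      is not constant.\<close>
    define M where "M = complex_of_real (Re P + Re Q + 2 * ln (s0 / 2))"
    have MS: "M \<in> S" using L1S by (simp add: S_def M_def)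
    have "sL M = s0 / 2" using s0(1) by (simp add: sL_def M_def)
    then have "ZL M \<notin> \<real>\<^sub>\<le>\<^sub>0" using small[of M] MS Sstrip s0(1) by auto
    moreover have "ZL M = ZL L1" using c MS L1S by (auto simp: constant_on_def)
    ultimately show False using L1(1) by (simp add: A_def)
  qed
  have "open (ZL ` S)"
    by (rule open_mapping_thm[OF hS S S(1) order_refl nc])
  then obtain e where e: "e > 0" "ball (ZL L1) e \<subseteq> ZL ` S"
    using L1S by (meson imageI openE)
  have "ZL L1 - of_real (e / 2) \<in> ball (ZL L1) e" using e(1) by (simp add: dist_norm)
  then have "ZL L1 - of_real (e / 2) \<in> ZL ` S" using e(2) by (rule subsetD[rotated])
  then obtain L2 where L2: "L2 \<in> S" "ZL L2 = ZL L1 - of_real (e / 2)" by (metis imageE)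
  have "ZL L2 \<in> \<real>\<^sub>\<le>\<^sub>0" using L1(1) e(1) unfolding L2(2) by (auto simp: A_def complex_nonpos_Reals_iff)
  then have "L2 \<in> A" using L2(1) Sstrip by (auto simp: A_def)
  then show False using L1(2)[of L2] e(1) by (simp add: L2(2))
qed

lemma wf_slit:
  assumes "s \<ge> 0" "c \<in> {0..1}"
  shows "wf s c \<notin> \<real>\<^sub>\<le>\<^sub>0"
proof (cases "s = 0")
  case True then show ?thesis using wf_0[OF assms(2)] by simp
next
  case False
  with assms have s: "s > 0" by simp
  define L where "L = Complex (Re P + Re Q + 2 * ln s) ((1 - 2 * c) * \<Theta>)"
  have sL: "sL L = s" using s by (simp add: sL_def L_def)
  have "\<bar>(1 - 2 * c) * \<Theta>\<bar> \<le> 1 * \<bar>\<Theta>\<bar>" unfolding abs_mult using assms(2) by (intro mult_right_mono) auto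
  then have "L \<in> strip" by (simp add: strip_def L_def)
  then have "ZL L \<notin> \<real>\<^sub>\<le>\<^sub>0" by (rule ZL_strip)
  moreover have "ZL L = wf s c / of_real s" using ZL_wf[of L c] sL by (simp add: L_def)
  ultimately have "wf s c / of_real s \<notin> \<real>\<^sub>\<le>\<^sub>0" by simp
  then show ?thesis using s by (auto simp: complex_nonpos_Reals_iff divide_le_0_iff)
qed

end

section \<open>The segment and the ray\<close>

locale path_pair = log_pair P Q for P Q :: complex +
  fixes \<mu> \<nu> :: complex and G :: "complex \<Rightarrow> complex"
  assumes G_hol: "G holomorphic_on cutm"
begin

text \<open>
  \<open>Lp\<close> is the segment of integration in the coordinate \<open>L\<close>, parametrized by \<open>[0, 1)\<close>, and \<open>JJ\<close> the integrand on it
  up to a constant factor.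
\<close>

definition E where "E = exp (P + Q)"
definition FL where "FL L = exp (\<mu> * L / 2) * (G (exp L) * yl \<nu> (ZL L))"
definition Lp where "Lp s = of_real (ln (1 - s)) + P + Q - Ln (1 + of_real s * E)" for s :: real
definition JJ where "JJ s = FL (Lp s) * ((1 + E) / ((1 - of_real s) * (1 + of_real s * E))) / 2" for s :: real

lemma E_polar: "E = of_real (exp (Re P + Re Q)) * cis \<Theta>"
  unfolding E_def \<Theta>_def by (subst exp_eq_polar) simp

lemma one_plus_sE_bt:
  assumes "s \<ge> 0"
  obtains r c where "r > 0" "c \<in> {0..1}" "1 + of_real s * E = of_real r * cis (c * \<Theta>)" "Ln (1 + of_real s * E) = Complex (ln r) (c * \<Theta>)"
proof -
  have "bt \<Theta> (of_real 1 + of_real (s * exp (Re P + Re Q)) * cis \<Theta>)"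
    by (rule bt_cone[OF Theta]) (use assms in \<open>auto intro: add_pos_nonneg\<close>)
  then have "bt \<Theta> (1 + of_real s * E)" by (simp add: E_polar mult.assoc)
  then obtain r c where r: "r > 0" "c \<in> {0..1}" "1 + of_real s * E = of_real r * cis (c * \<Theta>)" by (auto simp: bt_def)
  have a: "\<bar>c * \<Theta>\<bar> < pi"
  proof -
    have "\<bar>c * \<Theta>\<bar> \<le> 1 * \<bar>\<Theta>\<bar>" unfolding abs_mult using r(2) by (intro mult_right_mono) auto
    then show ?thesis using Theta by simp
  qed
  have "of_real r * cis (c * \<Theta>) = exp (Complex (ln r) (c * \<Theta>))"
    using r(1) by (simp add: exp_eq_polar flip: of_real_exp)
  moreover have "Ln (exp (Complex (ln r) (c * \<Theta>))) = Complex (ln r) (c * \<Theta>)"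
    by (rule Ln_exp) (use a in auto)
  ultimately show ?thesis using that r by simp
qed

lemma one_plus_sE: "s \<ge> 0 \<Longrightarrow> 1 + of_real s * E \<notin> \<real>\<^sub>\<le>\<^sub>0"
  by (rule one_plus_slit[of _ "s * exp (Re P + Re Q)" \<Theta>]) (use Theta in \<open>auto simp: E_polar\<close>)

lemma one_plus_sE': "s \<ge> 0 \<Longrightarrow> 1 + of_real s * E \<noteq> 0"
  using one_plus_sE by (metis nonpos_Reals_zero_I)

lemma Lp_strip:
  assumes "0 \<le> s" "s < 1"
  shows "Lp s \<in> strip"
proof -
  obtain r c where r: "c \<in> {0..1}" "Ln (1 + of_real s * E) = Complex (ln r) (c * \<Theta>)"
    using one_plus_sE_bt[OF assms(1)] by metis
  have "Im (Lp s) = (1 - c) * \<Theta>" unfolding Lp_def r(2) by (simp add: \<Theta>_def algebra_simps)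
  then have "\<bar>Im (Lp s)\<bar> \<le> 1 * \<bar>\<Theta>\<bar>" using r(1) by (simp only: abs_mult) (intro mult_right_mono, auto)
  then show ?thesis by (simp add: strip_def)
qed

text \<open>The image of the segment under \<open>x\<close> to \<open>(1 - x) / (1 + x)\<close>: the
  point \<open>w + s * (1 - w)\<close> with \<open>w = (1 - E) / (1 + E)\<close> goes to the
  right-hand side. The logarithm in \<open>Lp\<close> selects its continuous branch starting at
  \<open>P + Q\<close>.\<close>

lemma exp_Lp:
  assumes "0 \<le> s" "s < 1"
  shows "exp (Lp s) = (1 - of_real s) * E / (1 + of_real s * E)"
proof -
  have "exp (complex_of_real (ln (1 - s))) = 1 - of_real s" using assms by (simp flip: of_real_exp)
  then show ?thesis using one_plus_sE'[OF assms(1)]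
    unfolding Lp_def exp_diff by (simp add: exp_add E_def mult.assoc)
qed

lemma Lp_deriv:
  assumes "0 \<le> s" "s < 1"
  shows "(Lp has_vector_derivative - ((1 + E) / ((1 - of_real s) * (1 + of_real s * E)))) (at s)"
proof -
  have s1: "1 - complex_of_real s \<noteq> 0" using assms by (metis of_real_1 of_real_diff of_real_eq_0_iff diff_gt_0_iff_gt less_irrefl)
  have 1: "((\<lambda>s. complex_of_real (ln (1 - s))) has_vector_derivative of_real (- 1 / (1 - s))) (at s)"
  proof -
    have "((\<lambda>s. ln (1 - s)) has_real_derivative - 1 / (1 - s)) (at s)"
      using assms by (auto intro!: derivative_eq_intros simp: field_simps)
    then show ?thesis by (rule has_vector_derivative_of_real)
  qed
  have 2: "((\<lambda>s. Ln (1 + of_real s * E)) has_vector_derivative E / (1 + of_real s * E)) (at s)"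
  proof -
    have "((\<lambda>z. Ln (1 + z * E)) has_field_derivative E / (1 + of_real s * E)) (at (of_real s))"
      using one_plus_sE[OF assms(1)] one_plus_sE'[OF assms(1)] by (auto intro!: derivative_eq_intros simp: field_simps)
    from has_vector_derivative_real_field[OF this] show ?thesis by simp
  qed
  have "(Lp has_vector_derivative of_real (- 1 / (1 - s)) + 0 + 0 - E / (1 + of_real s * E)) (at s)"
    unfolding Lp_def[abs_def] by (intro has_vector_derivative_diff has_vector_derivative_add has_vector_derivative_const 1 2)
  moreover have "of_real (- 1 / (1 - s)) + 0 + 0 - E / (1 + of_real s * E) = - ((1 + E) / ((1 - of_real s) * (1 + of_real s * E)))"
    using s1 one_plus_sE'[OF assms(1)] by (simp add: divide_simps) (simp add: algebra_simps)
  ultimately show ?thesis by simp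
qed

lemma closed_strip: "closed strip"
  unfolding strip_def by (intro closed_Collect_le continuous_intros)

lemma convex_strip: "convex strip"
proof -
  have "strip = {L. Im L \<le> \<bar>\<Theta>\<bar>} \<inter> {L. Im L \<ge> - \<bar>\<Theta>\<bar>}" by (auto simp: strip_def abs_le_iff)
  then show ?thesis by (auto intro!: convex_Int convex_halfspace_Im_le convex_halfspace_Im_ge)
qed

definition dom where "dom = {L. \<bar>Im L\<bar> < pi} \<inter> ZL -` (- \<real>\<^sub>\<le>\<^sub>0)"

lemma open_dom: "open dom"
proof -
  have "{L. \<bar>Im L\<bar> < pi} = {L. Im L < pi} \<inter> {L. - pi < Im L}" by (auto simp: abs_less_iff)
  then have o: "open {L. \<bar>Im L\<bar> < pi}" by (simp only: open_Int open_halfspace_Im_lt open_halfspace_Im_gt)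
  show ?thesis unfolding dom_def
    by (rule continuous_open_preimage[OF holomorphic_on_imp_continuous_on[OF ZL_holomorphic] o open_slit])
qed

lemma strip_dom: "strip \<subseteq> dom"
  using ZL_strip strip_pi by (auto simp: dom_def)

lemma FL_holomorphic: "FL holomorphic_on dom"
proof -
  have z: "ZL holomorphic_on dom" by (rule holomorphic_on_subset[OF ZL_holomorphic]) (auto simp: dom_def)
  have 1: "(yl \<nu> \<circ> ZL) holomorphic_on dom"
    by (rule holomorphic_on_compose_gen[OF z yl_holomorphic]) (auto simp: dom_def)
  have 2: "(G \<circ> exp) holomorphic_on dom"
    by (rule holomorphic_on_compose_gen[OF _ G_hol]) (use one_plus_exp in \<open>auto simp: dom_def cutm_def intro!: holomorphic_intros\<close>)
  have "(\<lambda>L. exp (\<mu> * L / 2) * ((G \<circ> exp) L * (yl \<nu> \<circ> ZL) L)) holomorphic_on dom"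
    by (intro holomorphic_intros 1 2) auto
  then show ?thesis by (simp add: FL_def[abs_def])
qed

lemma continuous_on_JJ: "continuous_on {0..<1} JJ"
proof -
  have L: "continuous_on {0..<1} Lp"
    by (rule continuous_on_vector_derivative_at[OF Lp_deriv]) auto
  have F: "continuous_on {0..<1} (\<lambda>s. FL (Lp s))"
    by (rule continuous_on_compose2[OF holomorphic_on_imp_continuous_on[OF FL_holomorphic] L])
       (use Lp_strip strip_dom in auto)
  have "(1 - complex_of_real s) * (1 + of_real s * E) \<noteq> 0" if "s \<in> {0..<1}" for s
    using that one_plus_sE'[of s] of_real_eq_1_iff[of s, where 'a = complex] by auto
  then show ?thesis
    unfolding JJ_def[abs_def] by (intro continuous_intros F) auto
qed

lemma Ln_sE_bound: "\<exists>N\<ge>0. \<forall>s\<in>{0..1}. norm (Ln (1 + of_real s * E)) \<le> N"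
proof -
  have "continuous_on {0..1} (\<lambda>s::real. Ln (1 + of_real s * E))"
    by (intro continuous_intros) (use one_plus_sE in auto)
  then have "bounded ((\<lambda>s::real. Ln (1 + of_real s * E)) ` {0..1})"
    by (intro compact_imp_bounded compact_continuous_image) auto
  then obtain N where "N > 0" "\<And>s::real. s \<in> {0..1} \<Longrightarrow> norm (Ln (1 + of_real s * E)) \<le> N"
    unfolding bounded_pos by blast
  then show ?thesis by (intro exI[of _ N]) auto
qed

end

section \<open>Replacing the segment by the ray\<close>

locale kernel_path = legendre_solution \<mu> \<nu> G + path_pair P Q \<mu> \<nu> G
  for \<mu> \<nu> :: complex and G and P Q :: complex
begin

text \<open>The exponential contributes \<open>sL L powr Re \<mu>\<close>. The Legendre factor,
  taken at \<open>wf / sL L\<close> with \<open>wf\<close> in a compact set off the slit, costs at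
  most \<open>sL L powr (- \<rho>0)\<close>.\<close>

lemma FL_bound: "\<exists>C>0. \<forall>L\<in>strip. sL L \<le> 1 \<longrightarrow> norm (FL L) \<le> C * sL L powr (Re \<mu> - \<rho>0)"
proof -
  define X where "X = {0..1::real} \<times> {0..1::real}"
  have cX: "compact X" unfolding X_def by (intro compact_Times) auto
  have cw: "continuous_on X (\<lambda>x. wf (fst x) (snd x))"
    by (rule continuous_on_subset[OF continuous_on_wf]) (auto simp: X_def)
  obtain C1 where C1: "C1 > 0" "\<And>w t. w \<in> (\<lambda>x. wf (fst x) (snd x)) ` X \<Longrightarrow> 0 < t \<Longrightarrow> t \<le> 1 \<Longrightarrow> norm (yl \<nu> (w / of_real t)) \<le> C1 * t powr (-\<rho>0)"
  proof -
    have "(\<lambda>x. wf (fst x) (snd x)) ` X \<subseteq> - \<real>\<^sub>\<le>\<^sub>0" using wf_slit by (auto simp: X_def)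
    from yl_ray_bound[OF compact_continuous_image[OF cw cX] this \<rho>0(1,2)] show ?thesis using that by blast
  qed
  define T where "T x = p * q * (of_real (fst x) * cis (- (snd x * \<Theta>)))\<^sup>2" for x :: "real \<times> real"
  have T1: "T x \<in> cutm" if "x \<in> X" for x
  proof -
    define s c where "s = fst x" and "c = snd x"
    have c: "c \<in> {0..1}" "s \<ge> 0" using that by (auto simp: X_def s_def c_def)
    have "T x = of_real (exp (Re P) * exp (Re Q) * s\<^sup>2) * (cis (Im P) * cis (Im Q) * cis (- (c * \<Theta>)) * cis (- (c * \<Theta>)))"
      by (simp add: T_def p_polar q_polar power2_eq_square mult_ac s_def c_def)
    also have "cis (Im P) * cis (Im Q) * cis (- (c * \<Theta>)) * cis (- (c * \<Theta>)) = cis ((1 - 2 * c) * \<Theta>)"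
      by (simp add: cis_mult \<Theta>_def algebra_simps)
    finally have e: "T x = of_real (exp (Re P) * exp (Re Q) * s\<^sup>2) * cis ((1 - 2 * c) * \<Theta>)" .
    have "\<bar>(1 - 2 * c) * \<Theta>\<bar> \<le> 1 * \<bar>\<Theta>\<bar>" unfolding abs_mult using c by (intro mult_right_mono) auto
    then show ?thesis unfolding cutm_def using one_plus_slit[OF e] Theta by simp
  qed
  have "continuous_on X (\<lambda>x. G (T x))"
    by (rule continuous_on_compose2[OF holomorphic_on_imp_continuous_on[OF holG]])
       (use T1 in \<open>auto simp: T_def intro!: continuous_intros\<close>)
  then have "bounded ((\<lambda>x. G (T x)) ` X)" by (intro compact_imp_bounded compact_continuous_image cX)
  then obtain C2 where C2: "C2 > 0" "\<And>x. x \<in> X \<Longrightarrow> norm (G (T x)) \<le> C2" unfolding bounded_pos by blast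
  define K where "K = exp (\<bar>Im \<mu>\<bar> * pi / 2 + Re \<mu> * (Re P + Re Q) / 2)"
  show ?thesis
  proof (intro exI[of _ "K * C2 * C1"] conjI ballI impI)
    fix L assume L: "L \<in> strip" "sL L \<le> 1"
    obtain c where c: "c \<in> {0..1}" "Im L = (1 - 2 * c) * \<Theta>" using strip_angle[OF L(1)] by blast
    define s where "s = sL L"
    have s: "0 < s" "s \<le> 1" using sL_pos L by (auto simp: s_def)
    have x: "(s, c) \<in> X" using s c by (simp add: X_def)
    have Z: "ZL L = wf s c / of_real s" unfolding s_def by (rule ZL_wf[OF c(2)])
    have y: "norm (yl \<nu> (ZL L)) \<le> C1 * s powr (-\<rho>0)" unfolding Z
      by (rule C1(2)) (use x s in force)+
    have "exp L = T (s, c)" unfolding pq_tau[symmetric] \<tau>_polar[OF c(2)] T_def s_def by simp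
    then have g: "norm (G (exp L)) \<le> C2" using C2(2)[OF x] by simp
    have "norm (exp (\<mu> * L / 2)) = exp ((Re \<mu> * Re L - Im \<mu> * Im L) / 2)" by simp
    also have "\<dots> \<le> exp ((Re \<mu> * Re L + \<bar>Im \<mu>\<bar> * pi) / 2)"
    proof -
      have "- (Im \<mu> * Im L) \<le> \<bar>Im \<mu>\<bar> * \<bar>Im L\<bar>" by (metis abs_mult abs_ge_minus_self)
      also have "\<dots> \<le> \<bar>Im \<mu>\<bar> * pi" using strip_pi[OF L(1)] by (intro mult_left_mono) auto
      finally have *: "- (Im \<mu> * Im L) \<le> \<bar>Im \<mu>\<bar> * pi" .
      show ?thesis
        unfolding exp_le_cancel_iff diff_conv_add_uminus by (intro divide_right_mono add_left_mono *) simp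
    qed
    also have "\<dots> = K * s powr Re \<mu>"
      by (simp add: K_def s_def sL_def powr_def field_simps flip: exp_add)
    finally have e: "norm (exp (\<mu> * L / 2)) \<le> K * s powr Re \<mu>" .
    have "norm (FL L) \<le> (K * s powr Re \<mu>) * (C2 * (C1 * s powr (-\<rho>0)))"
      unfolding FL_def norm_mult using C2(1) by (intro mult_mono e g y) (auto simp: K_def)
    also have "\<dots> = K * C2 * C1 * (s powr Re \<mu> * s powr (-\<rho>0))" by simp
    also have "s powr Re \<mu> * s powr (-\<rho>0) = s powr (Re \<mu> - \<rho>0)" unfolding powr_add[symmetric] by simp
    finally show "norm (FL L) \<le> K * C2 * C1 * sL L powr (Re \<mu> - \<rho>0)" by (simp add: s_def)
  qed (use C1 C2 in \<open>simp add: K_def\<close>)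
qed

lemma p_in_Adom: "closed_segment 0 p \<subseteq> Adom q" "closed_segment 0 q \<subseteq> Adom 0"
proof -
  show "closed_segment 0 p \<subseteq> Adom q"
    by (rule segment_subset_Adom[OF p_polar _ q_polar _ ImP ImQ ImPQ]) auto
  show "closed_segment 0 q \<subseteq> Adom 0"
    by (rule segment_subset_Adom[OF q_polar _ _ _ ImQ, of 0 0 0]) (use ImQ in auto)
qed

text \<open>\<open>FL\<close> has a primitive \<open>g\<close> on the convex strip. Both truncated
  integrals are increments of \<open>g\<close> from the common point \<open>P + Q\<close>; their end
  points stay within distance \<open>N\<close> of each other while \<open>FL\<close> decays there,
  so the difference tends to zero.\<close>

lemma JJ_integral_limit:
  "((\<lambda>\<eta>. integral {0..1 - \<eta>} JJ) \<longlongrightarrow> exp (\<mu> * (P + Q) / 2) * UU q p) (at_right 0)"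
proof -
  have FLc: "continuous_on strip FL"
    by (rule holomorphic_on_imp_continuous_on[OF holomorphic_on_subset[OF FL_holomorphic strip_dom]])
  have FLd: "FL field_differentiable at x" if "x \<in> interior strip - {}" for x
    by (rule holomorphic_on_imp_differentiable_at[OF FL_holomorphic open_dom]) (use that interior_subset strip_dom in auto)
  \<comment> \<open>Derivatives are taken within \<open>strip\<close>, because it degenerates to the
    real line when \<open>\<Theta> = 0\<close>.\<close>
  obtain g where g: "\<And>L. L \<in> strip \<Longrightarrow> (g has_field_derivative FL L) (at L within strip)"
    using holomorphic_convex_primitive[OF convex_strip finite.emptyI FLc FLd] by metis
  have chain: "((\<lambda>x. g (f x)) has_vector_derivative f' * FL (f x)) (at x within S)"
    if "(f has_vector_derivative f') (at x)" "x \<in> S" "f ` S \<subseteq> strip" for f :: "real \<Rightarrow> complex" and f' x S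
  proof -
    have "(g has_field_derivative FL (f x)) (at (f x) within f ` S)"
      by (rule has_field_derivative_subset[OF g that(3)]) (use that in auto)
    from field_vector_diff_chain_within[OF has_vector_derivative_at_within[OF that(1)] this]
    show ?thesis by (simp add: o_def)
  qed
  define c where "c = exp (\<mu> * (P + Q) / 2)"
  have c0: "c \<noteq> 0" by (simp add: c_def)
  have I1: "integral {0..1 - \<eta>} JJ = - (1 / 2) * (g (Lp (1 - \<eta>)) - g (P + Q))" if \<eta>: "0 < \<eta>" "\<eta> < 1" for \<eta>
  proof -
    have "(JJ has_integral (- (1 / 2) * g (Lp (1 - \<eta>)) - - (1 / 2) * g (Lp 0))) {0..1 - \<eta>}"
    proof (rule fundamental_theorem_of_calculus)
      fix s assume s: "s \<in> {0..1 - \<eta>}"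
      then have s': "0 \<le> s" "s < 1" using \<eta> by auto
      have "((\<lambda>s. - (1 / 2) * g (Lp s)) has_vector_derivative - (1 / 2) * (- ((1 + E) / ((1 - of_real s) * (1 + of_real s * E))) * FL (Lp s))) (at s within {0..1 - \<eta>})"
        by (intro has_vector_derivative_mult_right chain Lp_deriv s' s) (use Lp_strip \<eta> in auto)
      then show "((\<lambda>s. - (1 / 2) * g (Lp s)) has_vector_derivative JJ s) (at s within {0..1 - \<eta>})"
        by (simp add: JJ_def mult_ac)
    qed (use \<eta> in simp)
    moreover have "Lp 0 = P + Q" by (simp add: Lp_def)
    ultimately show ?thesis by (simp add: integral_unique algebra_simps)
  qed
  define R where "R t = P + Q + of_real (2 * ln t)" for t :: real
  have Rstrip: "R t \<in> strip" for t by (simp add: R_def strip_def \<Theta>_def)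
  have I2: "c * integral {\<epsilon>..1} (KU q p) = (1 / 2) * (g (P + Q) - g (R \<epsilon>))" if \<epsilon>: "0 < \<epsilon>" "\<epsilon> \<le> 1" for \<epsilon>
  proof -
    have "((\<lambda>t. c * KU q p t) has_integral ((1 / 2) * g (R 1) - (1 / 2) * g (R \<epsilon>))) {\<epsilon>..1}"
    proof (rule fundamental_theorem_of_calculus[OF \<epsilon>(2)])
      fix t assume t: "t \<in> {\<epsilon>..1}"
      then have t0: "t > 0" using \<epsilon> by auto
      have dR: "(R has_vector_derivative 0 + of_real (2 / t)) (at t)"
      proof -
        have "((\<lambda>t. 2 * ln t) has_real_derivative 2 / t) (at t)"
          using t0 by (auto intro!: derivative_eq_intros)
        from has_vector_derivative_of_real[OF this] show ?thesis
          unfolding R_def[abs_def] by (intro has_vector_derivative_add has_vector_derivative_const)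
      qed
      have "((\<lambda>t. (1 / 2) * g (R t)) has_vector_derivative (1 / 2) * ((0 + of_real (2 / t)) * FL (R t))) (at t within {\<epsilon>..1})"
        by (intro has_vector_derivative_mult_right chain dR t) (use Rstrip in auto)
      moreover have "(1 / 2) * ((0 + of_real (2 / t)) * FL (R t)) = c * KU q p t"
      proof -
        have et: "exp (complex_of_real (ln t)) = of_real t" using t0 by (simp flip: of_real_exp)
        have e1: "exp (R t) = p * q * of_real t ^ 2"
        proof -
          have "exp (R t) = exp (P + Q) * (exp (of_real (ln t)) * exp (of_real (ln t)))"
            unfolding R_def by (simp flip: exp_add)
          then show ?thesis unfolding et by (simp add: p_def q_def exp_add power2_eq_square)
        qed
        have "\<tau> (R t) = exp (of_real (ln t))" by (simp add: \<tau>_def R_def)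
        then have Z: "ZL (R t) = RR p q (of_real t) / of_real t" unfolding ZL_def et by simp
        have "exp (\<mu> * R t / 2) = c * of_real t powr \<mu>"
          using t0 by (simp add: R_def c_def powr_def Ln_of_real algebra_simps add_divide_distrib flip: exp_add)
        moreover have "of_real t powr \<mu> = of_real t powr (\<mu> - 1) * of_real t"
          using t0 by (simp add: powr_diff)
        ultimately show ?thesis
          unfolding FL_def e1 Z KU_def using t0 by simp
      qed
      ultimately show "((\<lambda>t. (1 / 2) * g (R t)) has_vector_derivative c * KU q p t) (at t within {\<epsilon>..1})" by simp
    qed
    then have "integral {\<epsilon>..1} (\<lambda>t. c * KU q p t) = (1 / 2) * g (R 1) - (1 / 2) * g (R \<epsilon>)" by (rule integral_unique)
    moreover have "R 1 = P + Q" by (simp add: R_def)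
    ultimately show ?thesis by (simp add: algebra_simps)
  qed
  obtain N where N: "N \<ge> 0" "\<And>s. s \<in> {0..1} \<Longrightarrow> norm (Ln (1 + of_real s * E)) \<le> N"
    using Ln_sE_bound by blast
  obtain C where C: "C > 0" "\<And>L. L \<in> strip \<Longrightarrow> sL L \<le> 1 \<Longrightarrow> norm (FL L) \<le> C * sL L powr (Re \<mu> - \<rho>0)"
    using FL_bound by blast
  define e where "e = Re \<mu> - \<rho>0"
  have e: "e > 0" using \<rho>0 by (simp add: e_def)
  have pA: "{p} \<subseteq> Adom q" using p_in_Adom(1) by auto
  obtain C3 where C3: "C3 > 0" "\<And>t. 0 < t \<Longrightarrow> t \<le> 1 \<Longrightarrow> norm (KU q p t) \<le> C3 * t powr (e - 1)"
    using kernel_bounds[OF _ pA q1'] unfolding e_def by auto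
  define D where "D = C * exp (N / 2) powr e * N / 2 + norm c * (C3 / e)"
  have key: "norm (integral {0..1 - \<eta>} JJ - c * UU q p) \<le> D * \<eta> powr (e / 2)"
    if \<eta>: "0 < \<eta>" "\<eta> < min 1 (exp (- N))" for \<eta>
  proof -
    \<comment> \<open>Since \<open>p3\<close> is proportional to \<open>t\<^sup>2\<close> on the ray and to \<open>1 - s\<close> near the end of the segment, this choice keeps
      \<open>R \<epsilon>\<close> within a bounded distance of \<open>Lp (1 - \<eta>)\<close>.\<close>
    define \<epsilon> where "\<epsilon> = \<eta> powr (1 / 2)"
    have \<epsilon>: "0 < \<epsilon>" "\<epsilon> \<le> 1" using \<eta> powr_mono2[of "1/2" \<eta> 1] by (auto simp: \<epsilon>_def)
    have l\<epsilon>: "2 * ln \<epsilon> = ln \<eta>" using \<eta> by (simp add: \<epsilon>_def ln_powr)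
    have \<epsilon>e: "\<epsilon> powr e = \<eta> powr (e / 2)" by (simp add: \<epsilon>_def powr_powr)
    \<comment> \<open>A bound for \<open>sL\<close> at both end points: they differ by at most
      \<open>N\<close> in \<open>Re L\<close>, which is a factor \<open>exp (N / 2)\<close> in
      \<open>sL\<close>. The restriction \<open>\<eta> < exp (- N)\<close> gives
      \<open>\<sigma> \<le> 1\<close>, the range of \<open>FL_bound\<close>.\<close>
    define \<sigma> where "\<sigma> = \<epsilon> * exp (N / 2)"
    have "\<epsilon> \<le> exp (- N) powr (1 / 2)" unfolding \<epsilon>_def using \<eta> by (intro powr_mono2) auto
    also have "\<dots> = exp (- N / 2)" by (simp add: exp_powr_real)
    finally have "\<sigma> \<le> exp (- N / 2) * exp (N / 2)" unfolding \<sigma>_def by (intro mult_right_mono) auto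
    then have \<sigma>1: "\<sigma> \<le> 1" by (simp flip: exp_add)
    have \<sigma>0: "\<sigma> > 0" using \<epsilon> by (simp add: \<sigma>_def)
    define S where "S = strip \<inter> {L. Re L \<le> 2 * ln \<sigma> + Re P + Re Q}"
    have convS: "convex S" unfolding S_def by (intro convex_Int convex_strip convex_halfspace_Re_le)
    have sLS: "sL L \<le> \<sigma>" if "L \<in> S" for L
    proof -
      have "(Re L - Re P - Re Q) / 2 \<le> ln \<sigma>" using that by (simp add: S_def)
      then have "sL L \<le> exp (ln \<sigma>)" unfolding sL_def by (simp only: exp_le_cancel_iff)
      then show ?thesis using \<sigma>0 by simp
    qed
    have FS: "norm (FL L) \<le> C * \<sigma> powr e" if "L \<in> S" for L
    proof -
      have "norm (FL L) \<le> C * sL L powr e"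
        unfolding e_def by (rule C(2)) (use that sLS[OF that] \<sigma>1 in \<open>auto simp: S_def\<close>)
      also have "\<dots> \<le> C * \<sigma> powr e"
        using C(1) e sLS[OF that] sL_pos[of L] by (intro mult_left_mono powr_mono2) auto
      finally show ?thesis .
    qed
    have ln\<sigma>: "2 * ln \<sigma> = ln \<eta> + N" using \<epsilon> l\<epsilon> by (simp add: \<sigma>_def ln_mult)
    have a: "R \<epsilon> \<in> S"
    proof -
      have "Re (R \<epsilon>) \<le> 2 * ln \<sigma> + Re P + Re Q" using N(1) by (simp add: R_def l\<epsilon> ln\<sigma> del: of_real_mult)
      then show ?thesis using Rstrip[of \<epsilon>] by (simp add: S_def)
    qed
    have ba: "Lp (1 - \<eta>) = R \<epsilon> - Ln (1 + of_real (1 - \<eta>) * E)"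
      unfolding Lp_def R_def l\<epsilon> by simp
    have nL: "norm (Ln (1 + of_real (1 - \<eta>) * E)) \<le> N" by (rule N(2)) (use \<eta> in auto)
    have b: "Lp (1 - \<eta>) \<in> S"
    proof -
      have "\<bar>Re (Ln (1 + of_real (1 - \<eta>) * E))\<bar> \<le> N" using abs_Re_le_cmod nL order_trans by blast
      then have "Re (Lp (1 - \<eta>)) \<le> 2 * ln \<sigma> + Re P + Re Q"
        unfolding ba by (simp add: R_def l\<epsilon> ln\<sigma> del: of_real_diff)
      then show ?thesis using Lp_strip[of "1 - \<eta>"] \<eta> by (simp add: S_def)
    qed
    have "norm (g (R \<epsilon>) - g (Lp (1 - \<eta>))) \<le> C * \<sigma> powr e * norm (R \<epsilon> - Lp (1 - \<eta>))"
      by (rule field_differentiable_bound[OF convS _ FS a b]) (auto simp: S_def intro: has_field_derivative_subset[OF g])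
    also have "\<dots> \<le> C * \<sigma> powr e * N"
      using nL C(1) by (intro mult_left_mono) (auto simp: ba)
    finally have 1: "norm (g (R \<epsilon>) - g (Lp (1 - \<eta>))) \<le> C * \<sigma> powr e * N" .
    have \<sigma>e: "\<sigma> powr e = \<eta> powr (e / 2) * exp (N / 2) powr e"
      using \<epsilon> by (simp add: \<sigma>_def powr_mult \<epsilon>e)
    have 2: "norm (UU q p - integral {\<epsilon>..1} (KU q p)) \<le> C3 / e * \<epsilon> powr e"
      unfolding UU_def by (rule integrable_powr_majorant(3)[OF continuous_on_KU_t e C3(2) \<epsilon>]) (use pA q1' in auto)
    have "integral {0..1 - \<eta>} JJ - c * UU q p = (integral {0..1 - \<eta>} JJ - c * integral {\<epsilon>..1} (KU q p)) - c * (UU q p - integral {\<epsilon>..1} (KU q p))"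
      by (simp add: algebra_simps)
    also have "integral {0..1 - \<eta>} JJ - c * integral {\<epsilon>..1} (KU q p) = (1 / 2) * (g (R \<epsilon>) - g (Lp (1 - \<eta>)))"
    proof -
      have h: "integral {0..1 - \<eta>} JJ = - (1 / 2) * (g (Lp (1 - \<eta>)) - g (P + Q))" by (rule I1) (use \<eta> in auto)
      show ?thesis unfolding h I2[OF \<epsilon>] by (simp add: algebra_simps)
    qed
    also have "norm (\<dots> - c * (UU q p - integral {\<epsilon>..1} (KU q p))) \<le> (1 / 2) * norm (g (R \<epsilon>) - g (Lp (1 - \<eta>))) + norm c * norm (UU q p - integral {\<epsilon>..1} (KU q p))"
      by (rule order_trans[OF norm_triangle_ineq4]) (simp add: norm_mult)
    also have "\<dots> \<le> (1 / 2) * (C * \<sigma> powr e * N) + norm c * (C3 / e * \<epsilon> powr e)"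
      by (intro add_mono mult_left_mono 1 2) auto
    also have "\<dots> = D * \<eta> powr (e / 2)"
      unfolding \<sigma>e \<epsilon>e D_def by (simp add: algebra_simps)
    finally show ?thesis .
  qed
  show ?thesis
    unfolding c_def[symmetric]
  proof (rule Lim_transform_bound_at_right)
    show "eventually (\<lambda>\<eta>. norm (integral {0..1 - \<eta>} JJ - c * UU q p) \<le> D * \<eta> powr (e / 2)) (at_right 0)"
      unfolding eventually_at_right_field using key by (intro exI[of _ "min 1 (exp (- N))"]) auto
    show "((\<lambda>\<eta>. D * \<eta> powr (e / 2)) \<longlongrightarrow> 0) (at_right 0)" by (rule powr_tendsto_0_at_right) (use e in simp)
  qed
qed

end

section \<open>Divergence outside the convergence range\<close>

text \<open>
  On intervals of a fixed short length \<open>\<delta>\<close> the derivative \<open>\<psi>\<close> is nearly the constant \<open>exp (- \<beta> u) K\<close>, of modulus at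
  least \<open>norm K\<close>, so \<open>\<phi>\<close> cannot be Cauchy.
\<close>

lemma no_limit_if_exponential_derivative:
  fixes \<phi> \<psi> :: "real \<Rightarrow> complex"
  assumes d: "\<And>u. u \<ge> u0 \<Longrightarrow> (\<phi> has_vector_derivative \<psi> u) (at u)"
    and lim: "((\<lambda>u. exp (\<beta> * of_real u) * \<psi> u) \<longlongrightarrow> K) at_top" and K: "K \<noteq> 0" and \<beta>: "Re \<beta> \<le> 0"
  shows "\<not> (\<phi> \<longlongrightarrow> l) at_top"
proof
  assume \<phi>: "(\<phi> \<longlongrightarrow> l) at_top"
  have "((\<lambda>v. exp (- \<beta> * of_real v)) \<longlongrightarrow> exp (- \<beta> * of_real 0)) (at 0)"
    by (intro tendsto_intros)
  then have "eventually (\<lambda>v. dist (exp (- \<beta> * of_real v)) 1 < 1 / 4) (at (0::real))"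
    by (intro tendstoD) auto
  then obtain \<delta>0 where \<delta>0: "\<delta>0 > 0" "\<And>v::real. v \<noteq> 0 \<Longrightarrow> dist v 0 < \<delta>0 \<Longrightarrow> dist (exp (- \<beta> * of_real v)) 1 < 1 / 4"
    unfolding eventually_at by auto
  define \<delta> where "\<delta> = \<delta>0 / 2"
  have \<delta>: "\<delta> > 0" using \<delta>0 by (simp add: \<delta>_def)
  have near: "norm (exp (- \<beta> * of_real v) - 1) \<le> 1 / 4" if "0 \<le> v" "v \<le> \<delta>" for v
    using \<delta>0(2)[of v] that \<delta>0(1) by (cases "v = 0") (auto simp: dist_norm \<delta>_def)
  define c where "c = norm K"
  have c: "c > 0" using K by (simp add: c_def)
  have e1: "eventually (\<lambda>u. dist (exp (\<beta> * of_real u) * \<psi> u) K < c / 4) at_top"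
    using lim c by (intro tendstoD) auto
  \<comment> \<open>With errors \<open>1 / 4\<close> in the exponential and \<open>c / 4\<close> in
    the limit, \<open>\<psi>\<close> deviates from its model value by at most
    \<open>1 / 4 + 5 / 4 * 1 / 4 = 9 / 16\<close> of the latter's modulus. So \<open>\<phi>\<close>
    moves by at least \<open>7 / 16 * c * \<delta>\<close>, twice the tolerance chosen here.\<close>
  have e2: "eventually (\<lambda>u. dist (\<phi> u) l < 7 / 32 * c * \<delta>) at_top"
    using \<phi> c \<delta> by (intro tendstoD) auto
  obtain U where U: "\<And>u. u \<ge> U \<Longrightarrow> dist (exp (\<beta> * of_real u) * \<psi> u) K < c / 4"
      "\<And>u. u \<ge> U \<Longrightarrow> dist (\<phi> u) l < 7 / 32 * c * \<delta>"
    using eventually_conj[OF e1 e2] unfolding eventually_at_top_linorder by blast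
  define u where "u = max (max U u0) 0"
  have u: "u \<ge> U" "u \<ge> u0" "u \<ge> 0" by (auto simp: u_def)
  define w where "w = exp (- \<beta> * of_real u)"
  have w1: "norm w \<ge> 1" using \<beta> u(3) by (simp add: w_def mult_nonpos_nonneg)
  define hh where "hh v = \<phi> (u + v) - of_real v * (w * K)" for v :: real
  have dhh: "(hh has_vector_derivative \<psi> (u + v) - w * K) (at v within {0..\<delta>})" if v: "v \<in> {0..\<delta>}" for v
  proof -
    have "((\<lambda>v. u + v) has_real_derivative 1) (at v)" by (auto intro!: derivative_eq_intros)
    then have "(\<phi> \<circ> (\<lambda>v. u + v) has_vector_derivative 1 *\<^sub>R \<psi> (u + v)) (at v)"
      by (intro vector_diff_chain_at) (use d[of "u + v"] v u in \<open>auto simp: has_real_derivative_iff_has_vector_derivative\<close>)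
    moreover have "((\<lambda>v. of_real v * (w * K)) has_vector_derivative 1 * (w * K)) (at v)"
      by (intro has_vector_derivative_mult_left) (auto intro!: derivative_eq_intros)
    ultimately have "((\<lambda>v. (\<phi> \<circ> (\<lambda>v. u + v)) v - of_real v * (w * K)) has_vector_derivative 1 *\<^sub>R \<psi> (u + v) - 1 * (w * K)) (at v)"
      by (rule has_vector_derivative_diff)
    from has_vector_derivative_at_within[OF this, of "{0..\<delta>}"] show ?thesis
      by (simp add: hh_def[abs_def])
  qed
  have b: "norm (\<psi> (u + v) - w * K) \<le> norm w * (9 / 16 * c)" if v: "v \<in> {0..\<delta>}" for v
  proof -
    define \<kappa> where "\<kappa> = exp (\<beta> * of_real (u + v)) * \<psi> (u + v)"
    define h where "h = exp (- \<beta> * of_real v)"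
    have "exp (- \<beta> * of_real (u + v)) * exp (\<beta> * of_real (u + v)) = 1" by (simp flip: exp_add)
    moreover have "exp (- \<beta> * of_real (u + v)) = w * h" by (simp add: w_def h_def algebra_simps flip: exp_add)
    ultimately have "\<psi> (u + v) = w * h * \<kappa>" unfolding \<kappa>_def by (metis mult.assoc mult_1)
    then have "\<psi> (u + v) - w * K = w * ((h - 1) * K + h * (\<kappa> - K))" by (simp add: algebra_simps)
    also have "norm \<dots> \<le> norm w * (norm (h - 1) * c + norm h * norm (\<kappa> - K))"
      unfolding norm_mult[of w] by (intro mult_left_mono order_trans[OF norm_triangle_ineq]) (simp_all add: norm_mult c_def)
    also have "\<dots> \<le> norm w * (1 / 4 * c + 5 / 4 * (c / 4))"
    proof (intro mult_left_mono add_mono mult_mono mult_right_mono)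
      show h1: "norm (h - 1) \<le> 1 / 4" unfolding h_def by (rule near) (use v in auto)
      have "norm h \<le> norm (h - 1) + norm (1::complex)" using norm_triangle_ineq[of "h - 1" 1] by simp
      then show "norm h \<le> 5 / 4" using h1 by simp
      show "norm (\<kappa> - K) \<le> c / 4" using U(1)[of "u + v"] v u unfolding \<kappa>_def dist_norm by auto
    qed (use c in auto)
    finally show ?thesis by (simp add: algebra_simps)
  qed
  have "norm (hh \<delta> - hh 0) \<le> norm w * (9 / 16 * c) * norm (\<delta> - 0)"
  proof (rule differentiable_bound[where S = "{0..\<delta>}" and f' = "\<lambda>v h. h *\<^sub>R (\<psi> (u + v) - w * K)"])
    show "(hh has_derivative (\<lambda>h. h *\<^sub>R (\<psi> (u + v) - w * K))) (at v within {0..\<delta>})" if "v \<in> {0..\<delta>}" for v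
      using dhh[OF that] by (simp add: has_vector_derivative_def)
    show "onorm (\<lambda>h. h *\<^sub>R (\<psi> (u + v) - w * K)) \<le> norm w * (9 / 16 * c)" if "v \<in> {0..\<delta>}" for v
    proof (rule onorm_le)
      fix h :: real
      show "norm (h *\<^sub>R (\<psi> (u + v) - w * K)) \<le> norm w * (9 / 16 * c) * norm h"
        using mult_left_mono[OF b[OF that], of "\<bar>h\<bar>"] by (simp add: mult_ac)
    qed
  qed (use \<delta> in auto)
  then have "norm (\<phi> (u + \<delta>) - \<phi> u - of_real \<delta> * (w * K)) \<le> norm w * (9 / 16 * c) * \<delta>"
    using \<delta> by (simp add: hh_def algebra_simps)
  moreover have "norm (of_real \<delta> * (w * K)) = norm w * c * \<delta>" using \<delta> by (simp add: norm_mult c_def mult_ac)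
  moreover have "norm (of_real \<delta> * (w * K)) \<le> norm (\<phi> (u + \<delta>) - \<phi> u) + norm (\<phi> (u + \<delta>) - \<phi> u - of_real \<delta> * (w * K))"
    using norm_triangle_ineq4[of "\<phi> (u + \<delta>) - \<phi> u" "\<phi> (u + \<delta>) - \<phi> u - of_real \<delta> * (w * K)"] by simp
  ultimately have "norm w * (7 / 16 * c * \<delta>) \<le> norm (\<phi> (u + \<delta>) - \<phi> u)" by (simp add: algebra_simps)
  moreover have "1 * (7 / 16 * c * \<delta>) \<le> norm w * (7 / 16 * c * \<delta>)" using w1 c \<delta> by (intro mult_right_mono) auto
  moreover have "dist (\<phi> (u + \<delta>)) (\<phi> u) < 7 / 16 * c * \<delta>"
    using U(2)[of "u + \<delta>"] U(2)[of u] u \<delta> dist_triangle2[of "\<phi> (u + \<delta>)" "\<phi> u" l] by auto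
  ultimately show False unfolding dist_norm by linarith
qed

context path_pair
begin

text \<open>After \<open>s = 1 - exp (- u)\<close> the indefinite integral has a derivative
  asymptotic to \<open>K * exp (- \<beta> * u)\<close> with
  \<open>\<beta> = (\<mu> - \<nu>) / 2\<close>, which does not decay when
  \<open>Re \<mu> \<le> Re \<nu>\<close>. The constant \<open>K\<close> is nonzero because
  \<open>G 0\<close> and the limit from \<open>yl_limit\<close> are.\<close>

lemma not_integrable_JJ:
  assumes \<nu>: "Re \<nu> > -1/2" and \<mu>\<nu>: "Re \<mu> \<le> Re \<nu>" and G0: "G 0 \<noteq> 0"
  shows "\<not> JJ integrable_on {0..1}"
proof
  assume int: "JJ integrable_on {0..1}"
  define \<beta> where "\<beta> = (\<mu> - \<nu>) / 2"
  define s where "s u = 1 - exp (- u)" for u :: real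
  have s: "0 \<le> s u" "s u < 1" if "u \<ge> 0" for u using that by (auto simp: s_def)
  have s_lim: "(s \<longlongrightarrow> 1) at_top"
  proof -
    have "((\<lambda>u::real. exp (- u)) \<longlongrightarrow> 0) at_top"
      by (rule filterlim_compose[OF exp_at_bot filterlim_uminus_at_bot_at_top])
    from tendsto_diff[OF tendsto_const[of 1] this] show ?thesis by (simp add: s_def[abs_def])
  qed
  define \<phi> where "\<phi> u = integral {0..s u} JJ" for u
  define \<psi> where "\<psi> u = exp (- u) *\<^sub>R JJ (s u)" for u
  have "(\<phi> \<longlongrightarrow> integral {0..1} JJ) at_top"
  proof -
    have c: "continuous_on {0..1} (\<lambda>x. integral {0..x} JJ)" by (rule indefinite_integral_continuous_1[OF int])
    show ?thesis unfolding \<phi>_def[abs_def]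
    proof (rule continuous_on_tendsto_compose[OF c s_lim])
      show "eventually (\<lambda>u. s u \<in> {0..1}) at_top"
        using eventually_ge_at_top[of 0] by eventually_elim (use s in \<open>auto intro: less_imp_le\<close>)
    qed simp
  qed
  moreover have "\<not> (\<phi> \<longlongrightarrow> integral {0..1} JJ) at_top"
  proof -
    have d\<phi>: "(\<phi> has_vector_derivative \<psi> u) (at u)" if u: "u \<ge> 1" for u
    proof -
      define b where "b = (s u + 1) / 2"
      have b: "s u < b" "b < 1" "0 < s u" using s[of u] u by (auto simp: b_def s_def)
      have "((\<lambda>x. integral {0..x} JJ) has_vector_derivative JJ (s u)) (at (s u) within {0..b})"
        by (rule integral_has_vector_derivative[OF continuous_on_subset[OF continuous_on_JJ]]) (use b in auto)
      then have 1: "((\<lambda>x. integral {0..x} JJ) has_vector_derivative JJ (s u)) (at (s u))"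
        using b by (subst (asm) at_within_Icc_at) auto
      have 2: "(s has_vector_derivative exp (- u)) (at u)"
        unfolding s_def[abs_def] has_real_derivative_iff_has_vector_derivative[symmetric] by (auto intro!: derivative_eq_intros)
      from vector_diff_chain_at[OF 2 1] show ?thesis by (simp add: o_def \<phi>_def[abs_def] \<psi>_def)
    qed
    define lam where "lam u = Ln (1 + of_real (s u) * E)" for u
    define r where "r u = exp (- u / 2)" for u :: real
    \<comment> \<open>Chosen so that \<open>ZL (Lp (s u)) = W u / r u\<close>: \<open>W\<close>
      converges to a point off the slit, and the growth is entirely in the positive factor
      \<open>1 / r u\<close>.\<close>
    define W where "W u = RR p q (of_real (r u) * exp (- lam u / 2)) * exp (lam u / 2)" for u
    have E1: "1 + E \<notin> \<real>\<^sub>\<le>\<^sub>0" using one_plus_sE[of 1] by simp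
    have E1': "1 + E \<noteq> 0" using one_plus_sE'[of 1] by simp
    have lam_lim: "(lam \<longlongrightarrow> Ln (1 + E)) at_top"
      unfolding lam_def[abs_def]
    proof (rule tendsto_Ln)
      show "((\<lambda>u. 1 + of_real (s u) * E) \<longlongrightarrow> 1 + E) at_top"
        using tendsto_add[OF tendsto_const[of 1] tendsto_mult_right[OF tendsto_of_real[OF s_lim], of E]] by simp
    qed (rule E1)
    have r_lim: "((\<lambda>u. complex_of_real (r u)) \<longlongrightarrow> 0) at_top"
    proof -
      have "(r \<longlongrightarrow> 0) at_top" unfolding r_def
      proof (rule filterlim_compose[OF exp_at_bot])
        have "filterlim (\<lambda>u::real. u * (1/2)) at_top at_top"
          by (rule filterlim_at_top_mult_tendsto_pos[OF tendsto_const]) (auto intro: filterlim_ident)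
        then show "filterlim (\<lambda>u::real. - u / 2) at_bot at_top"
          by (simp add: filterlim_uminus_at_top)
      qed
      from tendsto_of_real[OF this, where 'a = complex] show ?thesis by simp
    qed
    define W1 where "W1 = RR p q 0 * exp (Ln (1 + E) / 2)"
    have W_lim: "(W \<longlongrightarrow> W1) at_top"
    proof -
      have t: "((\<lambda>u. of_real (r u) * exp (- lam u / 2)) \<longlongrightarrow> 0 * exp (- Ln (1 + E) / 2)) at_top"
        by (intro tendsto_intros r_lim lam_lim) simp
      have "isCont (\<lambda>t. RR p q t) 0"
        unfolding RR_def by (intro continuous_intros) (use p1' q1' in \<open>simp del: distrib_left_numeral distrib_right_numeral\<close>)
      then have "((\<lambda>u. RR p q (of_real (r u) * exp (- lam u / 2))) \<longlongrightarrow> RR p q 0) at_top"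
        using t by (intro isCont_tendsto_compose[of 0 "\<lambda>t. RR p q t"]) simp_all
      then show ?thesis unfolding W_def[abs_def] W1_def
        by (intro tendsto_mult tendsto_exp tendsto_divide lam_lim tendsto_const) simp_all
    qed
    \<comment> \<open>The principal logarithm gives \<open>exp (Ln (1 + E) / 2)\<close> half the
      angle of \<open>1 + E\<close>, so \<open>W1\<close> is a positive multiple of
      \<open>wf 0 (c / 2)\<close>.\<close>
    have W1s: "W1 \<notin> \<real>\<^sub>\<le>\<^sub>0"
    proof -
      obtain \<rho> c where \<rho>: "\<rho> > 0" "c \<in> {0..1}" "Ln (1 + of_real 1 * E) = Complex (ln \<rho>) (c * \<Theta>)"
        by (rule one_plus_sE_bt[of 1]) (use that in auto)
      have "exp (Ln (1 + E) / 2) = of_real (exp (ln \<rho> / 2)) * cis (c / 2 * \<Theta>)"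
        using \<rho>(3) by (simp add: exp_eq_polar flip: of_real_exp)
      then have "W1 = of_real (exp (ln \<rho> / 2)) * wf 0 (c / 2)"
        by (simp add: W1_def wf_def)
      moreover have "wf 0 (c / 2) \<notin> \<real>\<^sub>\<le>\<^sub>0" by (rule wf_0) (use \<rho> in auto)
      ultimately show ?thesis by (simp add: complex_nonpos_Reals_iff mult_le_0_iff del: of_real_exp)
    qed
    then have W10: "W1 \<noteq> 0" by (metis nonpos_Reals_zero_I)
    \<comment> \<open>Strictly between the angle of the limit and \<open>pi\<close>, so
      \<open>W u\<close> eventually lies in a closed sector to which \<open>yl_limit\<close>
      applies.\<close>
    define \<Theta>' where "\<Theta>' = (\<bar>Arg W1\<bar> + pi) / 2"
    obtain m M \<Theta>1 where "0 \<le> \<Theta>1" "\<Theta>1 < pi" "\<bar>Arg W1\<bar> \<le> \<Theta>1"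
      using compact_slit_bounds[of "{W1}"] W1s by auto
    then have \<Theta>': "0 \<le> \<Theta>'" "\<Theta>' < pi" "\<bar>Arg W1\<bar> < \<Theta>'" by (auto simp: \<Theta>'_def)
    obtain c C \<delta> where C: "\<delta> > 0" "\<And>r \<theta>. r \<ge> 1 \<Longrightarrow> \<theta> \<in> {-\<Theta>'..\<Theta>'} \<Longrightarrow>
        norm ((of_real r * cis \<theta>) powr (- \<nu>) * yl \<nu> (of_real r * cis \<theta>) - c) \<le> C * r powr (-\<delta>)"
      using yl_limit[OF \<nu> \<Theta>'(1,2)] by blast
    have c0: "c \<noteq> 0"
      by (rule yl_limit_nonzero[OF \<nu> C(1), of c C]) (use C(2)[of _ 0] \<Theta>' in auto)
    have rpos: "r u > 0" for u by (simp add: r_def)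
    have Rtop: "filterlim (\<lambda>u. norm (W u) / r u) at_top at_top"
    proof -
      have "filterlim (\<lambda>u::real. exp (u / 2)) at_top at_top"
      proof (rule filterlim_compose[OF exp_at_top])
        show "filterlim (\<lambda>u::real. u / 2) at_top at_top"
          using filterlim_tendsto_pos_mult_at_top[OF tendsto_const[of "1/2::real"] _ filterlim_ident] by simp
      qed
      from filterlim_tendsto_pos_mult_at_top[OF tendsto_norm[OF W_lim] _ this]
      have "filterlim (\<lambda>u. norm (W u) * exp (u / 2)) at_top at_top" using W10 by simp
      moreover have "norm (W u) * exp (u / 2) = norm (W u) / r u" for u
      proof -
        have "exp (u / 2) = inverse (r u)" by (simp add: r_def exp_minus)
        then show ?thesis unfolding divide_inverse by (rule arg_cong)
      qed
      ultimately show ?thesis by simp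
    qed
    have ylim: "((\<lambda>u. (W u / of_real (r u)) powr (- \<nu>) * yl \<nu> (W u / of_real (r u))) \<longlongrightarrow> c) at_top"
    proof -
      have ev: "eventually (\<lambda>u. norm (W u) / r u \<ge> 1) at_top" using Rtop by (simp add: filterlim_at_top)
      have "eventually (\<lambda>u. \<bar>Arg (W u)\<bar> < \<Theta>') at_top"
        using order_tendstoD(2)[OF tendsto_rabs[OF tendsto_Arg[OF W_lim W1s]] \<Theta>'(3)] .
      with ev have "eventually (\<lambda>u. norm ((W u / of_real (r u)) powr (- \<nu>) * yl \<nu> (W u / of_real (r u)) - c) \<le> C * (norm (W u) / r u) powr (-\<delta>)) at_top"
      proof eventually_elim
        case (elim u)
        have z: "W u / of_real (r u) = of_real (norm (W u) / r u) * cis (Arg (W u))"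
          using rcis_cmod_Arg[of "W u"] by (simp add: rcis_def)
        show ?case unfolding z by (rule C(2)) (use elim in auto)
      qed
      moreover have "((\<lambda>u. C * (norm (W u) / r u) powr (-\<delta>)) \<longlongrightarrow> 0) at_top"
        by (rule tendsto_mult_right_zero, rule tendsto_neg_powr[OF _ Rtop]) (use C(1) in simp)
      ultimately have "((\<lambda>u. (W u / of_real (r u)) powr (- \<nu>) * yl \<nu> (W u / of_real (r u)) - c) \<longlongrightarrow> 0) at_top"
        by (rule Lim_null_comparison)
      then show ?thesis by (simp add: LIM_zero_iff)
    qed
    define K where "K = exp (\<mu> / 2 * (P + Q - Ln (1 + E))) * (G 0 * (c * W1 powr \<nu>)) * ((1 + E) / (1 + E)) / 2"
    have K0: "K \<noteq> 0" using G0 c0 W10 E1' by (simp add: K_def)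
    have \<beta>0: "Re \<beta> \<le> 0" using \<mu>\<nu> by (simp add: \<beta>_def)
    have lim: "((\<lambda>u. exp (\<mu> / 2 * (P + Q - lam u)) * (G (exp (Lp (s u))) * ((W u / of_real (r u)) powr (- \<nu>) * yl \<nu> (W u / of_real (r u)) * W u powr \<nu>))
        * ((1 + E) / (1 + of_real (s u) * E)) / 2) \<longlongrightarrow> K) at_top"
    proof -
      have sE: "((\<lambda>u. 1 + complex_of_real (s u) * E) \<longlongrightarrow> 1 + E) at_top"
        using tendsto_add[OF tendsto_const[of 1] tendsto_mult_right[OF tendsto_of_real[OF s_lim], of E]] by simp
      have ex: "((\<lambda>u. exp (Lp (s u))) \<longlongrightarrow> 0) at_top"
      proof -
        have "((\<lambda>u. (1 - complex_of_real (s u)) * E / (1 + of_real (s u) * E)) \<longlongrightarrow> (1 - of_real 1) * E / (1 + E)) at_top"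
          by (intro tendsto_divide sE E1' tendsto_mult tendsto_diff tendsto_const tendsto_of_real s_lim)
        moreover have "eventually (\<lambda>u. (1 - complex_of_real (s u)) * E / (1 + of_real (s u) * E) = exp (Lp (s u))) at_top"
          using eventually_ge_at_top[of 0] by eventually_elim (use exp_Lp s in simp)
        ultimately show ?thesis using Lim_transform_eventually by fastforce
      qed
      have "isCont G 0"
        using holomorphic_on_imp_continuous_on[OF G_hol] open_cutm by (simp add: continuous_on_eq_continuous_at)
      then have Gl: "((\<lambda>u. G (exp (Lp (s u)))) \<longlongrightarrow> G 0) at_top" using ex by (rule isCont_tendsto_compose)
      have Wp: "((\<lambda>u. W u powr \<nu>) \<longlongrightarrow> W1 powr \<nu>) at_top"
      proof -
        have "((\<lambda>u. exp (\<nu> * Ln (W u))) \<longlongrightarrow> exp (\<nu> * Ln W1)) at_top"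
          by (intro tendsto_exp tendsto_mult tendsto_const tendsto_Ln W_lim W1s)
        moreover have "eventually (\<lambda>u. exp (\<nu> * Ln (W u)) = W u powr \<nu>) at_top"
          using tendsto_imp_eventually_ne[OF W_lim W10] by eventually_elim (simp add: powr_def)
        ultimately have "((\<lambda>u. W u powr \<nu>) \<longlongrightarrow> exp (\<nu> * Ln W1)) at_top" by (rule Lim_transform_eventually)
        then show ?thesis using W10 by (simp add: powr_def)
      qed
      show ?thesis unfolding K_def
        by (intro tendsto_divide tendsto_mult tendsto_exp tendsto_diff tendsto_const lam_lim Gl ylim Wp sE E1') simp
    qed
    have lim2: "((\<lambda>u. exp (\<beta> * of_real u) * \<psi> u) \<longlongrightarrow> K) at_top"
    proof (rule Lim_transform_eventually[OF lim])
      show "eventually (\<lambda>u. exp (\<mu> / 2 * (P + Q - lam u)) * (G (exp (Lp (s u))) * ((W u / of_real (r u)) powr (- \<nu>) * yl \<nu> (W u / of_real (r u)) * W u powr \<nu>))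
        * ((1 + E) / (1 + of_real (s u) * E)) / 2 = exp (\<beta> * of_real u) * \<psi> u) at_top"
        using eventually_ge_at_top[of 0] tendsto_imp_eventually_ne[OF W_lim W10]
      proof eventually_elim
        case (elim u)
        note su = s[OF elim(1)]
        have lns: "ln (1 - s u) = - u" by (simp add: s_def)
        have L: "Lp (s u) = - of_real u + (P + Q - lam u)" unfolding Lp_def lns lam_def by simp
        have h: "\<tau> (Lp (s u)) = of_real (r u) * exp (- lam u / 2)"
        proof -
          have "(- of_real u + (P + Q - lam u) - P - Q) / 2 = of_real (- u / 2) + - lam u / 2" by (simp add: field_simps)
          then show ?thesis unfolding \<tau>_def L r_def by (simp only: exp_add exp_of_real)
        qed
        have Z: "ZL (Lp (s u)) = W u / of_real (r u)"
          unfolding ZL_def W_def h by (simp add: exp_minus field_simps)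
        have rp: "(W u / of_real (r u)) powr (- \<nu>) * W u powr \<nu> = exp (- \<nu> * of_real u / 2)"
        proof -
          have "Ln (W u / of_real (r u)) = Ln (W u) - of_real (ln (r u))"
            by (rule Ln_divide_of_real[OF rpos elim(2)])
          also have "complex_of_real (ln (r u)) = - of_real u / 2" by (simp add: r_def)
          finally have "Ln (W u / of_real (r u)) = Ln (W u) + of_real u / 2" by simp
          then show ?thesis using elim(2) rpos[of u] by (simp add: powr_def algebra_simps flip: exp_add)
        qed
        have FLs: "FL (Lp (s u)) = exp (- \<mu> * of_real u / 2) * exp (\<mu> / 2 * (P + Q - lam u)) * (G (exp (Lp (s u))) * yl \<nu> (W u / of_real (r u)))"
          unfolding FL_def Z by (simp add: L algebra_simps add_divide_distrib diff_divide_distrib flip: exp_add)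
        have e1: "1 - complex_of_real (s u) = of_real (exp (- u))" by (simp add: s_def)
        have "exp (\<beta> * of_real u) * \<psi> u = exp (\<beta> * of_real u) * (FL (Lp (s u)) * ((1 + E) / (1 + of_real (s u) * E)) / 2)"
          unfolding \<psi>_def JJ_def e1 scaleR_conv_of_real by simp
        also have "\<dots> = (exp (\<beta> * of_real u) * exp (- \<mu> * of_real u / 2)) * (exp (\<mu> / 2 * (P + Q - lam u)) * (G (exp (Lp (s u))) * yl \<nu> (W u / of_real (r u)))) * ((1 + E) / (1 + of_real (s u) * E)) / 2"
          unfolding FLs by simp
        also have "exp (\<beta> * of_real u) * exp (- \<mu> * of_real u / 2) = (W u / of_real (r u)) powr (- \<nu>) * W u powr \<nu>"
          unfolding rp \<beta>_def by (simp add: field_simps flip: exp_add)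
        finally show ?case by (simp add: mult_ac)
      qed
    qed
    show ?thesis by (rule no_limit_if_exponential_derivative[OF d\<phi> lim2 K0 \<beta>0])
  qed
  ultimately show False by simp
qed

end

section \<open>The product formula\<close>

text \<open>
  \<open>Xl L = - tanh (L / 2)\<close>, with the junk value \<open>0\<close> at the poles.
\<close>

definition Xl :: "complex \<Rightarrow> complex" where
  "Xl L = (1 - exp L) / (1 + exp L)"

lemma one_plus_exp_slit:
  assumes "\<bar>Im L\<bar> < pi"
  shows "1 + exp L \<notin> \<real>\<^sub>\<le>\<^sub>0" and "1 + exp L \<noteq> 0"
proof -
  show "1 + exp L \<notin> \<real>\<^sub>\<le>\<^sub>0"
    by (rule one_plus_slit[of _ "exp (Re L)" "Im L"]) (use assms in \<open>simp_all add: exp_eq_polar\<close>)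
  then show "1 + exp L \<noteq> 0" by (metis nonpos_Reals_zero_I)
qed

lemma Im_Ln_one_plus_exp:
  assumes "\<bar>Im L\<bar> < pi"
  shows "\<exists>c\<in>{0..1}. Im (Ln (1 + exp L)) = c * Im L"
proof -
  have "bt (Im L) (of_real 1 + of_real (exp (Re L)) * cis (Im L))"
    by (rule bt_cone) (use assms in \<open>auto intro: add_pos_nonneg\<close>)
  then obtain r c where r: "r > 0" "c \<in> {0..1}" "1 + exp L = of_real r * cis (c * Im L)"
    by (auto simp: bt_def exp_eq_polar)
  have "\<bar>c * Im L\<bar> \<le> 1 * \<bar>Im L\<bar>" unfolding abs_mult using r(2) by (intro mult_right_mono) auto
  then have a: "\<bar>c * Im L\<bar> < pi" using assms by simp
  have "1 + exp L = exp (Complex (ln r) (c * Im L))"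
    using r by (simp add: exp_eq_polar[of "Complex (ln r) (c * Im L)"] flip: of_real_exp)
  moreover have "Ln (exp (Complex (ln r) (c * Im L))) = Complex (ln r) (c * Im L)"
    by (rule Ln_exp) (use a in auto)
  ultimately show ?thesis using r(2) by (intro bexI[of _ c]) simp_all
qed

lemma one_minus_Xl_squared:
  assumes "1 + exp L \<noteq> 0"
  shows "1 - (Xl L)\<^sup>2 = 4 * exp L / (1 + exp L)\<^sup>2"
proof -
  define v where "v = exp L"
  have "1 + v \<noteq> 0" using assms by (simp add: v_def)
  then show ?thesis unfolding Xl_def v_def[symmetric]
    by (simp add: divide_simps power2_eq_square) (simp add: algebra_simps)
qed

text \<open>The right-hand side has imaginary part \<open>(1 - 2 * c) * Im L\<close> with
  \<open>c\<close> in \<open>[0, 1]\<close>, hence below \<open>pi\<close> in modulus, and no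
  multiple of \<open>2 pi \<i>\<close> intervenes.\<close>

lemma Ln_one_minus_Xl_squared:
  assumes L: "\<bar>Im L\<bar> < pi"
  shows "Ln (1 - (Xl L)\<^sup>2) = of_real (ln 4) + L - 2 * Ln (1 + exp L)"
proof -
  obtain c where c: "c \<in> {0..1}" "Im (Ln (1 + exp L)) = c * Im L" using Im_Ln_one_plus_exp[OF L] by blast
  have "\<bar>(1 - 2 * c) * Im L\<bar> \<le> 1 * \<bar>Im L\<bar>" unfolding abs_mult using c(1) by (intro mult_right_mono) auto
  then have i: "\<bar>Im (of_real (ln 4) + L - 2 * Ln (1 + exp L))\<bar> < pi"
    using L by (simp add: c(2) algebra_simps)
  have "exp (of_real (ln 4) + L - 2 * Ln (1 + exp L)) = exp (of_real (ln 4)) * exp L / (exp (Ln (1 + exp L)) * exp (Ln (1 + exp L)))"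
    by (simp only: exp_diff exp_add mult_2)
  also have "\<dots> = 1 - (Xl L)\<^sup>2"
    using one_plus_exp_slit(2)[OF L] one_minus_Xl_squared[of L] by (simp add: power2_eq_square exp_of_real)
  finally show ?thesis using Ln_exp[of "of_real (ln 4) + L - 2 * Ln (1 + exp L)"] i by auto
qed

lemma one_minus_Xl_squared_nonzero: "\<bar>Im L\<bar> < pi \<Longrightarrow> 1 - (Xl L)\<^sup>2 \<noteq> 0"
  using one_minus_Xl_squared[of L] one_plus_exp_slit(2)[of L] by simp

lemma csqrt_one_minus_Xl_squared:
  assumes L: "\<bar>Im L\<bar> < pi"
  shows "csqrt (1 - (Xl L)\<^sup>2) = 2 * exp (L / 2) / (1 + exp L)"
proof -
  have "csqrt (1 - (Xl L)\<^sup>2) = exp (Ln (1 - (Xl L)\<^sup>2) / 2)"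
    by (rule csqrt_exp_Ln[OF one_minus_Xl_squared_nonzero[OF L]])
  also have "Ln (1 - (Xl L)\<^sup>2) / 2 = of_real (ln 2) + L / 2 - Ln (1 + exp L)"
  proof -
    have "ln (4::real) = 2 * ln 2" using ln_realpow[of "2::real" 2] by simp
    then show ?thesis unfolding Ln_one_minus_Xl_squared[OF L] by (simp add: field_simps)
  qed
  also have "exp (of_real (ln 2) + L / 2 - Ln (1 + exp L)) = 2 * exp (L / 2) / (1 + exp L)"
    using one_plus_exp_slit(2)[OF L] by (simp add: exp_diff exp_add exp_of_real)
  finally show ?thesis .
qed

text \<open>The involution \<open>x\<close> to \<open>(1 - x) / (1 + x)\<close> matches the two
  excluded rays with the nonpositive reals, the points \<open>-1\<close> and infinity being
  exchanged. So the principal logarithm of the image serves as \<open>P\<close>.\<close>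

lemma trig_domain_Xl:
  assumes "x \<in> trig_domain"
  obtains P where "\<bar>Im P\<bar> < pi" "x = Xl P"
proof -
  have x1: "1 + x \<noteq> 0"
  proof
    assume "1 + x = 0"
    then have "x = -1" by (simp add: add_eq_0_iff)
    then show False using assms by (simp add: trig_domain_def)
  qed
  define v where "v = (1 - x) / (1 + x)"
  have v: "v \<notin> \<real>\<^sub>\<le>\<^sub>0"
  proof
    assume "v \<in> \<real>\<^sub>\<le>\<^sub>0"
    then obtain r where r: "v = of_real r" "r \<le> 0" by (auto simp: nonpos_Reals_def)
    have e: "(1 - x) = of_real r * (1 + x)" using r(1) x1 by (simp add: v_def field_simps)
    then have e': "x * (1 + of_real r) = 1 - of_real r" by (simp add: algebra_simps)
    have r1: "1 + r \<noteq> 0"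
    proof
      assume "1 + r = 0"
      then have "r = -1" by simp
      then show False using e' by simp
    qed
    then have c1: "1 + complex_of_real r \<noteq> 0" by (metis of_real_1 of_real_add of_real_eq_0_iff)
    have xr: "x = of_real ((1 - r) / (1 + r))" using e' c1 by (simp add: field_simps)
    have "(1 - r) / (1 + r) \<le> -1 \<or> 1 \<le> (1 - r) / (1 + r)"
      using r(2) r1 by (cases "1 + r > 0") (auto simp: field_simps)
    then show False using assms xr by (simp add: trig_domain_def)
  qed
  then have v0: "v \<noteq> 0" by (metis nonpos_Reals_zero_I)
  have Im: "\<bar>Im (Ln v)\<bar> < pi"
    using Im_Ln_less_pi[OF v] mpi_less_Im_Ln[OF v0] by auto
  have "1 + v = 2 / (1 + x)" "1 - v = 2 * x / (1 + x)" using x1 by (simp_all add: v_def field_simps)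
  then have "Xl (Ln v) = x" using v0 x1 by (simp add: Xl_def)
  with Im show ?thesis using that by metis
qed

text \<open>In the half-exponentials \<open>a\<close>, \<open>b\<close>, \<open>c\<close> the three
  roots are rational and \<open>1 + B\<close> splits into four factors. Dividing them by
  \<open>a * b\<close>, \<open>b\<close> and \<open>a\<close> gives the numerator of
  \<open>RR\<close> at \<open>t = c / (a * b)\<close>.\<close>

lemma legendre_arg_identity:
  fixes a b c :: complex
  assumes nz: "a \<noteq> 0" "b \<noteq> 0" "c \<noteq> 0" "1 + a\<^sup>2 \<noteq> 0" "1 + b\<^sup>2 \<noteq> 0" "1 + c\<^sup>2 \<noteq> 0"
    and x: "x1 = (1 - a\<^sup>2) / (1 + a\<^sup>2)" "x2 = (1 - b\<^sup>2) / (1 + b\<^sup>2)" "x3 = (1 - c\<^sup>2) / (1 + c\<^sup>2)"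
    and s: "csqrt (1 - x1\<^sup>2) = 2 * a / (1 + a\<^sup>2)" "csqrt (1 - x2\<^sup>2) = 2 * b / (1 + b\<^sup>2)" "csqrt (1 - x3\<^sup>2) = 2 * c / (1 + c\<^sup>2)"
  shows "(1 + legendre_arg x1 x2 x3) / 2 =
    (a * b + c) * (b + a * c) * (a + b * c) * (1 + a * b * c) / (2 * (a * b * c) * ((1 + a\<^sup>2) * (1 + b\<^sup>2) * (1 + c\<^sup>2)))"
proof -
  define A B C where "A = 1 + a\<^sup>2" and "B = 1 + b\<^sup>2" and "C = 1 + c\<^sup>2"
  have ABC: "A \<noteq> 0" "B \<noteq> 0" "C \<noteq> 0" using nz by (simp_all add: A_def B_def C_def)
  define u v t where "u = 1 - a\<^sup>2" and "v = 1 - b\<^sup>2" and "t = 1 - c\<^sup>2"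
  define N where "N = 2 * (A * B * C)\<^sup>2 - (u * B * C)\<^sup>2 - (v * A * C)\<^sup>2 - (t * A * B)\<^sup>2 + (u * v * t)\<^sup>2"
  have q: "x1 = u / A" "x2 = v / B" "x3 = t / C" using x by (simp_all add: A_def B_def C_def u_def v_def t_def)
  have "2 - x1\<^sup>2 - x2\<^sup>2 - x3\<^sup>2 + x1\<^sup>2 * x2\<^sup>2 * x3\<^sup>2 = N / (A * B * C)\<^sup>2"
    unfolding q N_def using ABC by (simp add: power_divide power_mult_distrib add_divide_distrib diff_divide_distrib)
  moreover have "2 * (csqrt (1 - x1\<^sup>2) * csqrt (1 - x2\<^sup>2) * csqrt (1 - x3\<^sup>2)) = 16 * (a * b * c) / (A * B * C)"
    unfolding s A_def B_def C_def by simp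
  ultimately have "legendre_arg x1 x2 x3 = (N / (A * B * C)\<^sup>2) / (16 * (a * b * c) / (A * B * C))"
    by (simp add: legendre_arg_def)
  also have "\<dots> = N / (16 * (a * b * c) * (A * B * C))"
    using ABC nz by (simp add: power2_eq_square)
  finally have l: "legendre_arg x1 x2 x3 = N / (16 * (a * b * c) * (A * B * C))" .
  have n: "16 * (a * b * c) * (A * B * C) + N = 16 * ((a * b + c) * (b + a * c) * (a + b * c) * (1 + a * b * c))"
    unfolding N_def A_def B_def C_def u_def v_def t_def by algebra
  have d: "16 * (a * b * c) * (A * B * C) \<noteq> 0" using ABC nz by simp
  have "(1 + legendre_arg x1 x2 x3) / 2 = (16 * (a * b * c) * (A * B * C) + N) / (16 * (a * b * c) * (A * B * C)) / 2"
    unfolding l using d by (simp only: add_divide_distrib divide_self not_False_eq_True)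
  also have "\<dots> = (a * b + c) * (b + a * c) * (a + b * c) * (1 + a * b * c) / (2 * (a * b * c) * (A * B * C))"
  proof -
    have "16 * x / (16 * y * z) / 2 = x / (2 * y * z)" for x y z :: complex by simp
    then show ?thesis unfolding n .
  qed
  finally show ?thesis unfolding A_def B_def C_def .
qed

lemma legendre_arg_Xl:
  assumes "\<bar>Im P\<bar> < pi" "\<bar>Im Q\<bar> < pi" "\<bar>Im L\<bar> < pi"
  defines "a \<equiv> exp (P / 2)" and "b \<equiv> exp (Q / 2)" and "c \<equiv> exp (L / 2)"
  shows "(1 + legendre_arg (Xl P) (Xl Q) (Xl L)) / 2 =
    (a * b + c) * (b + a * c) * (a + b * c) * (1 + a * b * c) / (2 * (a * b * c) * ((1 + a\<^sup>2) * (1 + b\<^sup>2) * (1 + c\<^sup>2)))"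
proof (rule legendre_arg_identity)
  have e: "(exp (z / 2))\<^sup>2 = exp z" for z :: complex by (simp add: power2_eq_square flip: exp_add)
  note abc = a_def b_def c_def
  show "a \<noteq> 0" "b \<noteq> 0" "c \<noteq> 0" by (simp_all add: abc)
  show "1 + a\<^sup>2 \<noteq> 0" "1 + b\<^sup>2 \<noteq> 0" "1 + c\<^sup>2 \<noteq> 0" using one_plus_exp_slit(2) assms(1-3) by (simp_all add: abc e)
  show "Xl P = (1 - a\<^sup>2) / (1 + a\<^sup>2)" "Xl Q = (1 - b\<^sup>2) / (1 + b\<^sup>2)" "Xl L = (1 - c\<^sup>2) / (1 + c\<^sup>2)"
    by (simp_all add: abc e Xl_def)
  show "csqrt (1 - (Xl P)\<^sup>2) = 2 * a / (1 + a\<^sup>2)" "csqrt (1 - (Xl Q)\<^sup>2) = 2 * b / (1 + b\<^sup>2)" "csqrt (1 - (Xl L)\<^sup>2) = 2 * c / (1 + c\<^sup>2)"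
    using csqrt_one_minus_Xl_squared assms(1-3) by (simp_all add: abc e)
qed

text \<open>The addition theorem of tanh, which sends the lower limit of integration to
  \<open>P + Q\<close>.\<close>

lemma Xl_add:
  assumes "1 + exp P \<noteq> 0" "1 + exp Q \<noteq> 0"
  shows "1 + Xl P * Xl Q = 2 * (1 + exp (P + Q)) / ((1 + exp P) * (1 + exp Q))"
    and "1 + Xl P * Xl Q \<noteq> 0 \<Longrightarrow> (Xl P + Xl Q) / (1 + Xl P * Xl Q) = Xl (P + Q)"
proof -
  define u v where "u = exp P" and "v = exp Q"
  have uv: "1 + u \<noteq> 0" "1 + v \<noteq> 0" using assms by (simp_all add: u_def v_def)
  have d: "(1 + u) * (1 + v) \<noteq> 0" using uv by simp
  have "1 + (1 - u) / (1 + u) * ((1 - v) / (1 + v)) = ((1 + u) * (1 + v) + (1 - u) * (1 - v)) / ((1 + u) * (1 + v))"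
    using d by (simp add: add_divide_distrib)
  also have "(1 + u) * (1 + v) + (1 - u) * (1 - v) = 2 * (1 + u * v)" by (simp add: algebra_simps)
  finally show 1: "1 + Xl P * Xl Q = 2 * (1 + exp (P + Q)) / ((1 + exp P) * (1 + exp Q))"
    by (simp add: Xl_def u_def v_def exp_add)
  have "(1 - u) / (1 + u) + (1 - v) / (1 + v) = ((1 - u) * (1 + v) + (1 - v) * (1 + u)) / ((1 + u) * (1 + v))"
    using uv by (rule add_frac_eq)
  also have "(1 - u) * (1 + v) + (1 - v) * (1 + u) = 2 * (1 - u * v)" by (simp add: algebra_simps)
  finally have 2: "Xl P + Xl Q = 2 * (1 - exp (P + Q)) / ((1 + exp P) * (1 + exp Q))"
    by (simp add: Xl_def u_def v_def exp_add)
  show "(Xl P + Xl Q) / (1 + Xl P * Xl Q) = Xl (P + Q)" if "1 + Xl P * Xl Q \<noteq> 0"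
  proof -
    define D where "D = (1 + exp P) * (1 + exp Q)"
    have D: "D \<noteq> 0" using assms by (simp add: D_def)
    have "(Xl P + Xl Q) / (1 + Xl P * Xl Q) = (2 * (1 - exp (P + Q)) / D) / (2 * (1 + exp (P + Q)) / D)"
      unfolding 1 2 D_def ..
    also have "\<dots> = (1 - exp (P + Q)) / (1 + exp (P + Q))"
      using D by (simp del: distrib_left_numeral right_diff_distrib_numeral)
    finally show ?thesis by (simp add: Xl_def)
  qed
qed

lemma angle_condition:
  assumes P: "\<bar>Im P\<bar> < pi" and Q: "\<bar>Im Q\<bar> < pi"
    and ex: "product_integral_exists l \<alpha> (Xl P) (Xl Q)"
  shows "\<bar>Im P + Im Q\<bar> < pi"
proof (rule ccontr)
  assume neg: "\<not> \<bar>Im P + Im Q\<bar> < pi"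
  have nz: "1 + Xl P * Xl Q \<noteq> 0" using ex by (simp add: product_integral_exists_def)
  define w where "w = (Xl P + Xl Q) / (1 + Xl P * Xl Q)"
  have w: "w = Xl (P + Q)" unfolding w_def by (rule Xl_add(2)[OF one_plus_exp_slit(2)[OF P] one_plus_exp_slit(2)[OF Q] nz])
  have E1: "1 + exp (P + Q) \<noteq> 0"
  proof
    assume z: "1 + exp (P + Q) = 0"
    have "1 + Xl P * Xl Q = 0"
      unfolding Xl_add(1)[OF one_plus_exp_slit(2)[OF P] one_plus_exp_slit(2)[OF Q]] z by simp
    with nz show False by simp
  qed
  have w1: "w \<noteq> 1"
  proof
    assume "w = 1"
    then have "1 - exp (P + Q) = 1 + exp (P + Q)" using E1 unfolding w Xl_def by simp
    then have "exp (P + Q) = 0" by simp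
    then show False by simp
  qed
  have "\<forall>x3 \<in> closed_segment w 1 - {1}. x3 \<in> trig_domain \<and> legendre_arg (Xl P) (Xl Q) x3 \<notin> {z. z \<in> \<real> \<and> Re z \<le> - 1}"
    using ex unfolding product_integral_exists_def w_def by blast
  then have wt: "w \<in> trig_domain" and wa: "legendre_arg (Xl P) (Xl Q) w \<notin> {z. z \<in> \<real> \<and> Re z \<le> - 1}"
    using w1 by auto
  show False
  proof (cases "\<bar>Im P + Im Q\<bar> = pi")
    case True
    \<comment> \<open>Here \<open>exp (P + Q)\<close> is a negative real, so the lower limit is real
      of modulus above \<open>1\<close> and leaves \<open>trig_domain\<close>.\<close>
    define r where "r = exp (Re P + Re Q)"
    have "Im P + Im Q = pi \<or> Im P + Im Q = - pi" using True by linarith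
    then have "cos (Im P + Im Q) = -1 \<and> sin (Im P + Im Q) = 0"
      by (elim disjE) simp_all
    then have "exp (P + Q) = of_real (- r)" by (simp add: complex_eq_iff Re_exp Im_exp r_def)
    then have wr: "w = of_real ((1 + r) / (1 - r))" and r1: "r \<noteq> 1" using w E1 by (auto simp: Xl_def)
    have "r > 0" by (simp add: r_def)
    then have "(1 + r) / (1 - r) \<le> -1 \<or> 1 \<le> (1 + r) / (1 - r)"
      using r1 by (cases "1 - r > 0") (auto simp: field_simps)
    then show False using wt wr by (simp add: trig_domain_def)
  next
    case False
    \<comment> \<open>Returning \<open>P + Q\<close> to the strip by \<open>2 n pi \<i>\<close> flips the sign of \<open>exp (L / 2)\<close>, which makes the argument \<open>B\<close> equal to \<open>-1\<close>.\<close>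
    define n where "n = (if Im P + Im Q > 0 then -1 else 1 :: real)"
    define L where "L = P + Q + of_real (2 * n * pi) * \<i>"
    have L: "\<bar>Im L\<bar> < pi" using False neg P Q by (auto simp: L_def n_def abs_if split: if_splits)
    have n: "n = 1 \<or> n = -1" by (auto simp: n_def)
    have "exp (of_real (2 * n * pi) * \<i>) = (1::complex)" "exp (of_real (n * pi) * \<i>) = (-1::complex)"
      using n by (auto simp: exp_eq_polar complex_eq_iff)
    then have eL: "exp L = exp (P + Q)" and eL2: "exp (L / 2) = - (exp (P / 2) * exp (Q / 2))"
      by (simp_all add: L_def exp_add add_divide_distrib mult.assoc)
    have "w = Xl L" unfolding w Xl_def eL ..
    then have "(1 + legendre_arg (Xl P) (Xl Q) w) / 2 = 0"
      using legendre_arg_Xl[OF P Q L] unfolding eL2 by simp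
    then have "legendre_arg (Xl P) (Xl Q) w = -1" by (simp add: add_eq_0_iff)
    then show False using wa by simp
  qed
qed

lemma cutm_quotient: "p \<in> cutm \<Longrightarrow> p / (1 + p) \<in> cut1" "p \<in> cutm \<Longrightarrow> 1 + p \<noteq> 0"
proof -
  assume p: "p \<in> cutm"
  then have s: "1 + p \<notin> \<real>\<^sub>\<le>\<^sub>0" by (simp add: cutm_def)
  then show nz: "1 + p \<noteq> 0" by (metis nonpos_Reals_zero_I)
  show "p / (1 + p) \<in> cut1"
  proof (rule ccontr)
    assume "p / (1 + p) \<notin> cut1"
    then have "p / (1 + p) \<in> \<real>" and R: "Re (p / (1 + p)) \<ge> 1" by (auto simp: cut1_def)
    then obtain r where r: "p / (1 + p) = of_real r" "r \<ge> 1" by (auto elim!: Reals_cases)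
    have "1 - p / (1 + p) = 1 / (1 + p)" using nz by (simp add: field_simps)
    then have e: "1 / (1 + p) = of_real (1 - r)" by (simp add: r(1))
    have "1 / of_real (1 - r) = 1 + p" unfolding e[symmetric] by simp
    then have "1 + p = of_real (1 / (1 - r))" by simp
    moreover have "1 / (1 - r) \<le> 0" using r(2) by (simp add: divide_le_0_iff)
    ultimately have "1 + p \<in> \<real>\<^sub>\<le>\<^sub>0" by (simp only: nonpos_Reals_of_real_iff)
    with s show False by simp
  qed
qed

text \<open>Substituting the power times \<open>F\<close> leaves a residual term with coefficient
  \<open>e * (e + \<mu>)\<close>, hence the second relation. Its root \<open>- \<mu>\<close> is used
  in the generic case, and the root \<open>0\<close>, with \<open>m\<close> in the role of
  \<open>\<mu>\<close>, in the exceptional one.\<close>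

lemma legendre_solution_from_hyp:
  assumes F: "is_hyp a b (\<mu> + 1) F"
    and ab: "a + b = 1 - 2 * e" "e * (e + \<mu>) = 0" "a * b + (1 + \<mu>) * e + \<nu> * (\<nu> + 1) = 0"
  defines "G \<equiv> \<lambda>p. (1 + p) powr e * F (p / (1 + p))"
  shows "G holomorphic_on cutm"
    and "p \<in> cutm \<Longrightarrow> p * deriv (deriv G) p + (1 + \<mu>) * deriv G p + \<nu> * (\<nu> + 1) * (1 / (1 + p)\<^sup>2) * G p = 0"
proof -
  have Fh: "F holomorphic_on cut1" using F by (simp add: is_hyp_def)
  have F1: "(F has_field_derivative deriv F w) (at w)" "(deriv F has_field_derivative deriv (deriv F) w) (at w)" if "w \<in> cut1" for w
    using holomorphic_derivI[OF Fh open_cut1] holomorphic_derivI[OF holomorphic_deriv[OF Fh open_cut1] open_cut1] that by auto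
  define G1 where "G1 p = (1 + p) powr e * (e / (1 + p) * F (p / (1 + p)) + 1 / (1 + p)\<^sup>2 * deriv F (p / (1 + p)))" for p
  have dw: "((\<lambda>p. p / (1 + p)) has_field_derivative 1 / (1 + p)\<^sup>2) (at p)" if "p \<in> cutm" for p
    using cutm_quotient(2)[OF that] by (auto intro!: derivative_eq_intros simp: power2_eq_square)
  have dF: "((\<lambda>p. F (p / (1 + p))) has_field_derivative deriv F (p / (1 + p)) * (1 / (1 + p)\<^sup>2)) (at p)"
    and dF1: "((\<lambda>p. deriv F (p / (1 + p))) has_field_derivative deriv (deriv F) (p / (1 + p)) * (1 / (1 + p)\<^sup>2)) (at p)" if "p \<in> cutm" for p
    by (rule DERIV_chain2[where g = "\<lambda>p. p / (1 + p)", OF F1(1)[OF cutm_quotient(1)[OF that]] dw[OF that]],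
        rule DERIV_chain2[where g = "\<lambda>p. p / (1 + p)", OF F1(2)[OF cutm_quotient(1)[OF that]] dw[OF that]])
  have dpw: "((\<lambda>p. (1 + p) powr e) has_field_derivative (1 + p) powr e * (e / (1 + p))) (at p)" if "p \<in> cutm" for p
  proof -
    have "((\<lambda>p. (1 + p) powr e) has_field_derivative e * (1 + p) powr (e - 1) * 1) (at p)"
      by (rule derivative_eq_intros refl | use that in \<open>simp add: cutm_def\<close>)+
    then show ?thesis using cutm_quotient(2)[OF that] by (simp add: powr_diff mult_ac)
  qed
  have d1: "(G has_field_derivative G1 p) (at p)" if "p \<in> cutm" for p
    unfolding G_def
    by (rule DERIV_cong[OF DERIV_mult[OF dpw[OF that] dF[OF that]]]) (simp add: G1_def algebra_simps)
  show "G holomorphic_on cutm"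
    using d1 holomorphic_on_open[OF open_cutm] by blast
  show "p * deriv (deriv G) p + (1 + \<mu>) * deriv G p + \<nu> * (\<nu> + 1) * (1 / (1 + p)\<^sup>2) * G p = 0" if p: "p \<in> cutm"
  proof -
    define T where "T = (1 + p) powr e"
    define v where "v = 1 + p"
    have v: "v \<noteq> 0" using cutm_quotient(2)[OF p] by (simp add: v_def)
    define f f1 f2 where "f = F (p / v)" and "f1 = deriv F (p / v)" and "f2 = deriv (deriv F) (p / v)"
    have i1: "((\<lambda>p. e / (1 + p)) has_field_derivative - e / v\<^sup>2) (at p)"
      and i2: "((\<lambda>p. 1 / (1 + p)\<^sup>2) has_field_derivative - 2 / v ^ 3) (at p)"
      using v by (auto intro!: derivative_eq_intros simp: v_def divide_simps power2_eq_square power3_eq_cube)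
    have "(G1 has_field_derivative T * (e / v) * (e / v * f + 1 / v\<^sup>2 * f1)
        + (((- e / v\<^sup>2) * f + f1 * (1 / v\<^sup>2) * (e / v)) + ((- 2 / v ^ 3) * f1 + f2 * (1 / v\<^sup>2) * (1 / v\<^sup>2))) * T) (at p)"
      unfolding G1_def T_def f_def f1_def f2_def v_def
      by (intro DERIV_mult DERIV_add dpw[OF p] dF[OF p] dF1[OF p] i1[unfolded v_def] i2[unfolded v_def])
    then have "(deriv G has_field_derivative T * (e / v) * (e / v * f + 1 / v\<^sup>2 * f1)
        + (((- e / v\<^sup>2) * f + f1 * (1 / v\<^sup>2) * (e / v)) + ((- 2 / v ^ 3) * f1 + f2 * (1 / v\<^sup>2) * (1 / v\<^sup>2))) * T) (at p)"
      by (rule has_field_derivative_transform_within_open[OF _ open_cutm p]) (use DERIV_imp_deriv[OF d1] in auto)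
    then have g2: "deriv (deriv G) p = T * (e / v) * (e / v * f + 1 / v\<^sup>2 * f1)
        + (((- e / v\<^sup>2) * f + f1 * (1 / v\<^sup>2) * (e / v)) + ((- 2 / v ^ 3) * f1 + f2 * (1 / v\<^sup>2) * (1 / v\<^sup>2))) * T"
      by (rule DERIV_imp_deriv)
    have g1: "deriv G p = T * (e / v * f + 1 / v\<^sup>2 * f1)"
      using DERIV_imp_deriv[OF d1[OF p]] by (simp add: G1_def T_def f_def f1_def v_def)
    have g0: "G p = T * f" by (simp add: G_def T_def f_def v_def)
    define w where "w = p / v"
    have pw: "p = w * v" using v by (simp add: w_def)
    have w1: "1 - w = 1 / v" using v by (simp add: w_def v_def field_simps)
    have "w * (1 - w) * f2 + (\<mu> + 1 - (a + b + 1) * w) * f1 - a * b * f = 0"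
      using is_hyp_ode[OF F cutm_quotient(1)[OF p]] by (simp add: f_def f1_def f2_def v_def w_def)
    then have ode: "w * (1 / v) * f2 + (\<mu> + 1 - (2 - 2 * e) * w) * f1 - a * b * f = 0"
      unfolding w1 ab(1) by (simp add: algebra_simps)
    have "v\<^sup>2 * (p * deriv (deriv G) p + (1 + \<mu>) * deriv G p + \<nu> * (\<nu> + 1) * (1 / (1 + p)\<^sup>2) * G p)
      = T * (w * v * (e * e - e) * f + w * (2 * e - 2) * f1 + w * (1 / v) * f2 + (1 + \<mu>) * (e * v * f + f1) + \<nu> * (\<nu> + 1) * f)"
    proof -
      \<comment> \<open>Writing \<open>u\<close> for \<open>1 / v\<close> with the relation
        \<open>v * u = 1\<close> makes the claim polynomial and accessible to
        \<open>algebra\<close>.\<close>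
      have "v\<^sup>2 * ((w * v) * (T * (e * u) * (e * u * f + u\<^sup>2 * f1) + (((- e * u\<^sup>2) * f + f1 * u\<^sup>2 * (e * u)) + ((- 2 * u ^ 3) * f1 + f2 * u\<^sup>2 * u\<^sup>2)) * T)
          + (1 + \<mu>) * (T * (e * u * f + u\<^sup>2 * f1)) + N * u\<^sup>2 * (T * f))
        = T * (w * v * (e * e - e) * f + w * (2 * e - 2) * f1 + w * u * f2 + (1 + \<mu>) * (e * v * f + f1) + N * f)"
        if "v * u = 1" for u N using that by algebra
      from this[of "1 / v" "\<nu> * (\<nu> + 1)"] show ?thesis
        unfolding g2 g1 g0 v_def[symmetric] pw[symmetric] using v by (simp add: power_one_over)
    qed
    also have "\<dots> = T * ((w * (1 / v) * f2 + (\<mu> + 1 - (2 - 2 * e) * w) * f1 - a * b * f)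
        + (a * b + (1 + \<mu>) * e + \<nu> * (\<nu> + 1)) * f + (1 + \<mu>) * e * (v - 1) * f + w * v * (e * e - e) * f)"
      by (simp add: algebra_simps)
    also have "v - 1 = w * v" using pw by (simp add: v_def)
    also have "T * ((w * (1 / v) * f2 + (\<mu> + 1 - (2 - 2 * e) * w) * f1 - a * b * f)
        + (a * b + (1 + \<mu>) * e + \<nu> * (\<nu> + 1)) * f + (1 + \<mu>) * e * (w * v) * f + w * v * (e * e - e) * f)
      = T * (w * v * (e * (e + \<mu>)) * f)"
      unfolding ode ab(3) by (simp add: algebra_simps)
    finally show ?thesis using v ab(2) by simp
  qed
qed

text \<open>Treats the generic and the exceptional case together: \<open>\<mu>'\<close> is the
  exponent that actually governs the behaviour at \<open>p = 0\<close>, either \<open>\<mu>\<close>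
  or \<open>m = - \<mu>\<close>. The constant is compared only under
  \<open>Re \<mu>' > Re \<nu>\<close>, which is derived from the existence of the integral.\<close>

lemma gegenbauer_product:
  fixes \<mu> \<mu>' \<nu> k Const \<alpha> l :: complex
  assumes P: "\<bar>Im P\<bar> < pi" and Q: "\<bar>Im Q\<bar> < pi" and ex: "product_integral_exists l \<alpha> (Xl P) (Xl Q)"
    and G: "G holomorphic_on cutm"
      "\<And>p. p \<in> cutm \<Longrightarrow> p * deriv (deriv G) p + (1 + \<mu>') * deriv G p + \<nu> * (\<nu> + 1) * (1 / (1 + p)\<^sup>2) * G p = 0"
    and G0: "G 0 \<noteq> 0" and k0: "k \<noteq> 0"
    and Cf: "\<And>L. \<bar>Im L\<bar> < pi \<Longrightarrow> gegenbauer_C l \<alpha> (Xl L) * (1 - (Xl L)\<^sup>2) powr (\<mu> / 2) = k * (exp (\<mu>' * L / 2) * G (exp L))"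
    and pos: "Re \<mu>' + Re \<nu> + 1 > 0" and \<nu>: "\<nu> = l + \<alpha> - 1 / 2" and \<mu>: "\<mu> = \<alpha> - 1 / 2"
    and const: "Re \<mu>' > Re \<nu> \<Longrightarrow> k * G 0 = Const * mellin \<nu> (\<mu>' + 1)"
  shows "gegenbauer_C l \<alpha> (Xl P) * gegenbauer_C l \<alpha> (Xl Q) =
    Const / ((1 - (Xl P)\<^sup>2) powr (\<alpha> / 2 - 1 / 4) * (1 - (Xl Q)\<^sup>2) powr (\<alpha> / 2 - 1 / 4))
      * contour_integral (linepath ((Xl P + Xl Q) / (1 + Xl P * Xl Q)) 1) (product_integrand l \<alpha> (Xl P) (Xl Q))"
proof -
  have PQ: "\<bar>Im P + Im Q\<bar> < pi" by (rule angle_condition[OF P Q ex])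
  interpret path_pair P Q \<mu>' \<nu> G
    by unfold_locales (use P Q PQ G in auto)
  have nz: "1 + Xl P * Xl Q \<noteq> 0" using ex by (simp add: product_integral_exists_def)
  define w where "w = (Xl P + Xl Q) / (1 + Xl P * Xl Q)"
  have "w = Xl (P + Q)"
    unfolding w_def by (rule Xl_add(2)[OF one_plus_exp_slit(2)[OF P] one_plus_exp_slit(2)[OF Q] nz])
  then have wE: "w = (1 - E) / (1 + E)" by (simp add: Xl_def E_def)
  have E1: "1 + E \<noteq> 0" using one_plus_sE'[of 1] by simp
  have E0: "E \<noteq> 0" by (simp add: E_def)
  have pi: "product_integrand l \<alpha> (Xl P) (Xl Q) (linepath w 1 s) * (1 - w) = k * JJ s" if s: "s \<in> {0..1} - {1}" for s
  proof -
    have s': "0 \<le> s" "s < 1" using s by auto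
    define L where "L = Lp s"
    have L: "\<bar>Im L\<bar> < pi" unfolding L_def by (rule strip_pi[OF Lp_strip[OF s']])
    have sE: "1 + of_real s * E \<noteq> 0" by (rule one_plus_sE'[OF s'(1)])
    have s1: "1 - complex_of_real s \<noteq> 0" using s' by (metis of_real_1 of_real_diff of_real_eq_0_iff diff_gt_0_iff_gt less_irrefl)
    have eL: "exp L = (1 - of_real s) * E / (1 + of_real s * E)" unfolding L_def by (rule exp_Lp[OF s'])
    have w1: "1 - w = 2 * E / (1 + E)" "1 + w = 2 / (1 + E)" using E1 by (simp_all add: wE field_simps)
    define z where "z = linepath w 1 s"
    have "z = w + of_real s * (1 - w)" by (simp add: z_def linepath_def scaleR_conv_of_real algebra_simps)
    then have z: "1 - z = (1 - of_real s) * (1 - w)" "1 + z = (1 + w) + of_real s * (1 - w)" by (simp_all add: algebra_simps)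
    have z2: "1 + z = 2 * (1 + of_real s * E) / (1 + E)" 
    proof -
      have "1 + z = 2 / (1 + E) + of_real s * (2 * E / (1 + E))" unfolding z(2) unfolding w1 ..
      also have "\<dots> = (2 + of_real s * (2 * E)) / (1 + E)" by (simp only: add_divide_distrib times_divide_eq_right)
      finally show ?thesis by (simp add: algebra_simps)
    qed
    have z1: "1 - z = 2 * ((1 - of_real s) * E) / (1 + E)" unfolding z(1) w1 by simp
    have zX: "z = Xl L"
    proof -
      define D where "D = 1 + of_real s * E"
      have D: "D \<noteq> 0" using sE by (simp add: D_def)
      have n: "1 + exp L = (1 + E) / D" "1 - exp L = (D - (1 - of_real s) * E) / D"
        unfolding eL using D by (simp_all add: D_def field_simps)
      have "Xl L = (D - (1 - of_real s) * E) / (1 + E)" unfolding Xl_def n using D by simp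
      moreover have "2 * z = 2 * ((D - (1 - of_real s) * E) / (1 + E))"
      proof -
        have "2 * z = (1 + z) - (1 - z)" by simp
        also have "\<dots> = 2 * D / (1 + E) - 2 * ((1 - of_real s) * E) / (1 + E)" unfolding z1 z2 D_def ..
        also have "\<dots> = 2 * ((D - (1 - of_real s) * E) / (1 + E))"
          by (simp only: diff_divide_distrib right_diff_distrib times_divide_eq_right)
        finally show ?thesis .
      qed
      ultimately show ?thesis by (metis mult_cancel_left zero_neq_numeral)
    qed
    have zz: "1 - z\<^sup>2 = (1 - z) * (1 + z)" by (simp add: power2_eq_square algebra_simps)
    have q: "(1 - w) / (1 - z\<^sup>2) = (1 + E) / ((1 - of_real s) * (1 + of_real s * E)) / 2"
    proof -
      have "1 - w \<noteq> 0" unfolding w1 using E0 E1 by simp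
      moreover have "W / (A * W * (2 * D / V)) = V / (A * D) / 2" if "W \<noteq> 0" for W A D V :: complex
        using that by simp
      ultimately show ?thesis unfolding zz z(1) z2 by blast
    qed
    have z20: "1 - z\<^sup>2 \<noteq> 0" unfolding zX by (rule one_minus_Xl_squared_nonzero[OF L])
    have leg: "legendre_P (l + \<alpha> - 1 / 2) (legendre_arg (Xl P) (Xl Q) z) = yl \<nu> (ZL L)"
    proof -
      define a b c where "a = exp (P / 2)" and "b = exp (Q / 2)" and "c = exp (L / 2)"
      have e: "(exp (x / 2))\<^sup>2 = exp x" for x :: complex by (simp add: power2_eq_square flip: exp_add)
      have abc: "a \<noteq> 0" "b \<noteq> 0" "c \<noteq> 0" by (simp_all add: a_def b_def c_def)
      have pq: "p = a\<^sup>2" "q = b\<^sup>2" by (simp_all add: p_def q_def a_def b_def e)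
      have "\<tau> L * (a * b) = c" by (simp add: \<tau>_def a_def b_def c_def field_simps flip: exp_add)
      then have t: "\<tau> L = c / (a * b)" using abc by (simp add: field_simps)
      have cL: "p * q * (\<tau> L)\<^sup>2 = c\<^sup>2" unfolding pq_tau c_def e ..
      have m: "1 + c / (a * b) = (a * b + c) / (a * b)" "1 + a\<^sup>2 * (c / (a * b)) = (b + a * c) / b"
        "1 + b\<^sup>2 * (c / (a * b)) = (a + b * c) / a" "1 + a\<^sup>2 * b\<^sup>2 * (c / (a * b)) = 1 + a * b * c"
        using abc by (simp_all add: field_simps power2_eq_square)
      have "ZL L = ((a * b + c) / (a * b) * ((b + a * c) / b) * ((a + b * c) / a) * (1 + a * b * c)) / (2 * (1 + a\<^sup>2) * (1 + b\<^sup>2) * (1 + c\<^sup>2)) / (c / (a * b))"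
        unfolding ZL_def RR_def cL unfolding t pq m ..
      also have "\<dots> = (a * b + c) * (b + a * c) * (a + b * c) * (1 + a * b * c) / (2 * (a * b * c) * ((1 + a\<^sup>2) * (1 + b\<^sup>2) * (1 + c\<^sup>2)))"
      proof -
        have "(X1 / (a * b) * (X2 / b) * (X3 / a) * X4) / (2 * Y1 * Y2 * Y3) / (c / (a * b)) = X1 * X2 * X3 * X4 / (2 * (a * b * c) * (Y1 * Y2 * Y3))" for X1 X2 X3 X4 Y1 Y2 Y3
          using abc by (simp add: divide_simps)
        then show ?thesis .
      qed
      also have "\<dots> = (1 + legendre_arg (Xl P) (Xl Q) (Xl L)) / 2"
        unfolding a_def b_def c_def by (rule legendre_arg_Xl[OF P Q L, symmetric])
      finally have "ZL L = (1 + legendre_arg (Xl P) (Xl Q) z) / 2" unfolding zX .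
      then show ?thesis unfolding legendre_P_yl \<nu> by (simp only:)
    qed
    \<comment> \<open>The exponent is \<open>\<mu> / 2 - 1\<close>. The first factor is absorbed by
      \<open>Cf\<close>, and \<open>(1 - w) / (1 - z^2)\<close> is minus half the derivative of
      \<open>Lp\<close>.\<close>
    have "(1 - z\<^sup>2) powr (\<alpha> / 2 - 5 / 4) = (1 - z\<^sup>2) powr (\<mu> / 2) / (1 - z\<^sup>2)"
    proof -
      have "\<alpha> / 2 - 5 / 4 = \<mu> / 2 - 1" by (simp add: \<mu> field_simps)
      then show ?thesis using z20 by (simp add: powr_diff)
    qed
    then have "product_integrand l \<alpha> (Xl P) (Xl Q) z * (1 - w)
      = (gegenbauer_C l \<alpha> (Xl L) * (1 - (Xl L)\<^sup>2) powr (\<mu> / 2)) * yl \<nu> (ZL L) * ((1 - w) / (1 - z\<^sup>2))"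
      unfolding product_integrand_def leg by (simp add: zX)
    also have "\<dots> = k * JJ s"
      unfolding Cf[OF L] unfolding q JJ_def FL_def L_def by simp
    finally show ?thesis by (simp add: z_def)
  qed
  have ci: "product_integrand l \<alpha> (Xl P) (Xl Q) contour_integrable_on linepath w 1"
    using ex by (simp add: product_integral_exists_def w_def)
  define I where "I = contour_integral (linepath w 1) (product_integrand l \<alpha> (Xl P) (Xl Q))"
  have "(product_integrand l \<alpha> (Xl P) (Xl Q) has_contour_integral I) (linepath w 1)"
    unfolding I_def by (rule has_contour_integral_integral[OF ci])
  then have hi: "((\<lambda>s. k * JJ s) has_integral I) {0..1}"
    unfolding has_contour_integral_linepath
    by (rule has_integral_spike[of "{1}", rotated 2]) (use pi in auto)
  then have hJ: "(JJ has_integral I / k) {0..1}"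
    using has_integral_mult_right[OF hi, of "1 / k"] k0 by simp
  then have Ji: "JJ integrable_on {0..1}" and JI: "integral {0..1} JJ = I / k"
    by (auto simp: integrable_on_def integral_unique)
  have conv: "Re \<mu>' > Re \<nu>"
  proof (rule ccontr)
    assume "\<not> Re \<mu>' > Re \<nu>"
    \<comment> \<open>Together with \<open>pos\<close> the inequality
      \<open>Re \<mu>' \<le> Re \<nu>\<close> forces \<open>Re \<nu> > -1/2\<close>, the range of
      \<open>yl_limit\<close>.\<close>
    then have "\<not> JJ integrable_on {0..1}" using pos G0 by (intro not_integrable_JJ) auto
    with Ji show False by simp
  qed
  interpret K: kernel_path \<mu>' \<nu> G P Q
    by unfold_locales (use G conv pos in auto)
  have "((\<lambda>\<eta>. integral {0..1 - \<eta>} JJ) \<longlongrightarrow> integral {0..1} JJ) (at_right 0)"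
  proof -
    have c: "continuous_on {0..1} (\<lambda>x. integral {0..x} JJ)" by (rule indefinite_integral_continuous_1[OF Ji])
    have l: "((\<lambda>\<eta>::real. 1 - \<eta>) \<longlongrightarrow> 1) (at_right 0)"
      by (rule tendsto_eq_intros refl)+ simp
    show ?thesis
    proof (rule continuous_on_tendsto_compose[OF c l])
      show "eventually (\<lambda>\<eta>. 1 - \<eta> \<in> {0..1}) (at_right (0::real))"
        unfolding eventually_at_right_field by (intro exI[of _ 1]) auto
    qed simp
  qed
  then have "integral {0..1} JJ = exp (\<mu>' * (P + Q) / 2) * K.UU q p"
    by (intro tendsto_unique[OF _ _ K.JJ_integral_limit]) auto
  then have I: "I = k * (exp (\<mu>' * (P + Q) / 2) * K.UU q p)" using JI k0 by (simp add: field_simps)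
  have UG: "K.UU q p * G 0 = G p * G q * mellin \<nu> (\<mu>' + 1)"
    by (rule K.UU_product[OF q1' K.p_in_Adom G0])
  have kc: "k * G 0 = Const * mellin \<nu> (\<mu>' + 1)" by (rule const[OF conv])
  define S1 S2 where "S1 = (1 - (Xl P)\<^sup>2) powr (\<mu> / 2)" and "S2 = (1 - (Xl Q)\<^sup>2) powr (\<mu> / 2)"
  have S: "S1 \<noteq> 0" "S2 \<noteq> 0" using one_minus_Xl_squared_nonzero P Q by (simp_all add: S1_def S2_def)
  have me: "\<alpha> / 2 - 1 / 4 = \<mu> / 2" by (simp add: \<mu> field_simps)
  have f1: "gegenbauer_C l \<alpha> (Xl P) = k * (exp (\<mu>' * P / 2) * G p) / S1"
    using Cf[OF P] S(1) by (simp add: S1_def p_def field_simps)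
  have f2: "gegenbauer_C l \<alpha> (Xl Q) = k * (exp (\<mu>' * Q / 2) * G q) / S2"
    using Cf[OF Q] S(2) by (simp add: S2_def q_def field_simps)
  have ee: "exp (\<mu>' * (P + Q) / 2) = exp (\<mu>' * P / 2) * exp (\<mu>' * Q / 2)"
    by (simp add: algebra_simps add_divide_distrib flip: exp_add)
  have "(k * (G p * G q)) * G 0 = (Const * K.UU q p) * G 0"
  proof -
    have "(k * (G p * G q)) * G 0 = (k * G 0) * (G p * G q)" by simp
    also have "\<dots> = Const * (G p * G q * mellin \<nu> (\<mu>' + 1))" unfolding kc by simp
    also have "\<dots> = (Const * K.UU q p) * G 0" unfolding UG[symmetric] by simp
    finally show ?thesis .
  qed
  then have key: "k * (G p * G q) = Const * K.UU q p" using G0 by simp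
  have "gegenbauer_C l \<alpha> (Xl P) * gegenbauer_C l \<alpha> (Xl Q) = (exp (\<mu>' * P / 2) * exp (\<mu>' * Q / 2)) * k * (k * (G p * G q)) / (S1 * S2)"
    unfolding f1 f2 by simp
  also have "\<dots> = Const / (S1 * S2) * I"
    unfolding key I ee by simp
  finally show ?thesis
    unfolding me S1_def S2_def I_def w_def .
qed

section \<open>Evaluation of the constants\<close>

lemma notin_nonpos_Ints_if_Re_pos: "Re z > 0 \<Longrightarrow> z \<notin> \<int>\<^sub>\<le>\<^sub>0"
  by (auto elim!: nonpos_Ints_cases)

lemma gegenbauer_C_Xl:
  assumes L: "\<bar>Im L\<bar> < pi"
  shows "gegenbauer_C l \<alpha> (Xl L) * (1 - (Xl L)\<^sup>2) powr (\<mu> / 2) =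
    of_real (sqrt pi) * Gamma (2 * \<alpha> + l) * rGamma \<alpha> * rGamma (l + 1) / exp ((2 * \<alpha> - 1) * of_real (ln 2)) * exp (\<mu> * of_real (ln 2))
      * exp (\<mu> * L / 2) * (1 + exp L) powr (- \<mu>) * reg_hyp2F1 (- l) (2 * \<alpha> + l) (\<alpha> + 1 / 2) (exp L / (1 + exp L))"
proof -
  have nz: "1 + exp L \<noteq> 0" by (rule one_plus_exp_slit(2)[OF L])
  have x: "(1 - Xl L) / 2 = exp L / (1 + exp L)"
  proof -
    have "1 - Xl L = 2 * exp L / (1 + exp L)" using nz by (simp add: Xl_def field_simps)
    then have "1 - Xl L = 2 * (exp L / (1 + exp L))" by (simp only: times_divide_eq_right)
    moreover have "2 * z / 2 = z" for z :: complex by simp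
    ultimately show ?thesis by (simp only:)
  qed
  have l4: "ln (4::real) = 2 * ln 2" using ln_realpow[of "2::real" 2] by simp
  have "(1 - (Xl L)\<^sup>2) powr (\<mu> / 2) = exp (\<mu> / 2 * (of_real (ln 4) + L - 2 * Ln (1 + exp L)))"
    using one_minus_Xl_squared_nonzero[OF L] by (simp add: powr_def Ln_one_minus_Xl_squared[OF L])
  also have "\<mu> / 2 * (of_real (ln 4) + L - 2 * Ln (1 + exp L)) = \<mu> * of_real (ln 2) + \<mu> * L / 2 + - \<mu> * Ln (1 + exp L)"
    unfolding l4 by (simp add: field_simps)
  also have "exp (\<mu> * of_real (ln 2) + \<mu> * L / 2 + - \<mu> * Ln (1 + exp L)) = exp (\<mu> * of_real (ln 2)) * exp (\<mu> * L / 2) * (1 + exp L) powr (- \<mu>)"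
    using nz by (simp only: exp_add powr_def if_False)
  finally have s: "(1 - (Xl L)\<^sup>2) powr (\<mu> / 2) = exp (\<mu> * of_real (ln 2)) * exp (\<mu> * L / 2) * (1 + exp L) powr (- \<mu>)" .
  have "2 powr (2 * \<alpha> - 1) = exp ((2 * \<alpha> - 1) * of_real (ln 2))"
    using Ln_of_real[of 2] by (simp add: powr_def)
  then show ?thesis unfolding gegenbauer_C_def x s by simp
qed

lemma Gamma_duplication:
  assumes "Re z > 0"
  shows "Gamma z * Gamma (z + 1 / 2) = exp ((1 - 2 * z) * of_real (ln 2)) * of_real (sqrt pi) * Gamma (2 * z)"
  by (rule Gamma_legendre_duplication) (use assms in \<open>auto intro!: notin_nonpos_Ints_if_Re_pos\<close>)

text \<open>Legendre's duplication formula merges the two reciprocal Gamma factors of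
  \<open>mellin_formula\<close>.\<close>

lemma mellin_formula_at_exponent:
  assumes "Re \<mu> > Re \<nu>" "Re \<mu> + Re \<nu> + 1 > 0"
  shows "mellin \<nu> (\<mu> + 1) = Gamma ((\<mu> + \<nu> + 1) / 2) * Gamma ((\<mu> - \<nu>) / 2)
    / (2 * (exp (- \<mu> * of_real (ln 2)) * of_real (sqrt pi) * Gamma (\<mu> + 1)))"
proof -
  have "Re ((\<mu> + 1) / 2) > 0" using assms by simp
  from Gamma_duplication[OF this] have d: "Gamma ((\<mu> + 1) / 2) * Gamma ((\<mu> + 1 + 1) / 2) = exp (- \<mu> * of_real (ln 2)) * of_real (sqrt pi) * Gamma (\<mu> + 1)"
    by (simp add: add_divide_distrib add_ac)
  have "mellin \<nu> (\<mu> + 1) = Gamma ((\<mu> + 1 + \<nu>) / 2) * Gamma ((\<mu> + 1 - \<nu> - 1) / 2) * rGamma ((\<mu> + 1) / 2) * rGamma ((\<mu> + 1 + 1) / 2) / 2"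
    by (rule mellin_formula) (use assms in auto)
  also have "\<dots> = Gamma ((\<mu> + 1 + \<nu>) / 2) * Gamma ((\<mu> + 1 - \<nu> - 1) / 2) / (2 * (Gamma ((\<mu> + 1) / 2) * Gamma ((\<mu> + 1 + 1) / 2)))"
    by (simp only: rGamma_inverse_Gamma divide_inverse inverse_mult_distrib mult_ac)
  finally show ?thesis unfolding d by (simp add: add_ac)
qed

text \<open>Duplication at \<open>\<alpha> + l / 2\<close> joins a Gamma factor of the claimed
  constant with one of the Mellin transform. The other Mellin factor \<open>Gamma (- l / 2)\<close>
  accounts for the minus sign, through
  \<open>Gamma (1 - l / 2) = - l / 2 * Gamma (- l / 2)\<close>.\<close>

lemma product_constant_generic:
  assumes l: "Re l < 0" "l \<notin> \<int>\<^sub>\<le>\<^sub>0" and \<alpha>: "\<alpha> \<notin> \<int>\<^sub>\<le>\<^sub>0" and pos: "Re (l + 2 * \<alpha>) > 0"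
    and \<mu>: "\<mu> = \<alpha> - 1 / 2" and \<nu>: "\<nu> = l + \<alpha> - 1 / 2" and \<mu>1: "\<mu> + 1 \<notin> \<int>\<^sub>\<le>\<^sub>0"
  shows "of_real (sqrt pi) * Gamma (2 * \<alpha> + l) * rGamma \<alpha> * rGamma (l + 1) / exp ((2 * \<alpha> - 1) * of_real (ln 2)) * exp (\<mu> * of_real (ln 2)) * rGamma (\<mu> + 1)
    = - (2 powr l * of_real (sqrt pi) * Gamma (l / 2 + \<alpha> + 1 / 2)) / (Gamma l * Gamma \<alpha> * Gamma (1 - l / 2)) * mellin \<nu> (\<mu> + 1)"
proof -
  define t where "t = complex_of_real (ln 2)"
  define r where "r = complex_of_real (sqrt pi)"
  define A B D H N E1 E2 E3 E4 E5 where "A = Gamma (2 * \<alpha> + l)" and "B = Gamma \<alpha>" and "D = Gamma l" and "H = Gamma (- l / 2)"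
    and "N = Gamma (\<mu> + 1)" and "E1 = exp (l * t)" and "E2 = exp ((1 - 2 * (\<alpha> + l / 2)) * t)" and "E3 = exp (- \<mu> * t)"
    and "E4 = exp ((2 * \<alpha> - 1) * t)" and "E5 = exp (\<mu> * t)"
  define Z Y where "Z = Gamma (\<alpha> + l / 2)" and "Y = Gamma (\<alpha> + l / 2 + 1 / 2)"
  have l0: "l \<noteq> 0" using l by auto
  have nz: "B \<noteq> 0" "D \<noteq> 0" "H \<noteq> 0" "N \<noteq> 0" "r \<noteq> 0" "E1 \<noteq> 0" "E2 \<noteq> 0" "E3 \<noteq> 0" "E4 \<noteq> 0" "E5 \<noteq> 0"
    using l \<alpha> \<mu>1 notin_nonpos_Ints_if_Re_pos[of "- l / 2"]
    by (simp_all add: B_def D_def H_def N_def r_def E1_def E2_def E3_def E4_def E5_def Gamma_eq_zero_iff)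
  have e1: "E1 * E2 * E4 = 1" "E3 * E5 = 1"
    by (simp_all add: E1_def E2_def E3_def E4_def E5_def algebra_simps flip: exp_add)
  have ZY: "Z * Y = E2 * r * A"
    using Gamma_duplication[of "\<alpha> + l / 2"] pos by (simp add: Z_def Y_def E2_def r_def A_def t_def)
  have G1: "Gamma (l + 1) = l * D" using Gamma_plus1[OF l(2)] by (simp add: D_def)
  have G2: "Gamma (1 - l / 2) = - l / 2 * H"
    using Gamma_plus1[of "- l / 2"] notin_nonpos_Ints_if_Re_pos[of "- l / 2"] l by (simp add: H_def)
  have p2: "2 powr l = E1" using Ln_of_real[of 2] by (simp add: powr_def E1_def t_def)
  have M: "mellin \<nu> (\<mu> + 1) = Z * H / (2 * (E3 * r * N))"
  proof -
    have "mellin \<nu> (\<mu> + 1) = Gamma ((\<mu> + \<nu> + 1) / 2) * Gamma ((\<mu> - \<nu>) / 2) / (2 * (exp (- \<mu> * of_real (ln 2)) * of_real (sqrt pi) * Gamma (\<mu> + 1)))"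
      by (rule mellin_formula_at_exponent) (use l pos in \<open>auto simp: \<mu> \<nu>\<close>)
    moreover have "(\<mu> + \<nu> + 1) / 2 = \<alpha> + l / 2" "(\<mu> - \<nu>) / 2 = - l / 2" by (simp_all add: \<mu> \<nu> field_simps)
    ultimately show ?thesis by (simp add: Z_def H_def E3_def r_def N_def t_def)
  qed
  have Y: "Gamma (l / 2 + \<alpha> + 1 / 2) = Y" by (simp add: Y_def add_ac)
  have "- (E1 * r * Y) / (D * B * (- l / 2 * H)) * (Z * H / (2 * (E3 * r * N))) = E1 * (Z * Y) / (D * B * l * E3 * N)"
    using nz l0 by (simp add: field_simps)
  also have "\<dots> = (E1 * E2) * r * A / (D * B * l * E3 * N)" unfolding ZY by simp
  also have "E1 * E2 = 1 / E4" using e1(1) nz by (simp add: field_simps)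
  also have "1 / E4 * r * A / (D * B * l * E3 * N) = r * A / (B * (l * D)) / E4 * (1 / E3) / N"
    by (simp add: field_simps)
  also have "1 / E3 = E5" using e1(2) nz by (simp add: field_simps)
  finally have "- (E1 * r * Y) / (D * B * (- l / 2 * H)) * (Z * H / (2 * (E3 * r * N))) = r * A / (B * (l * D)) / E4 * E5 / N" .
  also have "\<dots> = r * A * inverse B * inverse (l * D) / E4 * E5 * inverse N"
    by (simp only: divide_inverse inverse_mult_distrib mult_ac)
  finally show ?thesis
    unfolding M Y p2 G2 rGamma_inverse_Gamma G1 t_def[symmetric] r_def[symmetric]
    unfolding A_def[symmetric] B_def[symmetric] D_def[symmetric] N_def[symmetric] E4_def[symmetric] E5_def[symmetric] ..
qed

text \<open>Since \<open>\<alpha> = 1 / 2 - m\<close>, the factors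
  \<open>Gamma (l / 2 + \<alpha> + 1 / 2)\<close> and \<open>Gamma (m - l / 2)\<close> are paired by
  reflection, and equal \<open>Gamma (l / 2) * Gamma (1 - l / 2)\<close> up to the sign
  \<open>(-1) ^ (m + 1)\<close>. The rest of the sign cancels against
  \<open>pochhammer (- l) m\<close>.\<close>

lemma product_constant_exceptional:
  fixes m :: nat
  assumes m: "\<mu> = - of_nat m" and l: "Re l > 2 * real m - 1" "Re l < 2 * real m" and \<alpha>: "\<alpha> \<notin> \<int>\<^sub>\<le>\<^sub>0" and m1: "m \<ge> 1"
    and \<mu>: "\<mu> = \<alpha> - 1 / 2" and \<nu>: "\<nu> = l + \<alpha> - 1 / 2"
  shows "of_real (sqrt pi) * Gamma (2 * \<alpha> + l) * rGamma \<alpha> * rGamma (l + 1) / exp ((2 * \<alpha> - 1) * of_real (ln 2)) * exp (\<mu> * of_real (ln 2))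
      * (pochhammer (- l) m * pochhammer (2 * \<alpha> + l) m) * rGamma (1 + of_nat m)
    = - (2 powr l * of_real (sqrt pi) * Gamma (l / 2 + \<alpha> + 1 / 2)) / (Gamma l * Gamma \<alpha> * Gamma (1 - l / 2)) * mellin \<nu> (of_nat m + 1)"
proof -
  have \<alpha>m: "\<alpha> = 1 / 2 - of_nat m" using m \<mu> by (simp add: algebra_simps)
  have \<nu>m: "\<nu> = l - of_nat m" by (simp add: \<nu> \<alpha>m)
  define t where "t = complex_of_real (ln 2)"
  define r where "r = complex_of_real (sqrt pi)"
  define B D N E1 E2 Em S where "B = Gamma \<alpha>" and "D = Gamma l" and "N = Gamma (of_nat m + 1 :: complex)"
    and "E1 = exp (l * t)" and "E2 = exp ((1 - l) * t)" and "Em = exp (of_nat m * t)" and "S = (-1 :: complex) ^ m"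
  define K1 K2 where "K1 = Gamma (1 - l / 2)" and "K2 = Gamma (l / 2)"
  have lp: "Re l > 0" using l m1 by simp
  have nz: "B \<noteq> 0" "D \<noteq> 0" "N \<noteq> 0" "r \<noteq> 0" "Em \<noteq> 0"
    using \<alpha> notin_nonpos_Ints_if_Re_pos[of l] notin_nonpos_Ints_if_Re_pos[of "of_nat m + 1"] lp
    by (simp_all add: B_def D_def N_def r_def Em_def Gamma_eq_zero_iff)
  \<comment> \<open>At a pole \<open>l\<close> would be an even integer, but \<open>Re l\<close>
    lies strictly between \<open>2 * m - 1\<close> and \<open>2 * m\<close>.\<close>
  have K1: "K1 \<noteq> 0"
  proof -
    have "1 - l / 2 \<notin> \<int>\<^sub>\<le>\<^sub>0"
    proof
      assume "1 - l / 2 \<in> \<int>\<^sub>\<le>\<^sub>0"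
      then obtain n where "1 - l / 2 = of_int n" by (elim nonpos_Ints_cases)
      then have "l = of_int (2 - 2 * n)" by (simp add: field_simps)
      then have "Re l = real_of_int (2 - 2 * n)" by (simp only: complex_Re_of_int)
      then have "real_of_int (2 * int m - 1) < real_of_int (2 - 2 * n)" "real_of_int (2 - 2 * n) < real_of_int (2 * int m)"
        using l by simp_all
      then have "2 * int m - 1 < 2 - 2 * n" "2 - 2 * n < 2 * int m" by (simp_all only: of_int_less_iff)
      then show False by presburger
    qed
    then show ?thesis by (simp add: K1_def Gamma_eq_zero_iff)
  qed
  have p2: "2 powr l = E1" using Ln_of_real[of 2] by (simp add: powr_def E1_def t_def)
  have et: "exp t = 2" by (simp add: t_def exp_of_real)
  have e12: "E1 * E2 = 2"
  proof -
    have "l * t + (1 - l) * t = t" by (simp add: algebra_simps)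
    then show ?thesis unfolding E1_def E2_def exp_add[symmetric] by (simp add: et)
  qed
  have M: "mellin \<nu> (of_nat m + 1) = Gamma (l / 2 + 1 / 2) * Gamma (of_nat m - l / 2) / (2 * (exp (- of_nat m * t) * r * N))"
  proof -
    have "mellin \<nu> (of_nat m + 1) = Gamma ((of_nat m + \<nu> + 1) / 2) * Gamma ((of_nat m - \<nu>) / 2) / (2 * (exp (- of_nat m * of_real (ln 2)) * of_real (sqrt pi) * Gamma (of_nat m + 1)))"
      by (rule mellin_formula_at_exponent) (use l in \<open>auto simp: \<nu>m\<close>)
    moreover have "(of_nat m + \<nu> + 1) / 2 = l / 2 + 1 / 2" "(of_nat m - \<nu>) / 2 = of_nat m - l / 2" by (simp_all add: \<nu>m field_simps)
    ultimately show ?thesis by (simp add: r_def N_def t_def)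
  qed
  have em: "exp (- of_nat m * t) = 1 / Em" by (simp add: Em_def exp_minus divide_inverse)
  have refl: "Gamma (of_nat m - l / 2) * Gamma (l / 2 - of_nat m + 1) = - S * (K2 * K1)"
  proof -
    have "Gamma (of_nat m - l / 2) * Gamma (1 - (of_nat m - l / 2)) = of_real pi / sin (of_real pi * (of_nat m - l / 2))"
      by (rule Gamma_reflection_complex)
    moreover have "sin (of_real pi * (of_nat m - l / 2)) = - S * sin (of_real pi * (l / 2))"
    proof -
      have c: "cos (complex_of_real pi * of_nat m) = S" "sin (complex_of_real pi * of_nat m) = 0"
      proof -
        have "complex_of_real pi * of_nat m = of_real (real m * pi)" by simp
        then show "cos (complex_of_real pi * of_nat m) = S" "sin (complex_of_real pi * of_nat m) = 0"
          by (simp_all only: cos_of_real sin_of_real cos_npi sin_npi S_def of_real_power of_real_minus of_real_1 of_real_0)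
      qed
      show ?thesis unfolding right_diff_distrib sin_diff c by simp
    qed
    moreover have "K2 * K1 = of_real pi / sin (of_real pi * (l / 2))"
      unfolding K1_def K2_def by (rule Gamma_reflection_complex)
    moreover have "S * S = 1" by (simp add: S_def flip: power_mult_distrib)
    then have "inverse S = S" by (metis inverse_unique)
    then have "a / (- S * s) = - S * (a / s)" for a s by (simp add: divide_inverse)
    moreover have "1 - (of_nat m - l / 2) = l / 2 - of_nat m + 1" by simp
    ultimately show ?thesis by (simp only:)
  qed
  have du: "K2 * Gamma (l / 2 + 1 / 2) = E2 * r * D"
    using Gamma_duplication[of "l / 2"] lp by (simp add: K2_def E2_def r_def D_def t_def)
  have Y: "l / 2 + \<alpha> + 1 / 2 = l / 2 - of_nat m + 1" by (simp add: \<alpha>m)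
  have "- (E1 * r * Gamma (l / 2 - of_nat m + 1)) / (D * B * K1) * (Gamma (l / 2 + 1 / 2) * Gamma (of_nat m - l / 2) / (2 * (1 / Em * r * N)))
    = - E1 * Em * Gamma (l / 2 + 1 / 2) * (Gamma (of_nat m - l / 2) * Gamma (l / 2 - of_nat m + 1)) / (2 * D * B * K1 * N)"
    using nz K1 by (simp add: field_simps)
  also have "\<dots> = S * E1 * Em * (K2 * Gamma (l / 2 + 1 / 2)) / (2 * D * B * N)"
    unfolding refl using K1 by (simp add: field_simps)
  also have "\<dots> = S * (E1 * E2) * Em * r / (2 * B * N)"
    unfolding du using nz by (simp add: field_simps)
  also have "\<dots> = S * Em * r / (B * N)" unfolding e12 using nz by (simp add: field_simps)
  finally have R: "- (E1 * r * Gamma (l / 2 - of_nat m + 1)) / (D * B * K1) * (Gamma (l / 2 + 1 / 2) * Gamma (of_nat m - l / 2) / (2 * (1 / Em * r * N)))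
    = S * Em * r / (B * N)" .
  define b where "b = 2 * \<alpha> + l"
  have b: "b = l - 2 * of_nat m + 1" by (simp add: b_def \<alpha>m)
  have bn: "b \<notin> \<int>\<^sub>\<le>\<^sub>0" by (rule notin_nonpos_Ints_if_Re_pos) (use l in \<open>simp add: b\<close>)
  define W where "W = Gamma (l - of_nat m + 1)"
  have W0: "W \<noteq> 0" unfolding W_def Gamma_eq_zero_iff by (rule notin_nonpos_Ints_if_Re_pos) (use l m1 in simp)
  have g1: "Gamma b * pochhammer b m = W"
  proof -
    have "b + of_nat m = l - of_nat m + 1" by (simp add: b)
    then have "W = Gamma (b + of_nat m)" by (simp only: W_def)
    then show ?thesis using pochhammer_Gamma[OF bn, of m] bn by (simp add: Gamma_eq_zero_iff)
  qed
  have L1: "Gamma (l + 1) \<noteq> 0" unfolding Gamma_eq_zero_iff by (rule notin_nonpos_Ints_if_Re_pos) (use lp in simp)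
  have g2: "pochhammer (- l) m = S * (Gamma (l + 1) / W)"
  proof -
    have "pochhammer (l - of_nat m + 1) m = Gamma (l - of_nat m + 1 + of_nat m) / W"
      unfolding W_def by (rule pochhammer_Gamma, rule notin_nonpos_Ints_if_Re_pos) (use l m1 in simp)
    then show ?thesis unfolding pochhammer_minus S_def by (simp add: algebra_simps)
  qed
  have x: "exp (\<mu> * t) / exp ((2 * \<alpha> - 1) * t) = Em"
    by (simp add: m \<alpha>m Em_def algebra_simps flip: exp_diff)
  have "r * Gamma b * rGamma \<alpha> * rGamma (l + 1) / exp ((2 * \<alpha> - 1) * t) * exp (\<mu> * t) * (pochhammer (- l) m * pochhammer b m) * rGamma (1 + of_nat m)
    = r * (Gamma b * pochhammer b m) * (exp (\<mu> * t) / exp ((2 * \<alpha> - 1) * t)) * pochhammer (- l) m / (B * Gamma (l + 1) * N)"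
    by (simp add: rGamma_inverse_Gamma B_def N_def divide_inverse add.commute mult_ac)
  also have "\<dots> = S * Em * r / (B * N)"
    unfolding g1 g2 x using W0 L1 by simp
  finally show ?thesis
    unfolding M em Y p2 R[symmetric] b_def r_def[symmetric] t_def[symmetric] by (simp only: B_def D_def K1_def)
qed

theorem corollary39:
  fixes x1 x2 l \<alpha> :: complex
  assumes "x1 \<in> trig_domain" and "x2 \<in> trig_domain"
    and "l \<noteq> 0" and "\<alpha> \<noteq> 0"
    and "Re (l + 2 * \<alpha>) > 0" and "Re l < 4"
    and "product_integral_exists l \<alpha> x1 x2"
  shows "gegenbauer_C l \<alpha> x1 * gegenbauer_C l \<alpha> x2 =
    - (2 powr l * of_real (sqrt pi) * Gamma (l / 2 + \<alpha> + 1 / 2))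
      / (Gamma l * Gamma \<alpha> * Gamma (1 - l / 2)
           * (1 - x1\<^sup>2) powr (\<alpha> / 2 - 1 / 4) * (1 - x2\<^sup>2) powr (\<alpha> / 2 - 1 / 4))
      * contour_integral (linepath ((x1 + x2) / (1 + x1 * x2)) 1)
          (product_integrand l \<alpha> x1 x2)"
proof -
  define Const where "Const = - (2 powr l * of_real (sqrt pi) * Gamma (l / 2 + \<alpha> + 1 / 2)) / (Gamma l * Gamma \<alpha> * Gamma (1 - l / 2))"
  have C: "- (2 powr l * of_real (sqrt pi) * Gamma (l / 2 + \<alpha> + 1 / 2)) / (Gamma l * Gamma \<alpha> * Gamma (1 - l / 2) * a * b) = Const / (a * b)" for a b
    by (simp add: Const_def mult.assoc)
  obtain P where P: "\<bar>Im P\<bar> < pi" "x1 = Xl P" using trig_domain_Xl[OF assms(1)] by blast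
  obtain Q where Q: "\<bar>Im Q\<bar> < pi" "x2 = Xl Q" using trig_domain_Xl[OF assms(2)] by blast
  note ex = assms(7)[unfolded P(2) Q(2)]
  define \<mu> where "\<mu> = \<alpha> - 1 / 2"
  define \<nu> where "\<nu> = l + \<alpha> - 1 / 2"
  show ?thesis
  proof (cases "\<alpha> \<in> \<int>\<^sub>\<le>\<^sub>0 \<or> l \<in> \<int>\<^sub>\<le>\<^sub>0")
    case True
    \<comment> \<open>\<open>Gamma\<close> is \<open>0\<close> at its poles and \<open>x / 0 = 0\<close>, so division by it agrees with the entire function \<open>rGamma\<close>.\<close>
    then have "rGamma \<alpha> = 0 \<or> rGamma (l + 1) = 0"
    proof
      assume "l \<in> \<int>\<^sub>\<le>\<^sub>0"
      then obtain n where n: "l = of_int n" "n \<le> 0" by (elim nonpos_Ints_cases)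
      then have "l + 1 = of_int (n + 1)" "n + 1 \<le> 0" using assms(3) by (cases "n = 0"; simp)+
      then have "l + 1 \<in> \<int>\<^sub>\<le>\<^sub>0" by (metis nonpos_Ints_of_int)
      then show ?thesis by (simp add: rGamma_eq_zero_iff)
    qed (simp add: rGamma_eq_zero_iff)
    then have "gegenbauer_C l \<alpha> x = 0" for x by (auto simp: gegenbauer_C_def)
    moreover have "Const = 0" using True by (auto simp: Const_def Gamma_eq_zero_iff)
    ultimately show ?thesis unfolding C by simp
  next
    case False
    then have \<alpha>: "\<alpha> \<notin> \<int>\<^sub>\<le>\<^sub>0" and l: "l \<notin> \<int>\<^sub>\<le>\<^sub>0" by auto
    have l1: "l + 1 \<notin> \<int>\<^sub>\<le>\<^sub>0"
    proof
      assume "l + 1 \<in> \<int>\<^sub>\<le>\<^sub>0"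
      then obtain n where n: "l + 1 = of_int n" "n \<le> 0" by (elim nonpos_Ints_cases)
      then have "l = of_int (n - 1)" by (simp add: algebra_simps)
      then show False using l n(2) by (metis nonpos_Ints_of_int diff_le_eq le_add_same_cancel1 order_trans zero_le_one add_0)
    qed
    define k0 where "k0 = of_real (sqrt pi) * Gamma (2 * \<alpha> + l) * rGamma \<alpha> * rGamma (l + 1) / exp ((2 * \<alpha> - 1) * of_real (ln 2)) * exp (\<mu> * of_real (ln 2))"
    have b: "2 * \<alpha> + l \<notin> \<int>\<^sub>\<le>\<^sub>0" by (rule notin_nonpos_Ints_if_Re_pos) (use assms(5) in simp)
    have k0: "k0 \<noteq> 0" using b \<alpha> l1 by (simp add: k0_def Gamma_eq_zero_iff rGamma_eq_zero_iff)
    let ?F = "reg_hyp2F1 (- l) (2 * \<alpha> + l) (\<alpha> + 1 / 2)"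
    have hyp: "is_hyp (- l) (2 * \<alpha> + l) (\<alpha> + 1 / 2) ?F" by (rule reg_hyp2F1_is_hyp)
    have \<mu>1: "\<mu> + 1 = \<alpha> + 1 / 2" by (simp add: \<mu>_def)
    have Cf: "gegenbauer_C l \<alpha> (Xl L) * (1 - (Xl L)\<^sup>2) powr (\<mu> / 2) = k0 * (exp (\<mu> * L / 2) * ((1 + exp L) powr (- \<mu>) * ?F (exp L / (1 + exp L))))"
      if "\<bar>Im L\<bar> < pi" for L
      unfolding gegenbauer_C_Xl[OF that] k0_def by simp
    show ?thesis
    proof (cases "\<mu> + 1 \<in> \<int>\<^sub>\<le>\<^sub>0")
      case False
      define G where "G p = (1 + p) powr (- \<mu>) * ?F (p / (1 + p))" for p
      have hyp': "is_hyp (- l) (2 * \<alpha> + l) (\<mu> + 1) ?F" using hyp by (simp add: \<mu>1)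
      have co: "- l + (2 * \<alpha> + l) = 1 - 2 * - \<mu>" "- \<mu> * (- \<mu> + \<mu>) = 0" "- l * (2 * \<alpha> + l) + (1 + \<mu>) * - \<mu> + \<nu> * (\<nu> + 1) = 0"
        by (simp_all add: \<mu>_def \<nu>_def field_simps)
      have Gh: "G holomorphic_on cutm"
        unfolding G_def by (rule legendre_solution_from_hyp(1)[OF hyp' co])
      have Go: "p * deriv (deriv G) p + (1 + \<mu>) * deriv G p + \<nu> * (\<nu> + 1) * (1 / (1 + p)\<^sup>2) * G p = 0" if "p \<in> cutm" for p
        unfolding G_def[abs_def] by (rule legendre_solution_from_hyp(2)[OF hyp' co that])
      have G0: "G 0 = rGamma (\<mu> + 1)" using is_hyp_0[OF hyp'] by (simp add: G_def)
      show ?thesis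
        unfolding C unfolding P(2) Q(2)
      proof (rule gegenbauer_product[OF P(1) Q(1) ex Gh Go _ k0 _ _ \<nu>_def \<mu>_def])
        show "G 0 \<noteq> 0" using False by (simp add: G0 rGamma_eq_zero_iff)
        show "gegenbauer_C l \<alpha> (Xl L) * (1 - (Xl L)\<^sup>2) powr (\<mu> / 2) = k0 * (exp (\<mu> * L / 2) * G (exp L))" if "\<bar>Im L\<bar> < pi" for L
          unfolding Cf[OF that] G_def ..
        show "Re \<mu> + Re \<nu> + 1 > 0" using assms(5) by (simp add: \<mu>_def \<nu>_def)
        show "k0 * G 0 = Const * mellin \<nu> (\<mu> + 1)" if "Re \<mu> > Re \<nu>"
          unfolding G0 k0_def Const_def
          by (rule product_constant_generic[OF _ l \<alpha> assms(5) \<mu>_def \<nu>_def False]) (use that in \<open>simp add: \<mu>_def \<nu>_def\<close>)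
      qed
    next
      case True
      then obtain n where n: "\<mu> + 1 = of_int n" "n \<le> 0" by (elim nonpos_Ints_cases)
      define m where "m = nat (1 - n)"
      have m1: "m \<ge> 1" using n(2) by (simp add: m_def)
      have "of_nat m = (of_int (1 - n) :: complex)" using n(2) by (simp add: m_def)
      then have "\<mu> + 1 = 1 - of_nat m" using n(1) by simp
      then have m: "\<mu> = - of_nat m" by (simp add: eq_neg_iff_add_eq_0)
      have \<alpha>m: "\<alpha> = 1 / 2 - of_nat m" using m by (simp add: \<mu>_def algebra_simps)
      \<comment> \<open>For \<open>m \<ge> 1\<close> this is at least \<open>m\<close>, so
        \<open>l\<close> is none of \<open>0, ..., m - 1\<close> and
        \<open>pochhammer (- l) m\<close> is nonzero.\<close>
      have lr: "Re l > 2 * real m - 1" using assms(5) by (simp add: \<alpha>m)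
      let ?F' = "reg_hyp2F1 (- l + of_nat m) (2 * \<alpha> + l + of_nat m) (1 + of_nat m)"
      have hyp1: "is_hyp (- l) (2 * \<alpha> + l) (1 - of_nat m) ?F" using hyp by (simp add: \<alpha>m)
      have hyp2: "is_hyp (- l + of_nat m) (2 * \<alpha> + l + of_nat m) (1 + of_nat m) ?F'" by (rule reg_hyp2F1_is_hyp)
      have hyp': "is_hyp (- l + of_nat m) (2 * \<alpha> + l + of_nat m) (of_nat m + 1) ?F'" using hyp2 by (simp add: add.commute)
      define G where "G p = (1 + p) powr 0 * ?F' (p / (1 + p))" for p
      have co: "(- l + of_nat m) + (2 * \<alpha> + l + of_nat m) = 1 - 2 * 0" "0 * (0 + of_nat m :: complex) = 0"
        "(- l + of_nat m) * (2 * \<alpha> + l + of_nat m) + (1 + of_nat m) * 0 + \<nu> * (\<nu> + 1) = 0"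
        by (simp_all add: \<alpha>m \<nu>_def field_simps)
      have Gh: "G holomorphic_on cutm"
        unfolding G_def by (rule legendre_solution_from_hyp(1)[OF hyp' co])
      have Go: "p * deriv (deriv G) p + (1 + of_nat m) * deriv G p + \<nu> * (\<nu> + 1) * (1 / (1 + p)\<^sup>2) * G p = 0" if "p \<in> cutm" for p
        unfolding G_def[abs_def] by (rule legendre_solution_from_hyp(2)[OF hyp' co that])
      have G0: "G 0 = rGamma (1 + of_nat m)" using is_hyp_0[OF hyp2] by (simp add: G_def)
      define k where "k = k0 * (pochhammer (- l) m * pochhammer (2 * \<alpha> + l) m)"
      have kn: "k \<noteq> 0"
      proof -
        have "pochhammer (2 * \<alpha> + l) m \<noteq> 0" using b by (auto simp: pochhammer_eq_0_iff)
        moreover have "pochhammer (- l) m \<noteq> 0"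
        proof
          assume "pochhammer (- l) m = 0"
          then obtain j where "j < m" "l = of_nat j" by (auto simp: pochhammer_eq_0_iff)
          then show False using lr m1 by simp
        qed
        ultimately show ?thesis using k0 by (simp add: k_def)
      qed
      show ?thesis
        unfolding C unfolding P(2) Q(2)
      proof (rule gegenbauer_product[OF P(1) Q(1) ex Gh Go _ kn _ _ \<nu>_def \<mu>_def])
        show "G 0 \<noteq> 0" using notin_nonpos_Ints_if_Re_pos[of "1 + of_nat m"] by (simp add: G0 rGamma_eq_zero_iff)
        show "gegenbauer_C l \<alpha> (Xl L) * (1 - (Xl L)\<^sup>2) powr (\<mu> / 2) = k * (exp (of_nat m * L / 2) * G (exp L))" if L: "\<bar>Im L\<bar> < pi" for L
        proof -
          define e where "e = exp L"
          have nz: "1 + e \<noteq> 0" using one_plus_exp_slit(2)[OF L] by (simp add: e_def)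
          have "e \<in> cutm" using one_plus_exp_slit(1)[OF L] by (simp add: cutm_def e_def)
          then have F: "?F (e / (1 + e)) = pochhammer (- l) m * pochhammer (2 * \<alpha> + l) m * (e / (1 + e)) ^ m * ?F' (e / (1 + e))"
            by (intro is_hyp_nonpos_int[OF hyp1 hyp2] cutm_quotient)
          have p1: "(1 + e) powr (- \<mu>) = (1 + e) ^ m" using nz by (simp add: m)
          \<comment> \<open>The power \<open>e ^ m\<close> with which the regularized series starts
            changes the exponent from \<open>\<mu> = - m\<close> to \<open>m\<close>, while
            \<open>(1 + e) powr (- \<mu>)\<close> cancels its denominator.\<close>
          have "exp (\<mu> * L / 2) * e ^ m = exp (of_nat m * L / 2)"
            unfolding e_def exp_of_nat_mult[symmetric] exp_add[symmetric] m by (simp add: field_simps)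
          then have "exp (\<mu> * L / 2) * ((1 + e) ^ m * (e / (1 + e)) ^ m) = exp (of_nat m * L / 2)"
            using nz by (simp add: power_divide)
          then show ?thesis
            unfolding Cf[OF L] G_def e_def[symmetric] F p1 k_def using nz by (simp add: mult_ac)
        qed
        show "Re (of_nat m) + Re \<nu> + 1 > 0" using lr m1 by (simp add: \<nu>_def \<alpha>m)
        show "k * G 0 = Const * mellin \<nu> (of_nat m + 1)" if "Re (of_nat m) > Re \<nu>"
          unfolding G0 k_def k0_def Const_def
          by (rule product_constant_exceptional[OF m lr _ \<alpha> m1 \<mu>_def \<nu>_def]) (use that in \<open>simp add: \<nu>_def \<alpha>m\<close>)
      qed
    qed
  qed
qed

end
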